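(* Let $\alpha<\beta$ be real numbers, $\Omega=(\alpha,\beta)$, and consider the problem $$\min_{u\in W^{1,p}((\alpha,\beta);\mathbb{R}^m)}\ \mathcal{I}(u)=\int_\alpha^\beta f(x,u(x),u'(x))\,dx+g_0(u(\alpha),u(\beta))$$ subject to $g_i(u(\alpha),u(\beta))\le0$, $i\in I$, and $g_j(u(\alpha),u(\beta))=0$, $j\in J$, where $f:(\alpha,\beta)\times\mathbb{R}^m\times\mathbb{R}^m\to\mathbb{R}$, $g_i:\mathbb{R}^m\times\mathbb{R}^m\to\mathbb{R}$ for $i\in I\cup J\cup\{0\}$, $I=\{1,\dots,\ell_1\}$, $J=\{\ell_1+1,\dots,\ell_2\}$. Let $f$ satisfy the codifferentiability conditions of order $p\in[1,+\infty]$; in the case $p=1$ suppose moreover that $$\underline{d}_{u,\xi}f(x,u,\xi)=\operatorname{co}\{(f_k(x,u,\xi),v_{1k},v_{2k})\mid k\in\{1,\dots,\ell\}\},\quad \overline{d}_{u,\xi}f(x,u,\xi)=\operatorname{co}\{(h_k(x,u,\xi),\omega_{1k},\omega_{2k})\mid k\in\{1,\dots,r\}\}$$ for some constant vectors $v_{1k},v_{2k},\omega_{1k},\omega_{2k}\in\mathbb{R}^m$ and Carathéodory functions $f_k,h_k:(\alpha,\beta)\times\mathbb{R}^m\times\mathbb{R}^m\to\mathbb{R}$. Let $u_*$ be a locally optimal solution of the problem and put $P_*=(u_*(\alpha),u_*(\beta))$ and $I(u_* )=\{i\in I\mid g_i(P_* )=0\}$. Suppose that the functions $g_i$, $i\in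 I\cup J\cup\{0\}$, are continuously codifferentiable at $P_*$, with codifferentials $[\underline{d}g_i(P_* ),\overline{d}g_i(P_* )]$, and that the sets $\underline{d}g_j(P_* )$ and $\overline{d}g_j(P_* )$, $j\in J$, are polytopes (convex hulls of finitely many points). Let vectors $(0,s_{1i},s_{2i})\in\overline{d}g_i(P_* )$, $i\in I$, and $(0,s_{1j},s_{2j})\in\overline{d}g_j(P_* )$, $(0,r_{1j},r_{2j})\in\underline{d}g_j(P_* )$, $j\in J$, be such that the following constraint qualification holds: $$C_j\cap\operatorname{cone}\{-C_k\mid k\in J\setminus\{j\}\}=\emptyset\quad\forall j\in J,$$ $$\operatorname{co}\{\underline{\partial}g_i(P_* )+(s_{1i},s_{2i})\mid i\in I(u_* )\}\cap\operatorname{cone}\{-C_j\mid j\in J\}=\emptyset,$$ where $C_j=\big(\underline{\partial}g_j(P_* )+(s_{1j},s_{2j})\big)\cup\big(-(r_{1j},r_{2j})-\overline{\partial}g_j(P_* )\big)$. Then for all $(0,s_{10},s_{20})\in\overline{d}g_0(P_* )$ and for any measurable selection $(0,w_1(\cdot),w_2(\cdot))$ of the multifunction $\overline{d}_{u,\xi}f(\cdot,u_*(\cdot),u_*'(\cdot))$ there exist an absolutely continuous function $\zeta\in W^{1,p'}((\alpha,\beta);\mathbb{R}^m)$, $\lambda_i\ge0$, $i\in I$, and $\underline{\mu}_j,\overline{\mu}_j\ge0$, $j\in J$, such that $\lambda_ig_i(P_* )=0$ for all $i\in I$, the Euler–Lagrange inclusion $$(0,\zeta'(x),\zeta(x))\in\underline{d}_{u,\xi}f(x,u_*(x),u_*'(x))+(0,w_1(x),w_2(x))$$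 holds for a.e. $x\in(\alpha,\beta)$, and the transversality condition holds: \begin{multline*} (0,\zeta(\alpha),-\zeta(\beta))\in\underline{d}g_0(P_* )+(0,s_{10},s_{20})+\sum_{i=1}^{\ell_1}\lambda_i\big(\underline{d}g_i(P_* )+(0,s_{1i},s_{2i})\big)\\+\sum_{j=\ell_1+1}^{\ell_2}\underline{\mu}_j\big(\underline{d}g_j(P_* )+(0,s_{1j},s_{2j})\big)-\sum_{j=\ell_1+1}^{\ell_2}\overline{\mu}_j\big((0,r_{1j},r_{2j})+\overline{d}g_j(P_* )\big). \end{multline*}
   Context: **Codifferentials.** Let $X$ be a real Banach space, $X^*$ its dual, $U\subseteq X$ open. A function $F:U\to\mathbb{R}$ is codifferentiable at $x\in U$ if there is a pair $DF(x)=[\underline{d}F(x),\overline{d}F(x)]$ (a codifferential) of convex subsets of $\mathbb{R}\times X^*$, compact in the product of the standard topology and the weak$^*$ topology, such that $\Phi_F(x,0)=\Psi_F(x,0)=0$ and for all $\Delta x\in X$ $$\lim_{\alpha\to+0}\frac1\alpha\big|F(x+\alpha\Delta x)-F(x)-\Phi_F(x,\alpha\Delta x)-\Psi_F(x,\alpha\Delta x)\big|=0,$$ where $\Phi_F(x,\Delta x)=\max_{(a,x^* )\in\underline{d}F(x)}(a+\langle x^*,\Delta x\rangle)$ and $\Psi_F(x,\Delta x)=\min_{(b,y^* )\in\overline{d}F(x)}(b+\langle y^*,\Delta x\rangle)$. Codifferentials are not unique. $F$ is continuously codifferentiable at $x$ if it is codifferentiable at every point of a neighbourhood of $x$ and there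 is a codifferential mapping $DF(\cdot)$ on this neighbourhood with $\underline{d}F(\cdot)$ and $\overline{d}F(\cdot)$ continuous at $x$ with respect to the Hausdorff metric. Given a codifferential, put $\underline{\partial}F(x)=\{x^*\mid(0,x^* )\in\underline{d}F(x)\}$ and $\overline{\partial}F(x)=\{y^*\mid(0,y^* )\in\overline{d}F(x)\}$. For $g_i:\mathbb{R}^m\times\mathbb{R}^m\to\mathbb{R}$ the sets $\underline{d}g_i,\overline{d}g_i$ are subsets of $\mathbb{R}\times\mathbb{R}^m\times\mathbb{R}^m$. **Notation.** $\operatorname{co}$ and $\operatorname{cone}$ of a family of sets denote the convex hull and the conic hull of their union, where $\operatorname{cone}C=\{\sum_{i=1}^n\alpha_ix_i\mid x_i\in C,\ \alpha_i\ge0,\ n\in\mathbb{N}\}$ is the smallest convex cone containing $C$, with the convention $\operatorname{cone}\emptyset=\{0\}$ (and $\operatorname{co}\emptyset=\emptyset$). The index sets $I$ or $J$ may be empty ($\ell_1,\ell_2\in\mathbb{N}\cup\{0\}$). Elements of $W^{1,p}((\alpha,\beta);\mathbb{R}^m)$ are identified with their absolutely continuous representatives on $[\alpha,\beta]$; the norm is $\|u\|_{1,p}=(\|u\|_p^p+\|u'\|_p^p)^{1/p}$ for $p<+\infty$ and $\max\{\|u\|_\infty,\|u'\|_\infty\}$ for $p=+\infty$; local optimality is with respect to this norm; $1/p+1/p'=1$; $|\cdot|$ is the Euclidean norm. For a.e. $x\in\Omega=(\alpha,\beta)$ the function $(u,\xi)\mapsto f(x,u,\xi)$ is assumed codifferentiable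 at every point of $\mathbb{R}^m\times\mathbb{R}^m$; $[\underline{d}_{u,\xi}f(x,u,\xi),\overline{d}_{u,\xi}f(x,u,\xi)]$ denotes a fixed choice of its codifferential, consisting of convex compact subsets of $\mathbb{R}\times\mathbb{R}^m\times\mathbb{R}^m$. A (set-valued or single-valued) map $F(x,y)$ is a Carathéodory map if it is measurable in $x$ for every $y$ and continuous in $y$ for (a.e.) every $x$ (for compact-valued maps into $\mathbb{R}^k$: Hausdorff continuous). A measurable selection of a multifunction $G$ on $\Omega$ is a measurable $z$ with $z(x)\in G(x)$ for a.e. $x$. **Codifferentiability conditions of order $p$.** $f$ satisfies them if: (1) $f$ is a Carathéodory function, and: if $1\le p<+\infty$, there are an a.e. nonnegative $\beta_0\in L^1(\Omega)$ and $C>0$ with $|f(x,u,\xi)|\le\beta_0(x)+C(|u|^p+|\xi|^p)$ for a.e. $x$ and all $(u,\xi)$; if $p=+\infty$, for any $N>0$ there is an a.e. nonnegative $\beta_N\in L^1(\Omega)$ with $|f(x,u,\xi)|\le\beta_N(x)$ for a.e. $x$ and all $(u,\xi)$ with $\max\{|u|,|\xi|\}\le N$; (2) for a.e. $x$ the function $(u,\xi)\mapsto f(x,u,\xi)$ is codifferentiable on $\mathbb{R}^m\times\mathbb{R}^m$, both $\underline{d}_{u,\xi}f$ and $\overline{d}_{u,\xi}f$ are Carathéodory maps, and: if $1\le p<+\infty$, there are $C>0$ and a.e. nonnegative $\beta_0\in L^1(\Omega)$, $\gamma\in L^{p'}(\Omega)$ such that for a.e. $x$, all $(u,\xi)$,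 all $(a,v_1,v_2)\in\underline{d}_{u,\xi}f(x,u,\xi)$ and $(b,w_1,w_2)\in\overline{d}_{u,\xi}f(x,u,\xi)$: $\max\{|a|,|b|\}\le\beta_0(x)+C(|u|^p+|\xi|^p)$ and $\max\{|v_1|,|v_2|,|w_1|,|w_2|\}\le\gamma(x)+C(|u|^{p-1}+|\xi|^{p-1})$; if $p=+\infty$, for any $N>0$ there is an a.e. nonnegative $\beta_N\in L^1(\Omega)$ such that $\max\{|a|,|v_1|,|v_2|,|b|,|w_1|,|w_2|\}\le\beta_N(x)$ for a.e. $x$, for all such triples and all $(u,\xi)$ with $\max\{|u|,|\xi|\}\le N$. *)

theory Defs
  imports "HOL-Analysis.Analysis" "HOL-Probability.Essential_Supremum"
begin

section \<open>Codifferentials\<close>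

text \<open>The dual of a Euclidean space is identified with the space itself by the inner product;
  weak-star compactness is then ordinary compactness. For the space
  \<open>real^'m \<times> real^'m\<close> the inner product is the sum of the componentwise ones.
  The functions \<open>codiff_hi\<close> and \<open>codiff_lo\<close> below are the maximum and the minimum only for
  nonempty compact sets, the only ones to which they are applied.\<close>

definition codiff_hi :: "(real \<times> 'a::euclidean_space) set \<Rightarrow> 'a \<Rightarrow> real" where
  "codiff_hi A h = (SUP (a, v)\<in>A. a + v \<bullet> h)"

definition codiff_lo :: "(real \<times> 'a::euclidean_space) set \<Rightarrow> 'a \<Rightarrow> real" where
  "codiff_lo B h = (INF (b, w)\<in>B. b + w \<bullet> h)"

definition is_codifferential ::
  "('a::euclidean_space \<Rightarrow> real) \<Rightarrow> 'a \<Rightarrow> (real \<times> 'a) set \<Rightarrow> (real \<times> 'a) set \<Rightarrow> bool" where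
  "is_codifferential F x A B \<longleftrightarrow>
     A \<noteq> {} \<and> convex A \<and> compact A \<and> B \<noteq> {} \<and> convex B \<and> compact B \<and>
     codiff_hi A 0 = 0 \<and> codiff_lo B 0 = 0 \<and>
     (\<forall>h. ((\<lambda>t. (1 / t) *
              \<bar>F (x + t *\<^sub>R h) - F x - codiff_hi A (t *\<^sub>R h) - codiff_lo B (t *\<^sub>R h)\<bar>)
            \<longlongrightarrow> 0) (at_right 0))"

text \<open>The Hausdorff metric on nonempty compact sets.\<close>

definition hausdorff_dist :: "'a::metric_space set \<Rightarrow> 'a set \<Rightarrow> real" where
  "hausdorff_dist A B = max (SUP x\<in>A. infdist x B) (SUP y\<in>B. infdist y A)"

definition hausdorff_continuous_at ::
  "('a::topological_space \<Rightarrow> 'b::metric_space set) \<Rightarrow> 'a \<Rightarrow> bool" where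
  "hausdorff_continuous_at G x \<longleftrightarrow> ((\<lambda>y. hausdorff_dist (G y) (G x)) \<longlongrightarrow> 0) (at x)"

text \<open>The pair \<open>DL, DU\<close> is a codifferential mapping witnessing that \<open>F\<close> is continuously
  codifferentiable at \<open>x\<close>; the codifferential of \<open>F\<close> at \<open>x\<close> is then \<open>[DL x, DU x]\<close>.\<close>

definition continuously_codifferentiable_at ::
  "('a::euclidean_space \<Rightarrow> real) \<Rightarrow> ('a \<Rightarrow> (real \<times> 'a) set) \<Rightarrow> ('a \<Rightarrow> (real \<times> 'a) set)
    \<Rightarrow> 'a \<Rightarrow> bool" where
  "continuously_codifferentiable_at F DL DU x \<longleftrightarrow>
     (\<exists>S. open S \<and> x \<in> S \<and> (\<forall>y\<in>S. is_codifferential F y (DL y) (DU y))) \<and>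
     hausdorff_continuous_at DL x \<and> hausdorff_continuous_at DU x"

text \<open>From \<open>d\<close> to \<open>\<partial>\<close>, both for the lower and the upper sets.\<close>

definition subd :: "(real \<times> 'a) set \<Rightarrow> 'a set" where
  "subd A = {v. (0, v) \<in> A}"

text \<open>The sets \<open>C\<^sub>j\<close> of the constraint qualification. Note that \<open>+\<close> is the Minkowski sum of
  \<^theory>\<open>HOL-Library.Set_Algebras\<close>; the minus sign of sets is rendered by an image, because
  \<open>-\<close> is complement resp. set difference.\<close>

definition cq_set ::
  "(real \<times> 'a::real_vector) set \<Rightarrow> (real \<times> 'a) set \<Rightarrow> 'a \<Rightarrow> 'a \<Rightarrow> 'a set" where
  "cq_set A B s r = (subd A + {s}) \<union> ({- r} + uminus ` subd B)"


section \<open>Lebesgue and Sobolev spaces on an interval\<close>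

text \<open>Exponents range over \<open>[1,\<infinity>]\<close> and are of type \<^typ>\<open>ennreal\<close>.\<close>

definition in_Lp :: "real \<Rightarrow> real \<Rightarrow> ennreal \<Rightarrow> (real \<Rightarrow> 'b::euclidean_space) \<Rightarrow> bool" where
  "in_Lp \<alpha> \<beta> p u \<longleftrightarrow>
     u \<in> borel_measurable (lebesgue_on {\<alpha><..<\<beta>}) \<and>
     (if p = \<infinity> then esssup (lebesgue_on {\<alpha><..<\<beta>}) (\<lambda>x. ereal (norm (u x))) < \<infinity>
      else integrable (lebesgue_on {\<alpha><..<\<beta>}) (\<lambda>x. norm (u x) powr enn2real p))"

definition Lp_norm :: "real \<Rightarrow> real \<Rightarrow> ennreal \<Rightarrow> (real \<Rightarrow> 'b::euclidean_space) \<Rightarrow> real" where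
  "Lp_norm \<alpha> \<beta> p u =
     (if p = \<infinity> then real_of_ereal (esssup (lebesgue_on {\<alpha><..<\<beta>}) (\<lambda>x. ereal (norm (u x))))
      else (LINT x|lebesgue_on {\<alpha><..<\<beta>}. norm (u x) powr enn2real p) powr (1 / enn2real p))"

definition abs_continuous_on :: "real \<Rightarrow> real \<Rightarrow> (real \<Rightarrow> 'b::real_normed_vector) \<Rightarrow> bool" where
  "abs_continuous_on \<alpha> \<beta> u \<longleftrightarrow>
     (\<forall>\<epsilon>>0. \<exists>\<delta>>0. \<forall>(n::nat) a b.
        (\<forall>i<n. \<alpha> \<le> a i \<and> a i \<le> b i \<and> b i \<le> \<beta>) \<and>
        disjoint_family_on (\<lambda>i. {a i<..<b i}) {..<n} \<and>
        (\<Sum>i<n. b i - a i) < \<delta> \<longrightarrow>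
        (\<Sum>i<n. norm (u (b i) - u (a i))) < \<epsilon>)"

abbreviation vderiv :: "(real \<Rightarrow> 'b::real_normed_vector) \<Rightarrow> real \<Rightarrow> 'b" where
  "vderiv u x \<equiv> vector_derivative u (at x)"

text \<open>Elements of \<open>W\<^sup>1\<^sup>,\<^sup>p\<close> are represented by absolutely continuous functions on \<open>[\<alpha>,\<beta>]\<close>, whose
  weak derivative is the derivative almost everywhere; values outside \<open>[\<alpha>,\<beta>]\<close> are irrelevant.
  Differentiability almost everywhere follows from absolute continuity (Lebesgue); it is listed
  because \<^const>\<open>vector_derivative\<close> is an arbitrary value at other points.\<close>

definition W1p :: "real \<Rightarrow> real \<Rightarrow> ennreal \<Rightarrow> (real \<Rightarrow> 'b::euclidean_space) set" where
  "W1p \<alpha> \<beta> p =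
     {u. abs_continuous_on \<alpha> \<beta> u \<and> (AE x in lebesgue_on {\<alpha><..<\<beta>}. u differentiable (at x)) \<and>
         in_Lp \<alpha> \<beta> p u \<and> in_Lp \<alpha> \<beta> p (vderiv u)}"

definition W1p_norm :: "real \<Rightarrow> real \<Rightarrow> ennreal \<Rightarrow> (real \<Rightarrow> 'b::euclidean_space) \<Rightarrow> real" where
  "W1p_norm \<alpha> \<beta> p u =
     (if p = \<infinity> then max (Lp_norm \<alpha> \<beta> p u) (Lp_norm \<alpha> \<beta> p (vderiv u))
      else (Lp_norm \<alpha> \<beta> p u powr enn2real p + Lp_norm \<alpha> \<beta> p (vderiv u) powr enn2real p)
             powr (1 / enn2real p))"


section \<open>Caratheodory maps and the codifferentiability conditions\<close>

definition caratheodory :: "real \<Rightarrow> real \<Rightarrow> (real \<Rightarrow> 'a::euclidean_space \<Rightarrow> real) \<Rightarrow> bool" where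
  "caratheodory \<alpha> \<beta> f \<longleftrightarrow>
     (\<forall>y. (\<lambda>x. f x y) \<in> borel_measurable (lebesgue_on {\<alpha><..<\<beta>})) \<and>
     (AE x in lebesgue_on {\<alpha><..<\<beta>}. continuous_on UNIV (f x))"

text \<open>A multifunction is measurable if the preimages of open sets are measurable.\<close>

definition measurable_multifun ::
  "real \<Rightarrow> real \<Rightarrow> (real \<Rightarrow> 'b::topological_space set) \<Rightarrow> bool" where
  "measurable_multifun \<alpha> \<beta> G \<longleftrightarrow>
     (\<forall>V. open V \<longrightarrow> {x \<in> {\<alpha><..<\<beta>}. G x \<inter> V \<noteq> {}} \<in> sets (lebesgue_on {\<alpha><..<\<beta>}))"

definition caratheodory_multifun ::
  "real \<Rightarrow> real \<Rightarrow> (real \<Rightarrow> 'a::euclidean_space \<Rightarrow> 'b::euclidean_space set) \<Rightarrow> bool" where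
  "caratheodory_multifun \<alpha> \<beta> G \<longleftrightarrow>
     (\<forall>y. measurable_multifun \<alpha> \<beta> (\<lambda>x. G x y)) \<and>
     (AE x in lebesgue_on {\<alpha><..<\<beta>}. \<forall>y. hausdorff_continuous_at (G x) y)"

definition nonneg_L1 :: "real \<Rightarrow> real \<Rightarrow> (real \<Rightarrow> real) \<Rightarrow> bool" where
  "nonneg_L1 \<alpha> \<beta> b \<longleftrightarrow>
     integrable (lebesgue_on {\<alpha><..<\<beta>}) b \<and> (AE x in lebesgue_on {\<alpha><..<\<beta>}. 0 \<le> b x)"

text \<open>Unlike \<open>powr\<close>, this power satisfies \<open>0\<^sup>0 = 1\<close>, which matters for
  \<open>|u|\<^sup>p\<^sup>-\<^sup>1\<close> when \<open>p = 1\<close>.\<close>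

definition rpow :: "real \<Rightarrow> real \<Rightarrow> real" where
  "rpow t s = (if s = 0 then 1 else t powr s)"

text \<open>Here \<open>q\<close> is the exponent conjugate to \<open>p\<close>, and \<open>[fl x z, fu x z]\<close> is the chosen
  codifferential of \<open>f x\<close> at \<open>z = (u, \<xi>)\<close>.\<close>

definition growth_values ::
  "real \<Rightarrow> real \<Rightarrow> ennreal \<Rightarrow> (real \<Rightarrow> (real^'m) \<times> (real^'m) \<Rightarrow> real) \<Rightarrow> bool" where
  "growth_values \<alpha> \<beta> p f \<longleftrightarrow>
     (if p = \<infinity> then
        \<forall>N>0. \<exists>\<beta>N. nonneg_L1 \<alpha> \<beta> \<beta>N \<and>
          (AE x in lebesgue_on {\<alpha><..<\<beta>}. \<forall>u \<xi>. max (norm u) (norm \<xi>) \<le> N \<longrightarrow> \<bar>f x (u, \<xi>)\<bar> \<le> \<beta>N x)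
      else
        \<exists>\<beta>0 c. nonneg_L1 \<alpha> \<beta> \<beta>0 \<and> c > 0 \<and>
          (AE x in lebesgue_on {\<alpha><..<\<beta>}. \<forall>u \<xi>.
             \<bar>f x (u, \<xi>)\<bar> \<le> \<beta>0 x + c * (rpow (norm u) (enn2real p) + rpow (norm \<xi>) (enn2real p))))"

definition growth_codifferential ::
  "real \<Rightarrow> real \<Rightarrow> ennreal \<Rightarrow> ennreal
    \<Rightarrow> (real \<Rightarrow> (real^'m) \<times> (real^'m) \<Rightarrow> (real \<times> (real^'m) \<times> (real^'m)) set)
    \<Rightarrow> (real \<Rightarrow> (real^'m) \<times> (real^'m) \<Rightarrow> (real \<times> (real^'m) \<times> (real^'m)) set) \<Rightarrow> bool" where
  "growth_codifferential \<alpha> \<beta> p q fl fu \<longleftrightarrow>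
     (if p = \<infinity> then
        \<forall>N>0. \<exists>\<beta>N. nonneg_L1 \<alpha> \<beta> \<beta>N \<and>
          (AE x in lebesgue_on {\<alpha><..<\<beta>}. \<forall>u \<xi>. max (norm u) (norm \<xi>) \<le> N \<longrightarrow>
             (\<forall>(a, v1, v2)\<in>fl x (u, \<xi>). \<forall>(b, w1, w2)\<in>fu x (u, \<xi>).
                Max {\<bar>a\<bar>, norm v1, norm v2, \<bar>b\<bar>, norm w1, norm w2} \<le> \<beta>N x))
      else
        \<exists>c \<beta>0 \<gamma>. c > 0 \<and> nonneg_L1 \<alpha> \<beta> \<beta>0 \<and>
          in_Lp \<alpha> \<beta> q \<gamma> \<and> (AE x in lebesgue_on {\<alpha><..<\<beta>}. 0 \<le> \<gamma> x) \<and>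
          (AE x in lebesgue_on {\<alpha><..<\<beta>}. \<forall>u \<xi>.
             \<forall>(a, v1, v2)\<in>fl x (u, \<xi>). \<forall>(b, w1, w2)\<in>fu x (u, \<xi>).
               max \<bar>a\<bar> \<bar>b\<bar> \<le> \<beta>0 x
                   + c * (rpow (norm u) (enn2real p) + rpow (norm \<xi>) (enn2real p)) \<and>
               Max {norm v1, norm v2, norm w1, norm w2} \<le> \<gamma> x
                   + c * (rpow (norm u) (enn2real p - 1) + rpow (norm \<xi>) (enn2real p - 1))))"

definition codifferentiability_conditions ::
  "real \<Rightarrow> real \<Rightarrow> ennreal \<Rightarrow> ennreal
    \<Rightarrow> (real \<Rightarrow> (real^'m) \<times> (real^'m) \<Rightarrow> real)
    \<Rightarrow> (real \<Rightarrow> (real^'m) \<times> (real^'m) \<Rightarrow> (real \<times> (real^'m) \<times> (real^'m)) set)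
    \<Rightarrow> (real \<Rightarrow> (real^'m) \<times> (real^'m) \<Rightarrow> (real \<times> (real^'m) \<times> (real^'m)) set) \<Rightarrow> bool" where
  "codifferentiability_conditions \<alpha> \<beta> p q f fl fu \<longleftrightarrow>
     caratheodory \<alpha> \<beta> f \<and> growth_values \<alpha> \<beta> p f \<and>
     (AE x in lebesgue_on {\<alpha><..<\<beta>}. \<forall>z. is_codifferential (f x) z (fl x z) (fu x z)) \<and>
     caratheodory_multifun \<alpha> \<beta> fl \<and> caratheodory_multifun \<alpha> \<beta> fu \<and>
     growth_codifferential \<alpha> \<beta> p q fl fu"


section \<open>The variational problem\<close>

definition bolza ::
  "real \<Rightarrow> real \<Rightarrow> (real \<Rightarrow> (real^'m) \<times> (real^'m) \<Rightarrow> real) \<Rightarrow> ((real^'m) \<times> (real^'m) \<Rightarrow> real)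
    \<Rightarrow> (real \<Rightarrow> real^'m) \<Rightarrow> real" where
  "bolza \<alpha> \<beta> f g0 u =
     (LINT x|lebesgue_on {\<alpha><..<\<beta>}. f x (u x, vderiv u x)) + g0 (u \<alpha>, u \<beta>)"

definition feasible ::
  "real \<Rightarrow> real \<Rightarrow> ennreal \<Rightarrow> nat set \<Rightarrow> nat set \<Rightarrow> (nat \<Rightarrow> (real^'m) \<times> (real^'m) \<Rightarrow> real)
    \<Rightarrow> (real \<Rightarrow> real^'m) set" where
  "feasible \<alpha> \<beta> p I J g =
     {u \<in> W1p \<alpha> \<beta> p. (\<forall>i\<in>I. g i (u \<alpha>, u \<beta>) \<le> 0) \<and> (\<forall>j\<in>J. g j (u \<alpha>, u \<beta>) = 0)}"

definition locally_optimal ::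
  "real \<Rightarrow> real \<Rightarrow> ennreal \<Rightarrow> (real \<Rightarrow> (real^'m) \<times> (real^'m) \<Rightarrow> real) \<Rightarrow> nat set \<Rightarrow> nat set
    \<Rightarrow> (nat \<Rightarrow> (real^'m) \<times> (real^'m) \<Rightarrow> real) \<Rightarrow> (real \<Rightarrow> real^'m) \<Rightarrow> bool" where
  "locally_optimal \<alpha> \<beta> p f I J g u \<longleftrightarrow>
     u \<in> feasible \<alpha> \<beta> p I J g \<and>
     (\<exists>\<epsilon>>0. \<forall>v\<in>feasible \<alpha> \<beta> p I J g.
        W1p_norm \<alpha> \<beta> p (\<lambda>x. v x - u x) < \<epsilon> \<longrightarrow> bolza \<alpha> \<beta> f (g 0) u \<le> bolza \<alpha> \<beta> f (g 0) v)"

end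

theory Submission
  imports Defs
begin

text \<open>
  The directional derivative of a codifferentiable function in a direction \<open>h\<close> is the maximum of
  \<open>v \<bullet> h\<close> over the lower slice \<open>subd A\<close> plus the minimum of \<open>w \<bullet> h\<close> over the upper slice
  \<open>subd B\<close>, hence is bounded by the support function of \<open>subd A + {w}\<close> for each \<open>w \<in> subd B\<close>.
  By the constraint qualification on the equality constraints there are end point directions which
  change a single \<open>g\<^sub>j\<close> and leave the others unchanged to first order; a Poincare--Miranda
  argument then corrects any linearized feasible direction to an admissible curve. Let \<open>D x\<close> be the
  lower slice for \<open>f\<close> at \<open>x\<close> shifted by \<open>(w1 x, w2 x)\<close>. Local optimality gives that
  \<open>\<integral> sup {v \<bullet> (h, h') | v \<in> D x} dx\<close> plus the support function of the end point term is nonnegative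
  for all Lipschitz \<open>h\<close> with linearized feasible end points. A Hahn--Banach argument over functionals
  dominated by an integral replaces the supremum by a single integrable selection \<open>(v1, v2)\<close> of \<open>D\<close>.
  Testing with \<open>h\<close> vanishing at the end points, the du Bois-Reymond lemma shows that \<open>v2\<close> is an
  indefinite integral \<open>\<zeta>\<close> of \<open>v1\<close>. The remaining inequality for the end points of \<open>h\<close> is finite
  dimensional, and separation from the closed multiplier cone yields the transversality condition.\<close>

section \<open>Support functions and directional derivatives\<close>

text \<open>The directional derivative of a codifferentiable function is only a difference of
  sublinear functions, so separation does not apply to it directly. Fixing one element of the upper
  slice, as \<open>(s10, s20)\<close>, \<open>(w1, w2)\<close> and the vectors of the constraint
  qualification do, replaces it by a sublinear majorant; everything after the primal inequality is
  convex analysis. An equality constraint needs majorants for both \<open>g j\<close> and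
  \<open>- g j\<close>, given by the two halves of \<open>C j\<close>; where both are nonpositive,
  the derivative of \<open>g j\<close> vanishes.

  Test functions are Lipschitz with bounded derivative for every \<open>p\<close>: their small
  multiples are small in all the norms at once, and dominated convergence only asks for an
  integrable local Lipschitz constant of \<open>f\<close>. They still attain all pairs of end
  values, which is what transversality tests.

  Moving along curves takes strict inequalities, forming polars nonstrict ones; a direction strict
  for all active inequality constraints bridges the two by a limit. Polytopes make the cones
  generated by the sets \<open>C j\<close> closed, so that compact sets can be separated from
  them.\<close>

definition support_fun :: "'a::euclidean_space set \<Rightarrow> 'a \<Rightarrow> real" where
  "support_fun S h = (SUP v\<in>S. v \<bullet> h)"

lemma bdd_above_inner:
  fixes S :: "'a::euclidean_space set"
  assumes "bounded S"
  shows "bdd_above ((\<lambda>v. v \<bullet> h) ` S)"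
proof -
  obtain B where B: "\<And>v. v \<in> S \<Longrightarrow> norm v \<le> B" using assms unfolding bounded_iff by blast
  have "v \<bullet> h \<le> B * norm h" if "v \<in> S" for v
    using norm_cauchy_schwarz[of v h] mult_right_mono[OF B[OF that], of "norm h"] by simp
  then show ?thesis by (intro bdd_aboveI2[where M="B * norm h"]) auto
qed

lemma support_fun_upper:
  "compact S \<Longrightarrow> v \<in> S \<Longrightarrow> v \<bullet> h \<le> support_fun S h"
  unfolding support_fun_def by (rule cSUP_upper) (auto intro: bdd_above_inner compact_imp_bounded)

lemma support_fun_least:
  "S \<noteq> {} \<Longrightarrow> (\<And>v. v \<in> S \<Longrightarrow> v \<bullet> h \<le> c) \<Longrightarrow> support_fun S h \<le> c"
  unfolding support_fun_def by (rule cSUP_least)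

lemma support_fun_attained:
  assumes "compact S" "S \<noteq> {}"
  obtains v where "v \<in> S" "v \<bullet> h = support_fun S h"
proof -
  have "\<exists>v\<in>S. \<forall>w\<in>S. w \<bullet> h \<le> v \<bullet> h"
    using assms by (intro continuous_attains_sup) (auto intro: continuous_intros)
  then obtain v where "v \<in> S" "\<And>w. w \<in> S \<Longrightarrow> w \<bullet> h \<le> v \<bullet> h" by blast
  then show ?thesis
    using that[of v] support_fun_upper[OF assms(1), of v h] support_fun_least[OF assms(2), of h "v \<bullet> h"]
    by force
qed

lemma support_fun_add:
  assumes "compact S" "S \<noteq> {}"
  shows "support_fun S (h + k) \<le> support_fun S h + support_fun S k"
  using assms support_fun_upper[OF assms(1)]
  by (intro support_fun_least) (auto simp: inner_add_right intro!: add_mono)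

lemma support_fun_scale:
  assumes "compact S" "S \<noteq> {}" "0 \<le> t"
  shows "support_fun S (t *\<^sub>R h) = t * support_fun S h"
proof (rule antisym)
  show "support_fun S (t *\<^sub>R h) \<le> t * support_fun S h"
    using assms support_fun_upper[OF assms(1)]
    by (intro support_fun_least) (auto intro!: mult_left_mono)
  obtain v where "v \<in> S" "v \<bullet> h = support_fun S h" using support_fun_attained[OF assms(1,2)] .
  then show "t * support_fun S h \<le> support_fun S (t *\<^sub>R h)"
    using support_fun_upper[OF assms(1), of v "t *\<^sub>R h"] by simp
qed

lemma support_fun_zero [simp]: "S \<noteq> {} \<Longrightarrow> support_fun S 0 = 0"
  by (simp add: support_fun_def)

lemma support_fun_sum_le:
  assumes "compact S" "S \<noteq> {}"
  shows "support_fun S (\<Sum>i\<in>T. h i) \<le> (\<Sum>i\<in>T. support_fun S (h i))"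
proof (induction T rule: infinite_finite_induct)
  case (insert i T)
  then show ?case using support_fun_add[OF assms, of "h i" "\<Sum>i\<in>T. h i"] by simp
qed (use assms in simp_all)

lemma abs_support_fun_le:
  assumes "compact S" "S \<noteq> {}" "\<And>v. v \<in> S \<Longrightarrow> norm v \<le> M"
  shows "\<bar>support_fun S h\<bar> \<le> M * norm h"
proof -
  obtain v where "v \<in> S" "v \<bullet> h = support_fun S h" using support_fun_attained[OF assms(1,2)] .
  then show ?thesis
    using Cauchy_Schwarz_ineq2[of v h] mult_right_mono[OF assms(3), of v "norm h"] by simp
qed

text \<open>Subadditivity applied to \<open>h = (h - k) + k\<close> and to
  \<open>k = (k - h) + h\<close> bounds the difference from both sides.\<close>

lemma support_fun_lipschitz:
  assumes "compact S" "S \<noteq> {}" "\<And>v. v \<in> S \<Longrightarrow> norm v \<le> M"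
  shows "\<bar>support_fun S h - support_fun S k\<bar> \<le> M * norm (h - k)"
  using support_fun_add[OF assms(1,2), of "h - k" k] support_fun_add[OF assms(1,2), of "k - h" h]
    abs_support_fun_le[OF assms, of "h - k"] abs_support_fun_le[OF assms, of "k - h"]
  by (simp add: norm_minus_commute)

lemma continuous_support_fun:
  assumes "compact S" "S \<noteq> {}"
  shows "continuous_on UNIV (support_fun S)"
proof -
  obtain M where "M > 0" "\<And>v. v \<in> S \<Longrightarrow> norm v \<le> M"
    using compact_imp_bounded[OF assms(1)] unfolding bounded_pos by blast
  then show ?thesis
    using support_fun_lipschitz[OF assms, of M]
    by (intro lipschitz_on_continuous_on[of M] lipschitz_onI) (auto simp: dist_norm)
qed

lemma plus_singleton_nonempty: "S \<noteq> {} \<Longrightarrow> S + {w} \<noteq> {}"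
  by (auto simp: set_plus_def)

lemma convex_plus_singleton: "convex S \<Longrightarrow> convex (S + {w})"
  by (intro convex_set_plus) auto

lemma compact_plus_singleton: "compact (S :: 'a::real_normed_vector set) \<Longrightarrow> compact (S + {w})"
proof -
  have "S + {w} = (\<lambda>v. v + w) ` S" by (auto simp: set_plus_def)
  then show "compact S \<Longrightarrow> compact (S + {w})" by (auto intro!: compact_continuous_image continuous_intros)
qed

lemma support_fun_plus_singleton:
  assumes "compact S" "S \<noteq> {}"
  shows "support_fun (S + {w}) h = support_fun S h + w \<bullet> h"
proof (rule antisym)
  show "support_fun (S + {w}) h \<le> support_fun S h + w \<bullet> h"
    using assms support_fun_upper[OF assms(1)]
    by (intro support_fun_least) (auto simp: set_plus_def inner_add_left)
  have c: "compact (S + {w})" by (rule compact_plus_singleton[OF assms(1)])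
  obtain v where "v \<in> S" "v \<bullet> h = support_fun S h" using support_fun_attained[OF assms] .
  then show "support_fun S h + w \<bullet> h \<le> support_fun (S + {w}) h"
    using support_fun_upper[OF c, of "v + w" h] by (auto simp: set_plus_def inner_add_left)
qed

text \<open>A point outside a compact convex set is strictly separated from it by some
  \<open>h\<close>, and the inequality then fails in the direction \<open>- h\<close>.\<close>

lemma mem_if_le_support_fun:
  assumes "compact S" "S \<noteq> {}" "convex S" "\<And>h. v \<bullet> h \<le> support_fun S h"
  shows "v \<in> S"
proof (rule ccontr)
  assume "v \<notin> S"
  then obtain h b where h: "h \<bullet> v < b" "\<And>w. w \<in> S \<Longrightarrow> b < h \<bullet> w"
    using separating_hyperplane_closed_point[of S v] assms compact_imp_closed by blast
  have "support_fun S (- h) \<le> - b"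
    using h(2) assms(2) by (intro support_fun_least) (auto simp: inner_commute less_imp_le)
  then show False using h(1) assms(4)[of "- h"] by (simp add: inner_commute)
qed

section \<open>Normalized codifferentials, their slices and directional derivatives\<close>

lemma codiff_hi_upper:
  fixes A :: "(real \<times> 'a::euclidean_space) set"
  assumes "compact A" "(a, v) \<in> A"
  shows "a + v \<bullet> h \<le> codiff_hi A h"
proof -
  have "bdd_above ((\<lambda>(a, v). a + v \<bullet> h) ` A)"
    using assms by (intro bounded_imp_bdd_above compact_imp_bounded compact_continuous_image)
      (auto simp: case_prod_unfold intro!: continuous_intros)
  then show ?thesis unfolding codiff_hi_def using assms(2) by (intro cSUP_upper2[of _ _ "(a, v)"]) auto
qed

lemma codiff_hi_least:
  assumes "A \<noteq> {}" "\<And>a v. (a, v) \<in> A \<Longrightarrow> a + v \<bullet> h \<le> c"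
  shows "codiff_hi A h \<le> c"
  unfolding codiff_hi_def using assms by (intro cSUP_least) auto

text \<open>At the increment 0 only first components are left, and the normalization makes their
  maximum 0.\<close>

lemma codiff_hi_nonpos:
  assumes "compact A" "codiff_hi A 0 = 0" "(a, v) \<in> A"
  shows "a \<le> 0"
  using codiff_hi_upper[OF assms(1,3), of 0] assms(2) by simp

lemma compact_subd:
  fixes A :: "(real \<times> 'a::euclidean_space) set"
  assumes "compact A" shows "compact (subd A)"
proof -
  have "subd A = snd ` (A \<inter> {z. fst z = 0})" by (force simp: subd_def)
  moreover have "closed {z::real \<times> 'a. fst z = 0}"
    by (intro closed_Collect_eq continuous_intros)
  ultimately show ?thesis
    using assms by (auto intro!: compact_continuous_image continuous_intros compact_Int_closed)
qed

lemma convex_subd: "convex A \<Longrightarrow> convex (subd A)"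
  unfolding subd_def convex_def by force

text \<open>The first component attains its maximum on the compact set \<open>A\<close>; the
  normalization makes this maximum 0, so a maximizer lies over 0.\<close>

lemma subd_nonempty:
  fixes A :: "(real \<times> 'a::euclidean_space) set"
  assumes "compact A" "A \<noteq> {}" "codiff_hi A 0 = 0"
  shows "subd A \<noteq> {}"
proof -
  have "\<exists>z\<in>A. \<forall>y\<in>A. fst y \<le> fst z"
    using assms by (intro continuous_attains_sup) (auto intro: continuous_intros)
  then obtain a v where av: "(a, v) \<in> A" "\<And>b w. (b, w) \<in> A \<Longrightarrow> b \<le> a" by force
  have "codiff_hi A 0 \<le> a" using assms(2) av(2) by (intro codiff_hi_least) auto
  then have "a = 0" using codiff_hi_nonpos[OF assms(1,3) av(1)] assms(3) by simp
  then show ?thesis using av(1) by (auto simp: subd_def)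
qed

lemma subd_uminus: "subd (uminus ` A) = uminus ` subd (A :: (real \<times> 'a::real_vector) set)"
  by (force simp: subd_def image_iff)

text \<open>On the reals an infimum is by definition minus the supremum of the negatives, so the
  identity is unconditional. Facts about upper sets thereby follow from those about lower sets,
  applied to the negated set.\<close>

lemma codiff_lo_eq_hi: "codiff_lo B h = - codiff_hi (uminus ` B) h"
proof -
  have "(\<lambda>(b, w). b + w \<bullet> h) ` uminus ` B = uminus ` (\<lambda>(b, w). b + w \<bullet> h) ` B"
    by (force simp: image_iff)
  then show ?thesis by (simp add: codiff_lo_def codiff_hi_def Inf_real_def image_image)
qed

text \<open>Elements \<open>(a, v)\<close> with \<open>a < 0\<close> and \<open>v \<bullet> h\<close> exceeding the support function of the slice
  \<open>a = 0\<close> have \<open>a\<close> bounded away from \<open>0\<close> by compactness, so they are irrelevant for small \<open>t\<close>.\<close>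

lemma codiff_hi_directional:
  fixes A :: "(real \<times> 'a::euclidean_space) set"
  assumes "compact A" "A \<noteq> {}" "codiff_hi A 0 = 0"
  shows "((\<lambda>t. codiff_hi A (t *\<^sub>R h) / t) \<longlongrightarrow> support_fun (subd A) h) (at_right 0)"
proof -
  define m where "m = support_fun (subd A) h"
  have ne: "subd A \<noteq> {}" and co: "compact (subd A)"
    using subd_nonempty[OF assms] compact_subd[OF assms(1)] by auto
  obtain v0 where v0: "v0 \<in> subd A" "v0 \<bullet> h = m" using support_fun_attained[OF co ne] m_def by metis
  obtain K where K: "K > 0" "\<And>z. z \<in> A \<Longrightarrow> norm z \<le> K"
    using compact_imp_bounded[OF assms(1)] unfolding bounded_pos by blast
  have lower: "m \<le> codiff_hi A (t *\<^sub>R h) / t" if "t > 0" for t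
    using codiff_hi_upper[OF assms(1), of 0 v0 "t *\<^sub>R h"] v0 that
    by (simp add: subd_def field_simps)
  have upper: "\<forall>\<^sub>F t in at_right 0. codiff_hi A (t *\<^sub>R h) / t \<le> m + \<epsilon>" if "\<epsilon> > 0" for \<epsilon>
  proof -
    define A' where "A' = A \<inter> {z. m + \<epsilon> \<le> snd z \<bullet> h}"
    have cA': "compact A'" unfolding A'_def
      using assms(1) by (intro compact_Int_closed closed_Collect_le continuous_intros)
    have "\<exists>d>0. \<forall>z\<in>A'. fst z \<le> - d"
    proof (cases "A' = {}")
      case False
      then have "\<exists>z\<in>A'. \<forall>y\<in>A'. fst y \<le> fst z"
        using cA' by (intro continuous_attains_sup) (auto intro: continuous_intros)
      then obtain z where z: "z \<in> A'" "\<And>y. y \<in> A' \<Longrightarrow> fst y \<le> fst z" by auto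
      have "fst z \<le> 0" using codiff_hi_nonpos[OF assms(1,3), of "fst z" "snd z"] z(1)
        by (auto simp: A'_def)
      moreover have "fst z \<noteq> 0"
      proof
        assume "fst z = 0"
        then have "snd z \<in> subd A" using z(1) by (auto simp: A'_def subd_def) (metis prod.collapse)
        then show False using support_fun_upper[OF co, of "snd z" h] z(1) \<open>\<epsilon> > 0\<close>
          by (auto simp: A'_def m_def)
      qed
      ultimately show ?thesis using z(2) by (intro exI[of _ "- fst z"]) auto
    qed (auto intro: exI[of _ 1])
    then obtain d where d: "d > 0" "\<And>z. z \<in> A' \<Longrightarrow> fst z \<le> - d" by blast
    \<comment> \<open>For \<open>t < t0\<close> one has
      \<open>t * (K * norm h + \<bar>m\<bar> + 1) \<le> d\<close>, so the drop
      \<open>a \<le> - d\<close> outweighs both the growth of \<open>t * (v \<bullet> h)\<close> and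
      a possibly negative \<open>t * m\<close>. The 1 keeps the denominator positive.\<close>
    define t0 where "t0 = d / (K * norm h + \<bar>m\<bar> + 1)"
    have pos: "K * norm h + \<bar>m\<bar> + 1 > 0" using K(1) by (simp add: add_nonneg_pos)
    have t0: "t0 > 0" unfolding t0_def using d(1) pos by simp
    have "codiff_hi A (t *\<^sub>R h) / t \<le> m + \<epsilon>" if t: "0 < t" "t < t0" for t
    proof -
      have "codiff_hi A (t *\<^sub>R h) \<le> t * (m + \<epsilon>)"
      proof (rule codiff_hi_least[OF assms(2)])
        fix a v assume av: "(a, v) \<in> A"
        show "a + v \<bullet> t *\<^sub>R h \<le> t * (m + \<epsilon>)"
        proof (cases "(a, v) \<in> A'")
          case True
          have "norm v \<le> K" using K(2)[OF av] norm_snd_le[of v a] by simp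
          then have "v \<bullet> h \<le> K * norm h"
            using norm_cauchy_schwarz[of v h] mult_right_mono[of "norm v" K "norm h"] by simp
          then have "t * (v \<bullet> h) \<le> t * (K * norm h)" using t by simp
          moreover have "t * (K * norm h) + t * \<bar>m\<bar> + t \<le> d"
            using t pos by (simp add: t0_def field_simps)
          moreover have "t * \<bar>m\<bar> \<ge> - (t * m)" using t by (simp add: abs_if)
          moreover have "t * \<epsilon> > 0" using t \<open>\<epsilon> > 0\<close> by simp
          ultimately have "a + t * (v \<bullet> h) \<le> t * m + t * \<epsilon>"
            using d(2)[OF True, unfolded fst_conv] t(1) by linarith
          then show ?thesis by (simp add: distrib_left)
        next
          case False
          then have "v \<bullet> h \<le> m + \<epsilon>" using av by (auto simp: A'_def)
          then have "t * (v \<bullet> h) \<le> t * (m + \<epsilon>)" using t by simp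
          then show ?thesis using codiff_hi_nonpos[OF assms(1,3) av] by simp
        qed
      qed
      then show ?thesis using t by (simp add: field_simps)
    qed
    then show ?thesis unfolding eventually_at_right_field using t0 by auto
  qed
  show ?thesis unfolding m_def[symmetric]
  proof (rule tendstoI)
    fix e :: real assume "e > 0"
    have "\<forall>\<^sub>F t in at_right 0. t > (0::real)" by (simp add: eventually_at_right_less)
    with upper[of "e/2"] \<open>e > 0\<close> have "\<forall>\<^sub>F t in at_right 0. codiff_hi A (t *\<^sub>R h) / t \<le> m + e/2 \<and> t > 0"
      by (auto intro: eventually_conj)
    then show "\<forall>\<^sub>F t in at_right 0. dist (codiff_hi A (t *\<^sub>R h) / t) m < e"
      by eventually_elim (use lower \<open>e > 0\<close> in \<open>force simp: dist_real_def abs_if\<close>)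
  qed
qed

text \<open>The subtracted term is minus the minimum of \<open>w \<bullet> h\<close> over
  \<open>subd B\<close>, so this is a maximum plus a minimum, written as a difference of two
  sublinear functions.\<close>

definition codiff_dir :: "(real \<times> 'a::euclidean_space) set \<Rightarrow> (real \<times> 'a) set \<Rightarrow> 'a \<Rightarrow> real" where
  "codiff_dir A B h = support_fun (subd A) h - support_fun (uminus ` subd B) h"

text \<open>Later citations pick facts by position: 11 to 13 concern the lower slice, 14, 15 and 18
  the upper slice, 16 and 17 the negated upper slice.\<close>

lemma is_codifferential_parts:
  fixes A :: "(real \<times> 'a::euclidean_space) set"
  assumes "is_codifferential F x A B"
  shows "compact A" "A \<noteq> {}" "codiff_hi A 0 = 0" "convex A"
    "compact B" "B \<noteq> {}" "compact (uminus ` B)" "uminus ` B \<noteq> {}" "codiff_hi (uminus ` B) 0 = 0" "convex B"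
    "compact (subd A)" "subd A \<noteq> {}" "convex (subd A)"
    "compact (subd B)" "subd B \<noteq> {}" "compact (uminus ` subd B)" "uminus ` subd B \<noteq> {}" "convex (subd B)"
proof -
  show *: "compact A" "A \<noteq> {}" "codiff_hi A 0 = 0" "convex A"
    "compact B" "B \<noteq> {}" "compact (uminus ` B)" "uminus ` B \<noteq> {}" "codiff_hi (uminus ` B) 0 = 0" "convex B"
    using assms by (auto simp: is_codifferential_def codiff_lo_eq_hi intro: compact_negations)
  show "compact (subd A)" "subd A \<noteq> {}" "convex (subd A)"
    using * compact_subd subd_nonempty convex_subd by auto
  show **: "compact (subd B)" "convex (subd B)"
    using * compact_subd convex_subd by auto
  show "compact (uminus ` subd B)" using ** compact_negations by auto
  have "subd (uminus ` B) \<noteq> {}" using * subd_nonempty by blast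
  then show "uminus ` subd B \<noteq> {}" "subd B \<noteq> {}" by (auto simp: subd_uminus)
qed

text \<open>Dividing the defining error term by \<open>t\<close> leaves difference quotients of
  \<open>codiff_hi\<close> for \<open>A\<close> and for the negated \<open>B\<close>, whose limits
  are known.\<close>

lemma codiff_directional:
  fixes F :: "'a::euclidean_space \<Rightarrow> real"
  assumes "is_codifferential F x A B"
  shows "((\<lambda>t. (F (x + t *\<^sub>R h) - F x) / t) \<longlongrightarrow> codiff_dir A B h) (at_right 0)"
proof -
  note c = is_codifferential_parts[OF assms]
  have 1: "((\<lambda>t. (1 / t) * \<bar>F (x + t *\<^sub>R h) - F x - codiff_hi A (t *\<^sub>R h) - codiff_lo B (t *\<^sub>R h)\<bar>)
            \<longlongrightarrow> 0) (at_right 0)"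
    using assms by (auto simp: is_codifferential_def)
  have 2: "((\<lambda>t. (F (x + t *\<^sub>R h) - F x) / t - codiff_hi A (t *\<^sub>R h) / t
     + codiff_hi (uminus ` B) (t *\<^sub>R h) / t) \<longlongrightarrow> 0) (at_right 0)"
  proof (rule Lim_null_comparison[OF _ 1])
    have "\<forall>\<^sub>F t in at_right 0. t > (0::real)" by (simp add: eventually_at_right_less)
    then show "\<forall>\<^sub>F t in at_right 0. norm ((F (x + t *\<^sub>R h) - F x) / t - codiff_hi A (t *\<^sub>R h) / t
     + codiff_hi (uminus ` B) (t *\<^sub>R h) / t) \<le> (1 / t) * \<bar>F (x + t *\<^sub>R h) - F x - codiff_hi A (t *\<^sub>R h) -
       codiff_lo B (t *\<^sub>R h)\<bar>"
      by eventually_elim (simp add: codiff_lo_eq_hi diff_divide_distrib[symmetric]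
        add_divide_distrib[symmetric])
  qed
  have "((\<lambda>t. ((F (x + t *\<^sub>R h) - F x) / t - codiff_hi A (t *\<^sub>R h) / t
     + codiff_hi (uminus ` B) (t *\<^sub>R h) / t) + codiff_hi A (t *\<^sub>R h) / t - codiff_hi (uminus ` B) (t *\<^sub>R h) /
       t)
     \<longlongrightarrow> 0 + support_fun (subd A) h - support_fun (subd (uminus ` B)) h) (at_right 0)"
    by (intro tendsto_intros 2 codiff_hi_directional c)
  then show ?thesis by (simp add: codiff_dir_def subd_uminus)
qed

section \<open>Local Lipschitz continuity from bounded slices\<close>

lemma codiff_dir_bound:
  assumes "is_codifferential F x A B"
    and "\<And>v. v \<in> subd A \<Longrightarrow> norm v \<le> M" "\<And>w. w \<in> subd B \<Longrightarrow> norm w \<le> M"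
  shows "\<bar>codiff_dir A B h\<bar> \<le> 2 * M * norm h"
proof -
  note c = is_codifferential_parts[OF assms(1)]
  have "\<bar>support_fun (subd A) h\<bar> \<le> M * norm h" "\<bar>support_fun (uminus ` subd B) h\<bar> \<le> M * norm h"
    using assms by (auto intro!: abs_support_fun_le c)
  then show ?thesis unfolding codiff_dir_def by linarith
qed

text \<open>A mean value inequality for a function with merely one-sided directional derivatives.
  The estimate \<open>\<bar>\<phi> b - \<phi> a\<bar> \<le> K * (b - a)\<close> is additive over
  adjacent intervals and holds for all short intervals around a given point, so bisection
  (\<open>Bolzano\<close>) extends it to the whole segment.\<close>

lemma codiff_lipschitz:
  fixes F :: "'a::euclidean_space \<Rightarrow> real"
  assumes "\<And>z. z \<in> closed_segment x y \<Longrightarrow> is_codifferential F z (A z) (B z)"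
    and "\<And>z v. z \<in> closed_segment x y \<Longrightarrow> v \<in> subd (A z) \<Longrightarrow> norm v \<le> M"
    and "\<And>z w. z \<in> closed_segment x y \<Longrightarrow> w \<in> subd (B z) \<Longrightarrow> norm w \<le> M"
  shows "\<bar>F y - F x\<bar> \<le> 2 * M * norm (y - x)"
proof (rule field_le_epsilon)
  fix e :: real assume "e > 0"
  define \<phi> where "\<phi> s = F (x + s *\<^sub>R (y - x))" for s
  define K where "K = 2 * M * norm (y - x) + e"
  have "\<bar>\<phi> 1 - \<phi> 0\<bar> \<le> K * (1 - 0)"
  proof (rule Bolzano[of 0 1 "\<lambda>a b. \<bar>\<phi> b - \<phi> a\<bar> \<le> K * (b - a)"])
    show "(0::real) \<le> 1" by simp
    show "\<bar>\<phi> c - \<phi> a\<bar> \<le> K * (c - a)"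
      if "\<bar>\<phi> b - \<phi> a\<bar> \<le> K * (b - a)" "\<bar>\<phi> c - \<phi> b\<bar> \<le> K * (c - b)" for a b c
      using that by (simp add: algebra_simps)
    fix s :: real assume s: "0 \<le> s" "s \<le> 1"
    define z where "z = x + s *\<^sub>R (y - x)"
    have "z \<in> closed_segment x y" unfolding z_def closed_segment_def
      using s by (auto simp: algebra_simps intro!: exI[of _ s])
    note cz = assms(1)[OF this] assms(2)[OF this] assms(3)[OF this]
    have dir: "\<exists>d>0. \<forall>t. 0 < t \<and> t < d \<longrightarrow> \<bar>F (z + t *\<^sub>R h) - F z\<bar> \<le> K * t"
      if "norm h = norm (y - x)" for h
    proof -
      have "\<bar>codiff_dir (A z) (B z) h\<bar> \<le> 2 * M * norm (y - x)"
        using codiff_dir_bound[OF cz, of h] that by simp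
      \<comment> \<open>The summand \<open>e\<close> of \<open>K\<close> makes the bound strict, so
        that it persists for the difference quotients with small \<open>t\<close>.\<close>
      then have "\<bar>codiff_dir (A z) (B z) h\<bar> < K" using \<open>e > 0\<close> by (simp add: K_def)
      then have "\<forall>\<^sub>F t in at_right 0. \<bar>(F (z + t *\<^sub>R h) - F z) / t\<bar> < K"
        using order_tendstoD(2)[OF tendsto_rabs[OF codiff_directional[OF cz(1), of h]]] by blast
      then obtain d where "d > 0" "\<And>t. 0 < t \<Longrightarrow> t < d \<Longrightarrow> \<bar>(F (z + t *\<^sub>R h) - F z) / t\<bar> < K"
        unfolding eventually_at_right_field by auto
      then show ?thesis
        by (intro exI[of _ d]) (force simp: abs_divide divide_less_eq)
    qed
    obtain d1 where d1: "d1 > 0" "\<And>t. 0 < t \<Longrightarrow> t < d1 \<Longrightarrow> \<bar>F (z + t *\<^sub>R (y - x)) - F z\<bar> \<le> K * t"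
      using dir[of "y - x"] by auto
    \<comment> \<open>Only one-sided derivatives are available, so the part of an interval to the
      left of \<open>s\<close> is reached along the opposite direction \<open>x - y\<close>.\<close>
    obtain d2 where d2: "d2 > 0" "\<And>t. 0 < t \<Longrightarrow> t < d2 \<Longrightarrow> \<bar>F (z + t *\<^sub>R (x - y)) - F z\<bar> \<le> K * t"
      using dir[of "x - y"] norm_minus_commute by metis
    show "\<exists>d>0. \<forall>a b. a \<le> s \<and> s \<le> b \<and> b - a < d \<longrightarrow> \<bar>\<phi> b - \<phi> a\<bar> \<le> K * (b - a)"
    proof (intro exI[of _ "min d1 d2"] conjI allI impI)
      show "min d1 d2 > 0" using d1 d2 by simp
      fix a b assume ab: "a \<le> s \<and> s \<le> b \<and> b - a < min d1 d2"
      have 1: "\<bar>\<phi> b - \<phi> s\<bar> \<le> K * (b - s)"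
      proof (cases "b = s")
        case False
        have "x + b *\<^sub>R (y - x) = z + (b - s) *\<^sub>R (y - x)" by (simp add: z_def algebra_simps)
        then show ?thesis using d1(2)[of "b - s"] ab False unfolding \<phi>_def z_def[symmetric] by simp
      qed simp
      have 2: "\<bar>\<phi> a - \<phi> s\<bar> \<le> K * (s - a)"
      proof (cases "a = s")
        case False
        have "x + a *\<^sub>R (y - x) = z + (s - a) *\<^sub>R (x - y)" by (simp add: z_def algebra_simps)
        then show ?thesis using d2(2)[of "s - a"] ab False unfolding \<phi>_def z_def[symmetric] by simp
      qed simp
      show "\<bar>\<phi> b - \<phi> a\<bar> \<le> K * (b - a)" using 1 2 by (simp add: algebra_simps)
    qed
  qed
  then show "\<bar>F y - F x\<bar> \<le> 2 * M * norm (y - x) + e" by (simp add: \<phi>_def K_def)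
qed

text \<open>By the local Lipschitz bound, replacing \<open>h\<close> by \<open>hn n\<close> changes
  the difference quotient by at most \<open>M * norm (hn n - h)\<close>, uniformly in the step
  \<open>t n\<close>.\<close>

lemma hadamard_directional:
  fixes F :: "'a::euclidean_space \<Rightarrow> real"
  assumes lip: "\<And>y y'. y \<in> cball z \<rho> \<Longrightarrow> y' \<in> cball z \<rho> \<Longrightarrow> \<bar>F y - F y'\<bar> \<le> M * norm (y - y')" "\<rho> > 0"
    and dir: "((\<lambda>t. (F (z + t *\<^sub>R h) - F z) / t) \<longlongrightarrow> d) (at_right 0)"
    and t: "t \<longlonglongrightarrow> 0" "\<And>n. t n > 0" and hn: "hn \<longlonglongrightarrow> h"
  shows "(\<lambda>n. (F (z + t n *\<^sub>R hn n) - F z) / t n) \<longlonglongrightarrow> d"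
proof -
  have f: "filterlim t (at_right 0) sequentially"
    using t by (auto simp: filterlim_at less_imp_neq[symmetric] less_imp_neq[THEN not_sym])
  have 1: "(\<lambda>n. (F (z + t n *\<^sub>R h) - F z) / t n) \<longlonglongrightarrow> d"
    using filterlim_compose[OF dir f] .
  have a: "(\<lambda>n. t n *\<^sub>R h) \<longlonglongrightarrow> 0 *\<^sub>R h" "(\<lambda>n. t n *\<^sub>R hn n) \<longlonglongrightarrow> 0 *\<^sub>R h"
    by (intro tendsto_intros t hn)+
  have ev: "\<forall>\<^sub>F n in sequentially. norm (t n *\<^sub>R h) < \<rho>" "\<forall>\<^sub>F n in sequentially. norm (t n *\<^sub>R hn n) < \<rho>"
    using a lip(2) by (auto intro!: order_tendstoD(2)[of _ 0] dest: tendsto_norm)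
  have m: "(\<lambda>n. M * norm (hn n - h)) \<longlonglongrightarrow> M * norm (h - h)"
    by (intro tendsto_intros hn)
  have 2: "(\<lambda>n. (F (z + t n *\<^sub>R hn n) - F (z + t n *\<^sub>R h)) / t n) \<longlonglongrightarrow> 0"
  proof (rule Lim_null_comparison)
    show "(\<lambda>n. M * norm (hn n - h)) \<longlonglongrightarrow> 0" using m by simp
    show "\<forall>\<^sub>F n in sequentially. norm ((F (z + t n *\<^sub>R hn n) - F (z + t n *\<^sub>R h)) / t n) \<le> M * norm (hn n - h)"
      using ev
    proof eventually_elim
      case (elim n)
      have "\<bar>F (z + t n *\<^sub>R hn n) - F (z + t n *\<^sub>R h)\<bar> \<le> M * norm (t n *\<^sub>R (hn n - h))"
        using lip(1)[of "z + t n *\<^sub>R hn n" "z + t n *\<^sub>R h"] elim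
        by (simp add: dist_norm scaleR_diff_right)
      also have "\<dots> = M * norm (hn n - h) * t n" using t(2)[of n] by simp
      finally show ?case using t(2)[of n] by (simp add: divide_le_eq)
    qed
  qed
  have "(\<lambda>n. (F (z + t n *\<^sub>R hn n) - F (z + t n *\<^sub>R h)) / t n + (F (z + t n *\<^sub>R h) - F z) / t n) \<longlonglongrightarrow> 0 + d"
    by (intro tendsto_intros 1 2)
  then show ?thesis by (simp add: add_divide_distrib[symmetric])
qed

text \<open>Every point of \<open>A\<close> has a nearest point of \<open>B\<close> at distance less
  than 1. This turns Hausdorff continuity into uniform boundedness of the codifferentials near a
  point.\<close>

lemma hausdorff_dist_bound:
  fixes A B :: "'a::euclidean_space set"
  assumes "compact A" "compact B" "B \<noteq> {}" "hausdorff_dist A B < 1" "\<And>y. y \<in> B \<Longrightarrow> norm y \<le> K" "x \<in> A"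
  shows "norm x \<le> K + 1"
proof -
  have "bdd_above ((\<lambda>x. infdist x B) ` A)"
    using assms by (intro bounded_imp_bdd_above compact_imp_bounded compact_continuous_image
      continuous_intros)
  then have "infdist x B \<le> (SUP x\<in>A. infdist x B)" using assms(6) by (intro cSUP_upper)
  also have "\<dots> < 1" using assms(4) by (simp add: hausdorff_dist_def)
  finally have "infdist x B < 1" .
  moreover obtain y where "y \<in> B" "infdist x B = dist x y"
    using infdist_attains_inf[of B x] assms compact_imp_closed by blast
  ultimately show ?thesis using assms(5)[of y] norm_triangle_sub[of x y] by (simp add: dist_norm)
qed

text \<open>Near \<open>x\<close> both sets stay within Hausdorff distance 1 of those at
  \<open>x\<close>, so their elements are bounded by \<open>K + 1\<close>, and the mean value
  inequality applies along segments of a small ball.\<close>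

lemma continuously_codifferentiable_lipschitz:
  fixes F :: "'a::euclidean_space \<Rightarrow> real"
  assumes "continuously_codifferentiable_at F DL DU x"
  obtains \<rho> M where "\<rho> > 0" "\<And>y y'. y \<in> cball x \<rho> \<Longrightarrow> y' \<in> cball x \<rho> \<Longrightarrow> \<bar>F y - F y'\<bar> \<le> M * norm (y - y')"
proof -
  obtain S where S: "open S" "x \<in> S" "\<And>y. y \<in> S \<Longrightarrow> is_codifferential F y (DL y) (DU y)"
    using assms by (auto simp: continuously_codifferentiable_at_def)
  have "\<forall>\<^sub>F y in at x. hausdorff_dist (DL y) (DL x) < 1" "\<forall>\<^sub>F y in at x. hausdorff_dist (DU y) (DU x) < 1"
    using assms by (auto simp: continuously_codifferentiable_at_def hausdorff_continuous_at_def
        intro: order_tendstoD(2))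
  moreover have "\<forall>\<^sub>F y in at x. y \<in> S" using S by (simp add: eventually_at_topological) blast
  ultimately have "\<forall>\<^sub>F y in at x. y \<in> S \<and> hausdorff_dist (DL y) (DL x) < 1 \<and>
    hausdorff_dist (DU y) (DU x) < 1"
    by (simp add: eventually_conj_iff)
  then obtain d where d: "d > 0" "\<And>y. y \<noteq> x \<Longrightarrow> dist y x < d \<Longrightarrow>
    y \<in> S \<and> hausdorff_dist (DL y) (DL x) < 1 \<and> hausdorff_dist (DU y) (DU x) < 1"
    unfolding eventually_at by auto
  note cx = is_codifferential_parts[OF S(3)[OF S(2)]]
  have "bounded (DL x \<union> DU x)" using cx by (auto intro: compact_imp_bounded)
  then obtain K where K: "\<And>z. z \<in> DL x \<union> DU x \<Longrightarrow> norm z \<le> K" unfolding bounded_iff by blast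
  have K0: "norm z \<le> K + 1" if "z \<in> DL x \<union> DU x" for z using K[OF that] by simp
  have bd: "y \<in> S \<and> (\<forall>v\<in>subd (DL y). norm v \<le> K + 1) \<and> (\<forall>v\<in>subd (DU y). norm v \<le> K + 1)"
    if "dist y x < d" for y
  \<comment> \<open>The limits along \<open>at x\<close> say nothing about \<open>x\<close> itself,
    which is therefore treated separately.\<close>
  proof (cases "y = x")
    case True
    then show ?thesis using S(2) K0 by (fastforce simp: subd_def norm_Pair)
  next
    case False
    note dy = d(2)[OF False that]
    note cy = is_codifferential_parts[OF S(3)[OF conjunct1[OF dy]]]
    have "norm z \<le> K + 1" if "z \<in> DL y \<union> DU y" for z
      using that hausdorff_dist_bound[of "DL y" "DL x" K z] hausdorff_dist_bound[of "DU y"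
        "DU x" K z] cx cy dy K
      by blast
    then show ?thesis using dy by (fastforce simp: subd_def norm_Pair)
  qed
  show ?thesis
  proof (rule that[of "d/2" "2 * (K + 1)"])
    show "d / 2 > 0" using d by simp
    fix y y' assume "y \<in> cball x (d/2)" "y' \<in> cball x (d/2)"
    then have "closed_segment y' y \<subseteq> cball x (d/2)"
      by (simp add: closed_segment_subset)
    then have "dist z x < d" if "z \<in> closed_segment y' y" for z
      using that d(1) by (force simp: dist_commute)
    then show "\<bar>F y - F y'\<bar> \<le> 2 * (K + 1) * norm (y - y')"
      using bd S(3) by (intro codiff_lipschitz[where A=DL and B=DU]) auto
  qed
qed

section \<open>Equality constraints\<close>

text \<open>Kuhn's lemma on a fine grid yields a cell in which every coordinate changes sign.\<close>

lemma poincare_miranda_approx: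
  fixes F :: "nat \<Rightarrow> (nat \<Rightarrow> real) \<Rightarrow> real" and \<kappa> K \<epsilon> :: real
  assumes \<kappa>: "\<kappa> > 0" and K: "K \<ge> 0" and \<epsilon>: "\<epsilon> > 0"
    and lip: "\<And>i x y. i < n \<Longrightarrow> \<forall>j<n. \<bar>x j\<bar> \<le> \<kappa> \<Longrightarrow> \<forall>j<n. \<bar>y j\<bar> \<le> \<kappa> \<Longrightarrow>
      \<bar>F i x - F i y\<bar> \<le> K * (\<Sum>j<n. \<bar>x j - y j\<bar>)"
    and lo: "\<And>i x. i < n \<Longrightarrow> \<forall>j<n. \<bar>x j\<bar> \<le> \<kappa> \<Longrightarrow> x i = - \<kappa> \<Longrightarrow> F i x \<le> 0"
    and hi: "\<And>i x. i < n \<Longrightarrow> \<forall>j<n. \<bar>x j\<bar> \<le> \<kappa> \<Longrightarrow> x i = \<kappa> \<Longrightarrow> 0 \<le> F i x"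
  obtains x where "\<forall>j<n. \<bar>x j\<bar> \<le> \<kappa>" "\<forall>i<n. \<bar>F i x\<bar> \<le> \<epsilon>"
proof -
  \<comment> \<open>The grid has step \<open>2 * \<kappa> / p\<close> in each of \<open>n\<close>
    coordinates; this \<open>p\<close> makes the oscillation of every \<open>F i\<close> over a cell
    at most \<epsilon>.\<close>
  obtain p :: nat where p0: "p > K * real n * (2 * \<kappa>) / \<epsilon>" using reals_Archimedean2 by blast
  have "K * real n * (2 * \<kappa>) / \<epsilon> \<ge> 0" using \<kappa> K \<epsilon> by simp
  then have p: "p > 0" using p0 by linarith
  have mesh: "K * (real n * (2 * \<kappa> / p)) \<le> \<epsilon>"
    using p0 p \<epsilon> by (simp add: field_simps)
  define grid where "grid x j = - \<kappa> + 2 * \<kappa> * real (x j) / real p" for x :: "nat \<Rightarrow> nat" and j :: nat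
  \<comment> \<open>Kuhn's lemma prescribes label 0 on the face \<open>x i = 0\<close> and label 1
    on the face \<open>x i = p\<close>. By \<open>lo\<close> and \<open>hi\<close> the forced labels
    agree with the sign of \<open>F i\<close>, so on the grid label 0 always means
    \<open>F i \<le> 0\<close> and label 1 means \<open>F i \<ge> 0\<close>.\<close>
  define label where "label x i = (if x i = 0 then 0 else if x i = p then 1 else
     if F i (grid x) < 0 then 0 else (1::nat))" for x i
  have cube: "\<bar>grid x j\<bar> \<le> \<kappa>" if "x j \<le> p" for x j
    using that p \<kappa> by (auto simp: grid_def abs_le_iff field_simps)
  obtain q where q: "\<forall>i<n. q i < p"
    and cell: "\<forall>i<n. \<exists>r s. (\<forall>j<n. q j \<le> r j \<and> r j \<le> q j + 1) \<and>
        (\<forall>j<n. q j \<le> s j \<and> s j \<le> q j + 1) \<and> label r i \<noteq> label s i"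
    by (rule kuhn_lemma[of p n label]) (use p in \<open>auto simp: label_def\<close>)
  have close: "\<bar>F i (grid q) - F i (grid r)\<bar> \<le> \<epsilon>" and sgn: "label r i = 0 \<Longrightarrow> F i (grid r) \<le> 0"
    "label r i \<noteq> 0 \<Longrightarrow> F i (grid r) \<ge> 0"
    if "i < n" and r: "\<forall>j<n. q j \<le> r j \<and> r j \<le> q j + 1" for i r
  proof -
    have rp: "\<forall>j<n. r j \<le> p" using r q by fastforce
    have 1: "\<forall>j<n. \<bar>grid q j\<bar> \<le> \<kappa>" "\<forall>j<n. \<bar>grid r j\<bar> \<le> \<kappa>"
      using q rp cube by (auto simp: less_imp_le)
    have "\<bar>grid q j - grid r j\<bar> \<le> 2 * \<kappa> / p" if "j < n" for j
    proof -
      have "r j = q j \<or> r j = q j + 1" using r that by fastforce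
      then show ?thesis using p \<kappa> by (auto simp: grid_def field_simps)
    qed
    then have "(\<Sum>j<n. \<bar>grid q j - grid r j\<bar>) \<le> (\<Sum>j<n. 2 * \<kappa> / p)" by (intro sum_mono) auto
    then have "K * (\<Sum>j<n. \<bar>grid q j - grid r j\<bar>) \<le> K * (real n * (2 * \<kappa> / p))"
      using K by (intro mult_left_mono) auto
    then show "\<bar>F i (grid q) - F i (grid r)\<bar> \<le> \<epsilon>" using lip[OF \<open>i < n\<close> 1] mesh by linarith
    have ends: "r i = 0 \<Longrightarrow> grid r i = - \<kappa>" "r i = p \<Longrightarrow> grid r i = \<kappa>"
      using p by (auto simp: grid_def)
    show "F i (grid r) \<le> 0" if "label r i = 0"
      using that lo[OF \<open>i < n\<close> 1(2) ends(1)] unfolding label_def by (metis less_imp_le zero_neq_one)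
    show "F i (grid r) \<ge> 0" if "label r i \<noteq> 0"
      using that hi[OF \<open>i < n\<close> 1(2) ends(2)] unfolding label_def by (metis not_le)
  qed
  \<comment> \<open>In each coordinate two corners of the cell carry different labels, hence
    opposite weak signs of \<open>F i\<close>, and both values are within \<epsilon> of the one at
    \<open>grid q\<close>.\<close>
  show ?thesis
  proof (rule that[of "grid q"])
    show "\<forall>j<n. \<bar>grid q j\<bar> \<le> \<kappa>" using q cube by (auto simp: less_imp_le)
    show "\<forall>i<n. \<bar>F i (grid q)\<bar> \<le> \<epsilon>"
    proof (intro allI impI)
      fix i assume i: "i < n"
      obtain r s where r: "\<forall>j<n. q j \<le> r j \<and> r j \<le> q j + 1" and s: "\<forall>j<n. q j \<le> s j \<and> s j \<le> q j + 1"
        and ne: "label r i \<noteq> label s i"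
        using cell[THEN spec, THEN mp, OF i] by (elim exE conjE)
      have "label r i = 0 \<or> label r i = 1" "label s i = 0 \<or> label s i = 1" by (auto simp: label_def)
      then consider "label r i = 0" "label s i \<noteq> 0" | "label r i \<noteq> 0" "label s i = 0" using ne by fastforce
      then show "\<bar>F i (grid q)\<bar> \<le> \<epsilon>"
      proof cases
        case 1
        then show ?thesis using close[OF i r] close[OF i s] sgn(1)[OF i r] sgn(2)[OF i s]
          unfolding abs_le_iff by linarith
      next
        case 2
        then show ?thesis using close[OF i r] close[OF i s] sgn(2)[OF i r] sgn(1)[OF i s]
          unfolding abs_le_iff by linarith
      qed
    qed
  qed
qed

text \<open>If uniformity failed, there would be steps tending to 0 and directions in
  \<open>C\<close> with error at least \<epsilon>; a convergent subsequence of the directions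
  contradicts the Hadamard form of the derivative together with the continuity of
  \<open>d\<close>.\<close>

lemma directional_uniform:
  fixes F :: "'a::euclidean_space \<Rightarrow> real"
  assumes lip: "\<And>y y'. y \<in> cball z \<rho> \<Longrightarrow> y' \<in> cball z \<rho> \<Longrightarrow> \<bar>F y - F y'\<bar> \<le> M * norm (y - y')" "\<rho> > 0"
    and dir: "\<And>h. ((\<lambda>t. (F (z + t *\<^sub>R h) - F z) / t) \<longlongrightarrow> d h) (at_right 0)"
    and d: "continuous_on UNIV d" and \<epsilon>: "\<epsilon> > 0" and C: "compact C"
  shows "\<forall>\<^sub>F t in at_right 0. \<forall>h\<in>C. \<bar>(F (z + t *\<^sub>R h) - F z) / t - d h\<bar> < \<epsilon>"
proof (rule ccontr)
  assume neg: "\<not> ?thesis"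
  have "\<exists>t h. 0 < t \<and> t < 1 / Suc n \<and> h \<in> C \<and> \<not> \<bar>(F (z + t *\<^sub>R h) - F z) / t - d h\<bar> < \<epsilon>" for n
  proof -
    have "\<not> (\<forall>t>0. t < 1 / Suc n \<longrightarrow> (\<forall>h\<in>C. \<bar>(F (z + t *\<^sub>R h) - F z) / t - d h\<bar> < \<epsilon>))"
      using neg unfolding eventually_at_right_field
        by (meson of_nat_0_less_iff zero_less_Suc zero_less_divide_1_iff)
    then show ?thesis by blast
  qed
  then obtain t h where th: "\<And>n. 0 < t n" "\<And>n::nat. t n < 1 / Suc n" "\<And>n. h n \<in> C"
      "\<And>n. \<not> \<bar>(F (z + t n *\<^sub>R h n) - F z) / t n - d (h n)\<bar> < \<epsilon>" by metis
  obtain l r where l: "l \<in> C" "strict_mono r" "(h \<circ> r) \<longlonglongrightarrow> l"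
    using C th(3) unfolding compact_def by metis
  have t0: "t \<longlonglongrightarrow> 0"
    by (rule tendsto_sandwich[OF _ _ tendsto_const LIMSEQ_inverse_real_of_nat])
       (use th(1,2) in \<open>auto simp: inverse_eq_divide intro!: always_eventually less_imp_le\<close>)
  have "(\<lambda>n. (F (z + (t \<circ> r) n *\<^sub>R (h \<circ> r) n) - F z) / (t \<circ> r) n) \<longlonglongrightarrow> d l"
  proof (rule hadamard_directional[where t="t \<circ> r"
    and hn="h \<circ> r", OF lip dir LIMSEQ_subseq_LIMSEQ[OF t0 l(2)] _ l(3)])
    show "0 < (t \<circ> r) n" for n by (simp add: th(1))
  qed
  moreover have "(\<lambda>n. d ((h \<circ> r) n)) \<longlonglongrightarrow> d l"
    using d l(3) by (rule continuous_on_tendsto_compose) auto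
  ultimately have "(\<lambda>n. \<bar>(F (z + (t \<circ> r) n *\<^sub>R (h \<circ> r) n) - F z) / (t \<circ> r) n - d ((h \<circ> r) n)\<bar>) \<longlonglongrightarrow> \<bar>d l - d l\<bar>"
    by (intro tendsto_intros)
  then have "\<forall>\<^sub>F n in sequentially. \<bar>(F (z + (t \<circ> r) n *\<^sub>R (h \<circ> r) n) - F z) / (t \<circ> r) n - d ((h \<circ> r) n)\<bar> < \<epsilon>"
    using \<epsilon> by (intro order_tendstoD(2)[of _ 0]) auto
  then show False using th(4) by (auto simp: eventually_sequentially)
qed

text \<open>The directions \<open>em j\<close> and \<open>ep j\<close> strictly increase resp. decrease the \<open>j\<close>-th function to first
  order without changing the others; moving along them turns the equations into a
  Poincare--Miranda problem.\<close>

lemma equality_constraints_tangent_nat: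
  fixes G :: "nat \<Rightarrow> 'a::euclidean_space \<Rightarrow> real" and Cp Cm :: "nat \<Rightarrow> 'a set"
  assumes lip: "\<And>j y y'. j < n \<Longrightarrow> y \<in> cball P \<rho> \<Longrightarrow> y' \<in> cball P \<rho> \<Longrightarrow> \<bar>G j y - G j y'\<bar> \<le> M * norm (y - y')"
      "\<rho> > 0" "M \<ge> 0"
    and dir: "\<And>j h. j < n \<Longrightarrow> ((\<lambda>t. (G j (P + t *\<^sub>R h) - G j P) / t) \<longlongrightarrow> d j h) (at_right 0)"
    and d: "\<And>j. j < n \<Longrightarrow> continuous_on UNIV (d j)"
    and zero: "\<And>j. j < n \<Longrightarrow> G j P = 0"
    and C: "\<And>j. j < n \<Longrightarrow> compact (Cp j) \<and> Cp j \<noteq> {} \<and> compact (Cm j) \<and> Cm j \<noteq> {}"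
    and dle: "\<And>j h. j < n \<Longrightarrow> d j h \<le> support_fun (Cp j) h"
    and dge: "\<And>j h. j < n \<Longrightarrow> - d j h \<le> support_fun (Cm j) h"
    and ep: "\<And>j. j < n \<Longrightarrow> support_fun (Cp j) (ep j) < 0"
    and em: "\<And>j. j < n \<Longrightarrow> support_fun (Cm j) (em j) < 0"
    and cross: "\<And>j k. j < n \<Longrightarrow> k < n \<Longrightarrow> j \<noteq> k \<Longrightarrow>
      support_fun (Cp j) (ep k) \<le> 0 \<and> support_fun (Cp j) (em k) \<le> 0 \<and>
      support_fun (Cm j) (ep k) \<le> 0 \<and> support_fun (Cm j) (em k) \<le> 0"
    and \<eta>: "\<And>j. j < n \<Longrightarrow> support_fun (Cp j) \<eta> \<le> 0 \<and> support_fun (Cm j) \<eta> \<le> 0"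
    and \<delta>: "\<delta> > 0"
  shows "\<forall>\<^sub>F t in at_right 0. \<exists>\<xi>\<in>cball \<eta> \<delta>. \<forall>j<n. G j (P + t *\<^sub>R \<xi>) = 0"
proof -
  \<comment> \<open>\<open>E\<close> dominates the lengths of all correction directions, and its
    summand 1 keeps it positive for \<open>n = 0\<close>. With
    \<open>\<kappa> = \<delta> / E\<close> the map \<open>N\<close> below sends the cube of half
    side \<kappa> into the ball of radius \<delta>.\<close>
  define E where "E = (\<Sum>k<n. norm (em k) + norm (ep k)) + 1"
  have E: "E \<ge> 1" unfolding E_def by (simp add: sum_nonneg)
  define \<kappa> where "\<kappa> = \<delta> / E"
  have \<kappa>: "\<kappa> > 0" "\<kappa> * E = \<delta>" using E \<delta> by (auto simp: \<kappa>_def)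
  \<comment> \<open>The smallest guaranteed rate of change over all indices; the inserted 1 covers
    \<open>n = 0\<close>.\<close>
  define m where "m = Min (insert 1 ((\<lambda>j. - support_fun (Cp j) (ep j)) ` {..<n} \<union> (\<lambda>j. - support_fun (Cm j)
    (em j)) ` {..<n}))"
  have m: "m > 0" unfolding m_def using ep em by (subst Min_gr_iff) auto
  have mp: "support_fun (Cp j) (ep j) \<le> - m" and mm: "support_fun (Cm j) (em j) \<le> - m" if "j < n" for j
  proof -
    have "m \<le> - support_fun (Cp j) (ep j)" "m \<le> - support_fun (Cm j) (em j)"
      unfolding m_def using that by (intro Min_le; auto)+
    then show "support_fun (Cp j) (ep j) \<le> - m" "support_fun (Cm j) (em j) \<le> - m" by linarith+
  qed
  \<comment> \<open>The positive and negative parts of \<open>x k\<close> go to different vectors,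
    because \<open>em k\<close> and \<open>ep k\<close> need not be opposite to each other.\<close>
  define N where "N x = \<eta> + (\<Sum>k<n. max (x k) 0 *\<^sub>R em k + max (- x k) 0 *\<^sub>R ep k)" for x :: "nat \<Rightarrow> real"
  have Nlip: "norm (N x - N y) \<le> E * (\<Sum>k<n. \<bar>x k - y k\<bar>)" for x y
  proof -
    have "N x - N y = (\<Sum>k<n. (max (x k) 0 - max (y k) 0) *\<^sub>R em k + (max (- x k) 0 - max (- y k) 0) *\<^sub>R ep k)"
      by (simp add: N_def sum_subtractf[symmetric] scaleR_diff_left algebra_simps)
    also have "norm \<dots> \<le> (\<Sum>k<n. \<bar>x k - y k\<bar> * E)"
    proof (rule sum_norm_le)
      fix k assume k: "k \<in> {..<n}"
      have "norm (em k) + norm (ep k) \<le> (\<Sum>k<n. norm (em k) + norm (ep k))"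
        using k by (intro member_le_sum) auto
      then have kE: "norm (em k) + norm (ep k) \<le> E" by (simp add: E_def)
      have "norm ((max (x k) 0 - max (y k) 0) *\<^sub>R em k + (max (- x k) 0 - max (- y k) 0) *\<^sub>R ep k)
        \<le> \<bar>max (x k) 0 - max (y k) 0\<bar> * norm (em k) + \<bar>max (- x k) 0 - max (- y k) 0\<bar> * norm (ep k)"
        by (metis norm_triangle_ineq norm_scaleR)
      also have "\<dots> \<le> \<bar>x k - y k\<bar> * norm (em k) + \<bar>x k - y k\<bar> * norm (ep k)"
        by (intro add_mono mult_right_mono) auto
      also have "\<dots> \<le> \<bar>x k - y k\<bar> * E"
        using mult_left_mono[OF kE, of "\<bar>x k - y k\<bar>"] by (simp add: distrib_left)
      finally show "norm ((max (x k) 0 - max (y k) 0) *\<^sub>R em k + (max (- x k) 0 - max (- y k) 0) *\<^sub>R ep k)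
        \<le> \<bar>x k - y k\<bar> * E" .
    qed
    finally show ?thesis by (simp add: sum_distrib_left mult.commute)
  qed
  have Nball: "N x \<in> cball \<eta> \<delta>" if "\<forall>j<n. \<bar>x j\<bar> \<le> \<kappa>" for x
  proof -
    have "norm (N x - \<eta>) \<le> (\<Sum>k<n. \<kappa> * (norm (em k) + norm (ep k)))"
      unfolding N_def add_diff_cancel_left'
    proof (rule sum_norm_le)
      fix k assume k: "k \<in> {..<n}"
      have "norm (max (x k) 0 *\<^sub>R em k + max (- x k) 0 *\<^sub>R ep k) \<le> \<bar>max (x k) 0\<bar> * norm (em k)
        + \<bar>max (- x k) 0\<bar> * norm (ep k)"
        by (metis norm_triangle_ineq norm_scaleR)
      also have "\<dots> \<le> \<kappa> * norm (em k) + \<kappa> * norm (ep k)"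
        using that k \<kappa>(1) by (intro add_mono mult_right_mono) (auto simp: abs_le_iff)
      finally show "norm (max (x k) 0 *\<^sub>R em k + max (- x k) 0 *\<^sub>R ep k) \<le> \<kappa> * (norm (em k) + norm (ep k))"
        by (simp add: distrib_left)
    qed
    also have "\<dots> \<le> \<kappa> * E" using \<kappa>(1) by (simp add: E_def sum_distrib_left[symmetric])
    finally show ?thesis using \<kappa>(2) by (simp add: dist_norm norm_minus_commute)
  qed
  \<comment> \<open>On a face all contributions except the one along \<open>e\<close> are
    nonpositive by \<open>cr\<close> and subadditivity, and that one carries the full weight
    \<kappa>.\<close>
  have face: "support_fun S (N x) \<le> \<kappa> * support_fun S e"
    if S: "compact S" "S \<noteq> {}" "support_fun S \<eta> \<le> 0" and j: "j < n"
      and cr: "\<And>k. k < n \<Longrightarrow> k \<noteq> j \<Longrightarrow> support_fun S (ep k) \<le> 0 \<and> support_fun S (em k) \<le> 0"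
      and xj: "max (x j) 0 *\<^sub>R em j + max (- x j) 0 *\<^sub>R ep j = \<kappa> *\<^sub>R e" for S x j e
  proof -
    have 1: "support_fun S (max (x k) 0 *\<^sub>R em k + max (- x k) 0 *\<^sub>R ep k) \<le> 0" if "k < n" "k \<noteq> j" for k
      using support_fun_add[OF S(1,2), of "max (x k) 0 *\<^sub>R em k" "max (- x k) 0 *\<^sub>R ep k"] cr[OF that]
        mult_nonneg_nonpos[of "max (x k) 0" "support_fun S (em k)"]
        mult_nonneg_nonpos[of "max (- x k) 0" "support_fun S (ep k)"]
      by (simp add: support_fun_scale[OF S(1,2)])
    have "support_fun S (N x) \<le> support_fun S \<eta> + support_fun S (\<Sum>k<n. max (x k) 0 *\<^sub>R em k
      + max (- x k) 0 *\<^sub>R ep k)"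
      unfolding N_def by (rule support_fun_add[OF S(1,2)])
    also have "\<dots> \<le> 0 + (\<Sum>k<n. support_fun S (max (x k) 0 *\<^sub>R em k + max (- x k) 0 *\<^sub>R ep k))"
      by (intro add_mono S support_fun_sum_le)
    also have "\<dots> \<le> (\<Sum>k<n. if k = j then \<kappa> * support_fun S e else 0)"
      unfolding add_0_left using 1 xj support_fun_scale[OF S(1,2), of \<kappa> e] \<kappa>(1) by (intro sum_mono) auto
    also have "\<dots> = \<kappa> * support_fun S e" using j by simp
    finally show ?thesis .
  qed
  have "\<forall>\<^sub>F t in at_right 0. \<forall>h\<in>cball \<eta> \<delta>. \<bar>(G j (P + t *\<^sub>R h) - G j P) / t - d j h\<bar> < \<kappa> * m" if "j < n" for j
    using directional_uniform[OF lip(1)[OF that] lip(2) dir[OF that] d[OF that], of "\<kappa> * m" "cball \<eta> \<delta>"] \<kappa> m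
    by (simp add: that)
  then have ev1: "\<forall>\<^sub>F t in at_right 0. \<forall>j\<in>{..<n}. \<forall>h\<in>cball \<eta> \<delta>. \<bar>(G j (P + t *\<^sub>R h) - G j P) / t - d j h\<bar>
    < \<kappa> * m"
    by (intro eventually_ball_finite) auto
  have "((\<lambda>t. t * (norm \<eta> + \<delta>)) \<longlongrightarrow> 0 * (norm \<eta> + \<delta>)) (at_right 0)" by (intro tendsto_intros)
  then have ev2: "\<forall>\<^sub>F t in at_right 0. t * (norm \<eta> + \<delta>) < \<rho>" using lip(2) by (auto dest: order_tendstoD(2))
  have ev3: "\<forall>\<^sub>F t in at_right 0. t > (0::real)" by (simp add: eventually_at_right_less)
  show ?thesis using ev1 ev2 ev3
  proof eventually_elim
    case (elim t)
    have inb: "P + t *\<^sub>R \<xi> \<in> cball P \<rho>" if "\<xi> \<in> cball \<eta> \<delta>" for \<xi>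
    proof -
      have "norm \<xi> \<le> norm \<eta> + \<delta>" using that norm_triangle_sub[of \<xi> \<eta>]
        by (simp add: dist_norm norm_minus_commute)
      then have "t * norm \<xi> \<le> \<rho>" using elim mult_left_mono[of "norm \<xi>" "norm \<eta> + \<delta>" t] by linarith
      then show ?thesis using elim(3) by (simp add: dist_norm)
    qed
    define F where "F i x = G i (P + t *\<^sub>R N x) / t" for i x
    have approx: "\<bar>F i x - d i (N x)\<bar> < \<kappa> * m" if "i < n" "\<forall>j<n. \<bar>x j\<bar> \<le> \<kappa>" for i x
    proof -
      have "\<bar>(G i (P + t *\<^sub>R N x) - G i P) / t - d i (N x)\<bar> < \<kappa> * m"
        using that(1) by (intro elim(1)[THEN bspec, THEN bspec] Nball[OF that(2)]) simp
      then show ?thesis using zero[OF that(1)] by (simp add: F_def)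
    qed
    have Flip: "\<bar>F i x - F i y\<bar> \<le> (M * E) * (\<Sum>j<n. \<bar>x j - y j\<bar>)"
      if "i < n" "\<forall>j<n. \<bar>x j\<bar> \<le> \<kappa>" "\<forall>j<n. \<bar>y j\<bar> \<le> \<kappa>" for i x y
    proof -
      have "\<bar>G i (P + t *\<^sub>R N x) - G i (P + t *\<^sub>R N y)\<bar> \<le> M * norm (t *\<^sub>R (N x - N y))"
        using lip(1)[OF that(1) inb[OF Nball[OF that(2)]] inb[OF Nball[OF that(3)]]]
        by (simp add: scaleR_diff_right)
      also have "\<dots> = t * (M * norm (N x - N y))" using elim by simp
      finally have "\<bar>F i x - F i y\<bar> \<le> M * norm (N x - N y)"
        using elim by (simp add: F_def diff_divide_distrib[symmetric] divide_le_eq mult.commute)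
      also have "\<dots> \<le> M * (E * (\<Sum>j<n. \<bar>x j - y j\<bar>))" using lip(3) Nlip by (intro mult_left_mono)
      finally show ?thesis by simp
    qed
    have lo: "F i x \<le> 0" if "i < n" "\<forall>j<n. \<bar>x j\<bar> \<le> \<kappa>" "x i = - \<kappa>" for i x
    proof -
      have "support_fun (Cp i) (N x) \<le> \<kappa> * support_fun (Cp i) (ep i)"
        using that C[of i] \<eta>[of i] cross[of i] \<kappa>(1) by (intro face[of _ i]) auto
      also have "\<dots> \<le> \<kappa> * - m" using mp that(1) \<kappa>(1) by (intro mult_left_mono) auto
      finally show ?thesis using approx[OF that(1,2)] dle[OF that(1), of "N x"] by linarith
    qed
    have hi: "0 \<le> F i x" if "i < n" "\<forall>j<n. \<bar>x j\<bar> \<le> \<kappa>" "x i = \<kappa>" for i x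
    proof -
      have "support_fun (Cm i) (N x) \<le> \<kappa> * support_fun (Cm i) (em i)"
        using that C[of i] \<eta>[of i] cross[of i] \<kappa>(1) by (intro face[of _ i]) auto
      also have "\<dots> \<le> \<kappa> * - m" using mm that(1) \<kappa>(1) by (intro mult_left_mono) auto
      finally show ?thesis using approx[OF that(1,2)] dge[OF that(1), of "N x"] by linarith
    qed
    \<comment> \<open>The grid argument gives only approximate zeros, here with error
      \<open>1 / Suc k\<close> after division by \<open>t\<close>; a limit point in the compact ball
      is an exact zero.\<close>
    have "\<exists>\<xi>\<in>cball \<eta> \<delta>. \<forall>i<n. \<bar>G i (P + t *\<^sub>R \<xi>)\<bar> \<le> t * (1 / Suc k)" for k
    proof -
      have ME: "M * E \<ge> 0" and e: "(0::real) < 1 / Suc k" using lip(3) E by auto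
      obtain x where x: "\<forall>j<n. \<bar>x j\<bar> \<le> \<kappa>" "\<forall>i<n. \<bar>F i x\<bar> \<le> 1 / Suc k"
        by (rule poincare_miranda_approx[OF \<kappa>(1) ME e Flip lo hi])
      then show ?thesis using elim(3)
        by (intro bexI[of _ "N x"] Nball) (auto simp: F_def abs_divide divide_le_eq mult.commute)
    qed
    then obtain \<xi> where \<xi>: "\<And>k. \<xi> k \<in> cball \<eta> \<delta>" "\<And>k i. i < n \<Longrightarrow> \<bar>G i (P + t *\<^sub>R \<xi> k)\<bar> \<le> t * (1 / Suc k)"
      by metis
    obtain l r where l: "l \<in> cball \<eta> \<delta>" "strict_mono r" "(\<xi> \<circ> r) \<longlonglongrightarrow> l"
      using compact_cball[of \<eta> \<delta>] \<xi>(1) unfolding compact_def by metis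
    show ?case
    proof (intro bexI[of _ l] allI impI)
      fix i assume i: "i < n"
      have "continuous_on (cball P \<rho>) (G i)"
        using lip(1)[OF i] lip(3)
        by (intro lipschitz_on_continuous_on[of M] lipschitz_onI) (auto simp: dist_norm)
      moreover have "(\<lambda>k. P + t *\<^sub>R (\<xi> \<circ> r) k) \<longlonglongrightarrow> P + t *\<^sub>R l" by (intro tendsto_intros l)
      ultimately have 1: "(\<lambda>k. G i (P + t *\<^sub>R (\<xi> \<circ> r) k)) \<longlonglongrightarrow> G i (P + t *\<^sub>R l)"
        by (rule continuous_on_tendsto_compose) (use inb l(1) \<xi>(1) in \<open>auto intro!: always_eventually\<close>)
      have "(\<lambda>k. t * (1 / Suc (r k))) \<longlonglongrightarrow> t * 0"
        using LIMSEQ_subseq_LIMSEQ[OF LIMSEQ_inverse_real_of_nat l(2)]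
        by (intro tendsto_intros) (simp add: inverse_eq_divide o_def)
      then have 2: "(\<lambda>k. t * (1 / Suc (r k))) \<longlonglongrightarrow> 0" by simp
      have "norm (G i (P + t *\<^sub>R (\<xi> \<circ> r) k)) \<le> t * (1 / Suc (r k))" for k
        unfolding o_def real_norm_def by (rule \<xi>(2)[OF i])
      then have "\<forall>\<^sub>F k in sequentially. norm (G i (P + t *\<^sub>R (\<xi> \<circ> r) k)) \<le> t * (1 / Suc (r k))"
        by (rule eventuallyI)
      then have "(\<lambda>k. G i (P + t *\<^sub>R (\<xi> \<circ> r) k)) \<longlonglongrightarrow> 0"
        using 2 by (rule Lim_null_comparison)
      then show "G i (P + t *\<^sub>R l) = 0" using 1 LIMSEQ_unique by blast
    qed (rule l)
  qed
qed

text \<open>An enumeration of \<open>J\<close> transfers the version in coordinates.\<close>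

lemma equality_constraints_tangent:
  fixes G :: "'i \<Rightarrow> 'a::euclidean_space \<Rightarrow> real" and Cp Cm :: "'i \<Rightarrow> 'a set"
  assumes J: "finite J"
    and lip: "\<And>j y y'. j \<in> J \<Longrightarrow> y \<in> cball P \<rho> \<Longrightarrow> y' \<in> cball P \<rho> \<Longrightarrow> \<bar>G j y - G j y'\<bar> \<le> M * norm (y - y')"
      "\<rho> > 0" "M \<ge> 0"
    and dir: "\<And>j h. j \<in> J \<Longrightarrow> ((\<lambda>t. (G j (P + t *\<^sub>R h) - G j P) / t) \<longlongrightarrow> d j h) (at_right 0)"
    and d: "\<And>j. j \<in> J \<Longrightarrow> continuous_on UNIV (d j)"
    and zero: "\<And>j. j \<in> J \<Longrightarrow> G j P = 0"
    and C: "\<And>j. j \<in> J \<Longrightarrow> compact (Cp j) \<and> Cp j \<noteq> {} \<and> compact (Cm j) \<and> Cm j \<noteq> {}"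
    and dle: "\<And>j h. j \<in> J \<Longrightarrow> d j h \<le> support_fun (Cp j) h"
    and dge: "\<And>j h. j \<in> J \<Longrightarrow> - d j h \<le> support_fun (Cm j) h"
    and ep: "\<And>j. j \<in> J \<Longrightarrow> support_fun (Cp j) (ep j) < 0"
    and em: "\<And>j. j \<in> J \<Longrightarrow> support_fun (Cm j) (em j) < 0"
    and cross: "\<And>j k. j \<in> J \<Longrightarrow> k \<in> J \<Longrightarrow> j \<noteq> k \<Longrightarrow>
      support_fun (Cp j) (ep k) \<le> 0 \<and> support_fun (Cp j) (em k) \<le> 0 \<and>
      support_fun (Cm j) (ep k) \<le> 0 \<and> support_fun (Cm j) (em k) \<le> 0"
    and \<eta>: "\<And>j. j \<in> J \<Longrightarrow> support_fun (Cp j) \<eta> \<le> 0 \<and> support_fun (Cm j) \<eta> \<le> 0"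
    and \<delta>: "\<delta> > 0"
  shows "\<forall>\<^sub>F t in at_right 0. \<exists>\<xi>\<in>cball \<eta> \<delta>. \<forall>j\<in>J. G j (P + t *\<^sub>R \<xi>) = 0"
proof -
  obtain b where b: "bij_betw b {..<card J} J" using ex_bij_betw_nat_finite[OF J] atLeast0LessThan by metis
  then have bJ: "\<And>i. i < card J \<Longrightarrow> b i \<in> J" and surj: "J = b ` {..<card J}"
    and inj: "\<And>i k. i < card J \<Longrightarrow> k < card J \<Longrightarrow> b i = b k \<longleftrightarrow> i = k"
    by (auto simp: bij_betw_def inj_on_def)
  have "\<forall>\<^sub>F t in at_right 0. \<exists>\<xi>\<in>cball \<eta> \<delta>. \<forall>j<card J. (G \<circ> b) j (P + t *\<^sub>R \<xi>) = 0"
    by (rule equality_constraints_tangent_nat[where \<rho>=\<rho> and M=M and d="d \<circ> b" and Cp="Cp \<circ> b"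
      and Cm="Cm \<circ> b"
          and ep="ep \<circ> b" and em="em \<circ> b"])
       (use lip dir d zero C dle dge ep em cross \<eta> \<delta> bJ inj in auto)
  then show ?thesis by eventually_elim (subst surj, auto)
qed

section \<open>Functionals dominated by an integral\<close>

text \<open>The vector space is a set of functions, so the pointwise operations are spelled out here
  and in the next two definitions. Sublinearity includes the factor 0 and thus forces the value 0 at
  the zero function.\<close>

definition fun_subspace :: "('i \<Rightarrow> 'a::real_vector) set \<Rightarrow> bool" where
  "fun_subspace B \<longleftrightarrow> (\<lambda>_. 0) \<in> B \<and> (\<forall>x\<in>B. \<forall>y\<in>B. (\<lambda>i. x i + y i) \<in> B) \<and> (\<forall>c. \<forall>x\<in>B. (\<lambda>i. c *\<^sub>R x i) \<in> B)"

definition fun_sublinear :: "('i \<Rightarrow> 'a::real_vector) set \<Rightarrow> (('i \<Rightarrow> 'a) \<Rightarrow> real) \<Rightarrow> bool" where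
  "fun_sublinear B p \<longleftrightarrow> (\<forall>x\<in>B. \<forall>y\<in>B. p (\<lambda>i. x i + y i) \<le> p x + p y) \<and>
     (\<forall>t\<ge>0. \<forall>x\<in>B. p (\<lambda>i. t *\<^sub>R x i) = t * p x)"

definition fun_linear :: "('i \<Rightarrow> 'a::real_vector) set \<Rightarrow> (('i \<Rightarrow> 'a) \<Rightarrow> real) \<Rightarrow> bool" where
  "fun_linear B \<Lambda> \<longleftrightarrow> (\<forall>x\<in>B. \<forall>y\<in>B. \<Lambda> (\<lambda>i. x i + y i) = \<Lambda> x + \<Lambda> y) \<and>
     (\<forall>t. \<forall>x\<in>B. \<Lambda> (\<lambda>i. t *\<^sub>R x i) = t * \<Lambda> x)"

lemma fun_subspaceD:
  assumes "fun_subspace B"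
  shows "(\<lambda>_. 0) \<in> B" "x \<in> B \<Longrightarrow> y \<in> B \<Longrightarrow> (\<lambda>i. x i + y i) \<in> B" "x \<in> B \<Longrightarrow> (\<lambda>i. c *\<^sub>R x i) \<in> B"
  using assms by (auto simp: fun_subspace_def)

lemma fun_linearD:
  assumes "fun_linear B \<Lambda>"
  shows "x \<in> B \<Longrightarrow> y \<in> B \<Longrightarrow> \<Lambda> (\<lambda>i. x i + y i) = \<Lambda> x + \<Lambda> y" "x \<in> B \<Longrightarrow> \<Lambda> (\<lambda>i. c *\<^sub>R x i) = c * \<Lambda> x"
  using assms by (auto simp: fun_linear_def)

lemma fun_sublinear_lower:
  assumes B: "fun_subspace B" and p: "fun_sublinear B p" and xy: "x \<in> B" "y \<in> B"
  shows "- p (\<lambda>i. - x i) \<le> p x" "p x \<le> p (\<lambda>i. x i + y i) + p (\<lambda>i. - y i)"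
proof -
  have neg: "(\<lambda>i. - z i) \<in> B" if "z \<in> B" for z
  proof -
    have "(\<lambda>i. (-1) *\<^sub>R z i) \<in> B" using B that unfolding fun_subspace_def by blast
    then show ?thesis by simp
  qed
  have add: "p (\<lambda>i. u i + v i) \<le> p u + p v" if "u \<in> B" "v \<in> B" for u v
    using p that by (auto simp: fun_sublinear_def)
  have "p (\<lambda>i. 0 *\<^sub>R x i) = 0 * p x" using p xy unfolding fun_sublinear_def by blast
  then have "p (\<lambda>_. 0) = 0" by simp
  then show "- p (\<lambda>i. - x i) \<le> p x" using add[OF xy(1) neg[OF xy(1)]] by simp
  have "(\<lambda>i. x i + y i) \<in> B" using B xy unfolding fun_subspace_def by blast
  from add[OF this neg[OF xy(2)]] show "p x \<le> p (\<lambda>i. x i + y i) + p (\<lambda>i. - y i)" by simp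
qed

text \<open>Among the sublinear functionals below \<open>p\<close>, a minimal one exists by Zorn's lemma; replacing
  \<open>q x\<close> by \<open>INF s\<ge>0. q (x + s w) - s q w\<close> shows that a minimal one is additive.\<close>

theorem fun_hahn_banach:
  fixes p :: "('i \<Rightarrow> 'a::real_vector) \<Rightarrow> real"
  assumes B: "fun_subspace B" and p: "fun_sublinear B p"
  obtains \<Lambda> where "fun_linear B \<Lambda>" "\<And>x. x \<in> B \<Longrightarrow> \<Lambda> x \<le> p x"
proof -
  have Badd: "(\<lambda>i. x i + y i) \<in> B" if "x \<in> B" "y \<in> B" for x y using B that by (auto simp: fun_subspace_def)
  have Bscale: "(\<lambda>i. c *\<^sub>R x i) \<in> B" if "x \<in> B" for x c using B that by (auto simp: fun_subspace_def)
  have Bneg: "(\<lambda>i. - x i) \<in> B" if "x \<in> B" for x using Bscale[OF that, of "-1"] by simp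
  \<comment> \<open>Pinning the values outside \<open>B\<close> to 0 lets functionals be compared
    and identified as plain functions.\<close>
  define Q where "Q = {q. fun_sublinear B q \<and> (\<forall>x\<in>B. q x \<le> p x) \<and> (\<forall>x. x \<notin> B \<longrightarrow> q x = 0)}"
  have Qadd: "q (\<lambda>i. x i + y i) \<le> q x + q y" if "q \<in> Q" "x \<in> B" "y \<in> B" for q x y
    using that by (auto simp: Q_def fun_sublinear_def)
  have Qscale: "q (\<lambda>i. t *\<^sub>R x i) = t * q x" if "q \<in> Q" "x \<in> B" "t \<ge> 0" for q x t
    using that by (auto simp: Q_def fun_sublinear_def)
  have Qlow: "- p (\<lambda>i. - x i) \<le> q x" if "q \<in> Q" "x \<in> B" for q x
  proof -
    have "- q (\<lambda>i. - x i) \<le> q x" using fun_sublinear_lower(1)[OF B, of q x x] that by (auto simp: Q_def)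
    moreover have "q (\<lambda>i. - x i) \<le> p (\<lambda>i. - x i)" using that Bneg by (auto simp: Q_def)
    ultimately show ?thesis by linarith
  qed
  define p0 where "p0 x = (if x \<in> B then p x else 0)" for x
  have p0: "p0 \<in> Q" using p Badd Bscale by (auto simp: Q_def p0_def fun_sublinear_def)
  define R where "R q r \<longleftrightarrow> (\<forall>x. r x \<le> q x)" for q r :: "('i \<Rightarrow> 'a) \<Rightarrow> real"
  have "\<exists>m\<in>Q. \<forall>a\<in>Q. R m a \<longrightarrow> a = m"
  proof (rule predicate_Zorn)
    show "partial_order_on Q (relation_of R Q)"
      by (rule partial_order_on_relation_ofI) (auto simp: R_def fun_eq_iff intro: order_trans antisym)
    fix C assume C: "C \<in> Chains (relation_of R Q)"
    then have CQ: "C \<subseteq> Q" and chain: "\<And>q r. q \<in> C \<Longrightarrow> r \<in> C \<Longrightarrow> R q r \<or> R r q"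
      by (auto simp: Chains_def relation_of_def)
    show "\<exists>u\<in>Q. \<forall>a\<in>C. R a u"
    proof (cases "C = {}")
      case True
      then show ?thesis using p0 by auto
    next
      case False
      define u where "u x = (INF q\<in>C. q x)" for x
      have bdd: "bdd_below ((\<lambda>q. q x) ` C)" for x
      proof (cases "x \<in> B")
        case True
        then show ?thesis using Qlow CQ by (intro bdd_belowI2[where m="- p (\<lambda>i. - x i)"]) auto
      next
        case False
        then show ?thesis using CQ by (intro bdd_belowI2[where m=0]) (auto simp: Q_def)
      qed
      have ule: "u x \<le> q x" if "q \<in> C" for q x unfolding u_def by (rule cINF_lower[OF bdd that])
      have uge: "c \<le> u x" if "\<And>q. q \<in> C \<Longrightarrow> c \<le> q x" for c x unfolding u_def
        by (rule cINF_greatest[OF False that])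
      have add: "u (\<lambda>i. x i + y i) \<le> u x + u y" if xy: "x \<in> B" "y \<in> B" for x y
      proof -
        \<comment> \<open>In a chain one of \<open>q1\<close> and \<open>q2\<close> lies below the
          other, so a single member serves both arguments; an infimum of sublinear functionals is
          not subadditive in general.\<close>
        have 1: "u (\<lambda>i. x i + y i) \<le> q1 x + q2 y" if q: "q1 \<in> C" "q2 \<in> C" for q1 q2
        proof -
          obtain q where q3: "q \<in> C" "q x \<le> q1 x" "q y \<le> q2 y"
            using chain[OF q] q unfolding R_def by blast
          have "u (\<lambda>i. x i + y i) \<le> q x + q y" using ule[OF q3(1)] Qadd[of q x y] CQ q3(1) xy
            by (meson order_trans subsetD)
          then show ?thesis using q3 by linarith
        qed
        have "u (\<lambda>i. x i + y i) - q1 x \<le> u y" if "q1 \<in> C" for q1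
          using 1[OF that] by (intro uge) (simp add: diff_le_eq add.commute)
        then have "u (\<lambda>i. x i + y i) - u y \<le> u x" by (intro uge) (simp add: diff_le_eq add.commute)
        then show ?thesis by simp
      qed
      have scale: "u (\<lambda>i. t *\<^sub>R x i) = t * u x" if x: "x \<in> B" and t: "t \<ge> 0" for x t
      proof (cases "t = 0")
        case True
        have "q (\<lambda>i. t *\<^sub>R x i) = 0" if "q \<in> C" for q using Qscale[of q x t] CQ that x t True by auto
        then have "u (\<lambda>i. t *\<^sub>R x i) = (INF q\<in>C. 0)" unfolding u_def by (intro INF_cong) auto
        then have "u (\<lambda>i. t *\<^sub>R x i) = 0" using \<open>C \<noteq> {}\<close> by simp
        then show ?thesis using True by simp
      next
        case False
        show ?thesis
        proof (rule antisym)
          have "u (\<lambda>i. t *\<^sub>R x i) / t \<le> u x"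
            using ule[of _ "\<lambda>i. t *\<^sub>R x i"] Qscale[of _ x t] CQ x t False
            by (intro uge) (auto simp: divide_le_eq mult.commute dest!: subsetD)
          then show "u (\<lambda>i. t *\<^sub>R x i) \<le> t * u x" using t False by (simp add: divide_le_eq mult.commute)
          show "t * u x \<le> u (\<lambda>i. t *\<^sub>R x i)"
          proof (rule uge)
            fix q assume "q \<in> C"
            then show "t * u x \<le> q (\<lambda>i. t *\<^sub>R x i)"
              using Qscale[of q x t] CQ x t mult_left_mono[OF ule, of q t x] by auto
          qed
        qed
      qed
      obtain q0 where q0: "q0 \<in> C" using False by blast
      have "u x \<le> p x" if "x \<in> B" for x using ule[OF q0, of x] q0 CQ that unfolding Q_def
        by (auto intro: order_trans)
      moreover have "u x = 0" if "x \<notin> B" for x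
      proof -
        have "q x = 0" if "q \<in> C" for q using CQ that \<open>x \<notin> B\<close> by (auto simp: Q_def)
        then have "u x = (INF q\<in>C. 0)" unfolding u_def by (intro INF_cong) auto
        then show ?thesis using False by simp
      qed
      ultimately have "u \<in> Q" using add scale by (auto simp: Q_def fun_sublinear_def)
      then show ?thesis using ule by (auto simp: R_def)
    qed
  qed
  then obtain m where m: "m \<in> Q" and min: "\<And>q. q \<in> Q \<Longrightarrow> (\<And>x. q x \<le> m x) \<Longrightarrow> q = m"
    unfolding R_def by blast
  have msub: "fun_sublinear B m" using m by (simp add: Q_def)
  have superadd: "m x + m w \<le> m (\<lambda>i. x i + w i)" if x: "x \<in> B" and w: "w \<in> B" for x w
  proof -
    define \<phi> where "\<phi> y s = m (\<lambda>i. y i + s *\<^sub>R w i) - s * m w" for y s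
    define q where "q y = (if y \<in> B then INF s\<in>{0..}. \<phi> y s else 0)" for y
    have low: "- m (\<lambda>i. - y i) \<le> \<phi> y s" if "y \<in> B" "s \<ge> 0" for y s
    proof -
      have "m (\<lambda>i. s *\<^sub>R w i) \<le> m (\<lambda>i. s *\<^sub>R w i + y i) + m (\<lambda>i. - y i)"
        using fun_sublinear_lower(2)[OF B msub Bscale[OF w] that(1)] .
      then show ?thesis using Qscale[OF m w that(2)] by (simp add: \<phi>_def add.commute)
    qed
    have bdd: "bdd_below (\<phi> y ` {0..})" if "y \<in> B" for y using low[OF that] by (intro bdd_belowI2) auto
    have qle: "q y \<le> \<phi> y s" if "y \<in> B" "s \<ge> 0" for y s
      using that cINF_lower[OF bdd, of y s] by (simp add: q_def)
    have qge: "c \<le> q y" if "y \<in> B" "\<And>s. s \<ge> 0 \<Longrightarrow> c \<le> \<phi> y s" for c y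
      unfolding q_def using that by (simp, intro cINF_greatest) auto
    have \<phi>0: "\<phi> y 0 = m y" for y by (simp add: \<phi>_def)
    have "q y \<le> m y" for y
      using qle[of y 0] m by (cases "y \<in> B") (auto simp: \<phi>0 q_def Q_def)
    moreover have "q \<in> Q"
    proof -
      have add: "q (\<lambda>i. y i + z i) \<le> q y + q z" if yz: "y \<in> B" "z \<in> B" for y z
      proof -
        have 1: "q (\<lambda>i. y i + z i) \<le> \<phi> y s + \<phi> z t" if st: "s \<ge> 0" "t \<ge> 0" for s t
        proof -
          have "m (\<lambda>i. (y i + s *\<^sub>R w i) + (z i + t *\<^sub>R w i)) \<le> m (\<lambda>i. y i + s *\<^sub>R w i) + m (\<lambda>i. z i
            + t *\<^sub>R w i)"
            by (rule Qadd[OF m Badd[OF yz(1) Bscale[OF w]] Badd[OF yz(2) Bscale[OF w]]])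
          moreover have "(\<lambda>i. (y i + s *\<^sub>R w i) + (z i + t *\<^sub>R w i)) = (\<lambda>i. (y i + z i) + (s + t) *\<^sub>R w i)"
            by (simp add: fun_eq_iff scaleR_add_left)
          ultimately have "\<phi> (\<lambda>i. y i + z i) (s + t) \<le> \<phi> y s + \<phi> z t" by (simp add: \<phi>_def distrib_right)
          then show ?thesis using qle[OF Badd[OF yz], of "s + t"] st by linarith
        qed
        have "q (\<lambda>i. y i + z i) - \<phi> y s \<le> q z" if "s \<ge> 0" for s
          using 1[OF that] by (intro qge yz) (simp add: diff_le_eq add.commute)
        then have "q (\<lambda>i. y i + z i) - q z \<le> q y" by (intro qge yz) (simp add: diff_le_eq add.commute)
        then show ?thesis by simp
      qed
      have scale: "q (\<lambda>i. c *\<^sub>R y i) = c * q y" if y: "y \<in> B" and c: "c \<ge> 0" for y c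
      proof -
        have \<phi>s: "\<phi> (\<lambda>i. c *\<^sub>R y i) (c * s) = c * \<phi> y s" if "s \<ge> 0" for s
        proof -
          have "m (\<lambda>i. c *\<^sub>R (y i + s *\<^sub>R w i)) = c * m (\<lambda>i. y i + s *\<^sub>R w i)"
            by (rule Qscale[OF m Badd[OF y Bscale[OF w]] c])
          then show ?thesis by (simp add: \<phi>_def scaleR_add_right algebra_simps)
        qed
        show ?thesis
        proof (cases "c = 0")
          case True
          have z0: "(\<lambda>i. 0) \<in> B" using B by (simp add: fun_subspace_def)
          have m0: "m (\<lambda>i. 0) = 0" using Qscale[OF m w, of 0] by simp
          have "\<phi> (\<lambda>i. 0) s = 0" if "s \<ge> 0" for s using Qscale[OF m w that] by (simp add: \<phi>_def)
          then have "q (\<lambda>i. 0) = 0" using z0 by (simp add: q_def)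
          then show ?thesis using True by simp
        next
          case False
          show ?thesis
          proof (rule antisym)
            have "q (\<lambda>i. c *\<^sub>R y i) / c \<le> q y"
            proof (rule qge[OF y])
              fix s :: real assume s: "s \<ge> 0"
              then show "q (\<lambda>i. c *\<^sub>R y i) / c \<le> \<phi> y s"
                using qle[OF Bscale[OF y], of "c * s" c] \<phi>s[OF s] c False
                  by (simp add: divide_le_eq mult.commute)
            qed
            then show "q (\<lambda>i. c *\<^sub>R y i) \<le> c * q y" using c False by (simp add: divide_le_eq mult.commute)
            show "c * q y \<le> q (\<lambda>i. c *\<^sub>R y i)"
            proof (rule qge[OF Bscale[OF y]])
              fix s :: real assume s: "s \<ge> 0"
              have "c * q y \<le> c * \<phi> y (s / c)" using qle[OF y, of "s / c"] s c
                by (intro mult_left_mono) auto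
              also have "\<dots> = \<phi> (\<lambda>i. c *\<^sub>R y i) s" using \<phi>s[of "s / c"] s c False by simp
              finally show "c * q y \<le> \<phi> (\<lambda>i. c *\<^sub>R y i) s" .
            qed
          qed
        qed
      qed
      have "q y \<le> p y" if "y \<in> B" for y using \<open>\<And>y. q y \<le> m y\<close>[of y] m that unfolding Q_def
        by (auto intro: order_trans)
      then show ?thesis using add scale by (auto simp: Q_def fun_sublinear_def q_def)
    qed
    \<comment> \<open>Minimality enters here; the choice \<open>s = 1\<close> in the infimum then
      bounds the value of \<open>m\<close> at \<open>x\<close> by its value at the sum of
      \<open>x\<close> and \<open>w\<close> minus \<open>m w\<close>.\<close>
    ultimately have "q = m" using min by blast
    then have "m x \<le> \<phi> x 1" using qle[OF x, of 1] by simp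
    then show ?thesis by (simp add: \<phi>_def)
  qed
  have add: "m (\<lambda>i. x i + w i) = m x + m w" if "x \<in> B" "w \<in> B" for x w
    using superadd[OF that] Qadd[OF m that] by simp
  have neg: "m (\<lambda>i. - x i) = - m x" if "x \<in> B" for x
    using add[OF that Bneg[OF that]] Qscale[OF m that, of 0] by simp
  have scale: "m (\<lambda>i. t *\<^sub>R x i) = t * m x" if x: "x \<in> B" for x t
  proof (cases "t \<ge> 0")
    case False
    then show ?thesis using Qscale[OF m x, of "- t"] neg[OF Bscale[OF x, of t]] by simp
  qed (use Qscale[OF m x] in auto)
  show ?thesis
    by (rule that[of m]) (use add scale m in \<open>auto simp: fun_linear_def Q_def\<close>)
qed

section \<open>Densities of linear functionals dominated by an integral\<close>

definition bounded_measurable :: "'b measure \<Rightarrow> ('b \<Rightarrow> 'a::euclidean_space) set" where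
  "bounded_measurable M = {Z \<in> borel_measurable M. \<exists>K. \<forall>x. norm (Z x) \<le> K}"

lemma fun_subspace_bounded_measurable: "fun_subspace (bounded_measurable M)"
proof -
  have "\<exists>K. \<forall>i. norm (x i + y i) \<le> K"
    if "\<forall>i. norm (x i) \<le> K1" "\<forall>i. norm (y i) \<le> K2" for x y :: "'a \<Rightarrow> 'b" and K1 K2
    using that by (intro exI[of _ "K1 + K2"]) (blast intro: norm_triangle_mono)
  moreover have "\<exists>K. \<forall>i. norm (c *\<^sub>R x i) \<le> K" if "\<forall>i. norm (x i) \<le> K1" for x :: "'a \<Rightarrow> 'b" and c K1
    using that by (intro exI[of _ "\<bar>c\<bar> * K1"]) (auto intro: mult_left_mono)
  ultimately show ?thesis
    unfolding fun_subspace_def bounded_measurable_def by (auto 4 3)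
qed

lemma fun_linear_sum:
  assumes B: "fun_subspace B" and \<Lambda>: "fun_linear B \<Lambda>" and x: "\<And>k. k \<in> T \<Longrightarrow> x k \<in> B"
  shows "(\<lambda>i. \<Sum>k\<in>T. x k i) \<in> B \<and> \<Lambda> (\<lambda>i. \<Sum>k\<in>T. x k i) = (\<Sum>k\<in>T. \<Lambda> (x k))"
proof -
  have z: "(\<lambda>_. 0) \<in> B" using B by (simp add: fun_subspace_def)
  have "\<Lambda> (\<lambda>_. 0) = 0" using fun_linearD(2)[OF \<Lambda> z, of 0] by simp
  then show ?thesis using x
  proof (induction T rule: infinite_finite_induct)
    case (insert k T)
    then have "x k \<in> B" "(\<lambda>i. \<Sum>k\<in>T. x k i) \<in> B" by auto
    then show ?case using insert B \<Lambda> by (auto simp: fun_subspace_def fun_linear_def)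
  qed (use z in auto)
qed

text \<open>At each point the indicators vanish from some index on, and \<open>norm (L x)\<close>
  dominates the integrands.\<close>

lemma integral_indicator_antimono_tendsto_0:
  fixes L :: "'b \<Rightarrow> real"
  assumes L: "integrable M L" and A: "\<And>i. A i \<in> sets M" "decseq A" "(\<Inter>i. A i) = {}"
  shows "(\<lambda>i. \<integral>x. indicator (A i) x * L x \<partial>M) \<longlonglongrightarrow> 0"
proof -
  have "(\<lambda>i. \<integral>x. indicator (A i) x * L x \<partial>M) \<longlonglongrightarrow> (\<integral>x. 0 \<partial>M)"
  proof (rule integral_dominated_convergence[where w="\<lambda>x. norm (L x)"])
    show "AE x in M. (\<lambda>i. indicator (A i) x * L x) \<longlonglongrightarrow> 0"
    proof (intro AE_I2)
      fix x
      obtain n where n: "x \<notin> A n" using A(3) by auto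
      have "indicator (A i) x * L x = 0" if "i \<ge> n" for i
        using n decseqD[OF A(2) that] by (auto simp: indicator_def)
      then show "(\<lambda>i. indicator (A i) x * L x) \<longlonglongrightarrow> 0"
        by (intro tendsto_eventually) (auto simp: eventually_sequentially)
    qed
  qed (use L A in \<open>auto simp: indicator_def\<close>)
  then show ?thesis by simp
qed

text \<open>The positive set function \<open>A \<mapsto> \<Lambda> (1\<^sub>A e) + \<integral>\<^sub>A L\<close> is countably additive, since it is
  continuous at the empty set by domination.\<close>

lemma dominated_functional_scalar_density:
  fixes \<Lambda> :: "('b \<Rightarrow> 'a::euclidean_space) \<Rightarrow> real" and L :: "'b \<Rightarrow> real"
  assumes M: "sigma_finite_measure M"
    and L: "integrable M L" "\<And>x. 0 \<le> L x"
    and \<Lambda>: "fun_linear (bounded_measurable M) \<Lambda>"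
    and dom: "\<And>Z. Z \<in> bounded_measurable M \<Longrightarrow> \<bar>\<Lambda> Z\<bar> \<le> (\<integral>x. L x * norm (Z x) \<partial>M)"
    and e: "norm e = 1"
  obtains v where "integrable M v" "\<And>A. A \<in> sets M \<Longrightarrow>
    \<Lambda> (\<lambda>x. indicator A x *\<^sub>R e) = (\<integral>x. indicator A x * v x \<partial>M)"
proof -
  interpret sigma_finite_measure M by fact
  have ind: "(\<lambda>x. indicator A x *\<^sub>R e) \<in> bounded_measurable M" if "A \<in> sets M" for A
    using that by (auto simp: bounded_measurable_def indicator_def intro!: exI[of _ "norm e"])
  have intL: "integrable M (\<lambda>x. indicator A x * L x)" if "A \<in> sets M" for A
    using integrable_mult_indicator[OF that L(1)] by simp
  have domA: "\<bar>\<Lambda> (\<lambda>x. indicator A x *\<^sub>R e)\<bar> \<le> (\<integral>x. indicator A x * L x \<partial>M)" if "A \<in> sets M" for A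
  proof -
    have "\<bar>\<Lambda> (\<lambda>x. indicator A x *\<^sub>R e)\<bar> \<le> (\<integral>x. L x * norm (indicator A x *\<^sub>R e) \<partial>M)"
      using dom[OF ind[OF that]] .
    also have "(\<lambda>x. L x * norm (indicator A x *\<^sub>R e)) = (\<lambda>x. indicator A x * L x)"
      using e by (auto simp: indicator_def fun_eq_iff)
    finally show ?thesis .
  qed
  define m where "m A = \<Lambda> (\<lambda>x. indicator A x *\<^sub>R e) + (\<integral>x. indicator A x * L x \<partial>M)" for A
  have m0: "0 \<le> m A" and m1: "m A \<le> 2 * (\<integral>x. indicator A x * L x \<partial>M)" if "A \<in> sets M" for A
    using domA[OF that] by (auto simp: m_def abs_le_iff)
  have madd: "m (A \<union> A') = m A + m A'" if "A \<in> sets M" "A' \<in> sets M" "A \<inter> A' = {}" for A A'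
  proof -
    have i: "indicator (A \<union> A') x = indicator A x + (indicator A' x :: real)" for x
      using that(3) by (auto simp: indicator_def)
    have "\<Lambda> (\<lambda>x. indicator (A \<union> A') x *\<^sub>R e) = \<Lambda> (\<lambda>x. indicator A x *\<^sub>R e + indicator A' x *\<^sub>R e)"
      by (simp add: i scaleR_add_left)
    also have "\<dots> = \<Lambda> (\<lambda>x. indicator A x *\<^sub>R e) + \<Lambda> (\<lambda>x. indicator A' x *\<^sub>R e)"
      using \<Lambda> ind[OF that(1)] ind[OF that(2)] by (auto simp: fun_linear_def)
    finally show ?thesis using intL that by (simp add: m_def i distrib_right)
  qed
  define N where "N = measure_of (space M) (sets M) (\<lambda>A. ennreal (m A))"
  have setsN: "sets N = sets M" and spaceN: "space N = space M"
    by (auto simp: N_def sets.space_closed sets.sigma_sets_eq)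
  have emp: "m {} = 0" using m1[of "{}"] m0[of "{}"] by simp
  have ca: "countably_additive (sets M) (\<lambda>A. ennreal (m A))"
  proof (rule sets.empty_continuous_imp_countably_additive)
    show "positive (sets M) (\<lambda>A. ennreal (m A))" using emp by (simp add: positive_def)
    show "additive (sets M) (\<lambda>A. ennreal (m A))"
      using madd m0 by (auto simp: additive_def)
    fix A :: "nat \<Rightarrow> 'b set" assume A: "range A \<subseteq> sets M" "decseq A" "(\<Inter>i. A i) = {}"
    have lim: "(\<lambda>i. 2 * (\<integral>x. indicator (A i) x * L x \<partial>M)) \<longlonglongrightarrow> 2 * 0"
      by (intro tendsto_intros integral_indicator_antimono_tendsto_0 L) (use A in auto)
    have "(\<lambda>i. m (A i)) \<longlonglongrightarrow> 0"
      by (rule tendsto_sandwich[OF _ _ tendsto_const lim[unfolded mult_zero_right]])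
        (use A m0 m1 in \<open>auto intro!: always_eventually\<close>)
    then show "(\<lambda>i. ennreal (m (A i))) \<longlonglongrightarrow> 0"
      using tendsto_ennrealI[of "\<lambda>i. m (A i)" 0] by simp
  qed auto
  have eN: "emeasure N A = ennreal (m A)" if "A \<in> sets M" for A
    unfolding N_def
    by (rule emeasure_measure_of_sigma[OF sets.sigma_algebra_axioms _ ca that]) (simp add: positive_def emp)
  have finN: "finite_measure N"
    by standard (simp add: eN spaceN)
  have "absolutely_continuous M N"
    unfolding absolutely_continuous_def
  proof
    fix A assume A: "A \<in> null_sets M"
    then have "(\<integral>x. indicator A x * L x \<partial>M) = 0"
      by (intro integral_eq_zero_AE) (auto dest!: AE_not_in elim!: eventually_mono)
    then have "m A = 0" using m0[of A] m1[of A] A by auto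
    then show "A \<in> null_sets N" using A by (auto simp: null_sets_def eN setsN)
  qed
  then obtain D where D: "D \<in> borel_measurable M" "AE x in M. RN_deriv M N x = ennreal (D x)" "\<And>x. 0 \<le> D x"
    using real_RN_deriv[OF finN _ setsN] by metis
  have dens: "density M (\<lambda>x. ennreal (D x)) = N"
  proof -
    have "density M (\<lambda>x. ennreal (D x)) = density M (RN_deriv M N)"
      using D by (intro density_cong) (auto elim: eventually_mono)
    then show ?thesis using density_RN_deriv[OF \<open>absolutely_continuous M N\<close> setsN] by simp
  qed
  have nnD: "(\<integral>\<^sup>+x. ennreal (indicator A x * D x) \<partial>M) = ennreal (m A)" if "A \<in> sets M" for A
  proof -
    have "ennreal (m A) = emeasure (density M (\<lambda>x. ennreal (D x))) A" using eN[OF that] dens by simp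
    also have "\<dots> = (\<integral>\<^sup>+x. ennreal (D x) * indicator A x \<partial>M)" using that D by (intro emeasure_density) auto
    also have "\<dots> = (\<integral>\<^sup>+x. ennreal (indicator A x * D x) \<partial>M)"
      by (intro nn_integral_cong) (auto simp: indicator_def)
    finally show ?thesis by simp
  qed
  have hD: "has_bochner_integral M (\<lambda>x. indicator A x * D x) (m A)" if "A \<in> sets M" for A
    using that D m0 nnD by (intro has_bochner_integral_nn_integral) auto
  have "integrable M (\<lambda>x. indicator (space M) x * D x)" using hD[of "space M"]
    by (auto simp: has_bochner_integral_iff)
  then have intD: "integrable M D" by (subst Bochner_Integration.integrable_cong[of M M D]) (auto simp:
    indicator_def)
  show ?thesis
  \<comment> \<open>Subtracting \<open>L\<close> undoes the shift that made the set function
    positive.\<close>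
  proof (rule that[of "\<lambda>x. D x - L x"])
    show "integrable M (\<lambda>x. D x - L x)" using intD L by simp
    fix A assume A: "A \<in> sets M"
    have "(\<integral>x. indicator A x * (D x - L x) \<partial>M)
      = (\<integral>x. indicator A x * D x \<partial>M) - (\<integral>x. indicator A x * L x \<partial>M)"
      using hD[OF A] intL[OF A] by (simp add: right_diff_distrib has_bochner_integral_iff)
    then show "\<Lambda> (\<lambda>x. indicator A x *\<^sub>R e) = (\<integral>x. indicator A x * (D x - L x) \<partial>M)"
      using hD[OF A] by (simp add: m_def has_bochner_integral_iff)
  qed
qed

text \<open>Scalar densities for the basis vectors assemble into a vector density that is right on
  indicators, hence on simple functions. Domination by \<open>L\<close> makes the functional
  continuous along uniformly bounded, pointwise convergent sequences, which settles the remaining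
  functions.\<close>

theorem dominated_functional_density:
  fixes \<Lambda> :: "('b \<Rightarrow> 'a::euclidean_space) \<Rightarrow> real" and L :: "'b \<Rightarrow> real"
  assumes M: "sigma_finite_measure M"
    and L: "integrable M L" "\<And>x. 0 \<le> L x"
    and \<Lambda>: "fun_linear (bounded_measurable M) \<Lambda>"
    and dom: "\<And>Z. Z \<in> bounded_measurable M \<Longrightarrow> \<bar>\<Lambda> Z\<bar> \<le> (\<integral>x. L x * norm (Z x) \<partial>M)"
  obtains v where "integrable M v" "\<And>Z. Z \<in> bounded_measurable M \<Longrightarrow> \<Lambda> Z = (\<integral>x. v x \<bullet> Z x \<partial>M)"
proof -
  have "\<exists>v. integrable M v \<and> (\<forall>A\<in>sets M. \<Lambda> (\<lambda>x. indicator A x *\<^sub>R e) = (\<integral>x. indicator A x * v x \<partial>M))"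
    if "e \<in> Basis" for e
    using dominated_functional_scalar_density[OF M L \<Lambda> dom norm_Basis[OF that]] by metis
  then obtain w where w: "\<And>e. e \<in> Basis \<Longrightarrow> integrable M (w e)"
    "\<And>e A. e \<in> Basis \<Longrightarrow> A \<in> sets M \<Longrightarrow> \<Lambda> (\<lambda>x. indicator A x *\<^sub>R e) = (\<integral>x. indicator A x * w e x \<partial>M)"
    by metis
  define v where "v x = (\<Sum>e\<in>Basis. w e x *\<^sub>R e)" for x
  have intv: "integrable M v" unfolding v_def
    by (intro Bochner_Integration.integrable_sum integrable_scaleR_left w)
  have vB: "v x \<bullet> e = w e x" if "e \<in> Basis" for x e
    using that by (simp add: v_def inner_sum_left inner_Basis if_distrib cong: if_cong)
  note sub = fun_subspace_bounded_measurable[of M, where 'b='a]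
  have add: "\<Lambda> (\<lambda>i. x i + y i) = \<Lambda> x + \<Lambda> y" if "x \<in> bounded_measurable M" "y \<in> bounded_measurable M" for x y
    using \<Lambda> that by (auto simp: fun_linear_def)
  have scale: "\<Lambda> (\<lambda>i. t *\<^sub>R x i) = t * \<Lambda> x" if "x \<in> bounded_measurable M" for x t
    using \<Lambda> that by (auto simp: fun_linear_def)
  have ind: "(\<lambda>x. indicator A x *\<^sub>R c) \<in> bounded_measurable M" if "A \<in> sets M" for A and c :: 'a
    using that by (auto simp: bounded_measurable_def indicator_def intro!: exI[of _ "norm c"])
  have indicator: "\<Lambda> (\<lambda>x. indicator A x *\<^sub>R c) = (\<integral>x. v x \<bullet> (indicator A x *\<^sub>R c) \<partial>M)"
    if A: "A \<in> sets M" for A c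
  proof -
    have mem: "(\<lambda>x. (c \<bullet> e) *\<^sub>R (indicator A x *\<^sub>R e)) \<in> bounded_measurable M" for e
      by (rule fun_subspaceD(3)[OF sub ind[OF A]])
    have "(\<lambda>x. indicator A x *\<^sub>R c) = (\<lambda>x. \<Sum>e\<in>Basis. (c \<bullet> e) *\<^sub>R (indicator A x *\<^sub>R e))"
    proof
      fix x
      have "indicator A x *\<^sub>R c = indicator A x *\<^sub>R (\<Sum>e\<in>Basis. (c \<bullet> e) *\<^sub>R e)"
        by (simp add: euclidean_representation)
      then show "indicator A x *\<^sub>R c = (\<Sum>e\<in>Basis. (c \<bullet> e) *\<^sub>R (indicator A x *\<^sub>R e))"
        by (simp add: scaleR_sum_right mult.commute)
    qed
    then have "\<Lambda> (\<lambda>x. indicator A x *\<^sub>R c) = (\<Sum>e\<in>Basis. \<Lambda> (\<lambda>x. (c \<bullet> e) *\<^sub>R (indicator A x *\<^sub>R e)))"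
      using fun_linear_sum[OF sub \<Lambda>, of Basis "\<lambda>e x. (c \<bullet> e) *\<^sub>R (indicator A x *\<^sub>R e)"] mem by simp
    also have "\<dots> = (\<Sum>e\<in>Basis. (c \<bullet> e) * (\<integral>x. indicator A x * w e x \<partial>M))"
      by (intro sum.cong refl) (simp only: scale[OF ind[OF A]] w(2)[OF _ A])
    also have "\<dots> = (\<integral>x. (\<Sum>e\<in>Basis. (c \<bullet> e) * (indicator A x * w e x)) \<partial>M)"
      using w(1) A by (subst Bochner_Integration.integral_sum)
        (use integrable_mult_indicator[OF A w(1)] in auto)
    also have "\<dots> = (\<integral>x. v x \<bullet> (indicator A x *\<^sub>R c) \<partial>M)"
    proof (intro Bochner_Integration.integral_cong refl)
      fix x
      have "v x \<bullet> c = (\<Sum>e\<in>Basis. (v x \<bullet> e) * (c \<bullet> e))" by (rule euclidean_inner)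
      also have "\<dots> = (\<Sum>e\<in>Basis. w e x * (c \<bullet> e))" by (intro sum.cong refl) (simp add: vB)
      finally show "(\<Sum>e\<in>Basis. (c \<bullet> e) * (indicator A x * w e x)) = v x \<bullet> (indicator A x *\<^sub>R c)"
        by (simp add: sum_distrib_left mult_ac)
    qed
    finally show ?thesis .
  qed
  have simple: "\<Lambda> (\<lambda>x. \<Sum>y\<in>T. indicator (A y) x *\<^sub>R y) = (\<integral>x. v x \<bullet> (\<Sum>y\<in>T. indicator (A y) x *\<^sub>R y) \<partial>M)"
    if "\<And>y. y \<in> T \<Longrightarrow> A y \<in> sets M" for T :: "'a set" and A
  proof -
    have "\<Lambda> (\<lambda>x. \<Sum>y\<in>T. indicator (A y) x *\<^sub>R y) = (\<Sum>y\<in>T. \<Lambda> (\<lambda>x. indicator (A y) x *\<^sub>R y))"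
      using fun_linear_sum[OF sub \<Lambda>, of T "\<lambda>y x. indicator (A y) x *\<^sub>R y"] ind that by blast
    also have "\<dots> = (\<Sum>y\<in>T. \<integral>x. v x \<bullet> (indicator (A y) x *\<^sub>R y) \<partial>M)"
      using that by (intro sum.cong refl indicator)
    also have "\<dots> = (\<integral>x. (\<Sum>y\<in>T. v x \<bullet> (indicator (A y) x *\<^sub>R y)) \<partial>M)"
    proof (rule Bochner_Integration.integral_sum[symmetric])
      fix y assume "y \<in> T"
      then have "integrable M (\<lambda>x. indicator (A y) x *\<^sub>R (v x \<bullet> y))"
        using that intv by (intro integrable_mult_indicator) auto
      then show "integrable M (\<lambda>x. v x \<bullet> (indicator (A y) x *\<^sub>R y))" by simp
    qed
    finally show ?thesis by (simp add: inner_sum_right)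
  qed
  show ?thesis
  proof (rule that[OF intv])
    fix Z :: "'b \<Rightarrow> 'a" assume Z: "Z \<in> bounded_measurable M"
    then obtain K where K: "\<And>x. norm (Z x) \<le> K" and Zm: "Z \<in> borel_measurable M"
      by (auto simp: bounded_measurable_def)
    have K0: "K \<ge> 0" using K norm_ge_zero order_trans by blast
    obtain s' where s': "\<And>n. simple_function M (s' n)" "\<And>x. x \<in> space M \<Longrightarrow> (\<lambda>n. s' n x) \<longlonglongrightarrow> Z x"
      "\<And>n x. x \<in> space M \<Longrightarrow> norm (s' n x) \<le> 2 * norm (Z x)"
      using borel_measurable_implies_sequence_metric[OF Zm, of 0] unfolding norm_conv_dist by metis
    \<comment> \<open>Written as a sum over indicators, the approximation vanishes outside
      \<open>space M\<close>; membership in \<open>bounded_measurable M\<close> asks for a bound at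
      every argument.\<close>
    define s where "s n x = (\<Sum>y\<in>s' n ` space M. indicator (s' n -` {y} \<inter> space M) x *\<^sub>R y)" for n x
    have fin: "finite (s' n ` space M)" for n using s'(1) by (simp add: simple_function_def)
    have s_eq: "s n x = s' n x" if "x \<in> space M" for n x
    proof -
      have "s n x = (\<Sum>y\<in>s' n ` space M. if y = s' n x then y else 0)"
        unfolding s_def using that by (intro sum.cong) (auto simp: indicator_def)
      then show ?thesis using fin that by simp
    qed
    have s_out: "s n x = 0" if "x \<notin> space M" for n x using that by (simp add: s_def)
    have sK: "norm (s n x) \<le> 2 * K" for n x
      using s_eq[of x n] s_out[of x n] s'(3)[of x n] K[of x] K0 by (cases "x \<in> space M") auto
    have ssets: "s' n -` {y} \<inter> space M \<in> sets M" if "y \<in> s' n ` space M" for n y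
      using s'(1)[of n] that by (auto simp: simple_function_def)
    have sm: "s n \<in> borel_measurable M" for n unfolding s_def using ssets
      by (intro borel_measurable_sum) auto
    have sB: "s n \<in> bounded_measurable M" for n using sm sK by (auto simp: bounded_measurable_def)
    have diff: "\<bar>\<Lambda> Z - \<Lambda> (s n)\<bar> \<le> (\<integral>x. L x * norm (Z x - s n x) \<partial>M)" for n
    proof -
      have neg: "(\<lambda>x. (-1) *\<^sub>R s n x) \<in> bounded_measurable M" using sB sub unfolding fun_subspace_def
        by blast
      have eq: "(\<lambda>x. Z x + (-1) *\<^sub>R s n x) = (\<lambda>x. Z x - s n x)" by simp
      have "(\<lambda>x. Z x - s n x) \<in> bounded_measurable M"
        unfolding eq[symmetric] by (rule fun_subspaceD(2)[OF sub Z neg])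
      moreover have "\<Lambda> (\<lambda>x. Z x - s n x) = \<Lambda> Z - \<Lambda> (s n)"
        using add[OF Z neg] scale[OF sB, of "-1" n] unfolding eq by simp
      ultimately show ?thesis using dom by metis
    qed
    have "(\<lambda>n. \<integral>x. L x * norm (Z x - s n x) \<partial>M) \<longlonglongrightarrow> (\<integral>x. 0 \<partial>M)"
    proof (rule integral_dominated_convergence[where w="\<lambda>x. L x * (3 * K)"])
      show "AE x in M. (\<lambda>n. L x * norm (Z x - s n x)) \<longlonglongrightarrow> 0"
      proof (intro AE_I2)
        fix x assume x: "x \<in> space M"
        have "(\<lambda>n. L x * norm (Z x - s' n x)) \<longlonglongrightarrow> L x * norm (Z x - Z x)"
          by (intro tendsto_intros s'(2)[OF x])
        then show "(\<lambda>n. L x * norm (Z x - s n x)) \<longlonglongrightarrow> 0" using s_eq[OF x] by simp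
      qed
      show "AE x in M. norm (L x * norm (Z x - s n x)) \<le> L x * (3 * K)" for n
      proof (intro AE_I2)
        fix x
        have "norm (Z x - s n x) \<le> 3 * K" using norm_triangle_ineq4[of "Z x" "s n x"] K[of x] sK[of n x]
          by linarith
        then show "norm (L x * norm (Z x - s n x)) \<le> L x * (3 * K)" using L(2)[of x]
          by (simp add: abs_mult mult_left_mono)
      qed
    qed (use L Zm sm in auto)
    then have int0: "(\<lambda>n. \<integral>x. L x * norm (Z x - s n x) \<partial>M) \<longlonglongrightarrow> 0" by simp
    have "\<forall>\<^sub>F n in sequentially. norm (\<Lambda> Z - \<Lambda> (s n)) \<le> (\<integral>x. L x * norm (Z x - s n x) \<partial>M)"
      using diff by simp
    then have "(\<lambda>n. \<Lambda> Z - \<Lambda> (s n)) \<longlonglongrightarrow> 0"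
      using int0 by (rule Lim_null_comparison)
    from tendsto_diff[OF tendsto_const[of "\<Lambda> Z"] this]
    have 1: "(\<lambda>n. \<Lambda> (s n)) \<longlonglongrightarrow> \<Lambda> Z" by simp
    have "(\<lambda>n. \<integral>x. v x \<bullet> s n x \<partial>M) \<longlonglongrightarrow> (\<integral>x. v x \<bullet> Z x \<partial>M)"
    proof (rule integral_dominated_convergence[where w="\<lambda>x. norm (v x) * (2 * K)"])
      show "AE x in M. (\<lambda>n. v x \<bullet> s n x) \<longlonglongrightarrow> v x \<bullet> Z x"
        using s_eq s'(2) by (intro AE_I2) (auto intro!: tendsto_intros)
      show "AE x in M. norm (v x \<bullet> s n x) \<le> norm (v x) * (2 * K)" for n
      proof (intro AE_I2)
        fix x
        show "norm (v x \<bullet> s n x) \<le> norm (v x) * (2 * K)"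
          using Cauchy_Schwarz_ineq2[of "v x" "s n x"] mult_left_mono[OF sK[of n x], of "norm (v x)"]
            by simp
      qed
    qed (use intv Zm sm in auto)
    moreover have "\<Lambda> (s n) = (\<integral>x. v x \<bullet> s n x \<partial>M)" for n
      unfolding s_def by (rule simple[OF ssets])
    ultimately show "\<Lambda> Z = (\<integral>x. v x \<bullet> Z x \<partial>M)" using 1 LIMSEQ_unique by auto
  qed
qed

section \<open>Lebesgue points\<close>

text \<open>For a suitable \<open>n\<close> the part of \<open>g\<close> above the level
  \<open>n\<close> has integral below \<open>e / 2\<close>, and the truncated part contributes at
  most \<open>n\<close> times the measure of \<open>A\<close>. The \<open>n + 1\<close> in the
  witness keeps its denominator positive.\<close>

lemma integral_absolutely_continuous:
  fixes g :: "'a \<Rightarrow> real"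
  assumes g: "integrable M g" "\<And>x. 0 \<le> g x" and e: "e > 0"
  obtains d where "d > 0" "\<And>A. A \<in> sets M \<Longrightarrow> emeasure M A < ennreal d \<Longrightarrow> (\<integral>x. indicator A x * g x \<partial>M) < e"
proof -
  have "(\<lambda>n. \<integral>x. g x - min (g x) (real n) \<partial>M) \<longlonglongrightarrow> (\<integral>x. 0 \<partial>M)"
  proof (rule integral_dominated_convergence[where w=g])
    show "AE x in M. (\<lambda>n. g x - min (g x) (real n)) \<longlonglongrightarrow> 0"
    proof (intro AE_I2 tendsto_eventually)
      fix x
      obtain N :: nat where "g x \<le> real N" using real_arch_simple by blast
      then show "\<forall>\<^sub>F n in sequentially. g x - min (g x) (real n) = 0"
        unfolding eventually_sequentially by (intro exI[of _ N]) auto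
    qed
  qed (use g in \<open>auto simp: min_def\<close>)
  then have "\<forall>\<^sub>F n in sequentially. (\<integral>x. g x - min (g x) (real n) \<partial>M) < e / 2"
    using e by (intro order_tendstoD(2)[of _ 0]) auto
  then obtain n where n: "(\<integral>x. g x - min (g x) (real n) \<partial>M) < e / 2"
    by (auto simp: eventually_sequentially)
  show ?thesis
  proof (rule that[of "e / (2 * (real n + 1))"])
    show "e / (2 * (real n + 1)) > 0" using e by simp
    fix A assume A: "A \<in> sets M" "emeasure M A < ennreal (e / (2 * (real n + 1)))"
    then have fin: "emeasure M A < \<infinity>" by (auto simp: less_top[symmetric])
    have mA: "measure M A < e / (2 * (real n + 1))"
      using A(2) fin e by (simp add: emeasure_eq_ennreal_measure ennreal_less_iff)
    have intm: "integrable M (\<lambda>x. min (g x) (real n))"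
      by (rule Bochner_Integration.integrable_bound[OF g(1)]) (use g in auto)
    have "(\<integral>x. indicator A x * g x \<partial>M) \<le> (\<integral>x. (g x - min (g x) (real n)) + real n * indicator A x \<partial>M)"
    proof (rule integral_mono)
      show "integrable M (\<lambda>x. indicator A x * g x)" using integrable_mult_indicator[OF A(1) g(1)] by simp
      show "integrable M (\<lambda>x. (g x - min (g x) (real n)) + real n * indicator A x)"
        using g A(1) fin intm by (intro Bochner_Integration.integrable_add
          Bochner_Integration.integrable_diff integrable_mult_right) auto
    qed (use g in \<open>auto simp: indicator_def\<close>)
    also have "\<dots> = (\<integral>x. g x - min (g x) (real n) \<partial>M) + real n * measure M A"
      using g A(1) fin intm by (subst Bochner_Integration.integral_add)
        (auto intro!: Bochner_Integration.integrable_diff integrable_mult_right simp: sets.Int_space_eq2)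
    also have "\<dots> < e"
    proof -
      have "real n * measure M A \<le> (real n + 1) * measure M A" by (simp add: mult_right_mono)
      also have "\<dots> < e / 2" using mA by (simp add: field_simps)
      finally show ?thesis using n by linarith
    qed
    finally show "(\<integral>x. indicator A x * g x \<partial>M) < e" .
  qed
qed

text \<open>If the averages of \<open>g\<close> stay above \<open>\<epsilon>\<close> on a subset of the zero set of \<open>g\<close>, a Vitali covering by
  intervals inside a thin open neighbourhood of the zero set shows that this subset is negligible.\<close>

lemma averages_vanish_on_zero_set:
  fixes g :: "real \<Rightarrow> real"
  assumes g: "integrable lebesgue g" "\<And>x. 0 \<le> g x" and E: "E \<in> sets lebesgue" "\<And>x. x \<in> E \<Longrightarrow> g x = 0"
    and \<epsilon>: "\<epsilon> > 0"
  shows "negligible {x \<in> E. \<forall>d>0. \<exists>r. 0 < r \<and> r < d \<and>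
    \<epsilon> * r < (\<integral>y. indicator (cball x r) y * g y \<partial>lebesgue)}"
    (is "negligible ?T")
  unfolding negligible_outer_le
proof (intro allI impI)
  fix e :: real assume e: "e > 0"
  \<comment> \<open>The bound \<open>\<epsilon> * e / 2\<close> makes the total length of the
    covering come out as at most \<open>e\<close>: an interval of radius \<open>r\<close> in it has
    length \<open>2 r\<close>, which is less than \<open>2 / \<epsilon>\<close> times the integral
    of \<open>g\<close> over it.\<close>
  obtain d where d: "d > 0" "\<And>A. A \<in> sets lebesgue \<Longrightarrow> emeasure lebesgue A < ennreal d \<Longrightarrow>
      (\<integral>x. indicator A x * g x \<partial>lebesgue) < \<epsilon> * e / 2"
    using integral_absolutely_continuous[OF g, of "\<epsilon> * e / 2"] e \<epsilon> by auto
  obtain U where U: "open U" "E \<subseteq> U" "U - E \<in> lmeasurable" "emeasure lebesgue (U - E) < ennreal d"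
    using sets_lebesgue_outer_open[OF E(1) d(1)] by blast
  have int: "integrable lebesgue (\<lambda>y. indicator A y * g y)" if "A \<in> sets lebesgue" for A
    using integrable_mult_indicator[OF that g(1)] by simp
  have Us: "U \<in> sets lebesgue" using U(1) by (metis borel_open sets_completionI_sets sets_lborel)
  \<comment> \<open>Since \<open>g\<close> vanishes on \<open>E\<close>, only the thin set
    \<open>U - E\<close> contributes.\<close>
  have "(\<integral>x. indicator U x * g x \<partial>lebesgue) = (\<integral>x. indicator (U - E) x * g x \<partial>lebesgue)"
    using E(2) by (intro Bochner_Integration.integral_cong) (auto simp: indicator_def)
  also have "\<dots> < \<epsilon> * e / 2" using d(2) U by (auto simp: fmeasurable_def)
  finally have gU: "(\<integral>x. indicator U x * g x \<partial>lebesgue) < \<epsilon> * e / 2" .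
  define K where "K = {(x, r). x \<in> ?T \<and> 0 < r \<and> cball x r \<subseteq> U \<and>
    \<epsilon> * r < (\<integral>y. indicator (cball x r) y * g y \<partial>lebesgue)}"
  obtain C where C: "countable C" "C \<subseteq> K"
    "pairwise (\<lambda>i j. disjnt (cball (fst i) (snd i)) (cball (fst j) (snd j))) C"
    "negligible (?T - (\<Union>i\<in>C. cball (fst i) (snd i)))"
  proof (rule Vitali_covering_theorem_cballs[of K snd ?T fst])
    show "0 < snd i" if "i \<in> K" for i using that by (auto simp: K_def)
    fix x d :: real assume x: "x \<in> ?T" and d: "0 < d"
    then obtain r0 where r0: "r0 > 0" "cball x r0 \<subseteq> U" using U(1,2) open_contains_cball by blast
    obtain r where r: "0 < r" "r < min d r0" "\<epsilon> * r < (\<integral>y. indicator (cball x r) y * g y \<partial>lebesgue)"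
      using x d r0(1) by (auto simp: min_less_iff_conj) (metis (no_types) d min_less_iff_conj r0(1))
    have "cball x r \<subseteq> U" using r(2) r0(2)
      by (meson min.strict_boundedE order_trans less_imp_le subset_cball)
    then have "(x, r) \<in> K" using x r by (simp add: K_def)
    then show "\<exists>i. i \<in> K \<and> x \<in> cball (fst i) (snd i) \<and> snd i < d"
      using r by (intro exI[of _ "(x, r)"]) auto
  qed
  let ?W = "\<Union>i\<in>C. cball (fst i) (snd i)"
  have bound: "measure lebesgue (\<Union>i\<in>F. cball (fst i) (snd i)) \<le> e" if F: "F \<subseteq> C" "finite F" for F
  proof -
    have "measure lebesgue (\<Union>i\<in>F. cball (fst i) (snd i)) \<le> (\<Sum>i\<in>F. measure lebesgue (cball (fst i) (snd i)))"
      using F(2) by (intro measure_UNION_le) auto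
    also have "\<dots> = (\<Sum>i\<in>F. 2 * snd i)"
      using F C(2) by (intro sum.cong) (auto simp: cball_eq_atLeastAtMost K_def)
    also have "\<dots> \<le> (\<Sum>i\<in>F. 2 / \<epsilon> * (\<integral>y. indicator (cball (fst i) (snd i)) y * g y \<partial>lebesgue))"
    proof (intro sum_mono)
      fix i assume "i \<in> F"
      then have "\<epsilon> * snd i < (\<integral>y. indicator (cball (fst i) (snd i)) y * g y \<partial>lebesgue)"
        using F C(2) by (auto simp: K_def)
      then show "2 * snd i \<le> 2 / \<epsilon> * (\<integral>y. indicator (cball (fst i) (snd i)) y * g y \<partial>lebesgue)"
        using \<epsilon> by (simp add: field_simps)
    qed
    also have "\<dots> = 2 / \<epsilon> * (\<integral>y. (\<Sum>i\<in>F. indicator (cball (fst i) (snd i)) y * g y) \<partial>lebesgue)"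
      by (subst Bochner_Integration.integral_sum) (auto intro!: int simp: sum_distrib_left)
    also have "\<dots> \<le> 2 / \<epsilon> * (\<integral>y. indicator U y * g y \<partial>lebesgue)"
    proof (intro mult_left_mono integral_mono)
      show "integrable lebesgue (\<lambda>y. \<Sum>i\<in>F. indicator (cball (fst i) (snd i)) y * g y)"
        by (intro Bochner_Integration.integrable_sum int) auto
      show "integrable lebesgue (\<lambda>y. indicator U y * g y)" by (rule int[OF Us])
      fix y
      have disj: "disjoint_family_on (\<lambda>i. cball (fst i) (snd i)) F"
        using C(3) F(1) unfolding disjoint_family_on_def pairwise_def disjnt_def by blast
      have "(\<Sum>i\<in>F. indicator (cball (fst i) (snd i)) y)
        = (indicator (\<Union>i\<in>F. cball (fst i) (snd i)) y :: real)"
        by (rule indicator_UN_disjoint[OF F(2) disj, symmetric])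
      also have "\<dots> \<le> indicator U y"
      proof -
        have "cball (fst i) (snd i) \<subseteq> U" if "i \<in> F" for i
        proof -
          have "i \<in> K" using that F(1) C(2) by blast
          then show ?thesis unfolding K_def by force
        qed
        then show ?thesis by (intro indicator_leI) blast
      qed
      finally have "(\<Sum>i\<in>F. indicator (cball (fst i) (snd i)) y) * g y \<le> indicator U y * g y"
        using g(2) by (intro mult_right_mono)
      then show "(\<Sum>i\<in>F. indicator (cball (fst i) (snd i)) y * g y) \<le> indicator U y * g y"
        by (simp add: sum_distrib_right)
    qed (use \<epsilon> in auto)
    also have "\<dots> \<le> 2 / \<epsilon> * (\<epsilon> * e / 2)" using gU \<epsilon> by (intro mult_left_mono) auto
    finally show ?thesis using \<epsilon> by simp
  qed
  have W: "?W \<in> lmeasurable" "measure lebesgue ?W \<le> e"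
    using fmeasurable_UN_bound[OF C(1), of "\<lambda>i. cball (fst i) (snd i)" lebesgue e]
      measure_UN_bound[OF C(1), of "\<lambda>i. cball (fst i) (snd i)" lebesgue e] bound by auto
  have N: "?T - ?W \<in> null_sets lebesgue" using C(4) negligible_iff_null_sets by blast
  show "\<exists>S. ?T \<subseteq> S \<and> S \<in> lmeasurable \<and> measure lebesgue S \<le> e"
  proof (intro exI conjI)
    show "?T \<subseteq> ?W \<union> (?T - ?W)" by blast
    show "?W \<union> (?T - ?W) \<in> lmeasurable" by (rule fmeasurable.Un[OF W(1) negligible_imp_measurable[OF C(4)]])
    show "measure lebesgue (?W \<union> (?T - ?W)) \<le> e"
      using W(2) measure_Un_null_set[OF fmeasurableD[OF W(1)] N] by simp
  qed
qed

text \<open>For a constant \<open>c\<close> the function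
  \<open>max (norm (f y - c) - 1 / Suc k) 0\<close>, cut off to a ball to be integrable, vanishes
  where \<open>f\<close> is within \<open>1 / Suc k\<close> of \<open>c\<close>, so its averages
  over small balls are small at almost all such points of the ball. Countably many triples of
  \<open>c\<close> in a dense set, \<open>k\<close> and \<open>N\<close> suffice, since some
  \<open>c\<close> is close to any given value of \<open>f\<close>.\<close>

lemma lebesgue_points:
  fixes f :: "real \<Rightarrow> 'a::euclidean_space"
  assumes f: "integrable lebesgue f"
  shows "AE x in lebesgue. \<forall>\<epsilon>>0. \<exists>d>0. \<forall>r. 0 < r \<and> r < d \<longrightarrow>
    (\<integral>y. indicator (cball x r) y * norm (f y - f x) \<partial>lebesgue) \<le> \<epsilon> * r"
proof -
  obtain D :: "'a set" where D: "countable D" "\<And>X. open X \<Longrightarrow> X \<noteq> {} \<Longrightarrow> \<exists>d\<in>D. d \<in> X"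
    by (erule countable_dense_setE)
  define g where "g c k N y = indicator (ball 0 (real N)) y * max (norm (f y - c) - 1 / Suc k) 0" for c
    and k N :: nat and y :: real
  define E where "E c k N = {x \<in> ball 0 (real N). norm (f x - c) < 1 / Suc k}" for c and k N :: nat
  define T where "T c k N = {x \<in> E c k N. \<forall>d>0. \<exists>r. 0 < r \<and> r < d \<and>
      1 / Suc k * r < (\<integral>y. indicator (cball x r) y * g c k N y \<partial>lebesgue)}" for c k N
  have fm: "f \<in> borel_measurable lebesgue" using f by auto
  have locint: "integrable lebesgue (\<lambda>y. indicator A y *\<^sub>R norm (f y - c))" if "A \<in> lmeasurable" for A c
  proof -
    have "integrable lebesgue (\<lambda>y. indicator A y *\<^sub>R f y)"
      using that f by (intro integrable_mult_indicator) (auto simp: fmeasurableD)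
    moreover have "integrable lebesgue (\<lambda>y. indicator A y *\<^sub>R c)"
      using that by (intro integrable_scaleR_left) (auto simp: fmeasurable_def)
    ultimately have "integrable lebesgue (\<lambda>y. norm (indicator A y *\<^sub>R f y - indicator A y *\<^sub>R c))" by auto
    then show ?thesis
      by (rule Bochner_Integration.integrable_cong[THEN iffD1, rotated -1]) (auto simp: indicator_def)
  qed
  have gint: "integrable lebesgue (g c k N)" for c k N
  proof (rule Bochner_Integration.integrable_bound[OF locint[of "ball 0 (real N)" c]])
    show "g c k N \<in> borel_measurable lebesgue" unfolding g_def using fm
      by (intro borel_measurable_times borel_measurable_max borel_measurable_diff borel_measurable_norm
        borel_measurable_const borel_measurable_indicator) auto
  qed (auto simp: g_def indicator_def)
  have Es: "E c k N \<in> sets lebesgue" for c k N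
  proof -
    have "E c k N = ball 0 (real N) \<inter> {x \<in> space lebesgue. norm (f x - c) < 1 / Suc k}"
      by (auto simp: E_def)
    moreover have "{x \<in> space lebesgue. norm (f x - c) < 1 / Suc k} \<in> sets lebesgue" using fm by measurable
    ultimately show ?thesis by auto
  qed
  have Tneg: "negligible (T c k N)" for c k N
    unfolding T_def by (rule averages_vanish_on_zero_set[OF gint _ Es]) (auto simp: g_def E_def)
  have "negligible (\<Union>c\<in>D. \<Union>k. \<Union>N. T c k N)"
    using D(1) Tneg unfolding negligible_iff_null_sets by (intro null_sets_UN' null_sets_UN) auto
  then have "AE x in lebesgue. x \<notin> (\<Union>c\<in>D. \<Union>k. \<Union>N. T c k N)"
    using negligible_iff_null_sets AE_not_in by blast
  then show ?thesis
  proof eventually_elim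
    case (elim x)
    show ?case
    proof (intro allI impI)
      fix \<epsilon> :: real assume \<epsilon>: "\<epsilon> > 0"
      \<comment> \<open>The 5 collects \<open>1 / Suc k\<close> from the averages of
        \<open>g\<close> and \<open>2 / Suc k\<close> over an interval of length
        \<open>2 r\<close>.\<close>
      obtain k :: nat where k: "5 / \<epsilon> < real k" using reals_Archimedean2 by blast
      have kk: "5 / real (Suc k) \<le> \<epsilon>" using k \<epsilon> by (simp add: field_simps)
      obtain c where c: "c \<in> D" "norm (f x - c) < 1 / Suc k"
        using D(2)[of "ball (f x) (1 / Suc k)"] by (auto simp: dist_norm)
      obtain N :: nat where N: "norm x < real N" using reals_Archimedean2 by blast
      have xE: "x \<in> E c k N" using N c by (auto simp: E_def)
      have "x \<notin> T c k N" using elim c(1) by auto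
      then obtain d where d: "d > 0" "\<And>r. 0 < r \<Longrightarrow> r < d \<Longrightarrow>
        (\<integral>y. indicator (cball x r) y * g c k N y \<partial>lebesgue) \<le> 1 / Suc k * r"
        using xE unfolding T_def mem_Collect_eq by (metis not_less)
      show "\<exists>d>0. \<forall>r. 0 < r \<and> r < d \<longrightarrow> (\<integral>y. indicator (cball x r) y * norm (f y - f x) \<partial>lebesgue) \<le> \<epsilon> * r"
      proof (intro exI[of _ "min d (real N - norm x)"] conjI allI impI)
        show "min d (real N - norm x) > 0" using d N by simp
        fix r assume r: "0 < r \<and> r < min d (real N - norm x)"
        have sub: "cball x r \<subseteq> ball 0 (real N)"
        proof
          fix y assume "y \<in> cball x r"
          then show "y \<in> ball 0 (real N)" using r norm_triangle_sub[of y x]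
            by (auto simp: dist_norm norm_minus_commute)
        qed
        have gi: "integrable lebesgue (\<lambda>y. indicator (cball x r) y * g c k N y)"
          using integrable_mult_indicator[OF _ gint, of "cball x r"] by auto
        have ci: "integrable lebesgue (\<lambda>y. 2 / Suc k * indicator (cball x r) y)"
          by (intro integrable_mult_right integrable_real_indicator)
            (use r in \<open>auto simp: cball_eq_atLeastAtMost\<close>)
        have "(\<integral>y. indicator (cball x r) y * norm (f y - f x) \<partial>lebesgue)
           \<le> (\<integral>y. indicator (cball x r) y * g c k N y + 2 / Suc k * indicator (cball x r) y \<partial>lebesgue)"
        proof (rule integral_mono)
          show "integrable lebesgue (\<lambda>y. indicator (cball x r) y * norm (f y - f x))"
            using locint[of "cball x r" "f x"] by simp
          show "integrable lebesgue (\<lambda>y. indicator (cball x r) y * g c k N y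
            + 2 / Suc k * indicator (cball x r) y)"
            using gi ci by (rule Bochner_Integration.integrable_add)
          fix y
          show "indicator (cball x r) y * norm (f y - f x) \<le> indicator (cball x r) y * g c k N y
            + 2 / Suc k * indicator (cball x r) y"
          proof (cases "y \<in> cball x r")
            case True
            then have yN: "y \<in> ball 0 (real N)" using sub by blast
            have "norm (f y - f x) \<le> norm (f y - c) + norm (f x - c)"
              using norm_triangle_ineq4[of "f y - c" "f x - c"] by simp
            also have "\<dots> \<le> max (norm (f y - c) - 1 / Suc k) 0 + 1 / Suc k + 1 / Suc k" using c(2)
              by (simp add: max_def)
            finally show ?thesis using True yN by (simp add: g_def)
          qed simp
        qed
        also have "\<dots> = (\<integral>y. indicator (cball x r) y * g c k N y \<partial>lebesgue) + 2 / Suc k * (2 * r)"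
          using gi ci r by (subst Bochner_Integration.integral_add) (auto simp: cball_eq_atLeastAtMost)
        also have "\<dots> \<le> 1 / Suc k * r + 2 / Suc k * (2 * r)" by (intro add_right_mono d(2)) (use r in auto)
        also have "\<dots> = 5 / real (Suc k) * r" by (simp add: add_divide_distrib[symmetric])
        also have "\<dots> \<le> \<epsilon> * r" using kk r by (intro mult_right_mono) auto
        finally show "(\<integral>y. indicator (cball x r) y * norm (f y - f x) \<partial>lebesgue) \<le> \<epsilon> * r" .
      qed
    qed
  qed
qed

text \<open>At a Lebesgue point the remainder of the linear approximation is an integral of
  \<open>f t - f x\<close> over the interval between \<open>x\<close> and \<open>y\<close>, hence
  small compared with its length.\<close>

theorem indefinite_integral_has_vector_derivative_AE:
  fixes f :: "real \<Rightarrow> 'a::euclidean_space"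
  assumes f: "integrable lebesgue f"
  shows "AE x in lebesgue. ((\<lambda>x. \<integral>t. indicator {..x} t *\<^sub>R f t \<partial>lebesgue) has_vector_derivative f x) (at x)"
  using lebesgue_points[OF f]
proof eventually_elim
  case (elim x)
  define F where "F x = (\<integral>t. indicator {..x} t *\<^sub>R f t \<partial>lebesgue)" for x
  have bound: "norm (F y - F x - (y - x) *\<^sub>R f x)
    \<le> (\<integral>t. indicator (cball x \<bar>y - x\<bar>) t * norm (f t - f x) \<partial>lebesgue)" for y
  proof -
    \<comment> \<open>A signed indicator of the interval between \<open>x\<close> and
      \<open>y\<close>, which treats both orders of the two points at once.\<close>
    define D where "D t = indicator {..y} t - (indicator {..x} t :: real)" for t
    have int: "integrable lebesgue (\<lambda>t. indicator {..z} t *\<^sub>R f t)" for z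
      using f by (intro integrable_mult_indicator) auto
    have 1: "F y - F x = (\<integral>t. D t *\<^sub>R f t \<partial>lebesgue)" "integrable lebesgue (\<lambda>t. D t *\<^sub>R f t)"
      using int[of x] int[of y] by (auto simp: F_def D_def scaleR_diff_left)
    have Deq: "D t = indicator {x<..y} t - indicator {y<..x} t" for t by (auto simp: D_def indicator_def)
    have 2: "has_bochner_integral lebesgue D (y - x)"
    proof -
      have "has_bochner_integral lebesgue (\<lambda>t. indicator {x<..y} t - indicator {y<..x} t :: real)
          (measure lebesgue {x<..y} - measure lebesgue {y<..x})"
        by (intro has_bochner_integral_diff has_bochner_integral_real_indicator; cases "x \<le> y") auto
      moreover have "measure lebesgue {x<..y} - measure lebesgue {y<..x} = y - x"
        by (cases "x \<le> y") auto
      ultimately show ?thesis by (simp add: Deq[abs_def])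
    qed
    have 3: "(y - x) *\<^sub>R f x = (\<integral>t. D t *\<^sub>R f x \<partial>lebesgue)" "integrable lebesgue (\<lambda>t. D t *\<^sub>R f x)"
      using 2 by (auto simp: has_bochner_integral_iff)
    have "F y - F x - (y - x) *\<^sub>R f x = (\<integral>t. D t *\<^sub>R f t - D t *\<^sub>R f x \<partial>lebesgue)"
      using 1 3 by simp
    also have "norm \<dots> \<le> (\<integral>t. norm (D t *\<^sub>R f t - D t *\<^sub>R f x) \<partial>lebesgue)"
      by (rule integral_norm_bound)
    also have "\<dots> \<le> (\<integral>t. indicator (cball x \<bar>y - x\<bar>) t * norm (f t - f x) \<partial>lebesgue)"
    proof (rule integral_mono)
      show "integrable lebesgue (\<lambda>t. norm (D t *\<^sub>R f t - D t *\<^sub>R f x))" using 1 3 by simp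
      have "integrable lebesgue (\<lambda>t. norm (indicator (cball x \<bar>y - x\<bar>) t *\<^sub>R f t - indicator (cball x \<bar>y -
        x\<bar>) t *\<^sub>R f x))"
        using f by (intro integrable_norm Bochner_Integration.integrable_diff integrable_mult_indicator
          integrable_scaleR_left)
          (auto simp: cball_eq_atLeastAtMost)
      then show "integrable lebesgue (\<lambda>t. indicator (cball x \<bar>y - x\<bar>) t * norm (f t - f x))"
        by (rule Bochner_Integration.integrable_cong[THEN iffD1, rotated -1]) (auto simp: indicator_def)
      fix t
      have "norm (D t *\<^sub>R (f t - f x)) \<le> indicator (cball x \<bar>y - x\<bar>) t * norm (f t - f x)"
        by (auto simp: D_def indicator_def dist_real_def)
      then show "norm (D t *\<^sub>R f t - D t *\<^sub>R f x) \<le> indicator (cball x \<bar>y - x\<bar>) t * norm (f t - f x)"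
        by (simp add: scaleR_diff_right)
    qed
    finally show ?thesis .
  qed
  have "((\<lambda>y. norm (F y - F x - (y - x) *\<^sub>R f x) / norm (y - x)) \<longlongrightarrow> 0) (at x)"
  proof (rule tendstoI)
    fix e :: real assume e: "e > 0"
    obtain d where d: "d > 0" "\<And>r. 0 < r \<Longrightarrow> r < d \<Longrightarrow>
      (\<integral>y. indicator (cball x r) y * norm (f y - f x) \<partial>lebesgue) \<le> e / 2 * r"
      using elim[rule_format, of "e/2"] e by auto
    have "dist (norm (F y - F x - (y - x) *\<^sub>R f x) / norm (y - x)) 0 < e" if "y \<noteq> x" "dist y x < d" for y
    proof -
      have "norm (F y - F x - (y - x) *\<^sub>R f x) \<le> e / 2 * \<bar>y - x\<bar>"
        using bound[of y] d(2)[of "\<bar>y - x\<bar>"] that by (auto simp: dist_real_def)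
      then have "norm (F y - F x - (y - x) *\<^sub>R f x) / norm (y - x) \<le> e / 2"
        using that by (simp add: divide_le_eq)
      then have "norm (F y - F x - (y - x) *\<^sub>R f x) / norm (y - x) < e" using e by linarith
      then show ?thesis by (simp add: dist_real_def)
    qed
    then show "\<forall>\<^sub>F y in at x. dist (norm (F y - F x - (y - x) *\<^sub>R f x) / norm (y - x)) 0 < e"
      using d(1) by (auto simp: eventually_at)
  qed
  then have "(F has_vector_derivative f x) (at x)"
    unfolding has_vector_derivative_def has_derivative_iff_norm by (simp add: bounded_linear_scaleR_left)
  then show ?case by (simp add: F_def[abs_def])
qed

section \<open>Measurability of codifferential integrands\<close>

text \<open>Completeness is what allows measurability to survive changes on null sets; the
  hypotheses on the integrand hold only for almost every point.\<close>

lemma complete_measure_lebesgue_on: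
  assumes "S \<in> sets lebesgue"
  shows "complete_measure (lebesgue_on S)"
proof
  fix A B assume "B \<subseteq> A" "A \<in> null_sets (lebesgue_on S)"
  then have "A \<subseteq> S" "B \<in> sets lebesgue"
    using assms completion.complete by (auto simp: null_sets_restrict_space)
  then show "B \<in> sets (lebesgue_on S)" using \<open>B \<subseteq> A\<close> assms by (auto simp: sets_restrict_space_iff)
qed

context complete_measure
begin

lemma borel_measurable_AE_eq:
  fixes f g :: "'a \<Rightarrow> 'b::topological_space"
  assumes f: "f \<in> borel_measurable M" and eq: "AE x in M. f x = g x"
  shows "g \<in> borel_measurable M"
proof (rule borel_measurableI)
  fix S :: "'b set" assume S: "open S"
  show "g -` S \<inter> space M \<in> sets M"
  proof (rule in_sets_AE)
    show "f -` S \<inter> space M \<in> sets M" using f S by (auto intro: measurable_sets)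
    show "AE x in M. (x \<in> f -` S \<inter> space M) = (x \<in> g -` S \<inter> space M)"
      using eq by eventually_elim simp
  qed auto
qed

text \<open>Setting all functions to 0 on the exceptional set makes them converge everywhere, and
  completeness permits this change.\<close>

lemma borel_measurable_AE_limit:
  fixes f :: "nat \<Rightarrow> 'a \<Rightarrow> 'b::{metric_space, zero}"
  assumes f: "\<And>n. f n \<in> borel_measurable M" and lim: "AE x in M. (\<lambda>n. f n x) \<longlonglongrightarrow> g x"
  shows "g \<in> borel_measurable M"
proof -
  define N where "N = {x \<in> space M. \<not> (\<lambda>n. f n x) \<longlonglongrightarrow> g x}"
  have null: "N \<in> null_sets M" using lim unfolding AE_iff_null_sets N_def .
  have N: "N \<in> sets M" "\<And>x. x \<in> space M - N \<Longrightarrow> (\<lambda>n. f n x) \<longlonglongrightarrow> g x" "AE x in M. x \<notin> N"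
    using null AE_not_in[OF null] by (auto simp: N_def)
  have "(\<lambda>x. if x \<in> N then 0 else g x) \<in> borel_measurable M"
  proof (rule borel_measurable_LIMSEQ_metric)
    show "(\<lambda>x. if x \<in> N then 0 else f n x) \<in> borel_measurable M" for n
      using N(1) f by (intro measurable_If_set) auto
    show "(\<lambda>n. if x \<in> N then 0 else f n x) \<longlonglongrightarrow> (if x \<in> N then 0 else g x)" if "x \<in> space M" for x
      using N(2) that by auto
  qed
  then show ?thesis by (rule borel_measurable_AE_eq) (use N(3) in \<open>eventually_elim, simp\<close>)
qed

text \<open>With a simple function in place of \<open>z\<close> the composition is a finite sum of
  measurable functions; continuity in the second argument carries this to the pointwise
  limit.\<close>

lemma borel_measurable_caratheodory_compose:
  fixes k :: "'a \<Rightarrow> 'b::euclidean_space \<Rightarrow> real"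
  assumes k: "\<And>y. (\<lambda>x. k x y) \<in> borel_measurable M" and cont: "AE x in M. continuous_on UNIV (k x)"
    and z: "z \<in> borel_measurable M"
  shows "(\<lambda>x. k x (z x)) \<in> borel_measurable M"
proof -
  obtain s where s: "\<And>n::nat. simple_function M (s n)" "\<And>x. x \<in> space M \<Longrightarrow> (\<lambda>n. s n x) \<longlonglongrightarrow> z x"
    using borel_measurable_implies_sequence_metric[OF z, of 0] by metis
  show ?thesis
  proof (rule borel_measurable_AE_limit)
    fix n
    have fin: "finite (s n ` space M)" using s(1) by (simp add: simple_function_def)
    have "(\<lambda>x. \<Sum>y\<in>s n ` space M. indicator (s n -` {y} \<inter> space M) x * k x y) \<in> borel_measurable M"
      using s(1)[of n] k by (intro borel_measurable_sum borel_measurable_times borel_measurable_indicator)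
        (auto simp: simple_function_def)
    moreover have "(\<Sum>y\<in>s n ` space M. indicator (s n -` {y} \<inter> space M) x * k x y) = k x (s n x)"
      if "x \<in> space M" for x
    proof -
      have "(\<Sum>y\<in>s n ` space M. indicator (s n -` {y} \<inter> space M) x * k x y) = (\<Sum>y\<in>s n ` space M. if y
        = s n x then k x y else 0)"
        using that by (intro sum.cong) (auto simp: indicator_def)
      then show ?thesis using fin that by simp
    qed
    ultimately show "(\<lambda>x. k x (s n x)) \<in> borel_measurable M" by (simp cong: measurable_cong)
  next
    show "AE x in M. (\<lambda>n. k x (s n x)) \<longlonglongrightarrow> k x (z x)"
      using cont
    proof (rule AE_mp, intro AE_I2 impI)
      fix x assume "x \<in> space M" "continuous_on UNIV (k x)"
      then show "(\<lambda>n. k x (s n x)) \<longlonglongrightarrow> k x (z x)"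
        using s(2) by (auto intro: continuous_on_tendsto_compose)
    qed
  qed
qed

end

text \<open>Passing from a point of \<open>A\<close> to a nearest point of \<open>B\<close> changes
  the first component by at most the distance and the inner product with \<open>h\<close> by at most
  the distance times \<open>norm h\<close>; hence the factor \<open>1 + norm h\<close>.\<close>

lemma codiff_hi_le_hausdorff:
  fixes A B :: "(real \<times> 'a::euclidean_space) set"
  assumes "compact A" "A \<noteq> {}" "compact B" "B \<noteq> {}"
  shows "codiff_hi A h \<le> codiff_hi B h + (1 + norm h) * hausdorff_dist A B"
proof (rule codiff_hi_least[OF assms(2)])
  fix a v assume av: "(a, v) \<in> A"
  have "bdd_above ((\<lambda>x. infdist x B) ` A)"
    using assms by (intro bounded_imp_bdd_above compact_imp_bounded compact_continuous_image
      continuous_intros)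
  then have "infdist (a, v) B \<le> (SUP x\<in>A. infdist x B)" using av by (intro cSUP_upper)
  then have 1: "infdist (a, v) B \<le> hausdorff_dist A B" by (simp add: hausdorff_dist_def)
  obtain b w where bw: "(b, w) \<in> B" "infdist (a, v) B = dist (a, v) (b, w)"
    using infdist_attains_inf[of B "(a, v)"] assms compact_imp_closed by (metis prod.exhaust)
  have 2: "\<bar>a - b\<bar> \<le> dist (a, v) (b, w)" "norm (v - w) \<le> dist (a, v) (b, w)"
    using dist_fst_le[of "(a, v)" "(b, w)"] dist_snd_le[of "(a, v)" "(b, w)"] by (auto simp: dist_norm)
  have "a + v \<bullet> h = (b + w \<bullet> h) + (a - b) + (v - w) \<bullet> h" by (simp add: inner_diff_left)
  also have "\<dots> \<le> codiff_hi B h + dist (a, v) (b, w) + dist (a, v) (b, w) * norm h"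
    using codiff_hi_upper[OF assms(3) bw(1), of h] 2 norm_cauchy_schwarz[of "v - w" h]
      mult_right_mono[OF 2(2), of "norm h"] by (intro add_mono) auto
  also have "\<dots> \<le> codiff_hi B h + (1 + norm h) * hausdorff_dist A B"
    using mult_left_mono[OF 1[unfolded bw(2)], of "1 + norm h"] by (simp add: algebra_simps)
  finally show "a + v \<bullet> h \<le> codiff_hi B h + (1 + norm h) * hausdorff_dist A B" .
qed

lemma hausdorff_dist_commute: "hausdorff_dist A B = hausdorff_dist B A"
  by (simp add: hausdorff_dist_def max.commute)

lemma continuous_codiff_hi:
  fixes G :: "'b::euclidean_space \<Rightarrow> (real \<times> 'a::euclidean_space) set"
  assumes G: "\<And>y. compact (G y)" "\<And>y. G y \<noteq> {}" and cont: "\<And>y. hausdorff_continuous_at G y"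
  shows "continuous_on UNIV (\<lambda>y. codiff_hi (G y) h)"
proof (rule continuous_at_imp_continuous_on, intro ballI)
  fix y
  have lim: "((\<lambda>y'. (1 + norm h) * hausdorff_dist (G y') (G y)) \<longlongrightarrow> (1 + norm h) * 0) (at y)"
    using cont[of y] unfolding hausdorff_continuous_at_def by (intro tendsto_intros)
  have "\<bar>codiff_hi (G y') h - codiff_hi (G y) h\<bar> \<le> (1 + norm h) * hausdorff_dist (G y') (G y)" for y'
    using codiff_hi_le_hausdorff[OF G(1,2) G(1,2), of y' h y] codiff_hi_le_hausdorff[OF G(1,2) G(1,2), of y
      h y']
    by (simp add: hausdorff_dist_commute[of "G y"])
  then have "\<forall>\<^sub>F y' in at y. norm (codiff_hi (G y') h - codiff_hi (G y) h)
    \<le> (1 + norm h) * hausdorff_dist (G y') (G y)"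
    by simp
  then have "((\<lambda>y'. codiff_hi (G y') h - codiff_hi (G y) h) \<longlongrightarrow> 0) (at y)"
    using lim[unfolded mult_zero_right] by (rule Lim_null_comparison)
  then show "isCont (\<lambda>y. codiff_hi (G y) h) y" unfolding isCont_def by (simp add: LIM_zero_iff)
qed

text \<open>The maximum exceeds \<open>c\<close> exactly when the set meets an open half-space, and
  measurability of a multifunction is defined by such hitting sets.\<close>

lemma borel_measurable_codiff_hi:
  fixes G :: "real \<Rightarrow> (real \<times> 'a::euclidean_space) set"
  assumes G: "measurable_multifun \<alpha> \<beta> G" and ae: "AE x in lebesgue_on {\<alpha><..<\<beta>}. compact (G x) \<and> G x \<noteq> {}"
  shows "(\<lambda>x. codiff_hi (G x) h) \<in> borel_measurable (lebesgue_on {\<alpha><..<\<beta>})"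
proof -
  interpret complete_measure "lebesgue_on {\<alpha><..<\<beta>}" by (rule complete_measure_lebesgue_on) auto
  show ?thesis
    unfolding borel_measurable_iff_greater
  proof
    fix c :: real
    define V where "V = {z::real \<times> 'a. c < fst z + snd z \<bullet> h}"
    have V: "open V" unfolding V_def by (intro open_Collect_less continuous_intros)
    show "{x \<in> space (lebesgue_on {\<alpha><..<\<beta>}). c < codiff_hi (G x) h} \<in> sets (lebesgue_on {\<alpha><..<\<beta>})"
    proof (rule in_sets_AE)
      show "{x \<in> {\<alpha><..<\<beta>}. G x \<inter> V \<noteq> {}} \<in> sets (lebesgue_on {\<alpha><..<\<beta>})"
        using G V by (simp add: measurable_multifun_def)
      show "AE x in lebesgue_on {\<alpha><..<\<beta>}. (x \<in> {x \<in> {\<alpha><..<\<beta>}. G x \<inter> V \<noteq> {}}) =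
          (x \<in> {x \<in> space (lebesgue_on {\<alpha><..<\<beta>}). c < codiff_hi (G x) h})"
        using ae
      proof eventually_elim
        case (elim x)
        have "c < codiff_hi (G x) h \<longleftrightarrow> G x \<inter> V \<noteq> {}"
        proof
          assume "c < codiff_hi (G x) h"
          then have "\<not> (\<forall>(a, v)\<in>G x. a + v \<bullet> h \<le> c)" using codiff_hi_least[of "G x" h c] elim by fastforce
          then show "G x \<inter> V \<noteq> {}" by (force simp: V_def)
        next
          assume "G x \<inter> V \<noteq> {}"
          then obtain a v where "(a, v) \<in> G x" "c < a + v \<bullet> h" by (auto simp: V_def)
          then show "c < codiff_hi (G x) h" using codiff_hi_upper[of "G x" a v h] elim by linarith
        qed
        then show ?case by simp
      qed
    qed auto
  qed
qed

text \<open>The slice over 0 need not depend Hausdorff continuously on \<open>y\<close>, so it is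
  not accessible to a Caratheodory argument directly. Its support function is, however, a limit of
  difference quotients of \<open>codiff_hi\<close>, and \<open>codiff_hi\<close> of the full set is
  a Caratheodory function. A second composition replaces the constant direction \<open>h\<close> by
  the function \<open>Z\<close>.\<close>

lemma borel_measurable_support_subd:
  fixes G :: "real \<Rightarrow> 'b::euclidean_space \<Rightarrow> (real \<times> 'a::euclidean_space) set"
  assumes G: "caratheodory_multifun \<alpha> \<beta> G"
    and ae: "AE x in lebesgue_on {\<alpha><..<\<beta>}. \<forall>y. compact (G x y) \<and> G x y \<noteq> {} \<and> codiff_hi (G x y) 0 = 0"
    and z: "z \<in> borel_measurable (lebesgue_on {\<alpha><..<\<beta>})"
    and Z: "Z \<in> borel_measurable (lebesgue_on {\<alpha><..<\<beta>})"
  shows "(\<lambda>x. support_fun (subd (G x (z x))) (Z x)) \<in> borel_measurable (lebesgue_on {\<alpha><..<\<beta>})"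
proof -
  interpret complete_measure "lebesgue_on {\<alpha><..<\<beta>}" by (rule complete_measure_lebesgue_on) auto
  have hi: "(\<lambda>x. codiff_hi (G x (z x)) h) \<in> borel_measurable (lebesgue_on {\<alpha><..<\<beta>})" for h
  proof (rule borel_measurable_caratheodory_compose[OF _ _ z, of "\<lambda>x y. codiff_hi (G x y) h"])
    show "(\<lambda>x. codiff_hi (G x y) h) \<in> borel_measurable (lebesgue_on {\<alpha><..<\<beta>})" for y
      using G ae by (intro borel_measurable_codiff_hi) (auto simp: caratheodory_multifun_def elim:
        eventually_mono)
    have "AE x in lebesgue_on {\<alpha><..<\<beta>}. \<forall>y. hausdorff_continuous_at (G x) y"
      using G by (simp add: caratheodory_multifun_def)
    with ae show "AE x in lebesgue_on {\<alpha><..<\<beta>}. continuous_on UNIV (\<lambda>y. codiff_hi (G x y) h)"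
      by eventually_elim (rule continuous_codiff_hi, auto)
  qed
  have supp: "(\<lambda>x. support_fun (subd (G x (z x))) h) \<in> borel_measurable (lebesgue_on {\<alpha><..<\<beta>})" for h
  proof (rule borel_measurable_AE_limit)
    show "(\<lambda>x. codiff_hi (G x (z x)) (inverse (real (Suc n)) *\<^sub>R h) / inverse (real (Suc n)))
      \<in> borel_measurable (lebesgue_on {\<alpha><..<\<beta>})" for n
      using hi by measurable
    have f: "filterlim (\<lambda>n. inverse (real (Suc n))) (at_right 0) sequentially"
      unfolding filterlim_at using LIMSEQ_inverse_real_of_nat by auto
    show "AE x in lebesgue_on {\<alpha><..<\<beta>}. (\<lambda>n. codiff_hi (G x (z x)) (inverse (real (Suc n)) *\<^sub>R h) / inverse
      (real (Suc n)))
        \<longlonglongrightarrow> support_fun (subd (G x (z x))) h"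
      using ae
    proof eventually_elim
      case (elim x)
      then show ?case
        using filterlim_compose[OF codiff_hi_directional[of "G x (z x)" h] f] by simp
    qed
  qed
  show ?thesis
  proof (rule borel_measurable_caratheodory_compose[OF _ _ Z, of "\<lambda>x y. support_fun (subd (G x (z x))) y"])
    show "(\<lambda>x. support_fun (subd (G x (z x))) y) \<in> borel_measurable (lebesgue_on {\<alpha><..<\<beta>})" for y
      by (rule supp)
    show "AE x in lebesgue_on {\<alpha><..<\<beta>}. continuous_on UNIV (support_fun (subd (G x (z x))))"
      using ae
    proof eventually_elim
      case (elim x)
      then have c: "compact (subd (G x (z x)))" "subd (G x (z x)) \<noteq> {}" using compact_subd subd_nonempty
        by auto
      then show ?case by (rule continuous_support_fun)
    qed
  qed
qed

section \<open>Test functions in Sobolev spaces\<close>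

lemma powr_add_le:
  fixes s t r :: real
  assumes "0 \<le> s" "0 \<le> t" "0 \<le> r"
  shows "(s + t) powr r \<le> 2 powr r * (s powr r + t powr r)"
proof -
  have "(s + t) powr r \<le> (2 * max s t) powr r" using assms by (intro powr_mono2) auto
  also have "\<dots> = 2 powr r * (max s t) powr r" using assms by (simp add: powr_mult)
  also have "(max s t) powr r \<le> s powr r + t powr r" by (simp add: max_def)
  finally show ?thesis by simp
qed

lemma finite_measure_interval: "finite_measure (lebesgue_on {\<alpha><..<\<beta>::real})"
  by (rule finite_measure_lebesgue_on) auto

lemma enn2real_ge_1: "1 \<le> p \<Longrightarrow> p \<noteq> \<infinity> \<Longrightarrow> 1 \<le> enn2real p"
  using enn2real_mono[of 1 p] by (simp add: less_top)

text \<open>The relation \<open>1 / p + 1 / q = 1\<close> is stated in \<open>ennreal\<close>; the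
  cases below translate it into real arithmetic. The last one, \<open>(p - 1) * q = p\<close>, is
  what puts the power \<open>p - 1\<close> of a function in \<open>L^p\<close> into
  \<open>L^q\<close>.\<close>

lemma conjugate_exponent:
  fixes p q :: ennreal
  assumes "1 \<le> p" "1 / p + 1 / q = 1"
  shows "1 \<le> q" "p = \<infinity> \<Longrightarrow> q = 1" "p = 1 \<Longrightarrow> q = \<infinity>"
    "p \<noteq> \<infinity> \<Longrightarrow> p \<noteq> 1 \<Longrightarrow> q \<noteq> \<infinity> \<and> (enn2real p - 1) * enn2real q = enn2real p"
proof -
  \<comment> \<open>In \<open>ennreal\<close> the quotient of 1 by 0 is infinite, which excludes
    \<open>q = 0\<close>.\<close>
  have q0: "q \<noteq> 0"
  proof
    assume "q = 0"
    then have "1 / q = \<infinity>" by simp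
    then show False using assms(2) by simp
  qed
  show q1: "1 \<le> q"
  proof (cases q)
    case (real r)
    then have r: "r > 0" using q0 by (cases "r = 0") auto
    have "1 / q \<le> 1" using assms(2) by (metis add.commute le_iff_add)
    then have "ennreal (1 / r) \<le> 1" using real r by (simp add: divide_ennreal flip: ennreal_1)
    then show ?thesis using r real by (simp add: divide_le_eq)
  qed simp
  show "q = 1" if "p = \<infinity>"
  proof (cases q)
    case (real r)
    then have r: "r > 0" using q0 by (cases "r = 0") auto
    have "1 / q = 1" using assms(2) that by simp
    then have "ennreal (1 / r) = 1" using real r by (simp add: divide_ennreal flip: ennreal_1)
    then show ?thesis using r real by simp
  qed (use assms(2) that in simp)
  show "q = \<infinity>" if "p = 1"
  proof (cases q)
    case (real r)
    then have r: "r > 0" using q0 by (cases "r = 0") auto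
    have "1 + ennreal (1 / r) = 1" using assms(2) that real r by (simp add: divide_ennreal flip: ennreal_1)
    then have "ennreal (1 + 1 / r) = ennreal 1" using r by (simp add: ennreal_plus)
    then show ?thesis using r by (subst (asm) ennreal_inj) auto
  qed simp
  show "q \<noteq> \<infinity> \<and> (enn2real p - 1) * enn2real q = enn2real p" if p: "p \<noteq> \<infinity>" "p \<noteq> 1"
  proof -
    obtain s where s: "p = ennreal s" "s \<ge> 1"
      using p(1) assms(1) by (cases p) auto
    have s1: "s \<noteq> 1" using s p(2) by auto
    have ps: "1 / p = ennreal (1 / s)" using s by (simp add: divide_ennreal flip: ennreal_1)
    have "q \<noteq> \<infinity>"
    proof
      assume "q = \<infinity>"
      then have "ennreal (1 / s) = 1" using assms(2) ps by simp
      then show False using s s1 by simp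
    qed
    then obtain r where r: "q = ennreal r" "r > 0" using q0 by (cases q) (auto simp: less_le)
    have "ennreal (1 / s) + ennreal (1 / r) = 1" using assms(2) ps r
      by (simp add: divide_ennreal flip: ennreal_1)
    then have "ennreal (1 / s + 1 / r) = ennreal 1" using r s by (simp add: ennreal_plus)
    then have "1 / s + 1 / r = 1" using r s by (subst (asm) ennreal_inj) auto
    then have "(s - 1) * r = s" using r s by (simp add: field_simps)
    then show ?thesis using r s \<open>q \<noteq> \<infinity>\<close> by simp
  qed
qed

text \<open>Trades the essential supremum, an extended real, for a real bound almost everywhere,
  which combines directly with other almost everywhere statements.\<close>

lemma in_Lp_infinity_iff:
  "in_Lp \<alpha> \<beta> top u \<longleftrightarrow> u \<in> borel_measurable (lebesgue_on {\<alpha><..<\<beta>}) \<and>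
     (\<exists>C. AE x in lebesgue_on {\<alpha><..<\<beta>}. norm (u x) \<le> C)"
proof (cases "u \<in> borel_measurable (lebesgue_on {\<alpha><..<\<beta>})")
  case True
  let ?e = "esssup (lebesgue_on {\<alpha><..<\<beta>}) (\<lambda>x. ereal (norm (u x)))"
  have m: "(\<lambda>x. ereal (norm (u x))) \<in> borel_measurable (lebesgue_on {\<alpha><..<\<beta>})" using True by measurable
  have "\<exists>C. AE x in lebesgue_on {\<alpha><..<\<beta>}. norm (u x) \<le> C" if fin: "?e < \<infinity>"
  proof -
    have ae: "AE x in lebesgue_on {\<alpha><..<\<beta>}. ereal (norm (u x)) \<le> ?e" by (rule esssup_AE)
    obtain C where C: "?e \<le> ereal C" using fin by (cases ?e) auto
    show ?thesis using ae C by (intro exI[of _ C]) (auto elim!: eventually_mono dest: order_trans)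
  qed
  moreover have "?e < \<infinity>" if "AE x in lebesgue_on {\<alpha><..<\<beta>}. norm (u x) \<le> C" for C
  proof -
    have "?e \<le> ereal C" using m that by (intro esssup_I) auto
    then show ?thesis by (rule le_less_trans) simp
  qed
  ultimately show ?thesis using True by (auto simp: in_Lp_def)
qed (simp add: in_Lp_def)

lemma in_Lp_bounded:
  assumes u: "u \<in> borel_measurable (lebesgue_on {\<alpha><..<\<beta>})"
    and b: "AE x in lebesgue_on {\<alpha><..<\<beta>}. norm (u x) \<le> C"
  shows "in_Lp \<alpha> \<beta> p u"
proof (cases "p = \<infinity>")
  case True
  then show ?thesis using assms by (auto simp: in_Lp_infinity_iff)
next
  case False
  interpret finite_measure "lebesgue_on {\<alpha><..<\<beta>}" by (rule finite_measure_interval)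
  have "AE x in lebesgue_on {\<alpha><..<\<beta>}. norm (norm (u x) powr enn2real p) \<le> \<bar>C\<bar> powr enn2real p"
    using b by eventually_elim (auto intro!: powr_mono2)
  then have "integrable (lebesgue_on {\<alpha><..<\<beta>}) (\<lambda>x. norm (u x) powr enn2real p)"
    using u by (intro integrable_const_bound) auto
  then show ?thesis using u False by (simp add: in_Lp_def)
qed

lemma in_Lp_AE_cong:
  fixes u v :: "real \<Rightarrow> 'b::euclidean_space"
  assumes "in_Lp \<alpha> \<beta> p u" and eq: "AE x in lebesgue_on {\<alpha><..<\<beta>}. u x = v x"
  shows "in_Lp \<alpha> \<beta> p v"
proof -
  interpret complete_measure "lebesgue_on {\<alpha><..<\<beta>}" by (rule complete_measure_lebesgue_on) auto
  have u: "u \<in> borel_measurable (lebesgue_on {\<alpha><..<\<beta>})" using assms by (simp add: in_Lp_def)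
  have v: "v \<in> borel_measurable (lebesgue_on {\<alpha><..<\<beta>})" by (rule borel_measurable_AE_eq[OF u eq])
  show ?thesis
  proof (cases "p = \<infinity>")
    case True
    then obtain C where "AE x in lebesgue_on {\<alpha><..<\<beta>}. norm (u x) \<le> C" using assms
      by (auto simp: in_Lp_infinity_iff)
    then have "AE x in lebesgue_on {\<alpha><..<\<beta>}. norm (v x) \<le> C" using eq by eventually_elim simp
    then show ?thesis using True v by (auto simp: in_Lp_infinity_iff)
  next
    case False
    have "integrable (lebesgue_on {\<alpha><..<\<beta>}) (\<lambda>x. norm (u x) powr enn2real p)" using assms False
      by (simp add: in_Lp_def)
    then have "integrable (lebesgue_on {\<alpha><..<\<beta>}) (\<lambda>x. norm (v x) powr enn2real p)"
      by (rule integrable_cong_AE_imp) (use v eq in \<open>auto elim: eventually_mono\<close>)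
    then show ?thesis using v False by (simp add: in_Lp_def)
  qed
qed

lemma in_Lp_add:
  fixes u v :: "real \<Rightarrow> 'b::euclidean_space"
  assumes "in_Lp \<alpha> \<beta> p u" "in_Lp \<alpha> \<beta> p v"
  shows "in_Lp \<alpha> \<beta> p (\<lambda>x. u x + v x)"
proof -
  have m: "u \<in> borel_measurable (lebesgue_on {\<alpha><..<\<beta>})" "v \<in> borel_measurable (lebesgue_on {\<alpha><..<\<beta>})"
    using assms by (auto simp: in_Lp_def)
  show ?thesis
  proof (cases "p = \<infinity>")
    case True
    then obtain C D where "AE x in lebesgue_on {\<alpha><..<\<beta>}. norm (u x) \<le> C"
      "AE x in lebesgue_on {\<alpha><..<\<beta>}. norm (v x) \<le> D"
      using assms by (auto simp: in_Lp_infinity_iff)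
    then have "AE x in lebesgue_on {\<alpha><..<\<beta>}. norm (u x + v x) \<le> C + D"
      by eventually_elim (rule norm_triangle_mono)
    then show ?thesis using True m by (auto simp: in_Lp_infinity_iff)
  next
    case False
    let ?P = "enn2real p"
    have 1: "integrable (lebesgue_on {\<alpha><..<\<beta>}) (\<lambda>x. 2 powr ?P * (norm (u x) powr ?P + norm (v x) powr ?P))"
      using assms False by (auto simp: in_Lp_def)
    have 2: "norm (norm (u x + v x) powr ?P) \<le> norm (2 powr ?P * (norm (u x) powr ?P + norm (v x) powr ?P))"
      for x
    proof -
      have "norm (u x + v x) powr ?P \<le> (norm (u x) + norm (v x)) powr ?P"
        by (intro powr_mono2 norm_triangle_ineq) auto
      also have "\<dots> \<le> 2 powr ?P * (norm (u x) powr ?P + norm (v x) powr ?P)" by (intro powr_add_le) auto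
      finally show ?thesis by simp
    qed
    have 3: "(\<lambda>x. norm (u x + v x) powr ?P) \<in> borel_measurable (lebesgue_on {\<alpha><..<\<beta>})"
      using m by measurable
    have "integrable (lebesgue_on {\<alpha><..<\<beta>}) (\<lambda>x. norm (u x + v x) powr ?P)"
      by (rule Bochner_Integration.integrable_bound[OF 1 3 AE_I2[OF 2]])
    then show ?thesis using m False by (simp add: in_Lp_def)
  qed
qed

lemma in_Lp_dominated:
  fixes v :: "real \<Rightarrow> 'b::euclidean_space" and \<gamma> :: "real \<Rightarrow> real"
  assumes \<gamma>: "in_Lp \<alpha> \<beta> q \<gamma>" and v: "v \<in> borel_measurable (lebesgue_on {\<alpha><..<\<beta>})"
    and le: "AE x in lebesgue_on {\<alpha><..<\<beta>}. norm (v x) \<le> \<bar>\<gamma> x\<bar>"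
  shows "in_Lp \<alpha> \<beta> q v"
proof (cases "q = \<infinity>")
  case True
  then obtain C where "AE x in lebesgue_on {\<alpha><..<\<beta>}. norm (\<gamma> x) \<le> C" using \<gamma>
    by (auto simp: in_Lp_infinity_iff)
  with le have "AE x in lebesgue_on {\<alpha><..<\<beta>}. norm (v x) \<le> C" by eventually_elim simp
  then show ?thesis using v True by (auto simp: in_Lp_infinity_iff)
next
  case False
  have 1: "integrable (lebesgue_on {\<alpha><..<\<beta>}) (\<lambda>x. norm (\<gamma> x) powr enn2real q)" using \<gamma> False
    by (simp add: in_Lp_def)
  have 2: "(\<lambda>x. norm (v x) powr enn2real q) \<in> borel_measurable (lebesgue_on {\<alpha><..<\<beta>})" using v by measurable
  have "AE x in lebesgue_on {\<alpha><..<\<beta>}. norm (norm (v x) powr enn2real q) \<le> norm (norm (\<gamma> x) powr enn2real q)"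
    using le by eventually_elim (auto intro!: powr_mono2)
  from Bochner_Integration.integrable_bound[OF 1 2 this] show ?thesis using v False by (simp add: in_Lp_def)
qed

text \<open>The interval has finite measure, and \<open>t \<le> 1 + t powr p\<close> for
  \<open>t \<ge> 0\<close> and \<open>p \<ge> 1\<close>.\<close>

lemma in_Lp_imp_integrable:
  fixes u :: "real \<Rightarrow> 'b::euclidean_space"
  assumes "in_Lp \<alpha> \<beta> p u" "1 \<le> p"
  shows "integrable (lebesgue_on {\<alpha><..<\<beta>}) u"
proof -
  interpret finite_measure "lebesgue_on {\<alpha><..<\<beta>}" by (rule finite_measure_interval)
  have m: "u \<in> borel_measurable (lebesgue_on {\<alpha><..<\<beta>})" using assms by (simp add: in_Lp_def)
  show ?thesis
  proof (cases "p = \<infinity>")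
    case True
    then show ?thesis using assms m by (auto simp: in_Lp_infinity_iff intro: integrable_const_bound)
  next
    case False
    have P: "1 \<le> enn2real p" using assms False by (intro enn2real_ge_1)
    have 1: "integrable (lebesgue_on {\<alpha><..<\<beta>}) (\<lambda>x. 1 + norm (u x) powr enn2real p)"
      using assms False by (auto simp: in_Lp_def)
    have 2: "norm (u x) \<le> norm (1 + norm (u x) powr enn2real p)" for x
    proof (cases "norm (u x) \<le> 1")
      case True
      then show ?thesis using powr_ge_zero[of "norm (u x)" "enn2real p"] unfolding real_norm_def by linarith
    next
      case False
      then have "norm (u x) powr 1 \<le> norm (u x) powr enn2real p" using P by (intro powr_mono) auto
      then show ?thesis using False by simp
    qed
    show ?thesis by (rule Bochner_Integration.integrable_bound[OF 1 m AE_I2[OF 2]])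
  qed
qed

section \<open>Absolute continuity and Lipschitz test functions\<close>

lemma abs_continuous_on_lipschitz:
  fixes h :: "real \<Rightarrow> 'b::real_normed_vector"
  assumes "K-lipschitz_on UNIV h"
  shows "abs_continuous_on \<alpha> \<beta> h"
  unfolding abs_continuous_on_def
proof (intro allI impI)
  fix \<epsilon> :: real assume \<epsilon>: "\<epsilon> > 0"
  have K: "K \<ge> 0" using assms lipschitz_on_nonneg by blast
  show "\<exists>\<delta>>0. \<forall>(n::nat) a b. (\<forall>i<n. \<alpha> \<le> a i \<and> a i \<le> b i \<and> b i \<le> \<beta>) \<and>
        disjoint_family_on (\<lambda>i. {a i<..<b i}) {..<n} \<and> (\<Sum>i<n. b i - a i) < \<delta> \<longrightarrow>
        (\<Sum>i<n. norm (h (b i) - h (a i))) < \<epsilon>"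
  proof (intro exI[of _ "\<epsilon> / (K + 1)"] conjI allI impI; (elim conjE)?)
    show "\<epsilon> / (K + 1) > 0" using K \<epsilon> by simp
    fix n :: nat and a b assume ab: "\<forall>i<n. \<alpha> \<le> a i \<and> a i \<le> b i \<and> b i \<le> \<beta>" "(\<Sum>i<n. b i - a i) < \<epsilon> / (K + 1)"
    have "(\<Sum>i<n. norm (h (b i) - h (a i))) \<le> (\<Sum>i<n. (K + 1) * (b i - a i))"
    proof (intro sum_mono)
      fix i assume "i \<in> {..<n}"
      then have "a i \<le> b i" using ab by auto
      then show "norm (h (b i) - h (a i)) \<le> (K + 1) * (b i - a i)"
        using lipschitz_onD[OF assms, of "b i" "a i"] by (simp add: dist_norm algebra_simps)
    qed
    also have "\<dots> = (K + 1) * (\<Sum>i<n. b i - a i)" by (simp add: sum_distrib_left)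
    also have "\<dots> < \<epsilon>" using ab(2) K by (simp add: less_divide_eq mult.commute)
    finally show "(\<Sum>i<n. norm (h (b i) - h (a i))) < \<epsilon>" .
  qed
qed

lemma abs_continuous_on_add:
  fixes u v :: "real \<Rightarrow> 'b::real_normed_vector"
  assumes "abs_continuous_on \<alpha> \<beta> u" "abs_continuous_on \<alpha> \<beta> v"
  shows "abs_continuous_on \<alpha> \<beta> (\<lambda>x. u x + v x)"
  unfolding abs_continuous_on_def
proof (intro allI impI)
  fix \<epsilon> :: real assume \<epsilon>: "\<epsilon> > 0"
  let ?P = "\<lambda>u \<delta> \<epsilon>. \<forall>(n::nat) a b. (\<forall>i<n. \<alpha> \<le> a i \<and> a i \<le> b i \<and> b i \<le> \<beta>) \<and>
        disjoint_family_on (\<lambda>i. {a i<..<b i}) {..<n} \<and> (\<Sum>i<n. b i - a i) < \<delta> \<longrightarrow>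
        (\<Sum>i<n. norm (u (b i) - u (a i))) < \<epsilon>"
  obtain d1 where d1: "d1 > 0" "?P u d1 (\<epsilon>/2)" 
    using assms(1)[unfolded abs_continuous_on_def, THEN spec, THEN mp, OF half_gt_zero[OF \<epsilon>]]
      by (elim exE conjE)
  obtain d2 where d2: "d2 > 0" "?P v d2 (\<epsilon>/2)" 
    using assms(2)[unfolded abs_continuous_on_def, THEN spec, THEN mp, OF half_gt_zero[OF \<epsilon>]]
      by (elim exE conjE)
  show "\<exists>\<delta>>0. ?P (\<lambda>x. u x + v x) \<delta> \<epsilon>"
  proof (intro exI[of _ "min d1 d2"] conjI allI impI; (elim conjE)?)
    show "min d1 d2 > 0" using d1 d2 by simp
    fix n :: nat and a b
    assume ab: "\<forall>i<n. \<alpha> \<le> a i \<and> a i \<le> b i \<and> b i \<le> \<beta>" "disjoint_family_on (\<lambda>i. {a i<..<b i}) {..<n}"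
      "(\<Sum>i<n. b i - a i) < min d1 d2"
    have 1: "(\<Sum>i<n. norm (u (b i) - u (a i))) < \<epsilon>/2" using d1(2) ab by simp
    have 2: "(\<Sum>i<n. norm (v (b i) - v (a i))) < \<epsilon>/2" using d2(2) ab by simp
    have "(\<Sum>i<n. norm ((u (b i) + v (b i)) - (u (a i) + v (a i)))) \<le> (\<Sum>i<n. norm (u (b i) - u (a i))
      + norm (v (b i) - v (a i)))"
      by (intro sum_mono) (metis add_diff_add norm_triangle_ineq)
    then show "(\<Sum>i<n. norm ((u (b i) + v (b i)) - (u (a i) + v (a i)))) < \<epsilon>" using 1 2
      by (simp add: sum.distrib)
  qed
qed

text \<open>Bounded Lipschitz test functions \<open>h\<close> together with a bounded representative \<open>k\<close> of their
  derivative; \<^const>\<open>vector_derivative\<close> itself has junk values on a null set.\<close>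

definition test_pair :: "real \<Rightarrow> real \<Rightarrow> (real \<Rightarrow> 'b::euclidean_space) \<Rightarrow> (real \<Rightarrow> 'b) \<Rightarrow> bool" where
  "test_pair \<alpha> \<beta> h k \<longleftrightarrow> (\<exists>K. K-lipschitz_on UNIV h) \<and> (\<exists>K. \<forall>x. norm (h x) \<le> K \<and> norm (k x) \<le> K) \<and>
     k \<in> borel_measurable (lebesgue_on {\<alpha><..<\<beta>}) \<and>
     (AE x in lebesgue_on {\<alpha><..<\<beta>}. (h has_vector_derivative k x) (at x))"

lemma test_pair_add:
  assumes "test_pair \<alpha> \<beta> h k" "test_pair \<alpha> \<beta> h' k'"
  shows "test_pair \<alpha> \<beta> (\<lambda>x. h x + h' x) (\<lambda>x. k x + k' x)"
proof -
  obtain K K' B B' where K: "K-lipschitz_on UNIV h" "K'-lipschitz_on UNIV h'"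
    and B: "\<And>x. norm (h x) \<le> B \<and> norm (k x) \<le> B" "\<And>x. norm (h' x) \<le> B' \<and> norm (k' x) \<le> B'"
    using assms by (auto simp: test_pair_def)
  have "norm (h x + h' x) \<le> B + B' \<and> norm (k x + k' x) \<le> B + B'" for x
    using B norm_triangle_mono by blast
  moreover have "AE x in lebesgue_on {\<alpha><..<\<beta>}. (h has_vector_derivative k x) (at x)"
    "AE x in lebesgue_on {\<alpha><..<\<beta>}. (h' has_vector_derivative k' x) (at x)" using assms
      by (auto simp: test_pair_def)
  then have "AE x in lebesgue_on {\<alpha><..<\<beta>}. ((\<lambda>x. h x + h' x) has_vector_derivative k x + k' x) (at x)"
    by eventually_elim (rule has_vector_derivative_add)
  moreover have "(\<lambda>x. k x + k' x) \<in> borel_measurable (lebesgue_on {\<alpha><..<\<beta>})"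
    using assms by (auto simp: test_pair_def)
  ultimately show ?thesis using lipschitz_on_add[OF K] unfolding test_pair_def by blast
qed

lemma test_pair_scale:
  assumes "test_pair \<alpha> \<beta> h k"
  shows "test_pair \<alpha> \<beta> (\<lambda>x. c *\<^sub>R h x) (\<lambda>x. c *\<^sub>R k x)"
proof -
  obtain K B where K: "K-lipschitz_on UNIV h" and B: "\<And>x. norm (h x) \<le> B \<and> norm (k x) \<le> B"
    using assms by (auto simp: test_pair_def)
  have "norm (c *\<^sub>R h x) \<le> \<bar>c\<bar> * B \<and> norm (c *\<^sub>R k x) \<le> \<bar>c\<bar> * B" for x
    using B by (simp add: mult_left_mono)
  moreover have "AE x in lebesgue_on {\<alpha><..<\<beta>}. (h has_vector_derivative k x) (at x)" using assms
    by (auto simp: test_pair_def)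
  then have "AE x in lebesgue_on {\<alpha><..<\<beta>}. ((\<lambda>x. c *\<^sub>R h x) has_vector_derivative c *\<^sub>R k x) (at x)"
    by eventually_elim (rule bounded_linear.has_vector_derivative[OF bounded_linear_scaleR_right])
  moreover have "\<exists>K. K-lipschitz_on UNIV (\<lambda>x. c *\<^sub>R h x)" using lipschitz_on_cmult[OF K, of c] by blast
  ultimately show ?thesis using assms unfolding test_pair_def by auto
qed

lemma test_pair_const: "test_pair \<alpha> \<beta> (\<lambda>_. e) (\<lambda>_. 0)"
proof -
  have "0-lipschitz_on UNIV (\<lambda>_::real. e)" by (intro lipschitz_onI) auto
  moreover have "\<exists>K. \<forall>x::real. norm e \<le> K \<and> norm (0::'a) \<le> K" by (auto intro: exI[of _ "norm e"])
  ultimately show ?thesis unfolding test_pair_def by auto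
qed

text \<open>Clamping makes the function Lipschitz on the whole line; it is affine or constant away
  from \<open>a\<close> and \<open>b\<close>, so the derivative can fail only at these two points.
  Ramps supply both prescribed end values and the test family for the du Bois-Reymond lemma.\<close>

lemma test_pair_ramp:
  assumes "a \<le> b"
  shows "test_pair \<alpha> \<beta> (\<lambda>x. (max a (min x b) - a) *\<^sub>R e) (\<lambda>x. indicator {a<..<b} x *\<^sub>R e)"
proof -
  let ?h = "\<lambda>x. (max a (min x b) - a) *\<^sub>R e"
  have "norm (?h x - ?h y) \<le> norm e * norm (x - y)" for x y
  proof -
    have "?h x - ?h y = (max a (min x b) - max a (min y b)) *\<^sub>R e" by (simp add: scaleR_diff_left)
    then have "norm (?h x - ?h y) = \<bar>max a (min x b) - max a (min y b)\<bar> * norm e" by simp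
    also have "\<dots> \<le> \<bar>x - y\<bar> * norm e" by (intro mult_right_mono) (auto simp: max_def min_def)
    finally show ?thesis by (simp add: mult.commute)
  qed
  then have 1: "(norm e)-lipschitz_on UNIV ?h" by (intro lipschitz_onI) (auto simp: dist_norm)
  have 2: "norm (?h x) \<le> \<bar>b - a\<bar> * norm e + norm e \<and> norm (indicator {a<..<b} x *\<^sub>R e)
    \<le> \<bar>b - a\<bar> * norm e + norm e" for x
  proof -
    have "\<bar>max a (min x b) - a\<bar> \<le> \<bar>b - a\<bar>" using assms by (auto simp: max_def min_def)
    then have "norm (?h x) \<le> \<bar>b - a\<bar> * norm e" unfolding norm_scaleR by (rule mult_right_mono) simp
    moreover have "indicator {a<..<b} x * norm e \<le> norm e" by (auto simp: indicator_def)
    moreover have "0 \<le> \<bar>b - a\<bar> * norm e" by simp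
    ultimately show ?thesis using norm_ge_zero[of e]
      by (simp only: norm_scaleR real_norm_def abs_indicator) linarith
  qed
  have d: "(?h has_vector_derivative indicator {a<..<b} x *\<^sub>R e) (at x)" if ne: "x \<noteq> a" "x \<noteq> b" for x
  proof -
    consider "x < a" | "a < x" "x < b" | "b < x"
      using ne linorder_less_linear[of x a] linorder_less_linear[of x b] by blast
    then show ?thesis
    proof cases
      case 1
      have "((\<lambda>_. 0) has_vector_derivative 0) (at x)" by simp
      then have "(?h has_vector_derivative 0) (at x)"
        by (rule has_vector_derivative_transform_within_open[of _ _ _ "{..<a}"]) (use 1 in auto)
      then show ?thesis using 1 by simp
    next
      case 2
      have "((\<lambda>x. (x - a) *\<^sub>R e) has_vector_derivative 1 *\<^sub>R e) (at x)" by (auto intro!: derivative_eq_intros)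
      then have "(?h has_vector_derivative 1 *\<^sub>R e) (at x)"
        by (rule has_vector_derivative_transform_within_open[of _ _ _ "{a<..<b}"]) (use 2 in auto)
      then show ?thesis using 2 by simp
    next
      case 3
      have "((\<lambda>_. (b - a) *\<^sub>R e) has_vector_derivative 0) (at x)" by simp
      then have "(?h has_vector_derivative 0) (at x)"
        by (rule has_vector_derivative_transform_within_open[of _ _ _ "{b<..}"]) (use 3 assms in auto)
      then show ?thesis using 3 by simp
    qed
  qed
  have ae: "AE x in lebesgue_on {\<alpha><..<\<beta>}. x \<noteq> a \<and> x \<noteq> b"
  proof -
    have "AE x in lebesgue. x \<noteq> a \<and> x \<noteq> b"
      using AE_not_in[of "{a,b}" lebesgue] negligible_iff_null_sets[of "{a, b}"]
        by (auto simp: negligible_finite)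
    then show ?thesis by (subst AE_restrict_space_iff) (auto elim: eventually_mono)
  qed
  have "AE x in lebesgue_on {\<alpha><..<\<beta>}. (?h has_vector_derivative indicator {a<..<b} x *\<^sub>R e) (at x)"
    using ae by eventually_elim (rule d, auto)
  moreover have "(\<lambda>x. indicator {a<..<b} x *\<^sub>R e) \<in> borel_measurable (lebesgue_on {\<alpha><..<\<beta>})"
    by (intro measurable_restrict_space1 measurable_completion borel_measurable_scaleR
      borel_measurable_indicator) auto
  ultimately show ?thesis unfolding test_pair_def using 1 2 by blast
qed

text \<open>The derivative of the sum is known to be \<open>vderiv u x + k x\<close> only almost
  everywhere, so its integrability is transferred along this equality.\<close>

lemma W1p_add_test_pair:
  fixes u :: "real \<Rightarrow> 'b::euclidean_space"
  assumes u: "u \<in> W1p \<alpha> \<beta> p" and h: "test_pair \<alpha> \<beta> h k"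
  shows "(\<lambda>x. u x + h x) \<in> W1p \<alpha> \<beta> p"
    and "AE x in lebesgue_on {\<alpha><..<\<beta>}. vderiv (\<lambda>x. u x + h x) x = vderiv u x + k x"
proof -
  obtain K B where K: "K-lipschitz_on UNIV h" and B: "\<And>x. norm (h x) \<le> B \<and> norm (k x) \<le> B"
    using h by (auto simp: test_pair_def)
  have km: "k \<in> borel_measurable (lebesgue_on {\<alpha><..<\<beta>})" using h by (simp add: test_pair_def)
  have "h \<in> borel_measurable lborel"
    using borel_measurable_continuous_onI[OF lipschitz_on_continuous_on[OF K]] by simp
  then have hm: "h \<in> borel_measurable (lebesgue_on {\<alpha><..<\<beta>})"
    by (intro measurable_restrict_space1 measurable_completion)
  have ud: "AE x in lebesgue_on {\<alpha><..<\<beta>}. u differentiable (at x)" using u by (simp add: W1p_def)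
  have hd: "AE x in lebesgue_on {\<alpha><..<\<beta>}. (h has_vector_derivative k x) (at x)" using h
    by (simp add: test_pair_def)
  have both: "AE x in lebesgue_on {\<alpha><..<\<beta>}. ((\<lambda>x. u x + h x) has_vector_derivative vderiv u x + k x) (at x)"
    using ud hd by eventually_elim (auto intro: has_vector_derivative_add simp: vector_derivative_works)
  show d: "AE x in lebesgue_on {\<alpha><..<\<beta>}. vderiv (\<lambda>x. u x + h x) x = vderiv u x + k x"
    using both by eventually_elim (rule vector_derivative_at)
  have "AE x in lebesgue_on {\<alpha><..<\<beta>}. (\<lambda>x. u x + h x) differentiable (at x)"
    using both by eventually_elim (rule differentiableI_vector)
  moreover have "abs_continuous_on \<alpha> \<beta> (\<lambda>x. u x + h x)"
    using u abs_continuous_on_lipschitz[OF K] by (auto simp: W1p_def intro: abs_continuous_on_add)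
  moreover have "in_Lp \<alpha> \<beta> p (\<lambda>x. u x + h x)"
    using u B by (intro in_Lp_add in_Lp_bounded[OF hm, of B]) (auto simp: W1p_def)
  moreover have "in_Lp \<alpha> \<beta> p (\<lambda>x. vderiv u x + k x)"
    using u B by (intro in_Lp_add in_Lp_bounded[OF km, of B]) (auto simp: W1p_def)
  then have "in_Lp \<alpha> \<beta> p (vderiv (\<lambda>x. u x + h x))"
    by (rule in_Lp_AE_cong) (use d in \<open>auto elim: eventually_mono\<close>)
  ultimately show "(\<lambda>x. u x + h x) \<in> W1p \<alpha> \<beta> p" by (simp add: W1p_def)
qed

lemma integral_powr_bounded:
  fixes u :: "real \<Rightarrow> 'b::euclidean_space"
  assumes ab: "\<alpha> \<le> \<beta>" and P: "0 \<le> P" and u: "u \<in> borel_measurable (lebesgue_on {\<alpha><..<\<beta>})"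
    and b: "AE x in lebesgue_on {\<alpha><..<\<beta>}. norm (u x) \<le> c"
  shows "(LINT x|lebesgue_on {\<alpha><..<\<beta>}. norm (u x) powr P) \<le> (\<beta> - \<alpha>) * c powr P"
proof -
  interpret finite_measure "lebesgue_on {\<alpha><..<\<beta>}" by (rule finite_measure_interval)
  have *: "AE x in lebesgue_on {\<alpha><..<\<beta>}. norm (u x) powr P \<le> c powr P"
    using b by eventually_elim (auto intro!: powr_mono2 P)
  have "(LINT x|lebesgue_on {\<alpha><..<\<beta>}. norm (u x) powr P) \<le> (LINT x|lebesgue_on {\<alpha><..<\<beta>}. c powr P)"
  proof (rule integral_mono_AE)
    show "integrable (lebesgue_on {\<alpha><..<\<beta>}) (\<lambda>x. norm (u x) powr P)"
      using u * by (intro integrable_const_bound[where B="c powr P"]) auto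
  qed (use * in auto)
  also have "\<dots> = (\<beta> - \<alpha>) * c powr P"
    using ab by (simp add: measure_restrict_space)
  finally show ?thesis .
qed

text \<open>The pointwise bound makes each of the two integrals at most
  \<open>(\<beta> - \<alpha>) * c powr p\<close>, hence the factor with
  \<open>2 * (\<beta> - \<alpha>)\<close>. Small multiples of a test function are therefore close to
  0 in the norm that defines local optimality, whatever \<open>p\<close> is.\<close>

lemma W1p_norm_test_pair:
  fixes h :: "real \<Rightarrow> 'b::euclidean_space"
  assumes ab: "\<alpha> \<le> \<beta>" and p: "1 \<le> p" and h: "test_pair \<alpha> \<beta> h k" and c: "\<And>x. x \<in> {\<alpha><..<\<beta>} \<Longrightarrow> norm (h x) \<le> c"
    "\<And>x. x \<in> {\<alpha><..<\<beta>} \<Longrightarrow> norm (k x) \<le> c" and c0: "0 \<le> c"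
  shows "W1p_norm \<alpha> \<beta> p h \<le> c * (if p = \<infinity> then 1 else (2 * (\<beta> - \<alpha>)) powr (1 / enn2real p))"
proof -
  let ?M = "lebesgue_on {\<alpha><..<\<beta>}"
  interpret complete_measure ?M by (rule complete_measure_lebesgue_on) auto
  obtain K where K: "K-lipschitz_on UNIV h" using h by (auto simp: test_pair_def)
  have km: "k \<in> borel_measurable ?M" using h by (simp add: test_pair_def)
  have "h \<in> borel_measurable lborel"
    using borel_measurable_continuous_onI[OF lipschitz_on_continuous_on[OF K]] by simp
  then have hm: "h \<in> borel_measurable ?M"
    by (intro measurable_restrict_space1 measurable_completion)
  have hd: "AE x in ?M. (h has_vector_derivative k x) (at x)" using h by (simp add: test_pair_def)
  then have eq: "AE x in ?M. k x = vderiv h x" by eventually_elim (simp add: vector_derivative_at)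
  have vm: "vderiv h \<in> borel_measurable ?M" by (rule borel_measurable_AE_eq[OF km eq])
  have bh: "AE x in ?M. norm (h x) \<le> c" using c(1) by (intro AE_I2) auto
  have "AE x in ?M. norm (k x) \<le> c" using c(2) by (intro AE_I2) auto
  then have bv: "AE x in ?M. norm (vderiv h x) \<le> c" using eq by eventually_elim simp
  show ?thesis
  proof (cases "p = \<infinity>")
    case True
    have ess: "Lp_norm \<alpha> \<beta> \<infinity> u \<le> c" if "u \<in> borel_measurable ?M" "AE x in ?M. norm (u x) \<le> c"
      for u :: "real \<Rightarrow> 'b"
    proof -
      have "esssup ?M (\<lambda>x. ereal (norm (u x))) \<le> ereal c" using that by (intro esssup_I) auto
      then show ?thesis unfolding Lp_norm_def using c0
        by (cases "esssup ?M (\<lambda>x. ereal (norm (u x)))") auto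
    qed
    show ?thesis using ess[OF hm bh] ess[OF vm bv] True by (simp add: W1p_norm_def)
  next
    case False
    define P where "P = enn2real p"
    have P: "1 \<le> P" unfolding P_def using p False by (rule enn2real_ge_1)
    have L: "Lp_norm \<alpha> \<beta> p u powr P \<le> (\<beta> - \<alpha>) * c powr P"
      if "u \<in> borel_measurable ?M" "AE x in ?M. norm (u x) \<le> c" for u :: "real \<Rightarrow> 'b"
    proof -
      have "Lp_norm \<alpha> \<beta> p u powr P = (LINT x|?M. norm (u x) powr P)"
        using False P by (simp add: Lp_norm_def P_def[symmetric] powr_powr)
      also have "\<dots> \<le> (\<beta> - \<alpha>) * c powr P" using ab P that by (intro integral_powr_bounded) auto
      finally show ?thesis .
    qed
    have "W1p_norm \<alpha> \<beta> p h = (Lp_norm \<alpha> \<beta> p h powr P + Lp_norm \<alpha> \<beta> p (vderiv h) powr P) powr (1 / P)"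
      using False by (simp add: W1p_norm_def P_def)
    also have "\<dots> \<le> (2 * (\<beta> - \<alpha>) * c powr P) powr (1 / P)"
    proof (intro powr_mono2)
      show "Lp_norm \<alpha> \<beta> p h powr P + Lp_norm \<alpha> \<beta> p (vderiv h) powr P \<le> 2 * (\<beta> - \<alpha>) * c powr P"
        using L[OF hm bh] L[OF vm bv] unfolding mult.assoc by linarith
    qed (use P in auto)
    also have "\<dots> = (2 * (\<beta> - \<alpha>)) powr (1 / P) * (c powr P) powr (1 / P)"
      using ab by (intro powr_mult)
    also have "(c powr P) powr (1 / P) = c" using P c0 by (simp add: powr_powr)
    finally show ?thesis using False by (simp add: P_def mult.commute)
  qed
qed

section \<open>Directional derivative of the integral functional\<close>

text \<open>Adding 1 brings the base to at least 1, so that the exponent may be raised from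
  \<open>r\<close> to \<open>P\<close>; it also covers \<open>r = 0\<close>, where
  \<open>rpow\<close> is 1.\<close>

lemma rpow_le: "0 \<le> s \<Longrightarrow> s \<le> t \<Longrightarrow> 0 \<le> r \<Longrightarrow> r \<le> P \<Longrightarrow> rpow s r \<le> (t + 1) powr P"
proof -
  assume a: "0 \<le> s" "s \<le> t" "0 \<le> r" "r \<le> P"
  have "rpow s r \<le> (t + 1) powr r"
    unfolding rpow_def using a by (auto intro!: powr_mono2)
  also have "\<dots> \<le> (t + 1) powr P" using a by (intro powr_mono) auto
  finally show "rpow s r \<le> (t + 1) powr P" .
qed

lemma integrable_shifted_powr:
  fixes u :: "real \<Rightarrow> 'b::euclidean_space"
  assumes u: "in_Lp \<alpha> \<beta> p u" and p: "p \<noteq> \<infinity>" and c: "0 \<le> c"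
  shows "integrable (lebesgue_on {\<alpha><..<\<beta>}) (\<lambda>x. (norm (u x) + c) powr enn2real p)"
proof -
  interpret finite_measure "lebesgue_on {\<alpha><..<\<beta>}" by (rule finite_measure_interval)
  let ?P = "enn2real p"
  have m: "u \<in> borel_measurable (lebesgue_on {\<alpha><..<\<beta>})" using u by (simp add: in_Lp_def)
  have 1: "integrable (lebesgue_on {\<alpha><..<\<beta>}) (\<lambda>x. 2 powr ?P * (norm (u x) powr ?P + c powr ?P))"
    using u p by (auto simp: in_Lp_def)
  have 2: "norm ((norm (u x) + c) powr ?P) \<le> norm (2 powr ?P * (norm (u x) powr ?P + c powr ?P))" for x
    using powr_add_le[of "norm (u x)" c ?P] c by simp
  have 3: "(\<lambda>x. (norm (u x) + c) powr ?P) \<in> borel_measurable (lebesgue_on {\<alpha><..<\<beta>})"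
    using m by measurable
  show ?thesis by (rule Bochner_Integration.integrable_bound[OF 1 3 AE_I2[OF 2]])
qed

text \<open>The bound concerns the slices over 0, as these determine directional derivatives and
  local Lipschitz constants.\<close>

definition codiff_bounded :: "(real \<times> 'a::euclidean_space) set \<Rightarrow> (real \<times> 'a) set \<Rightarrow> real \<Rightarrow> bool" where
  "codiff_bounded A B c \<longleftrightarrow> (\<forall>v\<in>subd A. norm v \<le> c) \<and> (\<forall>w\<in>subd B. norm w \<le> c)"

text \<open>The mean value inequality works along segments, so bounds are wanted on a whole unit
  ball around \<open>(u x, vderiv u x)\<close>. They make \<open>f x\<close> Lipschitz there with a
  constant that is integrable in \<open>x\<close>.\<close>

lemma growth_near:
  fixes u :: "real \<Rightarrow> real^'m"
  assumes p: "1 \<le> p" "1 / p + 1 / q = 1" and u: "u \<in> W1p \<alpha> \<beta> p"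
    and g: "growth_codifferential \<alpha> \<beta> p q fl fu"
    and ne: "AE x in lebesgue_on {\<alpha><..<\<beta>}. \<forall>z. fl x z \<noteq> {} \<and> fu x z \<noteq> {}"
  obtains L where "integrable (lebesgue_on {\<alpha><..<\<beta>}) L" "\<And>x. 0 \<le> L x"
    "AE x in lebesgue_on {\<alpha><..<\<beta>}. \<forall>z. norm (z - (u x, vderiv u x)) \<le> 1 \<longrightarrow>
      codiff_bounded (fl x z) (fu x z) (L x)"
proof -
  let ?M = "lebesgue_on {\<alpha><..<\<beta>}"
  have uL: "in_Lp \<alpha> \<beta> p u" "in_Lp \<alpha> \<beta> p (vderiv u)" using u by (auto simp: W1p_def)
  have near: "norm a \<le> norm (u x) + 1" "norm b \<le> norm (vderiv u x) + 1"
    if "norm ((a, b) - (u x, vderiv u x)) \<le> 1" for a b x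
    using that norm_fst_le[of "a - u x" "b - vderiv u x"] norm_snd_le[of "b - vderiv u x" "a - u x"]
      norm_triangle_sub[of a "u x"] norm_triangle_sub[of b "vderiv u x"] by auto
  have pair: "norm (v1, v2) \<le> 2 * c" if "norm v1 \<le> c" "norm v2 \<le> c" for v1 v2 :: "real^'m" and c
    using norm_Pair_le[of v1 v2] that by linarith
  show ?thesis
  proof (cases "p = \<infinity>")
    case True
    obtain C1 C2 where C: "AE x in ?M. norm (u x) \<le> C1" "AE x in ?M. norm (vderiv u x) \<le> C2"
      using uL True by (auto simp: in_Lp_infinity_iff)
    \<comment> \<open>The essential bounds of \<open>u\<close> and its derivative plus 1, the radius
      of the ball.\<close>
    define N where "N = max \<bar>C1\<bar> \<bar>C2\<bar> + 1"
    have N: "N > 0" by (simp add: N_def add_nonneg_pos)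
    obtain b where b: "nonneg_L1 \<alpha> \<beta> b" "AE x in ?M. \<forall>u \<xi>. max (norm u) (norm \<xi>) \<le> N \<longrightarrow>
             (\<forall>(a, v1, v2)\<in>fl x (u, \<xi>). \<forall>(b', w1, w2)\<in>fu x (u, \<xi>).
                Max {\<bar>a\<bar>, norm v1, norm v2, \<bar>b'\<bar>, norm w1, norm w2} \<le> b x)"
      using g[unfolded growth_codifferential_def if_P[OF True], THEN spec, THEN mp, OF N]
        by (elim exE conjE)
    show ?thesis
    proof (rule that[of "\<lambda>x. 2 * \<bar>b x\<bar>"])
      show "integrable ?M (\<lambda>x. 2 * \<bar>b x\<bar>)" using b(1) by (auto simp: nonneg_L1_def)
      show "AE x in ?M. \<forall>z. norm (z - (u x, vderiv u x)) \<le> 1 \<longrightarrow> codiff_bounded (fl x z) (fu x z) (2 * \<bar>b x\<bar>)"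
        using C b(2) ne
      proof eventually_elim
        case (elim x)
        show ?case
        proof (intro allI impI)
          fix z assume z: "norm (z - (u x, vderiv u x)) \<le> 1"
          obtain y \<xi> where zy: "z = (y, \<xi>)" by (cases z)
          have "max (norm y) (norm \<xi>) \<le> N" using near[of y \<xi> x] z elim(1,2) by (auto simp: zy N_def)
          note * = elim(3)[THEN spec, THEN spec, THEN mp, OF this]
          have bd: "norm v1 \<le> b x \<and> norm v2 \<le> b x \<and> norm w1 \<le> b x \<and> norm w2 \<le> b x"
            if "(a, v1, v2) \<in> fl x z" "(c, w1, w2) \<in> fu x z" for a v1 v2 c w1 w2
            using bspec[OF bspec[OF * that(1)[unfolded zy], unfolded prod.case] that(2)[unfolded zy],
              unfolded prod.case] by simp
          \<comment> \<open>The growth condition quantifies over both codifferential sets at once,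
            so bounding the elements of one set takes a witness from the other.\<close>
          obtain a v1 v2 c w1 w2 where el: "(a, v1, v2) \<in> fl x z" "(c, w1, w2) \<in> fu x z"
            using elim(4) by (metis all_not_in_conv prod.exhaust)
          show "codiff_bounded (fl x z) (fu x z) (2 * \<bar>b x\<bar>)"
            unfolding codiff_bounded_def subd_def using bd[OF _ el(2)] bd[OF el(1)]
            by (auto intro!: pair order_trans[OF _ abs_ge_self])
        qed
      qed
    qed auto
  next
    case False
    define P where "P = enn2real p"
    have P: "1 \<le> P" unfolding P_def using p(1) False by (rule enn2real_ge_1)
    obtain c \<beta>0 \<gamma> where c: "c > 0" "in_Lp \<alpha> \<beta> q \<gamma>" "AE x in ?M. 0 \<le> \<gamma> x"
      "AE x in ?M. \<forall>u \<xi>. \<forall>(a, v1, v2)\<in>fl x (u, \<xi>). \<forall>(b, w1, w2)\<in>fu x (u, \<xi>).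
               max \<bar>a\<bar> \<bar>b\<bar> \<le> \<beta>0 x + c * (rpow (norm u) P + rpow (norm \<xi>) P) \<and>
               Max {norm v1, norm v2, norm w1, norm w2} \<le> \<gamma> x
                   + c * (rpow (norm u) (P - 1) + rpow (norm \<xi>) (P - 1))"
      unfolding P_def using g[unfolded growth_codifferential_def if_not_P[OF False]] by (elim exE conjE)
    \<comment> \<open>One unit of the 2 is the radius of the ball, the other comes from
      \<open>rpow_le\<close>. Raising the exponent from \<open>P - 1\<close> to \<open>P\<close> is
      harmless, because only integrability of \<open>L0\<close> is at stake.\<close>
    define L0 where "L0 x = \<bar>\<gamma> x\<bar> + c * ((norm (u x) + 2) powr P + (norm (vderiv u x) + 2) powr P)" for x
    have "integrable ?M \<gamma>" using in_Lp_imp_integrable[OF c(2)] conjugate_exponent(1)[OF p] by simp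
    then have L0i: "integrable ?M L0"
      unfolding L0_def P_def using uL False
      by (intro Bochner_Integration.integrable_add integrable_mult_right integrable_shifted_powr
        integrable_abs) auto
    show ?thesis
    proof (rule that[of "\<lambda>x. 2 * L0 x"])
      show "integrable ?M (\<lambda>x. 2 * L0 x)" using L0i by simp
      show "0 \<le> 2 * L0 x" for x using c(1) by (simp add: L0_def)
      show "AE x in ?M. \<forall>z. norm (z - (u x, vderiv u x)) \<le> 1 \<longrightarrow> codiff_bounded (fl x z) (fu x z) (2 * L0 x)"
        using c(4) ne
      proof eventually_elim
        case (elim x)
        show ?case
        proof (intro allI impI)
          fix z assume z: "norm (z - (u x, vderiv u x)) \<le> 1"
          obtain y \<xi> where zy: "z = (y, \<xi>)" by (cases z)
          have "rpow (norm y) (P - 1) \<le> (norm (u x) + 1 + 1) powr P"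
            "rpow (norm \<xi>) (P - 1) \<le> (norm (vderiv u x) + 1 + 1) powr P"
            by (rule rpow_le; use near[of y \<xi> x] z P in \<open>simp add: zy\<close>)+
          then have "c * (rpow (norm y) (P - 1) + rpow (norm \<xi>) (P - 1)) \<le> c * ((norm (u x) + 2) powr P
            + (norm (vderiv u x) + 2) powr P)"
            using c(1) by (intro mult_left_mono add_mono) (auto simp: add.assoc)
          then have le: "\<gamma> x + c * (rpow (norm y) (P - 1) + rpow (norm \<xi>) (P - 1)) \<le> L0 x"
            by (simp add: L0_def)
          have bd: "norm v1 \<le> L0 x \<and> norm v2 \<le> L0 x \<and> norm w1 \<le> L0 x \<and> norm w2 \<le> L0 x"
            if "(a, v1, v2) \<in> fl x z" "(c, w1, w2) \<in> fu x z" for a v1 v2 c w1 w2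
            using bspec[OF bspec[OF elim(1)[THEN spec, THEN spec] that(1)[unfolded zy], unfolded prod.case]
              that(2)[unfolded zy], unfolded prod.case] le by simp
          obtain a v1 v2 c w1 w2 where el: "(a, v1, v2) \<in> fl x z" "(c, w1, w2) \<in> fu x z"
            using elim(2) by (metis all_not_in_conv prod.exhaust)
          show "codiff_bounded (fl x z) (fu x z) (2 * L0 x)"
            unfolding codiff_bounded_def subd_def using bd[OF _ el(2)] bd[OF el(1)]
            by (auto intro!: pair)
        qed
      qed
    qed
  qed
qed

text \<open>Here the exponent \<open>P - 1\<close> has to be kept: by \<open>(P - 1) * q = P\<close>
  it yields a bound in \<open>L^q\<close>. On the graph of \<open>(u, vderiv u)\<close> itself this
  gives the integrability of the derivative of the later function \<zeta>.\<close>

lemma growth_dual_exponent: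
  fixes u :: "real \<Rightarrow> real^'m"
  assumes p: "1 \<le> p" "1 / p + 1 / q = 1" and u: "u \<in> W1p \<alpha> \<beta> p"
    and g: "growth_codifferential \<alpha> \<beta> p q fl fu"
  obtains \<gamma> where "in_Lp \<alpha> \<beta> q \<gamma>"
    "AE x in lebesgue_on {\<alpha><..<\<beta>}. \<forall>(a, v1, v2)\<in>fl x (u x, vderiv u x). \<forall>(b, w1, w2)\<in>fu x (u x, vderiv u x).
        norm v1 \<le> \<gamma> x \<and> norm v2 \<le> \<gamma> x \<and> norm w1 \<le> \<gamma> x \<and> norm w2 \<le> \<gamma> x"
proof -
  let ?M = "lebesgue_on {\<alpha><..<\<beta>}"
  have uL: "in_Lp \<alpha> \<beta> p u" "in_Lp \<alpha> \<beta> p (vderiv u)" using u by (auto simp: W1p_def)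
  then have um: "u \<in> borel_measurable ?M" "vderiv u \<in> borel_measurable ?M" by (auto simp: in_Lp_def)
  show ?thesis
  proof (cases "p = \<infinity>")
    case True
    then have q: "q = 1" using conjugate_exponent[OF p] by simp
    obtain C1 C2 where C: "AE x in ?M. norm (u x) \<le> C1" "AE x in ?M. norm (vderiv u x) \<le> C2"
      using uL True by (auto simp: in_Lp_infinity_iff)
    define N where "N = max \<bar>C1\<bar> \<bar>C2\<bar> + 1"
    have N: "N > 0" by (simp add: N_def add_nonneg_pos)
    obtain b where b: "nonneg_L1 \<alpha> \<beta> b" "AE x in ?M. \<forall>u \<xi>. max (norm u) (norm \<xi>) \<le> N \<longrightarrow>
             (\<forall>(a, v1, v2)\<in>fl x (u, \<xi>). \<forall>(b', w1, w2)\<in>fu x (u, \<xi>).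
                Max {\<bar>a\<bar>, norm v1, norm v2, \<bar>b'\<bar>, norm w1, norm w2} \<le> b x)"
      using g[unfolded growth_codifferential_def if_P[OF True], THEN spec, THEN mp, OF N]
        by (elim exE conjE)
    show ?thesis
    proof (rule that[of b])
      show "in_Lp \<alpha> \<beta> q b" using b(1) q by (auto simp: in_Lp_def nonneg_L1_def)
      show "AE x in ?M. \<forall>(a, v1, v2)\<in>fl x (u x, vderiv u x). \<forall>(b', w1, w2)\<in>fu x (u x, vderiv u x).
        norm v1 \<le> b x \<and> norm v2 \<le> b x \<and> norm w1 \<le> b x \<and> norm w2 \<le> b x"
        using C b(2)
      proof eventually_elim
        case (elim x)
        have "max (norm (u x)) (norm (vderiv u x)) \<le> N" using elim(1,2) by (auto simp: N_def)
        note * = elim(3)[THEN spec, THEN spec, THEN mp, OF this]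
        have "norm v1 \<le> b x \<and> norm v2 \<le> b x \<and> norm w1 \<le> b x \<and> norm w2 \<le> b x"
          if "(a, v1, v2) \<in> fl x (u x, vderiv u x)" "(c, w1, w2) \<in> fu x (u x, vderiv u x)"
            for a v1 v2 c w1 w2
          using bspec[OF bspec[OF * that(1), unfolded prod.case] that(2), unfolded prod.case] by simp
        then show ?case by blast
      qed
    qed
  next
    case False
    define P where "P = enn2real p"
    have P: "1 \<le> P" unfolding P_def using p(1) False by (rule enn2real_ge_1)
    obtain c \<beta>0 \<gamma> where c: "c > 0" "in_Lp \<alpha> \<beta> q \<gamma>" "AE x in ?M. 0 \<le> \<gamma> x"
      "AE x in ?M. \<forall>u \<xi>. \<forall>(a, v1, v2)\<in>fl x (u, \<xi>). \<forall>(b, w1, w2)\<in>fu x (u, \<xi>).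
               max \<bar>a\<bar> \<bar>b\<bar> \<le> \<beta>0 x + c * (rpow (norm u) P + rpow (norm \<xi>) P) \<and>
               Max {norm v1, norm v2, norm w1, norm w2} \<le> \<gamma> x
                   + c * (rpow (norm u) (P - 1) + rpow (norm \<xi>) (P - 1))"
      unfolding P_def using g[unfolded growth_codifferential_def if_not_P[OF False]] by (elim exE conjE)
    have rp: "in_Lp \<alpha> \<beta> q (\<lambda>x. c * rpow (norm (y x)) (P - 1))"
      if y: "in_Lp \<alpha> \<beta> p y" for y :: "real \<Rightarrow> real^'m"
    \<comment> \<open>For \<open>p = 1\<close> the power \<open>rpow t 0\<close> is the constant 1,
      which is bounded; otherwise the conjugacy relation applies.\<close>
    proof (cases "p = 1")
      case True
      then have "P = 1" by (simp add: P_def)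
      then show ?thesis by (intro in_Lp_bounded[of _ _ _ "\<bar>c\<bar>"]) (auto simp: rpow_def)
    next
      case p1: False
      have q: "q \<noteq> \<infinity>" "(P - 1) * enn2real q = P" using conjugate_exponent(4)[OF p False p1]
        by (auto simp: P_def)
      have "P \<noteq> 1"
        using p1 False P_def by (cases p) (auto simp flip: ennreal_1)
      then have rpw: "rpow s (P - 1) = s powr (P - 1)" for s by (simp add: rpow_def)
      have ym: "y \<in> borel_measurable ?M" using y by (simp add: in_Lp_def)
      have "integrable ?M (\<lambda>x. c powr enn2real q * norm (y x) powr P)" using y False
        by (auto simp: in_Lp_def P_def)
      also have "(\<lambda>x. c powr enn2real q * norm (y x) powr P)
        = (\<lambda>x. norm (c * norm (y x) powr (P - 1)) powr enn2real q)"
        using c(1) q(2) by (simp add: powr_mult powr_powr abs_mult)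
      finally show ?thesis unfolding rpw using q(1) ym by (simp add: in_Lp_def)
    qed
    show ?thesis
    proof (rule that[of "\<lambda>x. (\<gamma> x + c * rpow (norm (u x)) (P - 1)) + c * rpow (norm (vderiv u x)) (P - 1)"])
      show "in_Lp \<alpha> \<beta> q (\<lambda>x. (\<gamma> x + c * rpow (norm (u x)) (P - 1)) + c * rpow (norm (vderiv u x)) (P - 1))"
        using uL c(2) by (intro in_Lp_add rp)
      show "AE x in ?M. \<forall>(a, v1, v2)\<in>fl x (u x, vderiv u x). \<forall>(b', w1, w2)\<in>fu x (u x, vderiv u x).
        norm v1 \<le> (\<gamma> x + c * rpow (norm (u x)) (P - 1)) + c * rpow (norm (vderiv u x)) (P - 1) \<and>
        norm v2 \<le> (\<gamma> x + c * rpow (norm (u x)) (P - 1)) + c * rpow (norm (vderiv u x)) (P - 1) \<and>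
        norm w1 \<le> (\<gamma> x + c * rpow (norm (u x)) (P - 1)) + c * rpow (norm (vderiv u x)) (P - 1) \<and>
        norm w2 \<le> (\<gamma> x + c * rpow (norm (u x)) (P - 1)) + c * rpow (norm (vderiv u x)) (P - 1)"
        using c(4)
      proof eventually_elim
        case (elim x)
        have "norm v1 \<le> (\<gamma> x + c * rpow (norm (u x)) (P - 1)) + c * rpow (norm (vderiv u x)) (P - 1) \<and>
          norm v2 \<le> (\<gamma> x + c * rpow (norm (u x)) (P - 1)) + c * rpow (norm (vderiv u x)) (P - 1) \<and>
          norm w1 \<le> (\<gamma> x + c * rpow (norm (u x)) (P - 1)) + c * rpow (norm (vderiv u x)) (P - 1) \<and>
          norm w2 \<le> (\<gamma> x + c * rpow (norm (u x)) (P - 1)) + c * rpow (norm (vderiv u x)) (P - 1)"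
          if "(a, v1, v2) \<in> fl x (u x, vderiv u x)" "(b, w1, w2) \<in> fu x (u x, vderiv u x)"
            for a v1 v2 b w1 w2
          using bspec[OF bspec[OF elim[THEN spec, THEN spec] that(1), unfolded prod.case] that(2), unfolded
            prod.case]
          by (simp add: distrib_left)
        then show ?case by blast
      qed
    qed
  qed
qed

lemma growth_values_integrable:
  fixes u :: "real \<Rightarrow> real^'m"
  assumes p: "1 \<le> p" and u: "u \<in> W1p \<alpha> \<beta> p" and f: "caratheodory \<alpha> \<beta> f" "growth_values \<alpha> \<beta> p f"
  shows "integrable (lebesgue_on {\<alpha><..<\<beta>}) (\<lambda>x. f x (u x, vderiv u x))"
proof -
  let ?M = "lebesgue_on {\<alpha><..<\<beta>}"
  interpret complete_measure ?M by (rule complete_measure_lebesgue_on) auto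
  have uL: "in_Lp \<alpha> \<beta> p u" "in_Lp \<alpha> \<beta> p (vderiv u)" using u by (auto simp: W1p_def)
  then have um: "u \<in> borel_measurable ?M" "vderiv u \<in> borel_measurable ?M" by (auto simp: in_Lp_def)
  have m: "(\<lambda>x. f x (u x, vderiv u x)) \<in> borel_measurable ?M"
    by (rule borel_measurable_caratheodory_compose[of f "\<lambda>x. (u x, vderiv u x)"])
      (use f(1) um in \<open>auto simp: caratheodory_def intro!: borel_measurable_Pair\<close>)
  show ?thesis
  proof (cases "p = \<infinity>")
    case True
    obtain C1 C2 where C: "AE x in ?M. norm (u x) \<le> C1" "AE x in ?M. norm (vderiv u x) \<le> C2"
      using uL True by (auto simp: in_Lp_infinity_iff)
    define N where "N = max \<bar>C1\<bar> \<bar>C2\<bar> + 1"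
    have N: "N > 0" by (simp add: N_def add_nonneg_pos)
    obtain b where b: "nonneg_L1 \<alpha> \<beta> b" "AE x in ?M. \<forall>u \<xi>. max (norm u) (norm \<xi>) \<le> N \<longrightarrow> \<bar>f x (u, \<xi>)\<bar> \<le> b x"
      using f(2)[unfolded growth_values_def if_P[OF True], THEN spec, THEN mp, OF N] by (elim exE conjE)
    have 1: "AE x in ?M. norm (f x (u x, vderiv u x)) \<le> norm (b x)"
      using C b(2)
    proof eventually_elim
      case (elim x)
      have "max (norm (u x)) (norm (vderiv u x)) \<le> N" using elim(1,2) by (auto simp: N_def)
      from elim(3)[THEN spec, THEN spec, THEN mp, OF this] show ?case by simp
    qed
    have "integrable ?M b" using b(1) by (simp add: nonneg_L1_def)
    then show ?thesis using m 1 by (rule Bochner_Integration.integrable_bound)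
  next
    case False
    define P where "P = enn2real p"
    have P: "1 \<le> P" unfolding P_def using p(1) False by (rule enn2real_ge_1)
    obtain b c where b: "nonneg_L1 \<alpha> \<beta> b" "c > 0"
      "AE x in ?M. \<forall>u \<xi>. \<bar>f x (u, \<xi>)\<bar> \<le> b x + c * (rpow (norm u) P + rpow (norm \<xi>) P)"
      unfolding P_def using f(2)[unfolded growth_values_def if_not_P[OF False]] by (elim exE conjE)
    have i: "integrable ?M (\<lambda>x. \<bar>b x\<bar> + c * ((norm (u x) + 1) powr P + (norm (vderiv u x) + 1) powr P))"
      unfolding P_def using uL False b(1)
      by (intro Bochner_Integration.integrable_add integrable_mult_right integrable_shifted_powr
        integrable_abs) (auto simp: nonneg_L1_def)
    have "AE x in ?M. norm (f x (u x, vderiv u x)) \<le> norm (\<bar>b x\<bar> + c * ((norm (u x) + 1) powr P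
      + (norm (vderiv u x) + 1) powr P))"
      using b(3)
    proof eventually_elim
      case (elim x)
      have "c * (rpow (norm (u x)) P + rpow (norm (vderiv u x)) P) \<le> c * ((norm (u x) + 1) powr P
        + (norm (vderiv u x) + 1) powr P)"
        using b(2) P by (intro mult_left_mono add_mono rpow_le) auto
      moreover have "\<bar>f x (u x, vderiv u x)\<bar> \<le> b x + c * (rpow (norm (u x)) P + rpow (norm (vderiv u x)) P)"
        using elim by blast
      ultimately show ?case unfolding real_norm_def by linarith
    qed
    then show ?thesis by (rule Bochner_Integration.integrable_bound[OF i m])
  qed
qed

text \<open>The minimum over the upper slice is at most the value at the single element
  \<open>w\<close>; what remains is sublinear.\<close>

lemma codiff_dir_le:
  assumes c: "is_codifferential F x A B" and w: "w \<in> subd B"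
  shows "codiff_dir A B h \<le> support_fun (subd A + {w}) h"
proof -
  note c = is_codifferential_parts[OF c]
  have "- w \<bullet> h \<le> support_fun (uminus ` subd B) h" using w by (intro support_fun_upper c) auto
  then show ?thesis using support_fun_plus_singleton[OF c(11,12), of w h] by (simp add: codiff_dir_def)
qed

text \<open>The counterpart for \<open>- F\<close>, with an element of the lower slice fixed. Where
  this majorant and the one of \<open>codiff_dir_le\<close> are both nonpositive, the directional
  derivative is 0.\<close>

lemma codiff_dir_ge:
  assumes c: "is_codifferential F x A B" and v: "v \<in> subd A"
  shows "- codiff_dir A B h \<le> support_fun ({- v} + uminus ` subd B) h"
proof -
  note c = is_codifferential_parts[OF c]
  have "v \<bullet> h \<le> support_fun (subd A) h" using v by (intro support_fun_upper c)
  then show ?thesis using support_fun_plus_singleton[OF c(16,17), of "- v" h]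
    by (simp add: codiff_dir_def add.commute)
qed

lemma continuous_codiff_dir:
  assumes "is_codifferential F x A B"
  shows "continuous_on UNIV (codiff_dir A B)"
  unfolding codiff_dir_def using is_codifferential_parts[OF assms]
  by (intro continuous_intros continuous_support_fun)

lemma test_pair_measurable:
  assumes "test_pair \<alpha> \<beta> h k"
  shows "h \<in> borel_measurable (lebesgue_on {\<alpha><..<\<beta>})" "k \<in> borel_measurable (lebesgue_on {\<alpha><..<\<beta>})"
proof -
  obtain K where K: "K-lipschitz_on UNIV h" using assms by (auto simp: test_pair_def)
  have "h \<in> borel_measurable lborel"
    using borel_measurable_continuous_onI[OF lipschitz_on_continuous_on[OF K]] by simp
  then show "h \<in> borel_measurable (lebesgue_on {\<alpha><..<\<beta>})"
    by (intro measurable_restrict_space1 measurable_completion)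
  show "k \<in> borel_measurable (lebesgue_on {\<alpha><..<\<beta>})" using assms by (simp add: test_pair_def)
qed

text \<open>Affine interpolation between the two end values in \<zeta>, constant outside the
  interval and therefore Lipschitz on the whole line.\<close>

definition ramp_fun :: "real \<Rightarrow> real \<Rightarrow> 'b::euclidean_space \<times> 'b \<Rightarrow> real \<Rightarrow> 'b" where
  "ramp_fun \<alpha> \<beta> \<zeta> x = fst \<zeta> + (max \<alpha> (min x \<beta>) - \<alpha>) *\<^sub>R ((snd \<zeta> - fst \<zeta>) /\<^sub>R (\<beta> - \<alpha>))"

definition ramp_deriv :: "real \<Rightarrow> real \<Rightarrow> 'b::euclidean_space \<times> 'b \<Rightarrow> real \<Rightarrow> 'b" where
  "ramp_deriv \<alpha> \<beta> \<zeta> x = indicator {\<alpha><..<\<beta>} x *\<^sub>R ((snd \<zeta> - fst \<zeta>) /\<^sub>R (\<beta> - \<alpha>))"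

lemma test_pair_ramp_fun:
  assumes "\<alpha> < \<beta>"
  shows "test_pair \<alpha> \<beta> (ramp_fun \<alpha> \<beta> \<zeta>) (ramp_deriv \<alpha> \<beta> \<zeta>)"
proof -
  have "test_pair \<alpha> \<beta> (\<lambda>x. fst \<zeta> + (max \<alpha> (min x \<beta>) - \<alpha>) *\<^sub>R e) (\<lambda>x. 0 + indicator {\<alpha><..<\<beta>} x *\<^sub>R e)" for e
    by (rule test_pair_add[OF test_pair_const test_pair_ramp]) (use assms in simp)
  then show ?thesis unfolding ramp_fun_def[abs_def] ramp_deriv_def[abs_def] add_0_left .
qed

lemma ramp_fun_endpoints: "\<alpha> < \<beta> \<Longrightarrow> (ramp_fun \<alpha> \<beta> \<zeta> \<alpha>, ramp_fun \<alpha> \<beta> \<zeta> \<beta>) = \<zeta>"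
  by (cases \<zeta>) (simp add: ramp_fun_def)

text \<open>The 3 bounds the values and \<open>2 / (\<beta> - \<alpha>)\<close> the slope; one
  constant serves both. Ramps with small end values are thus uniformly small together with their
  derivatives.\<close>

lemma ramp_fun_bound:
  fixes \<zeta> :: "'b::euclidean_space \<times> 'b"
  assumes "\<alpha> < \<beta>"
  shows "norm (ramp_fun \<alpha> \<beta> \<zeta> x) \<le> (3 + 2 / (\<beta> - \<alpha>)) * norm \<zeta>"
    and "norm (ramp_deriv \<alpha> \<beta> \<zeta> x) \<le> (3 + 2 / (\<beta> - \<alpha>)) * norm \<zeta>"
proof -
  have n: "norm (fst \<zeta>) \<le> norm \<zeta>" "norm (snd \<zeta>) \<le> norm \<zeta>"
    using norm_fst_le[of "fst \<zeta>" "snd \<zeta>"] norm_snd_le[of "snd \<zeta>" "fst \<zeta>"] by auto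
  then have d: "norm (snd \<zeta> - fst \<zeta>) \<le> 2 * norm \<zeta>" using norm_triangle_ineq4[of "snd \<zeta>" "fst \<zeta>"] by linarith
  define e where "e = (snd \<zeta> - fst \<zeta>) /\<^sub>R (\<beta> - \<alpha>)"
  have e: "norm e = norm (snd \<zeta> - fst \<zeta>) / (\<beta> - \<alpha>)" using assms
    by (simp add: e_def divide_inverse mult.commute)
  have "norm ((max \<alpha> (min x \<beta>) - \<alpha>) *\<^sub>R e) \<le> (\<beta> - \<alpha>) * norm e"
    unfolding norm_scaleR using assms by (intro mult_right_mono) (auto simp: max_def min_def)
  also have "\<dots> = norm (snd \<zeta> - fst \<zeta>)" using assms e by simp
  finally have "norm (ramp_fun \<alpha> \<beta> \<zeta> x) \<le> 3 * norm \<zeta>"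
    unfolding ramp_fun_def e_def[symmetric]
      using norm_triangle_ineq[of "fst \<zeta>" "(max \<alpha> (min x \<beta>) - \<alpha>) *\<^sub>R e"] n d by linarith
  moreover have "0 \<le> 2 / (\<beta> - \<alpha>) * norm \<zeta>" using assms by simp
  ultimately show "norm (ramp_fun \<alpha> \<beta> \<zeta> x) \<le> (3 + 2 / (\<beta> - \<alpha>)) * norm \<zeta>" by (simp add: distrib_right)
  have "norm (ramp_deriv \<alpha> \<beta> \<zeta> x) \<le> norm e" unfolding ramp_deriv_def e_def[symmetric]
    by (simp add: indicator_def)
  also have "\<dots> \<le> 2 / (\<beta> - \<alpha>) * norm \<zeta>" using d assms by (simp add: e divide_right_mono)
  also have "\<dots> \<le> (3 + 2 / (\<beta> - \<alpha>)) * norm \<zeta>" by (simp add: distrib_right)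
  finally show "norm (ramp_deriv \<alpha> \<beta> \<zeta> x) \<le> (3 + 2 / (\<beta> - \<alpha>)) * norm \<zeta>" .
qed

lemma codifferentiability_conditionsD:
  assumes "codifferentiability_conditions \<alpha> \<beta> p q f fl fu"
  shows "caratheodory \<alpha> \<beta> f" "growth_values \<alpha> \<beta> p f"
    "AE x in lebesgue_on {\<alpha><..<\<beta>}. \<forall>z. is_codifferential (f x) z (fl x z) (fu x z)"
    "caratheodory_multifun \<alpha> \<beta> fl" "caratheodory_multifun \<alpha> \<beta> fu" "growth_codifferential \<alpha> \<beta> p q fl fu"
  using assms by (simp_all add: codifferentiability_conditions_def)

text \<open>Dominated convergence for the difference quotients: they converge pointwise by the
  Hadamard form of the derivative and are eventually bounded by \<open>2 * L x * R\<close> through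
  the local Lipschitz constant. The direction may vary with \<open>n\<close>, because the end points
  of a variation have to be corrected for the equality constraints.\<close>

lemma integral_functional_directional:
  fixes u :: "real \<Rightarrow> real^'m"
  assumes p: "1 \<le> p" "1 / p + 1 / q = 1"
    and f: "codifferentiability_conditions \<alpha> \<beta> p q f fl fu"
    and u: "u \<in> W1p \<alpha> \<beta> p"
    and tp: "\<And>n. test_pair \<alpha> \<beta> (h n) (k n)" "test_pair \<alpha> \<beta> h0 k0"
    and conv: "e \<longlonglongrightarrow> 0" "\<And>n x. norm (h n x - h0 x) \<le> e n" "\<And>n x. norm (k n x - k0 x) \<le> e n"
    and t: "t \<longlonglongrightarrow> 0" "\<And>n. t n > 0"
  defines "\<D> \<equiv> \<lambda>x. codiff_dir (fl x (u x, vderiv u x)) (fu x (u x, vderiv u x)) (h0 x, k0 x)"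
  shows "integrable (lebesgue_on {\<alpha><..<\<beta>}) \<D>"
    and "(\<lambda>n. ((LINT x|lebesgue_on {\<alpha><..<\<beta>}. f x (u x + t n *\<^sub>R h n x, vderiv (\<lambda>x. u x + t n *\<^sub>R h n x) x))
          - (LINT x|lebesgue_on {\<alpha><..<\<beta>}. f x (u x, vderiv u x))) / t n) \<longlonglongrightarrow> integral\<^sup>L (lebesgue_on {\<alpha><..<\<beta>})
            \<D>"
proof -
  let ?M = "lebesgue_on {\<alpha><..<\<beta>}"
  interpret complete_measure ?M by (rule complete_measure_lebesgue_on) auto
  note fD = codifferentiability_conditionsD[OF f]
  have ne: "AE x in ?M. \<forall>z. fl x z \<noteq> {} \<and> fu x z \<noteq> {}"
    using fD(3) by eventually_elim (auto simp: is_codifferential_def)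
  obtain L where L: "integrable ?M L" "\<And>x. 0 \<le> L x"
    "AE x in ?M. \<forall>z. norm (z - (u x, vderiv u x)) \<le> 1 \<longrightarrow> codiff_bounded (fl x z) (fu x z) (L x)"
    by (rule growth_near[OF p u fD(6) ne]) (rule that)
  define z where "z x = (u x, vderiv u x)" for x
  define H where "H n x = (h n x, k n x)" for n x
  define H0 where "H0 x = (h0 x, k0 x)" for x
  obtain B where B: "\<And>x. norm (h0 x) \<le> B \<and> norm (k0 x) \<le> B" using tp(2) by (auto simp: test_pair_def)
  obtain E where E: "\<And>n. \<bar>e n\<bar> \<le> E"
    using convergent_imp_Bseq[of e] conv(1) by (auto simp: convergent_def Bseq_def)
  \<comment> \<open>A bound for all pairs \<open>(h n x, k n x)\<close>: both components are within
    \<open>E\<close> of functions bounded by \<open>B\<close>, and the norm of a pair is at most the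
    sum of the norms.\<close>
  define R where "R = 2 * (B + E)"
  have HR: "norm (H n x) \<le> R" for n x
  proof -
    have "norm (h n x) \<le> B + E" using norm_triangle_sub[of "h n x" "h0 x"] conv(2)[of n x] E[of n] B[of x]
      by linarith
    moreover have "norm (k n x) \<le> B + E"
      using norm_triangle_sub[of "k n x" "k0 x"] conv(3)[of n x] E[of n] B[of x] by linarith
    ultimately show ?thesis using norm_Pair_le[of "h n x" "k n x"] by (simp add: H_def R_def)
  qed
  have R0: "0 \<le> R" using HR norm_ge_zero order_trans by blast
  have Hlim: "(\<lambda>n. H n x) \<longlonglongrightarrow> H0 x" for x
  proof -
    have "(\<lambda>n. h n x - h0 x) \<longlonglongrightarrow> 0" "(\<lambda>n. k n x - k0 x) \<longlonglongrightarrow> 0"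
      using conv by (auto intro!: Lim_null_comparison[of _ e])
    then have "(\<lambda>n. h n x) \<longlonglongrightarrow> h0 x" "(\<lambda>n. k n x) \<longlonglongrightarrow> k0 x" by (simp_all add: LIM_zero_iff)
    then show ?thesis unfolding H_def H0_def by (intro tendsto_Pair)
  qed
  define v where "v n x = u x + t n *\<^sub>R h n x" for n x
  have v: "v n \<in> W1p \<alpha> \<beta> p" "AE x in ?M. (v n x, vderiv (v n) x) = z x + t n *\<^sub>R H n x" for n
  proof -
    note * = W1p_add_test_pair[OF u test_pair_scale[OF tp(1), of "t n" n]]
    show "v n \<in> W1p \<alpha> \<beta> p" using *(1) by (simp add: v_def[abs_def])
    have eq: "(\<lambda>x. u x + t n *\<^sub>R h n x) = v n" by (simp add: fun_eq_iff v_def)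
    show "AE x in ?M. (v n x, vderiv (v n) x) = z x + t n *\<^sub>R H n x"
      using *(2) unfolding eq by eventually_elim (simp add: z_def H_def v_def)
  qed
  define Q where "Q n x = (f x (v n x, vderiv (v n) x) - f x (z x)) / t n" for n x
  have fi: "integrable ?M (\<lambda>x. f x (z x))" unfolding z_def
    by (rule growth_values_integrable[OF p(1) u fD(1,2)])
  have fvi: "integrable ?M (\<lambda>x. f x (v n x, vderiv (v n) x))" for n
    by (rule growth_values_integrable[OF p(1) v(1) fD(1,2)])
  have Qi: "integrable ?M (Q n)" for n unfolding Q_def using fi fvi
    by (intro integrable_divide Bochner_Integration.integrable_diff)
  have vall: "AE x in ?M. \<forall>n. (v n x, vderiv (v n) x) = z x + t n *\<^sub>R H n x"
    using v(2) by (simp add: AE_all_countable)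
  have lip: "AE x in ?M. \<forall>y\<in>cball (z x) 1. \<forall>y'\<in>cball (z x) 1. \<bar>f x y - f x y'\<bar> \<le> 2 * L x * norm (y - y')"
    using L(3) fD(3)
  proof eventually_elim
    case (elim x)
    show ?case
    proof (intro ballI)
      fix y y' assume y: "y \<in> cball (z x) 1" "y' \<in> cball (z x) 1"
      then have "closed_segment y' y \<subseteq> cball (z x) 1" by (simp add: closed_segment_subset)
      then have "norm (w - z x) \<le> 1" if "w \<in> closed_segment y' y" for w
        using that by (metis dist_commute dist_norm mem_cball subsetD)
      then have "codiff_bounded (fl x w) (fu x w) (L x)" if "w \<in> closed_segment y' y" for w
        using elim(1) that unfolding z_def by blast
      then show "\<bar>f x y - f x y'\<bar> \<le> 2 * L x * norm (y - y')"
        using elim(2) by (intro codiff_lipschitz[where A="fl x"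
          and B="fu x"]) (auto simp: codiff_bounded_def)
    qed
  qed
  have Qlim: "AE x in ?M. (\<lambda>n. Q n x) \<longlonglongrightarrow> \<D> x"
    using lip vall fD(3)
  proof eventually_elim
    case (elim x)
    have "(\<lambda>n. (f x (z x + t n *\<^sub>R H n x) - f x (z x)) / t n) \<longlonglongrightarrow> \<D> x"
    proof (rule hadamard_directional[where \<rho>=1 and M="2 * L x" and h="H0 x"])
      show "((\<lambda>t. (f x (z x + t *\<^sub>R H0 x) - f x (z x)) / t) \<longlongrightarrow> \<D> x) (at_right 0)"
        unfolding \<D>_def H0_def z_def using elim(3) by (intro codiff_directional) blast
    qed (use elim(1) t Hlim in auto)
    then show ?case using elim(2) by (simp add: Q_def)
  qed
  have \<D>m: "\<D> \<in> borel_measurable ?M"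
    using Qi by (intro borel_measurable_AE_limit[OF _ Qlim]) auto
  have "(\<lambda>n. t n * R) \<longlonglongrightarrow> 0 * R" by (intro tendsto_intros t)
  then have "\<forall>\<^sub>F n in sequentially. t n * R < 1" by (intro order_tendstoD(2)[of _ 0]) auto
  \<comment> \<open>From this index on the increments have norm below 1 at every \<open>x\<close>,
    so the Lipschitz bound on the unit ball applies.\<close>
  then obtain N where N: "\<And>n. n \<ge> N \<Longrightarrow> t n * R < 1" by (auto simp: eventually_sequentially)
  have bound: "AE x in ?M. norm (Q (n + N) x) \<le> 2 * L x * R" for n
    using lip vall
  proof eventually_elim
    case (elim x)
    let ?n = "n + N"
    have "norm (t ?n *\<^sub>R H ?n x) \<le> t ?n * R" using HR[of ?n x] t(2)[of ?n] by (simp add: mult_left_mono)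
    then have in_ball: "z x + t ?n *\<^sub>R H ?n x \<in> cball (z x) 1" using N[of ?n] by (simp add: dist_norm)
    have "\<bar>f x (z x + t ?n *\<^sub>R H ?n x) - f x (z x)\<bar> \<le> 2 * L x * norm (z x + t ?n *\<^sub>R H ?n x - z x)"
      using elim(1) in_ball by (metis centre_in_cball zero_le_one)
    also have "\<dots> \<le> 2 * L x * (t ?n * R)"
      using L(2)[of x] \<open>norm (t ?n *\<^sub>R H ?n x) \<le> t ?n * R\<close> by (intro mult_left_mono) auto
    finally show ?case using elim(2) t(2)[of ?n] by (simp add: Q_def divide_le_eq mult_ac)
  qed
  have lim: "AE x in ?M. (\<lambda>n. Q (n + N) x) \<longlonglongrightarrow> \<D> x"
    using Qlim by eventually_elim (rule LIMSEQ_ignore_initial_segment)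
  have wi: "integrable ?M (\<lambda>x. 2 * L x * R)" using L(1) by simp
  have Qm: "Q (n + N) \<in> borel_measurable ?M" for n using Qi by auto
  show "integrable ?M \<D>" by (rule integrable_dominated_convergence[OF \<D>m Qm wi lim bound])
  have "(\<lambda>n. integral\<^sup>L ?M (Q (n + N))) \<longlonglongrightarrow> integral\<^sup>L ?M \<D>"
    by (rule integral_dominated_convergence[OF \<D>m Qm wi lim bound])
  then have "(\<lambda>n. integral\<^sup>L ?M (Q n)) \<longlonglongrightarrow> integral\<^sup>L ?M \<D>" by (rule LIMSEQ_offset)
  moreover have "integral\<^sup>L ?M (Q n) = ((LINT x|?M. f x (v n x, vderiv (v n) x)) - (LINT x|?M. f x (z x))) /
    t n" for n
    unfolding Q_def using fi fvi by simp
  ultimately show "(\<lambda>n. ((LINT x|?M. f x (u x + t n *\<^sub>R h n x, vderiv (\<lambda>x. u x + t n *\<^sub>R h n x) x))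
          - (LINT x|?M. f x (u x, vderiv u x))) / t n) \<longlonglongrightarrow> integral\<^sup>L ?M \<D>"
    unfolding v_def[abs_def] z_def by simp
qed

section \<open>Primal optimality condition\<close>

lemma finite_common_lipschitz:
  fixes G :: "'i \<Rightarrow> 'a::euclidean_space \<Rightarrow> real"
  assumes "finite T" "\<And>i. i \<in> T \<Longrightarrow> continuously_codifferentiable_at (G i) (DL i) (DU i) P"
  obtains \<rho> M where "\<rho> > 0" "M \<ge> 0"
    "\<And>i y y'. i \<in> T \<Longrightarrow> y \<in> cball P \<rho> \<Longrightarrow> y' \<in> cball P \<rho> \<Longrightarrow> \<bar>G i y - G i y'\<bar> \<le> M * norm (y - y')"
proof -
  have "\<exists>\<rho> M. \<rho> > 0 \<and> M \<ge> 0 \<and> (\<forall>i\<in>T. \<forall>y\<in>cball P \<rho>. \<forall>y'\<in>cball P \<rho>. \<bar>G i y - G i y'\<bar> \<le> M * norm (y - y'))"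
    using assms
  proof (induction T)
    case empty
    show ?case by (intro exI[of _ 1]) auto
  next
    case (insert i T)
    obtain \<rho> M where 1: "\<rho> > 0" "M \<ge> 0" "\<And>i y y'. i \<in> T \<Longrightarrow> y \<in> cball P \<rho> \<Longrightarrow> y' \<in> cball P \<rho> \<Longrightarrow>
      \<bar>G i y - G i y'\<bar> \<le> M * norm (y - y')"
      using insert.IH insert.prems by blast
    obtain \<rho>' M' where 2: "\<rho>' > 0" "\<And>y y'. y \<in> cball P \<rho>' \<Longrightarrow> y' \<in> cball P \<rho>' \<Longrightarrow>
      \<bar>G i y - G i y'\<bar> \<le> M' * norm (y - y')"
      by (rule continuously_codifferentiable_lipschitz[OF insert.prems[OF insertI1]]) blast
    have sub: "cball P (min \<rho> \<rho>') \<subseteq> cball P \<rho>" "cball P (min \<rho> \<rho>') \<subseteq> cball P \<rho>'" by auto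
    have "\<bar>G k y - G k y'\<bar> \<le> max M M' * norm (y - y')"
      if "k \<in> insert i T" "y \<in> cball P (min \<rho> \<rho>')" "y' \<in> cball P (min \<rho> \<rho>')" for k y y'
    proof -
      have "M * norm (y - y') \<le> max M M' * norm (y - y')" "M' * norm (y - y') \<le> max M M' * norm (y - y')"
        by (intro mult_right_mono; simp)+
      moreover have "\<bar>G k y - G k y'\<bar> \<le> M * norm (y - y') \<or> \<bar>G k y - G k y'\<bar> \<le> M' * norm (y - y')"
        using 1(3)[of k y y'] 2(2)[of y y'] that sub by blast
      ultimately show ?thesis by linarith
    qed
    then show ?case using 1 2 by (intro exI[of _ "min \<rho> \<rho>'"] exI[of _ "max M M'"]) auto
  qed
  then show ?thesis using that by blast
qed

text \<open>The end points are corrected from \<open>(h \<alpha>, h \<beta>)\<close> to nearby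
  vectors that satisfy the equality constraints exactly, and the correction is carried into the
  interior by a ramp that tends to 0 uniformly with its derivative. The resulting curves are
  eventually feasible and close to \<open>u\<close>; the cost difference divided by the step has the
  asserted limit bound.\<close>

lemma primal_necessary_condition:
  fixes u :: "real \<Rightarrow> real^'m" and g :: "nat \<Rightarrow> (real^'m) \<times> (real^'m) \<Rightarrow> real"
  assumes ab: "\<alpha> < \<beta>" and p: "1 \<le> p" "1 / p + 1 / q = 1"
    and f: "codifferentiability_conditions \<alpha> \<beta> p q f fl fu"
    and opt: "locally_optimal \<alpha> \<beta> p f I J g u" and P: "P = (u \<alpha>, u \<beta>)"
    and IJ: "finite I" "finite J"
    and g: "\<And>i. i \<in> I \<union> J \<union> {0} \<Longrightarrow> continuously_codifferentiable_at (g i) (gl i) (gu i) P"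
    and s: "\<And>i. i \<in> I \<union> J \<union> {0} \<Longrightarrow> s i \<in> subd (gu i P)"
    and r: "\<And>j. j \<in> J \<Longrightarrow> r j \<in> subd (gl j P)"
    and ep: "\<And>j. j \<in> J \<Longrightarrow> support_fun (subd (gl j P) + {s j}) (ep j) < 0"
    and em: "\<And>j. j \<in> J \<Longrightarrow> support_fun ({- r j} + uminus ` subd (gu j P)) (em j) < 0"
    and cross: "\<And>j k. j \<in> J \<Longrightarrow> k \<in> J \<Longrightarrow> j \<noteq> k \<Longrightarrow>
      support_fun (subd (gl j P) + {s j}) (ep k) \<le> 0 \<and> support_fun (subd (gl j P) + {s j}) (em k) \<le> 0 \<and>
      support_fun ({- r j} + uminus ` subd (gu j P)) (ep k) \<le> 0 \<and> support_fun ({- r j} + uminus ` subd (gu j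
        P)) (em k) \<le> 0"
    and h: "test_pair \<alpha> \<beta> h k"
    and eq: "\<And>j. j \<in> J \<Longrightarrow> support_fun (subd (gl j P) + {s j}) (h \<alpha>, h \<beta>) \<le> 0 \<and>
      support_fun ({- r j} + uminus ` subd (gu j P)) (h \<alpha>, h \<beta>) \<le> 0"
    and ineq: "\<And>i. i \<in> I \<Longrightarrow> g i P = 0 \<Longrightarrow> support_fun (subd (gl i P) + {s i}) (h \<alpha>, h \<beta>) < 0"
  shows "0 \<le> (LINT x|lebesgue_on {\<alpha><..<\<beta>}. codiff_dir (fl x (u x, vderiv u x)) (fu x (u x, vderiv u x)) (h
    x, k x))
     + support_fun (subd (gl 0 P) + {s 0}) (h \<alpha>, h \<beta>)"
proof -
  define \<eta> where "\<eta> = (h \<alpha>, h \<beta>)"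
  have u: "u \<in> W1p \<alpha> \<beta> p" and uc: "\<And>i. i \<in> I \<Longrightarrow> g i P \<le> 0" "\<And>j. j \<in> J \<Longrightarrow> g j P = 0"
    using opt by (auto simp: locally_optimal_def feasible_def P)
  have cod: "is_codifferential (g i) P (gl i P) (gu i P)" if "i \<in> I \<union> J \<union> {0}" for i
    using g[OF that] by (auto simp: continuously_codifferentiable_at_def)
  note cp = is_codifferential_parts[OF cod]
  obtain \<rho> M where lip: "\<rho> > 0" "M \<ge> 0" "\<And>i y y'. i \<in> I \<union> J \<union> {0} \<Longrightarrow> y \<in> cball P \<rho> \<Longrightarrow> y' \<in> cball P \<rho> \<Longrightarrow>
    \<bar>g i y - g i y'\<bar> \<le> M * norm (y - y')"
    using finite_common_lipschitz[of "I \<union> J \<union> {0}" g gl gu P] IJ g by auto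
  have tangent: "\<forall>\<^sub>F t in at_right 0. \<exists>\<xi>\<in>cball \<eta> \<delta>. \<forall>j\<in>J. g j (P + t *\<^sub>R \<xi>) = 0" if "\<delta> > 0" for \<delta>
  proof (rule equality_constraints_tangent[where \<rho>=\<rho> and M=M and d="\<lambda>j. codiff_dir (gl j P) (gu j P)"
        and Cp="\<lambda>j. subd (gl j P) + {s j}" and Cm="\<lambda>j. {- r j} + uminus ` subd (gu j P)" and ep=ep
          and em=em, OF IJ(2)])
    fix j assume j: "j \<in> J"
    then have jj: "j \<in> I \<union> J \<union> {0}" by simp
    show "((\<lambda>t. (g j (P + t *\<^sub>R h) - g j P) / t) \<longlongrightarrow> codiff_dir (gl j P) (gu j P) h) (at_right 0)" for h
      by (rule codiff_directional[OF cod[OF jj]])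
    show "continuous_on UNIV (codiff_dir (gl j P) (gu j P))" by (rule continuous_codiff_dir[OF cod[OF jj]])
    show "compact (subd (gl j P) + {s j}) \<and> subd (gl j P) + {s j} \<noteq> {} \<and>
      compact ({- r j} + uminus ` subd (gu j P)) \<and> {- r j} + uminus ` subd (gu j P) \<noteq> {}"
      using cp[OF jj] compact_plus_singleton[of "uminus ` subd (gu j P)" "- r j"]
      by (auto intro!: compact_plus_singleton simp: add.commute[of "{- r j}"])
    show "codiff_dir (gl j P) (gu j P) h \<le> support_fun (subd (gl j P) + {s j}) h" for h
      by (rule codiff_dir_le[OF cod[OF jj] s[OF jj]])
    show "- codiff_dir (gl j P) (gu j P) h \<le> support_fun ({- r j} + uminus ` subd (gu j P)) h" for h
      by (rule codiff_dir_ge[OF cod[OF jj] r[OF j]])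
  qed (use lip uc ep em cross eq that in \<open>auto simp: \<eta>_def\<close>)
  \<comment> \<open>A diagonal choice: the radius \<open>1 / Suc n\<close> for the correction, then
    a step small enough for this radius.\<close>
  have "\<exists>t \<xi>. 0 < t \<and> t < 1 / Suc n \<and> \<xi> \<in> cball \<eta> (1 / Suc n) \<and> (\<forall>j\<in>J. g j (P + t *\<^sub>R \<xi>) = 0)" for n
  proof -
    obtain b where b: "b > 0" "\<And>t. 0 < t \<Longrightarrow> t < b \<Longrightarrow> \<exists>\<xi>\<in>cball \<eta> (1 / Suc n). \<forall>j\<in>J. g j (P + t *\<^sub>R \<xi>) = 0"
      using tangent[of "1 / Suc n"] unfolding eventually_at_right_field by auto
    obtain t where "0 < t" "t < min b (1 / Suc n)" using dense[of 0 "min b (1 / Suc n)"] b(1) by auto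
    moreover from this obtain \<xi> where "\<xi> \<in> cball \<eta> (1 / Suc n)" "\<forall>j\<in>J. g j (P + t *\<^sub>R \<xi>) = 0"
      using b(2)[of t] by fastforce
    ultimately show ?thesis by (intro exI[of _ t] exI[of _ \<xi>]) simp
  qed
  then obtain t \<xi> where t: "\<And>n. 0 < t n" "\<And>n. t n < 1 / Suc n" and \<xi>: "\<And>n. \<xi> n \<in> cball \<eta> (1 / Suc n)"
    and eqJ: "\<And>n j. j \<in> J \<Longrightarrow> g j (P + t n *\<^sub>R \<xi> n) = 0" by metis
  have inv: "(\<lambda>n. 1 / real (Suc n)) \<longlonglongrightarrow> 0" using LIMSEQ_inverse_real_of_nat by (simp add: inverse_eq_divide)
  have t0: "t \<longlonglongrightarrow> 0"
    by (rule tendsto_sandwich[OF _ _ tendsto_const inv]) (use t in \<open>auto intro!: always_eventually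
      less_imp_le\<close>)
  have \<xi>n: "norm (\<xi> n - \<eta>) \<le> 1 / Suc n" for n using \<xi>[of n] by (simp add: dist_norm norm_minus_commute)
  then have "\<forall>\<^sub>F n in sequentially. norm (\<xi> n - \<eta>) \<le> 1 / Suc n" by simp
  then have "(\<lambda>n. \<xi> n - \<eta>) \<longlonglongrightarrow> 0" using inv by (rule Lim_null_comparison)
  then have \<xi>lim: "\<xi> \<longlonglongrightarrow> \<eta>" by (simp add: LIM_zero_iff)
  have had: "(\<lambda>n. (g i (P + t n *\<^sub>R \<xi> n) - g i P) / t n) \<longlonglongrightarrow> codiff_dir (gl i P) (gu i P) \<eta>"
    if "i \<in> I \<union> J \<union> {0}" for i
    by (rule hadamard_directional[OF lip(3)[OF that] lip(1) codiff_directional[OF cod[OF that]] t0 t(1)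
      \<xi>lim])
  have "\<forall>\<^sub>F n in sequentially. g i (P + t n *\<^sub>R \<xi> n) \<le> 0" if i: "i \<in> I" for i
  \<comment> \<open>An active constraint stays feasible because its majorant is strictly negative in
    the direction \<eta>, an inactive one by continuity.\<close>
  proof (cases "g i P = 0")
    case True
    have ii: "i \<in> I \<union> J \<union> {0}" using i by simp
    have "codiff_dir (gl i P) (gu i P) \<eta> < 0"
      using codiff_dir_le[OF cod[OF ii] s[OF ii], of \<eta>] ineq[OF i True] by (simp add: \<eta>_def)
    from order_tendstoD(2)[OF had[OF ii] this] show ?thesis
    proof eventually_elim
      case (elim n)
      then show ?case using t(1)[of n] True by (simp add: divide_less_0_iff)
    qed
  next
    case False
    then have neg: "g i P < 0" using uc(1)[OF i] by simp
    have "(\<lambda>n. P + t n *\<^sub>R \<xi> n) \<longlonglongrightarrow> P + 0 *\<^sub>R \<eta>" by (intro tendsto_intros t0 \<xi>lim)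
    then have lim: "(\<lambda>n. P + t n *\<^sub>R \<xi> n) \<longlonglongrightarrow> P" by simp
    have "continuous_on (cball P \<rho>) (g i)"
      using lip(3)[of i] lip(2) i by (intro lipschitz_on_continuous_on[of M] lipschitz_onI) (auto simp:
        dist_norm)
    then have "isCont (g i) P" by (rule continuous_on_interior) (use lip(1) in simp)
    then have "(\<lambda>n. g i (P + t n *\<^sub>R \<xi> n)) \<longlonglongrightarrow> g i P" using lim by (rule isCont_tendsto_compose)
    from order_tendstoD(2)[OF this neg] show ?thesis by eventually_elim simp
  qed
  then have evI: "\<forall>\<^sub>F n in sequentially. \<forall>i\<in>I. g i (P + t n *\<^sub>R \<xi> n) \<le> 0"
    using IJ(1) by (simp add: eventually_ball_finite)
  define c where "c = 3 + 2 / (\<beta> - \<alpha>)"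
  have c0: "c \<ge> 0" using ab by (simp add: c_def)
  \<comment> \<open>Adding the ramp with end values \<open>\<xi> n - \<eta>\<close> changes the end
    values of \<open>h\<close> from \<eta> to \<open>\<xi> n\<close>.\<close>
  define hn where "hn n x = h x + ramp_fun \<alpha> \<beta> (\<xi> n - \<eta>) x" for n x
  define kn where "kn n x = k x + ramp_deriv \<alpha> \<beta> (\<xi> n - \<eta>) x" for n x
  have tp: "test_pair \<alpha> \<beta> (hn n) (kn n)" for n
    unfolding hn_def[abs_def] kn_def[abs_def] by (rule test_pair_add[OF h test_pair_ramp_fun[OF ab]])
  have close: "norm (hn n x - h x) \<le> c * (1 / Suc n)" "norm (kn n x - k x) \<le> c * (1 / Suc n)" for n x
    using ramp_fun_bound[OF ab, of "\<xi> n - \<eta>" x] mult_left_mono[OF \<xi>n[of n] c0]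
      by (auto simp: hn_def kn_def c_def)
  have cinv: "(\<lambda>n. c * (1 / Suc n)) \<longlonglongrightarrow> 0" using tendsto_mult_left[OF inv, of c] by simp
  define v where "v n x = u x + t n *\<^sub>R hn n x" for n x
  have vend: "(v n \<alpha>, v n \<beta>) = P + t n *\<^sub>R \<xi> n" for n
  proof -
    have "(hn n \<alpha>, hn n \<beta>) = \<eta> + (ramp_fun \<alpha> \<beta> (\<xi> n - \<eta>) \<alpha>, ramp_fun \<alpha> \<beta> (\<xi> n - \<eta>) \<beta>)"
      by (simp add: hn_def \<eta>_def)
    then have "(hn n \<alpha>, hn n \<beta>) = \<xi> n" using ramp_fun_endpoints[OF ab, of "\<xi> n - \<eta>"] by simp
    then have "t n *\<^sub>R \<xi> n = (t n *\<^sub>R hn n \<alpha>, t n *\<^sub>R hn n \<beta>)" by (metis scaleR_Pair)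
    then show ?thesis by (simp add: v_def P)
  qed
  have vW: "v n \<in> W1p \<alpha> \<beta> p" for n
    using W1p_add_test_pair(1)[OF u test_pair_scale[OF tp]] by (simp add: v_def[abs_def])
  obtain B where B: "\<And>x. norm (h x) \<le> B \<and> norm (k x) \<le> B" using h by (auto simp: test_pair_def)
  have B0: "0 \<le> B" using B norm_ge_zero order_trans by blast
  define D where "D = (if p = \<infinity> then 1 else (2 * (\<beta> - \<alpha>)) powr (1 / enn2real p))"
  have nrm: "W1p_norm \<alpha> \<beta> p (\<lambda>x. v n x - u x) \<le> t n * (B + c) * D" for n
  proof -
    have le1: "c * (1 / Suc n) \<le> c" using c0 by (simp add: divide_le_eq mult_le_cancel_left1)
    have "norm (hn n x) \<le> B + c" "norm (kn n x) \<le> B + c" for x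
      using norm_triangle_sub[of "hn n x" "h x"] norm_triangle_sub[of "kn n x"
        "k x"] close[of n x] B[of x] le1 by linarith+
    then have "norm (t n *\<^sub>R hn n x) \<le> t n * (B + c)" "norm (t n *\<^sub>R kn n x) \<le> t n * (B + c)" for x
      using t(1)[of n] by (simp_all add: mult_left_mono)
    then have "W1p_norm \<alpha> \<beta> p (\<lambda>x. t n *\<^sub>R hn n x) \<le> t n * (B + c) * D"
      unfolding D_def using ab p(1) t(1)[of n] B0 c0
      by (intro W1p_norm_test_pair[OF _ _ test_pair_scale[OF tp]]) auto
    then show ?thesis by (simp add: v_def)
  qed
  obtain \<epsilon> where \<epsilon>: "\<epsilon> > 0" "\<And>w. w \<in> feasible \<alpha> \<beta> p I J g \<Longrightarrow> W1p_norm \<alpha> \<beta> p (\<lambda>x. w x - u x) < \<epsilon> \<Longrightarrow>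
      bolza \<alpha> \<beta> f (g 0) u \<le> bolza \<alpha> \<beta> f (g 0) w" using opt unfolding locally_optimal_def by blast
  have "(\<lambda>n. t n * (B + c) * D) \<longlonglongrightarrow> 0 * (B + c) * D" by (intro tendsto_intros t0)
  then have "\<forall>\<^sub>F n in sequentially. t n * (B + c) * D < \<epsilon>" using \<epsilon>(1)
    by (intro order_tendstoD(2)[of _ 0]) auto
  with evI have ev: "\<forall>\<^sub>F n in sequentially. bolza \<alpha> \<beta> f (g 0) u \<le> bolza \<alpha> \<beta> f (g 0) (v n)"
  proof eventually_elim
    case (elim n)
    have "v n \<in> feasible \<alpha> \<beta> p I J g" using vW elim(1) eqJ vend by (auto simp: feasible_def)
    then show ?case using \<epsilon>(2)[of "v n"] nrm[of n] elim(2) by linarith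
  qed
  let ?M = "lebesgue_on {\<alpha><..<\<beta>}"
  let ?dir = "\<lambda>x. codiff_dir (fl x (u x, vderiv u x)) (fu x (u x, vderiv u x)) (h x, k x)"
  have 1: "(\<lambda>n. ((LINT x|?M. f x (v n x, vderiv (v n) x)) - (LINT x|?M. f x (u x, vderiv u x))) / t n)
    \<longlonglongrightarrow> integral\<^sup>L ?M ?dir"
    using integral_functional_directional(2)[OF p f u tp h cinv close t0 t(1)] unfolding v_def[abs_def] .
  have 2: "(\<lambda>n. (g 0 (P + t n *\<^sub>R \<xi> n) - g 0 P) / t n) \<longlonglongrightarrow> codiff_dir (gl 0 P) (gu 0 P) \<eta>" by (rule had) simp
  have "0 \<le> integral\<^sup>L ?M ?dir + codiff_dir (gl 0 P) (gu 0 P) \<eta>"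
  proof (rule tendsto_lowerbound[OF tendsto_add[OF 1 2]])
    show "\<forall>\<^sub>F n in sequentially. 0 \<le> ((LINT x|?M. f x (v n x, vderiv (v n) x)) - (LINT x|?M. f x (u x, vderiv
      u x))) / t n
       + (g 0 (P + t n *\<^sub>R \<xi> n) - g 0 P) / t n"
      using ev
    proof eventually_elim
      case (elim n)
      then have "0 \<le> ((LINT x|?M. f x (v n x, vderiv (v n) x)) - (LINT x|?M. f x (u x, vderiv u x)))
        + (g 0 (P + t n *\<^sub>R \<xi> n) - g 0 P)"
        by (simp add: bolza_def vend P[symmetric])
      then show ?case using t(1)[of n] unfolding add_divide_distrib[symmetric] by simp
    qed
  qed simp
  also have "codiff_dir (gl 0 P) (gu 0 P) \<eta> \<le> support_fun (subd (gl 0 P) + {s 0}) \<eta>"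
    by (rule codiff_dir_le[OF cod s]) auto
  finally show ?thesis by (simp add: \<eta>_def)
qed

section \<open>Selections from integrals of support functions\<close>

text \<open>On the set where \<open>g x < f x\<close> the integral of the positive function
  \<open>f x - g x\<close> is at most 0, so this set is null.\<close>

lemma AE_le_if_integrals_le:
  fixes f g :: "'a \<Rightarrow> real"
  assumes "integrable M f" "integrable M g"
    and le: "\<And>A. A \<in> sets M \<Longrightarrow> (\<integral>x. indicator A x * f x \<partial>M) \<le> (\<integral>x. indicator A x * g x \<partial>M)"
  shows "AE x in M. f x \<le> g x"
proof -
  define A where "A = {x \<in> space M. g x < f x}"
  have fg: "f \<in> borel_measurable M" "g \<in> borel_measurable M" using assms by auto
  then have A: "A \<in> sets M" unfolding A_def by measurable
  have i: "integrable M (\<lambda>x. indicator A x * f x)" "integrable M (\<lambda>x. indicator A x * g x)"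
    using integrable_mult_indicator[OF A assms(1)] integrable_mult_indicator[OF A assms(2)] by auto
  then have i2: "integrable M (\<lambda>x. indicator A x * (f x - g x))" by (simp add: right_diff_distrib)
  have nn: "AE x in M. 0 \<le> indicator A x * (f x - g x)" by (intro AE_I2) (auto simp: A_def indicator_def)
  have "(\<integral>x. indicator A x * (f x - g x) \<partial>M) \<le> 0" using le[OF A] i by (simp add: right_diff_distrib)
  then have "(\<integral>x. indicator A x * (f x - g x) \<partial>M) = 0" using integral_nonneg_AE[OF nn] by linarith
  then have "AE x in M. indicator A x * (f x - g x) = 0" using integral_nonneg_eq_0_iff_AE[OF i2 nn] by simp
  then show ?thesis
    by (rule AE_mp) (intro AE_I2, auto simp: A_def indicator_def split: if_splits)
qed

lemma integrable_support_integrand: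
  fixes D :: "'b \<Rightarrow> 'a::euclidean_space set"
  assumes L: "integrable M L" "\<And>x. 0 \<le> L x"
    and D: "AE x in M. compact (D x) \<and> D x \<noteq> {} \<and> convex (D x) \<and> (\<forall>v\<in>D x. norm v \<le> L x)"
    and meas: "(\<lambda>x. support_fun (D x) (Z x)) \<in> borel_measurable M"
    and Z: "Z \<in> bounded_measurable M"
  shows "integrable M (\<lambda>x. L x * norm (Z x))" "AE x in M. \<bar>support_fun (D x) (Z x)\<bar> \<le> L x * norm (Z x)"
    "integrable M (\<lambda>x. support_fun (D x) (Z x))"
proof -
  obtain K where K: "\<And>x. norm (Z x) \<le> K" "Z \<in> borel_measurable M" using Z
    by (auto simp: bounded_measurable_def)
  have K0: "0 \<le> K" using K(1) norm_ge_zero order_trans by blast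
  have 1: "integrable M (\<lambda>x. L x * K)" using L(1) by simp
  have 2: "(\<lambda>x. L x * norm (Z x)) \<in> borel_measurable M" using L(1) K(2) by auto
  have 3: "norm (L x * norm (Z x)) \<le> norm (L x * K)" for x
    using mult_left_mono[OF K(1)[of x] L(2)[of x]] L(2)[of x] K0 by (simp add: abs_mult)
  show LZi: "integrable M (\<lambda>x. L x * norm (Z x))"
    by (rule Bochner_Integration.integrable_bound[OF 1 2 AE_I2[OF 3]])
  show sbound: "AE x in M. \<bar>support_fun (D x) (Z x)\<bar> \<le> L x * norm (Z x)"
    using D by eventually_elim (auto intro!: abs_support_fun_le)
  show "integrable M (\<lambda>x. support_fun (D x) (Z x))"
    by (rule Bochner_Integration.integrable_bound[OF LZi meas])
      (use sbound L(2) in \<open>auto simp: abs_mult elim: eventually_mono\<close>)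
qed

text \<open>The multiplier is obtained from a linear minorant of the value function
  \<open>Y \<mapsto> INF (Z, c)\<in>T. \<integral> support_fun (D x) (Y x + Z x) + c\<close>, which is sublinear and nonnegative at \<open>0\<close>.\<close>

theorem measurable_selection_sandwich:
  fixes D :: "'b \<Rightarrow> 'a::euclidean_space set" and T :: "(('b \<Rightarrow> 'a) \<times> real) set"
  assumes M: "sigma_finite_measure M"
    and L: "integrable M L" "\<And>x. 0 \<le> L x"
    and D: "AE x in M. compact (D x) \<and> D x \<noteq> {} \<and> convex (D x) \<and> (\<forall>v\<in>D x. norm v \<le> L x)"
    and meas: "\<And>Z. Z \<in> bounded_measurable M \<Longrightarrow> (\<lambda>x. support_fun (D x) (Z x)) \<in> borel_measurable M"
    and TB: "\<And>Z c. (Z, c) \<in> T \<Longrightarrow> Z \<in> bounded_measurable M"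
    and T0: "((\<lambda>_. 0), 0) \<in> T"
    and Tadd: "\<And>Z c Y d. (Z, c) \<in> T \<Longrightarrow> (Y, d) \<in> T \<Longrightarrow> ((\<lambda>x. Z x + Y x), c + d) \<in> T"
    and Tscale: "\<And>Z c t. (Z, c) \<in> T \<Longrightarrow> t > 0 \<Longrightarrow> ((\<lambda>x. t *\<^sub>R Z x), t * c) \<in> T"
    and nonneg: "\<And>Z c. (Z, c) \<in> T \<Longrightarrow> 0 \<le> (\<integral>x. support_fun (D x) (Z x) \<partial>M) + c"
  obtains v where "integrable M v" "AE x in M. v x \<in> D x" "\<And>Z c. (Z, c) \<in> T \<Longrightarrow> 0 \<le> (\<integral>x. v x \<bullet> Z x \<partial>M) + c"
proof -
  define B where "B = (bounded_measurable M :: ('b \<Rightarrow> 'a) set)"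
  have sub: "fun_subspace B" unfolding B_def by (rule fun_subspace_bounded_measurable)
  note Bz = fun_subspaceD(1)[OF sub] and Badd = fun_subspaceD(2)[OF sub]
    and Bscale = fun_subspaceD(3)[OF sub]
  have Bneg: "(\<lambda>x. - Z x) \<in> B" if "Z \<in> B" for Z using Bscale[OF that, of "-1"] by simp
  have TB': "Z \<in> B" if "(Z, c) \<in> T" for Z c using TB[OF that] by (simp add: B_def)
  define S where "S Z = (\<integral>x. support_fun (D x) (Z x) \<partial>M)" for Z
  have LZi: "integrable M (\<lambda>x. L x * norm (Z x))"
    and sbound: "AE x in M. \<bar>support_fun (D x) (Z x)\<bar> \<le> L x * norm (Z x)"
    and Si: "integrable M (\<lambda>x. support_fun (D x) (Z x))" if "Z \<in> B" for Z
    using integrable_support_integrand[OF L D meas[of Z]] that by (auto simp: B_def)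
  have Sadd: "S (\<lambda>x. Z x + Y x) \<le> S Z + S Y" if ZY: "Z \<in> B" "Y \<in> B" for Z Y
  proof -
    have "S (\<lambda>x. Z x + Y x) \<le> (\<integral>x. support_fun (D x) (Z x) + support_fun (D x) (Y x) \<partial>M)"
      unfolding S_def
    proof (rule integral_mono_AE)
      show "AE x in M. support_fun (D x) (Z x + Y x) \<le> support_fun (D x) (Z x) + support_fun (D x) (Y x)"
        using D by eventually_elim (auto intro: support_fun_add)
    qed (use Si[OF Badd[OF ZY]] Si[OF ZY(1)] Si[OF ZY(2)] in auto)
    then show ?thesis using Si ZY by (simp add: S_def)
  qed
  have Sscale: "S (\<lambda>x. t *\<^sub>R Z x) = t * S Z" if Z: "Z \<in> B" and t: "t \<ge> 0" for Z t
  proof -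
    have "S (\<lambda>x. t *\<^sub>R Z x) = (\<integral>x. t * support_fun (D x) (Z x) \<partial>M)"
      unfolding S_def
    proof (rule integral_cong_AE)
      show "AE x in M. support_fun (D x) (t *\<^sub>R Z x) = t * support_fun (D x) (Z x)"
        using D by eventually_elim (use t in \<open>auto intro: support_fun_scale\<close>)
    qed (use Si[OF Bscale[OF Z]] Si[OF Z] in auto)
    then show ?thesis by (simp add: S_def)
  qed
  have S0: "S (\<lambda>_. 0) = 0" using Sscale[OF Bz, of 0] by simp
  have Sle: "S Z \<le> (\<integral>x. L x * norm (Z x) \<partial>M)" if Z: "Z \<in> B" for Z
    unfolding S_def by (rule integral_mono_AE[OF Si[OF Z] LZi[OF Z]]) (use sbound[OF Z] in \<open>auto elim:
      eventually_mono\<close>)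
  define V where "V Y = (INF (Z, c)\<in>T. S (\<lambda>x. Y x + Z x) + c)" for Y
  \<comment> \<open>The hypothesis \<open>nonneg\<close> enters here: it bounds the value function
    from below, so the infimum is finite.\<close>
  have low: "- S (\<lambda>x. - Y x) \<le> S (\<lambda>x. Y x + Z x) + c" if "Y \<in> B" "(Z, c) \<in> T" for Y Z c
  proof -
    have "S (\<lambda>x. (Y x + Z x) + - Y x) \<le> S (\<lambda>x. Y x + Z x) + S (\<lambda>x. - Y x)"
      by (rule Sadd[OF Badd[OF that(1) TB'[OF that(2)]] Bneg[OF that(1)]])
    then show ?thesis using nonneg[OF that(2)] by (simp add: S_def)
  qed
  have bdd: "bdd_below ((\<lambda>(Z, c). S (\<lambda>x. Y x + Z x) + c) ` T)" if "Y \<in> B" for Y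
    using low[OF that] by (intro bdd_belowI2[where m="- S (\<lambda>x. - Y x)"]) auto
  have Vle: "V Y \<le> S (\<lambda>x. Y x + Z x) + c" if "Y \<in> B" "(Z, c) \<in> T" for Y Z c
    unfolding V_def using cINF_lower[OF bdd[OF that(1)] that(2)] by simp
  have Vge: "m \<le> V Y" if "Y \<in> B" "\<And>Z c. (Z, c) \<in> T \<Longrightarrow> m \<le> S (\<lambda>x. Y x + Z x) + c" for m Y
    unfolding V_def using T0 that by (intro cINF_greatest) auto
  have Vadd: "V (\<lambda>x. Y x + Y' x) \<le> V Y + V Y'" if Y: "Y \<in> B" "Y' \<in> B" for Y Y'
  proof -
    have 1: "V (\<lambda>x. Y x + Y' x) \<le> (S (\<lambda>x. Y x + Z x) + c) + (S (\<lambda>x. Y' x + Z' x) + c')"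
      if "(Z, c) \<in> T" "(Z', c') \<in> T" for Z c Z' c'
    proof -
      have "S (\<lambda>x. (Y x + Z x) + (Y' x + Z' x)) \<le> S (\<lambda>x. Y x + Z x) + S (\<lambda>x. Y' x + Z' x)"
        by (rule Sadd[OF Badd[OF Y(1) TB'[OF that(1)]] Badd[OF Y(2) TB'[OF that(2)]]])
      moreover have "(\<lambda>x. (Y x + Z x) + (Y' x + Z' x)) = (\<lambda>x. (Y x + Y' x) + (Z x + Z' x))"
        by (simp add: fun_eq_iff)
      ultimately show ?thesis using Vle[OF Badd[OF Y] Tadd[OF that]] by simp
    qed
    have "V (\<lambda>x. Y x + Y' x) - (S (\<lambda>x. Y x + Z x) + c) \<le> V Y'" if "(Z, c) \<in> T" for Z c
    proof (rule Vge[OF Y(2)])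
      fix Z' c' assume "(Z', c') \<in> T"
      from 1[OF that this] show "V (\<lambda>x. Y x + Y' x) - (S (\<lambda>x. Y x + Z x) + c) \<le> S (\<lambda>x. Y' x + Z' x) + c'"
        by linarith
    qed
    then have "V (\<lambda>x. Y x + Y' x) - V Y' \<le> V Y" by (intro Vge[OF Y(1)]) (simp add: algebra_simps)
    then show ?thesis by simp
  qed
  have Vscale: "V (\<lambda>x. t *\<^sub>R Y x) = t * V Y" if Y: "Y \<in> B" and t: "t \<ge> 0" for Y t
  proof (cases "t = 0")
    case True
    have "V (\<lambda>_. 0) \<le> 0" using Vle[OF Bz T0] S0 by simp
    moreover have "0 \<le> V (\<lambda>_. 0)" using low[OF Bz] S0 by (intro Vge[OF Bz]) fastforce
    ultimately show ?thesis using True by simp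
  next
    case False
    then have t0: "t > 0" using t by simp
    have le: "V (\<lambda>x. r *\<^sub>R X x) \<le> r * V X" if X: "X \<in> B" and r: "r > 0" for X r
    proof -
      have "V (\<lambda>x. r *\<^sub>R X x) / r \<le> V X"
      proof (rule Vge[OF X])
        fix Z c assume Z: "(Z, c) \<in> T"
        have "S (\<lambda>x. r *\<^sub>R (X x + Z x)) = r * S (\<lambda>x. X x + Z x)"
          using Sscale[OF Badd[OF X TB'[OF Z]]] r by simp
        moreover have "V (\<lambda>x. r *\<^sub>R X x) \<le> S (\<lambda>x. r *\<^sub>R X x + r *\<^sub>R Z x) + r * c"
          by (rule Vle[OF Bscale[OF X] Tscale[OF Z r]])
        ultimately show "V (\<lambda>x. r *\<^sub>R X x) / r \<le> S (\<lambda>x. X x + Z x) + c"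
          using r by (simp add: divide_le_eq scaleR_add_right algebra_simps)
      qed
      then show ?thesis using r by (simp add: divide_le_eq mult.commute)
    qed
    have "V (\<lambda>x. inverse t *\<^sub>R (t *\<^sub>R Y x)) \<le> inverse t * V (\<lambda>x. t *\<^sub>R Y x)"
      using t0 by (intro le Bscale[OF Y]) auto
    then have "t * V Y \<le> V (\<lambda>x. t *\<^sub>R Y x)" using t0 by (simp add: field_simps)
    then show ?thesis using le[OF Y t0] by simp
  qed
  have "fun_sublinear B V" unfolding fun_sublinear_def using Vadd Vscale by blast
  then obtain \<Lambda> where \<Lambda>: "fun_linear B \<Lambda>" "\<And>Y. Y \<in> B \<Longrightarrow> \<Lambda> Y \<le> V Y"
    by (rule fun_hahn_banach[OF sub]) blast
  have \<Lambda>neg: "\<Lambda> (\<lambda>x. - Z x) = - \<Lambda> Z" if "Z \<in> B" for Z using fun_linearD(2)[OF \<Lambda>(1) that, of "-1"] by simp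
  have \<Lambda>S: "\<Lambda> Z \<le> S Z" if "Z \<in> B" for Z using \<Lambda>(2)[OF that] Vle[OF that T0] by simp
  have dom: "\<bar>\<Lambda> Z\<bar> \<le> (\<integral>x. L x * norm (Z x) \<partial>M)" if Z: "Z \<in> bounded_measurable M" for Z
  proof -
    have ZB: "Z \<in> B" using Z by (simp add: B_def)
    show ?thesis
      using \<Lambda>S[OF ZB] \<Lambda>S[OF Bneg[OF ZB]] \<Lambda>neg[OF ZB] Sle[OF ZB] Sle[OF Bneg[OF ZB]]
        by (simp add: abs_le_iff)
  qed
  obtain v where v: "integrable M v" "\<And>Z. Z \<in> bounded_measurable M \<Longrightarrow> \<Lambda> Z = (\<integral>x. v x \<bullet> Z x \<partial>M)"
    by (rule dominated_functional_density[OF M L \<Lambda>(1)[unfolded B_def] dom]) auto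
  show ?thesis
  proof (rule that[OF v(1)])
    show "0 \<le> (\<integral>x. v x \<bullet> Z x \<partial>M) + c" if "(Z, c) \<in> T" for Z c
    proof -
      \<comment> \<open>At the argument \<open>- Z\<close> the pair \<open>(Z, c)\<close> itself
        competes in the infimum, with value \<open>c\<close>, since \<open>S\<close> vanishes at the
        zero function.\<close>
      have "\<Lambda> (\<lambda>x. - Z x) \<le> S (\<lambda>x. - Z x + Z x) + c"
        using \<Lambda>(2)[OF Bneg[OF TB'[OF that]]] Vle[OF Bneg[OF TB'[OF that]] that] by linarith
      then show ?thesis using \<Lambda>neg[OF TB'[OF that]] v(2)[OF TB[OF that]] S0 by simp
    qed
    \<comment> \<open>A countable dense set of directions keeps the exceptional set null; continuity
      of the support function extends the inequality to all directions.\<close>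
    obtain E :: "'a set" where E: "countable E" "\<And>X. open X \<Longrightarrow> X \<noteq> {} \<Longrightarrow> \<exists>d\<in>E. d \<in> X"
      by (erule countable_dense_setE)
    have "AE x in M. v x \<bullet> e \<le> support_fun (D x) e" for e
    proof (rule AE_le_if_integrals_le)
      show "integrable M (\<lambda>x. v x \<bullet> e)" using v(1) by simp
      have ce: "(\<lambda>_. e) \<in> B" by (auto simp: B_def bounded_measurable_def)
      show "integrable M (\<lambda>x. support_fun (D x) e)" using Si[OF ce] .
      fix A assume A: "A \<in> sets M"
      have ind: "(\<lambda>x. indicator A x *\<^sub>R e) \<in> B"
        using A by (auto simp: B_def bounded_measurable_def indicator_def intro!: exI[of _ "norm e"])
      have "(\<integral>x. indicator A x * (v x \<bullet> e) \<partial>M) = \<Lambda> (\<lambda>x. indicator A x *\<^sub>R e)"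
        using v(2)[OF ind[unfolded B_def]] by simp
      also have "\<dots> \<le> S (\<lambda>x. indicator A x *\<^sub>R e)" by (rule \<Lambda>S[OF ind])
      also have "\<dots> = (\<integral>x. indicator A x * support_fun (D x) e \<partial>M)"
        unfolding S_def
      proof (rule integral_cong_AE)
        show "AE x in M. support_fun (D x) (indicator A x *\<^sub>R e) = indicator A x * support_fun (D x) e"
          using D by eventually_elim (auto simp: indicator_def)
      qed (use Si[OF ind] Si[OF ce] A in auto)
      finally show "(\<integral>x. indicator A x * (v x \<bullet> e) \<partial>M) \<le> (\<integral>x. indicator A x * support_fun (D x) e \<partial>M)" .
    qed
    then have "AE x in M. \<forall>e\<in>E. v x \<bullet> e \<le> support_fun (D x) e" using E(1) by (simp add: AE_ball_countable)
    with D show "AE x in M. v x \<in> D x"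
    proof eventually_elim
      case (elim x)
      show ?case
      proof (rule mem_if_le_support_fun)
        fix h
        have cl: "closed {e. v x \<bullet> e \<le> support_fun (D x) e}"
          using elim(1) by (intro closed_Collect_le continuous_intros continuous_support_fun) auto
        show "v x \<bullet> h \<le> support_fun (D x) h"
        proof (rule ccontr)
          assume "\<not> v x \<bullet> h \<le> support_fun (D x) h"
          then have "h \<in> - {e. v x \<bullet> e \<le> support_fun (D x) e}" by simp
          then obtain d where "d \<in> E" "d \<in> - {e. v x \<bullet> e \<le> support_fun (D x) e}"
            using E(2)[of "- {e. v x \<bullet> e \<le> support_fun (D x) e}"] cl by blast
          then show False using elim(2) by blast
        qed
      qed (use elim(1) in auto)
    qed
  qed
qed

section \<open>Indefinite integrals and the du Bois-Reymond lemma\<close>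

lemma abs_continuous_on_imp_continuous_on:
  fixes u :: "real \<Rightarrow> 'b::real_normed_vector"
  assumes "abs_continuous_on \<alpha> \<beta> u"
  shows "continuous_on {\<alpha>..\<beta>} u"
  unfolding continuous_on_iff
proof (intro ballI allI impI)
  fix x \<epsilon> :: real assume x: "x \<in> {\<alpha>..\<beta>}" and \<epsilon>: "\<epsilon> > 0"
  obtain d where d: "d > 0" "\<forall>(n::nat) a b. (\<forall>i<n. \<alpha> \<le> a i \<and> a i \<le> b i \<and> b i \<le> \<beta>) \<and>
        disjoint_family_on (\<lambda>i. {a i<..<b i}) {..<n} \<and> (\<Sum>i<n. b i - a i) < d \<longrightarrow>
        (\<Sum>i<n. norm (u (b i) - u (a i))) < \<epsilon>"
    using assms[unfolded abs_continuous_on_def, THEN spec, THEN mp, OF \<epsilon>] by (elim exE conjE)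
  have "dist (u y) (u x) < \<epsilon>" if y: "y \<in> {\<alpha>..\<beta>}" "dist y x < d" for y
  proof -
    have "norm (u (max x y) - u (min x y)) < \<epsilon>"
      using d(2)[THEN spec, THEN spec, THEN spec, THEN mp, of 1 "\<lambda>_. min x y" "\<lambda>_. max x y"] x y
      by (auto simp: disjoint_family_on_def dist_real_def max_def min_def)
    then show ?thesis by (cases "x \<le> y") (auto simp: dist_norm norm_minus_commute max_def min_def)
  qed
  then show "\<exists>d>0. \<forall>y\<in>{\<alpha>..\<beta>}. dist y x < d \<longrightarrow> dist (u y) (u x) < \<epsilon>" using d(1) by blast
qed

lemma integral_interval_eq:
  fixes f :: "real \<Rightarrow> 'a::euclidean_space"
  shows "integral\<^sup>L (lebesgue_on {\<alpha><..<\<beta>}) f = integral\<^sup>L lebesgue (\<lambda>x. indicator {\<alpha><..<\<beta>} x *\<^sub>R f x)"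
    and "integrable (lebesgue_on {\<alpha><..<\<beta>}) f \<longleftrightarrow> integrable lebesgue (\<lambda>x. indicator {\<alpha><..<\<beta>} x *\<^sub>R f x)"
  by (rule integral_restrict_space, simp) (rule integrable_restrict_space, simp)

lemma AE_interval_iff: "(AE x in lebesgue_on {\<alpha><..<\<beta>::real}. Q x) \<longleftrightarrow> (AE x in lebesgue. x \<in> {\<alpha><..<\<beta>} \<longrightarrow> Q x)"
  by (rule AE_restrict_space_iff) simp

lemma borel_sets_interval: "A \<in> sets borel \<Longrightarrow> A \<inter> {\<alpha><..<\<beta>::real} \<in> sets (lebesgue_on {\<alpha><..<\<beta>})"
  by (auto simp: sets_restrict_space_iff)

text \<open>Formed over the fixed interval with an indicator, it is defined for every real
  \<open>x\<close> and constant to the left of \<alpha> and to the right of \<beta>.\<close>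

definition primitive :: "real \<Rightarrow> real \<Rightarrow> (real \<Rightarrow> 'a::euclidean_space) \<Rightarrow> real \<Rightarrow> 'a" where
  "primitive \<alpha> \<beta> f x = (LINT y|lebesgue_on {\<alpha><..<\<beta>}. indicator {..x} y *\<^sub>R f y)"

lemma integrable_indicator_interval:
  fixes f :: "real \<Rightarrow> 'a::euclidean_space"
  assumes "integrable (lebesgue_on {\<alpha><..<\<beta>}) f" "A \<in> sets borel"
  shows "integrable (lebesgue_on {\<alpha><..<\<beta>}) (\<lambda>y. indicator A y *\<^sub>R f y)"
proof -
  have "integrable (lebesgue_on {\<alpha><..<\<beta>}) (\<lambda>y. indicator (A \<inter> {\<alpha><..<\<beta>}) y *\<^sub>R f y)"
    by (rule integrable_mult_indicator[OF borel_sets_interval[OF assms(2)] assms(1)])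
  then show ?thesis
    by (rule Bochner_Integration.integrable_cong[THEN iffD1, rotated -1]) (auto simp: indicator_def)
qed

lemma primitive_has_vector_derivative:
  fixes f :: "real \<Rightarrow> 'a::euclidean_space"
  assumes "integrable (lebesgue_on {\<alpha><..<\<beta>}) f"
  shows "AE x in lebesgue_on {\<alpha><..<\<beta>}. (primitive \<alpha> \<beta> f has_vector_derivative f x) (at x)"
proof -
  have "integrable lebesgue (\<lambda>x. indicator {\<alpha><..<\<beta>} x *\<^sub>R f x)" using assms integral_interval_eq(2) by blast
  from indefinite_integral_has_vector_derivative_AE[OF this]
  have "AE x in lebesgue. (primitive \<alpha> \<beta> f has_vector_derivative indicator {\<alpha><..<\<beta>} x *\<^sub>R f x) (at x)"
    unfolding primitive_def[abs_def] integral_interval_eq(1) by (simp add: mult.commute)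
  then show ?thesis unfolding AE_interval_iff by eventually_elim auto
qed

lemma primitive_endpoints:
  "primitive \<alpha> \<beta> f \<alpha> = 0" "primitive \<alpha> \<beta> f \<beta> = integral\<^sup>L (lebesgue_on {\<alpha><..<\<beta>}) f"
proof -
  have "primitive \<alpha> \<beta> f \<alpha> = (LINT y|lebesgue_on {\<alpha><..<\<beta>}. 0)"
    unfolding primitive_def by (intro Bochner_Integration.integral_cong) (auto simp: indicator_def)
  then show "primitive \<alpha> \<beta> f \<alpha> = 0" by simp
  show "primitive \<alpha> \<beta> f \<beta> = integral\<^sup>L (lebesgue_on {\<alpha><..<\<beta>}) f"
    unfolding primitive_def by (intro Bochner_Integration.integral_cong) (auto simp: indicator_def)
qed

lemma primitive_bound:
  fixes f :: "real \<Rightarrow> 'a::euclidean_space"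
  assumes f: "integrable (lebesgue_on {\<alpha><..<\<beta>}) f" and ab: "a \<le> b"
  shows "norm (primitive \<alpha> \<beta> f b - primitive \<alpha> \<beta> f a)
    \<le> (LINT y|lebesgue_on {\<alpha><..<\<beta>}. indicator {a<..b} y * norm (f y))"
proof -
  have "primitive \<alpha> \<beta> f b - primitive \<alpha> \<beta> f a
    = (LINT y|lebesgue_on {\<alpha><..<\<beta>}. indicator {..b} y *\<^sub>R f y - indicator {..a} y *\<^sub>R f y)"
    unfolding primitive_def using f by (intro Bochner_Integration.integral_diff[symmetric]
      integrable_indicator_interval) auto
  also have "\<dots> = (LINT y|lebesgue_on {\<alpha><..<\<beta>}. indicator {a<..b} y *\<^sub>R f y)"
    using ab by (intro Bochner_Integration.integral_cong) (auto simp: indicator_def)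
  also have "norm \<dots> \<le> (LINT y|lebesgue_on {\<alpha><..<\<beta>}. norm (indicator {a<..b} y *\<^sub>R f y))"
    by (rule integral_norm_bound)
  finally show ?thesis by simp
qed

lemma primitive_bounded:
  fixes f :: "real \<Rightarrow> 'a::euclidean_space"
  assumes "integrable (lebesgue_on {\<alpha><..<\<beta>}) f"
  shows "norm (primitive \<alpha> \<beta> f x) \<le> (LINT y|lebesgue_on {\<alpha><..<\<beta>}. norm (f y))"
proof -
  have "norm (primitive \<alpha> \<beta> f x) \<le> (LINT y|lebesgue_on {\<alpha><..<\<beta>}. norm (indicator {..x} y *\<^sub>R f y))"
    unfolding primitive_def by (rule integral_norm_bound)
  also have "\<dots> \<le> (LINT y|lebesgue_on {\<alpha><..<\<beta>}. norm (f y))"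
  proof (rule integral_mono)
    show "integrable (lebesgue_on {\<alpha><..<\<beta>}) (\<lambda>y. norm (indicator {..x} y *\<^sub>R f y))"
      by (intro integrable_norm integrable_indicator_interval[OF assms]) simp
    show "integrable (lebesgue_on {\<alpha><..<\<beta>}) (\<lambda>y. norm (f y))" by (intro integrable_norm assms)
  qed (auto simp: indicator_def)
  finally show ?thesis .
qed

text \<open>The increments are bounded by integrals of \<open>norm (f y)\<close> over disjoint
  intervals whose union has small measure, so the absolute continuity of the integral
  applies.\<close>

lemma primitive_abs_continuous:
  fixes f :: "real \<Rightarrow> 'a::euclidean_space"
  assumes f: "integrable (lebesgue_on {\<alpha><..<\<beta>}) f"
  shows "abs_continuous_on \<alpha> \<beta> (primitive \<alpha> \<beta> f)"
  unfolding abs_continuous_on_def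
proof (intro allI impI)
  let ?M = "lebesgue_on {\<alpha><..<\<beta>}"
  fix \<epsilon> :: real assume \<epsilon>: "\<epsilon> > 0"
  obtain d where d: "d > 0" "\<And>A. A \<in> sets ?M \<Longrightarrow> emeasure ?M A < ennreal d \<Longrightarrow>
    (LINT y|?M. indicator A y * norm (f y)) < \<epsilon>"
    by (rule integral_absolutely_continuous[OF integrable_norm[OF f] norm_ge_zero \<epsilon>]) (rule that)
  show "\<exists>\<delta>>0. \<forall>(n::nat) a b. (\<forall>i<n. \<alpha> \<le> a i \<and> a i \<le> b i \<and> b i \<le> \<beta>) \<and>
        disjoint_family_on (\<lambda>i. {a i<..<b i}) {..<n} \<and> (\<Sum>i<n. b i - a i) < \<delta> \<longrightarrow>
        (\<Sum>i<n. norm (primitive \<alpha> \<beta> f (b i) - primitive \<alpha> \<beta> f (a i))) < \<epsilon>"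
  proof (intro exI[of _ d] conjI allI impI; (elim conjE)?)
    show "d > 0" by (rule d)
    fix n :: nat and a b :: "nat \<Rightarrow> real"
    assume ab: "\<forall>i<n. \<alpha> \<le> a i \<and> a i \<le> b i \<and> b i \<le> \<beta>"
      and disj: "disjoint_family_on (\<lambda>i. {a i<..<b i}) {..<n}"
      and sum: "(\<Sum>i<n. b i - a i) < d"
    let ?A = "\<Union>i<n. {a i<..<b i}"
    have sub: "?A \<subseteq> {\<alpha><..<\<beta>}" using ab by force
    have As: "?A \<in> sets ?M" using sub by (auto simp: sets_restrict_space_iff)
    have "emeasure ?M ?A = emeasure lebesgue ?A" using sub by (intro emeasure_restrict_space) auto
    also have "\<dots> \<le> (\<Sum>i<n. emeasure lebesgue {a i<..<b i})" by (intro emeasure_subadditive_finite) auto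
    also have "\<dots> = (\<Sum>i<n. ennreal (b i - a i))" using ab by (intro sum.cong) auto
    also have "\<dots> = ennreal (\<Sum>i<n. b i - a i)" using ab by (intro sum_ennreal) auto
    also have "\<dots> < ennreal d" using sum d(1) by (intro ennreal_lessI) auto
    finally have small: "emeasure ?M ?A < ennreal d" .
    have "(\<Sum>i<n. norm (primitive \<alpha> \<beta> f (b i) - primitive \<alpha> \<beta> f (a i)))
      \<le> (\<Sum>i<n. LINT y|?M. indicator {a i<..<b i} y * norm (f y))"
    proof (rule sum_mono)
      fix i assume i: "i \<in> {..<n}"
      have "norm (primitive \<alpha> \<beta> f (b i) - primitive \<alpha> \<beta> f (a i))
        \<le> (LINT y|?M. indicator {a i<..b i} y * norm (f y))"
        using f ab i by (intro primitive_bound) auto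
      \<comment> \<open>The definition makes only the open intervals disjoint; the right end point
        is a null set and may be dropped.\<close>
      also have "\<dots> = (LINT y|?M. indicator {a i<..<b i} y * norm (f y))"
      proof (rule integral_cong_AE)
        have "AE y in lebesgue. y \<noteq> b i" using AE_not_in[of "{b i}" lebesgue] by simp
        then have "AE y in ?M. y \<noteq> b i" unfolding AE_interval_iff by eventually_elim simp
        then show "AE y in ?M. indicator {a i<..b i} y * norm (f y) = indicator {a i<..<b i} y * norm (f y)"
          by eventually_elim (auto simp: indicator_def)
        show "(\<lambda>y. indicator {a i<..b i} y * norm (f y)) \<in> borel_measurable ?M"
          "(\<lambda>y. indicator {a i<..<b i} y * norm (f y)) \<in> borel_measurable ?M"
          using integrable_indicator_interval[OF integrable_norm[OF f], of "{a i<..b i}"]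
            integrable_indicator_interval[OF integrable_norm[OF f], of "{a i<..<b i}"] by auto
      qed
      finally show "norm (primitive \<alpha> \<beta> f (b i) - primitive \<alpha> \<beta> f (a i))
        \<le> (LINT y|?M. indicator {a i<..<b i} y * norm (f y))" .
    qed
    also have "\<dots> = (LINT y|?M. (\<Sum>i<n. indicator {a i<..<b i} y * norm (f y)))"
      using integrable_indicator_interval[OF integrable_norm[OF f]]
      by (intro Bochner_Integration.integral_sum[symmetric]) auto
    also have "\<dots> = (LINT y|?M. indicator ?A y * norm (f y))"
      by (simp add: sum_distrib_right[symmetric] indicator_UN_disjoint[OF _ disj])
    also have "\<dots> < \<epsilon>" by (rule d(2)[OF As small])
    finally show "(\<Sum>i<n. norm (primitive \<alpha> \<beta> f (b i) - primitive \<alpha> \<beta> f (a i))) < \<epsilon>" .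
  qed
qed

text \<open>Fubini applied to \<open>min x b - \<alpha> = \<integral> 1(y < b) 1(y < x) dy\<close>.\<close>

lemma integral_ramp:
  fixes f :: "real \<Rightarrow> 'a::euclidean_space"
  assumes f: "integrable (lebesgue_on {\<alpha><..<\<beta>}) f" and b: "\<alpha> \<le> b" "b \<le> \<beta>"
  shows "(LINT x|lebesgue_on {\<alpha><..<\<beta>}. (max \<alpha> (min x b) - \<alpha>) *\<^sub>R f x)
    = (LINT y|lebesgue_on {\<alpha><..<\<beta>}. indicator {..b} y *\<^sub>R (primitive \<alpha> \<beta> f \<beta> - primitive \<alpha> \<beta> f y))"
proof -
  let ?M = "lebesgue_on {\<alpha><..<\<beta>}"
  interpret finite_measure ?M by (rule finite_measure_interval)
  interpret P: pair_sigma_finite ?M ?M ..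
  define g where "g x y = (indicator {..b} y * indicator {y<..} x) *\<^sub>R f x" for x y
  have fm: "f \<in> borel_measurable ?M" using f by auto
  have idm: "(\<lambda>x. x) \<in> borel_measurable ?M"
    by (rule measurable_restrict_space1) (simp add: measurable_completion)
  have fst: "(\<lambda>z. fst z) \<in> borel_measurable (?M \<Otimes>\<^sub>M ?M)" "(\<lambda>z. snd z) \<in> borel_measurable (?M \<Otimes>\<^sub>M ?M)"
    using measurable_compose[OF measurable_fst idm] measurable_compose[OF measurable_snd idm] by auto
  have "g = (\<lambda>x y. (if y \<le> b \<and> y < x then f x else 0))" by (auto simp: g_def indicator_def fun_eq_iff)
  moreover have "(\<lambda>z. if snd z \<le> b \<and> snd z < fst z then f (fst z) else 0) \<in> borel_measurable (?M \<Otimes>\<^sub>M ?M)"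
    using fst measurable_compose[OF measurable_fst fm] by measurable
  ultimately have gm: "case_prod g \<in> borel_measurable (?M \<Otimes>\<^sub>M ?M)" by (simp add: case_prod_unfold)
  have inner_int: "integrable ?M (\<lambda>y. g x y)" for x
  proof (rule integrable_const_bound[where B="norm (f x)"])
    show "AE y in ?M. norm (g x y) \<le> norm (f x)" by (intro AE_I2) (auto simp: g_def indicator_def)
    have "(\<lambda>y. if y \<le> b \<and> y < x then f x else 0) \<in> borel_measurable ?M" using idm by measurable
    then show "(\<lambda>y. g x y) \<in> borel_measurable ?M"
      by (rule measurable_cong[THEN iffD1, rotated]) (auto simp: g_def indicator_def)
  qed
  have "integrable (?M \<Otimes>\<^sub>M ?M) (case_prod g)"
  proof (rule P.Fubini_integrable[OF gm])
    show "AE x in ?M. integrable ?M (\<lambda>y. case_prod g (x, y))" using inner_int by simp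
    have 1: "integrable ?M (\<lambda>x. measure ?M (space ?M) * norm (f x))" using f by auto
    have 2: "(\<lambda>x. LINT y|?M. norm (case_prod g (x, y))) \<in> borel_measurable ?M"
      using gm by (intro borel_measurable_lebesgue_integral) (auto simp: case_prod_unfold intro!:
        borel_measurable_norm)
    have 3: "norm (LINT y|?M. norm (case_prod g (x, y))) \<le> norm (measure ?M (space ?M) * norm (f x))" for x
    proof -
      have "(LINT y|?M. norm (g x y)) \<le> (LINT y|?M. norm (f x))"
        by (intro integral_mono integrable_norm[OF inner_int]) (auto simp: g_def indicator_def)
      moreover have "0 \<le> (LINT y|?M. norm (g x y))" by simp
      ultimately show ?thesis by simp
    qed
    show "integrable ?M (\<lambda>x. LINT y|?M. norm (case_prod g (x, y)))"
      by (rule Bochner_Integration.integrable_bound[OF 1 2 AE_I2[OF 3]])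
  qed
  from P.Fubini_integral[OF this]
  have fub: "(LINT y|?M. LINT x|?M. g x y) = (LINT x|?M. LINT y|?M. g x y)" .
  have "(LINT y|?M. g x y) = (max \<alpha> (min x b) - \<alpha>) *\<^sub>R f x" if x: "x \<in> {\<alpha><..<\<beta>}" for x
  proof -
    have "(LINT y|?M. g x y) = (LINT y|lebesgue. (indicator {\<alpha><..<\<beta>} y * (indicator {..b} y * indicator
      {y<..} x)) *\<^sub>R f x)"
      unfolding integral_interval_eq(1) g_def by simp
    also have "\<dots> = (LINT y|lebesgue. indicator (if x \<le> b then {\<alpha><..<x} else {\<alpha><..b}) y *\<^sub>R f x)"
      using x by (intro Bochner_Integration.integral_cong) (auto simp: indicator_def)
    also have "\<dots> = (max \<alpha> (min x b) - \<alpha>) *\<^sub>R f x"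
    proof (cases "x \<le> b")
      case True
      have "integrable lebesgue (indicator {\<alpha><..<x} :: real \<Rightarrow> real)" using x
        by (intro integrable_real_indicator) auto
      then show ?thesis using True x by (simp add: integral_scaleR_left)
    next
      case False
      have "integrable lebesgue (indicator {\<alpha><..b} :: real \<Rightarrow> real)" using b
        by (intro integrable_real_indicator) auto
      then show ?thesis using False x b by (simp add: integral_scaleR_left)
    qed
    finally show ?thesis .
  qed
  then have 1: "(LINT x|?M. LINT y|?M. g x y) = (LINT x|?M. (max \<alpha> (min x b) - \<alpha>) *\<^sub>R f x)"
    by (intro Bochner_Integration.integral_cong) auto
  have "(LINT x|?M. g x y) = indicator {..b} y *\<^sub>R (primitive \<alpha> \<beta> f \<beta> - primitive \<alpha> \<beta> f y)" for y
  proof -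
    have "(LINT x|?M. g x y) = (LINT x|?M. indicator {..b} y *\<^sub>R (f x - indicator {..y} x *\<^sub>R f x))"
      by (intro Bochner_Integration.integral_cong) (auto simp: g_def indicator_def)
    also have "\<dots> = indicator {..b} y *\<^sub>R ((LINT x|?M. f x) - primitive \<alpha> \<beta> f y)"
      using f integrable_indicator_interval[OF f, of "{..y}"] by (simp add: primitive_def)
    finally show ?thesis by (simp add: primitive_endpoints)
  qed
  then show ?thesis using fub 1 by simp
qed

text \<open>Testing with ramps on \<open>[\<alpha>, b]\<close> for all \<open>b\<close> identifies the primitive of \<open>v2\<close>.\<close>

lemma du_bois_reymond:
  fixes v1 v2 :: "real \<Rightarrow> 'a::euclidean_space"
  assumes ab: "\<alpha> < \<beta>" and v: "integrable (lebesgue_on {\<alpha><..<\<beta>}) v1" "integrable (lebesgue_on {\<alpha><..<\<beta>}) v2"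
    and zero: "\<And>h k. test_pair \<alpha> \<beta> h k \<Longrightarrow> h \<alpha> = 0 \<Longrightarrow> h \<beta> = 0 \<Longrightarrow>
      (LINT x|lebesgue_on {\<alpha><..<\<beta>}. v1 x \<bullet> h x + v2 x \<bullet> k x) = 0"
  obtains \<kappa> where "AE x in lebesgue_on {\<alpha><..<\<beta>}. v2 x = primitive \<alpha> \<beta> v1 x - primitive \<alpha> \<beta> v1 \<beta> + \<kappa>"
    "\<And>h k. test_pair \<alpha> \<beta> h k \<Longrightarrow> (LINT x|lebesgue_on {\<alpha><..<\<beta>}. v1 x \<bullet> h x + v2 x \<bullet> k x)
        = \<kappa> \<bullet> h \<beta> - (\<kappa> - primitive \<alpha> \<beta> v1 \<beta>) \<bullet> h \<alpha>"
proof -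
  let ?M = "lebesgue_on {\<alpha><..<\<beta>}"
  interpret finite_measure ?M by (rule finite_measure_interval)
  define V where "V = primitive \<alpha> \<beta> v1"
  define \<Lambda> where "\<Lambda> h k = (LINT x|?M. v1 x \<bullet> h x + v2 x \<bullet> k x)" for h k
  have bi: "integrable ?M (\<lambda>x. v x \<bullet> Z x)"
    if "integrable ?M v" "Z \<in> borel_measurable ?M" "\<And>x. norm (Z x) \<le> K" for v Z :: "real \<Rightarrow> 'a" and K
  proof -
    have K0: "0 \<le> K" using that(3) norm_ge_zero order_trans by blast
    have 1: "integrable ?M (\<lambda>x. norm (v x) * K)" using that(1) by auto
    have 2: "(\<lambda>x. v x \<bullet> Z x) \<in> borel_measurable ?M" using that by auto
    have 3: "norm (v x \<bullet> Z x) \<le> norm (norm (v x) * K)" for x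
      using Cauchy_Schwarz_ineq2[of "v x" "Z x"] mult_left_mono[OF that(3)[of x], of "norm (v x)"] K0
        by simp
    show ?thesis by (rule Bochner_Integration.integrable_bound[OF 1 2 AE_I2[OF 3]])
  qed
  have int: "integrable ?M (\<lambda>x. v1 x \<bullet> h x)" "integrable ?M (\<lambda>x. v2 x \<bullet> k x)"
    if h: "test_pair \<alpha> \<beta> h k" for h k
  proof -
    obtain K where "\<And>x. norm (h x) \<le> K \<and> norm (k x) \<le> K" using h by (auto simp: test_pair_def)
    then show "integrable ?M (\<lambda>x. v1 x \<bullet> h x)" "integrable ?M (\<lambda>x. v2 x \<bullet> k x)"
      using bi[OF v(1) test_pair_measurable(1)[OF h]] bi[OF v(2) test_pair_measurable(2)[OF h]] by blast+
  qed
  \<comment> \<open>The functional depends on the end values alone: the difference of the two test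
    pairs vanishes at both ends.\<close>
  have diff: "\<Lambda> h k = c * \<Lambda> h' k'"
    if h: "test_pair \<alpha> \<beta> h k" "test_pair \<alpha> \<beta> h' k'" and e: "h \<alpha> = c *\<^sub>R h' \<alpha>" "h \<beta> = c *\<^sub>R h' \<beta>"
      for h k h' k' c
  proof -
    note tp = test_pair_add[OF h(1) test_pair_scale[OF h(2), of "- c"]]
    have "(LINT x|?M. v1 x \<bullet> (h x + - c *\<^sub>R h' x) + v2 x \<bullet> (k x + - c *\<^sub>R k' x)) = 0"
      using e by (intro zero tp) auto
    also have "(LINT x|?M. v1 x \<bullet> (h x + - c *\<^sub>R h' x) + v2 x \<bullet> (k x + - c *\<^sub>R k' x))
      = (LINT x|?M. (v1 x \<bullet> h x + v2 x \<bullet> k x) - c * (v1 x \<bullet> h' x + v2 x \<bullet> k' x))"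
      by (intro Bochner_Integration.integral_cong) (auto simp: inner_add_right inner_diff_right
        algebra_simps)
    also have "\<dots> = \<Lambda> h k - c * \<Lambda> h' k'"
      unfolding \<Lambda>_def using int[OF h(1)] int[OF h(2)] by simp
    finally show ?thesis by simp
  qed
  \<comment> \<open>The combination produced by integration by parts: on the ramp up to
    \<open>b\<close> with slope \<open>e\<close> the functional is \<open>e\<close> times the
    integral of \<psi> up to \<open>b\<close>.\<close>
  define \<psi> where "\<psi> y = v2 y + (V \<beta> - V y)" for y
  have Vb: "norm (V x) \<le> (LINT y|?M. norm (v1 y))" for x unfolding V_def
    by (rule primitive_bounded[OF v(1)])
  have Vm: "V \<in> borel_measurable ?M"
  proof -
    have "continuous_on {\<alpha>..\<beta>} V"
      unfolding V_def by (rule abs_continuous_on_imp_continuous_on[OF primitive_abs_continuous[OF v(1)]])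
    then have "continuous_on {\<alpha><..<\<beta>} V" by (rule continuous_on_subset) auto
    then show ?thesis by (rule continuous_imp_measurable_on_sets_lebesgue) simp
  qed
  have Vi: "integrable ?M V" using Vm Vb by (intro integrable_const_bound) auto
  have \<psi>i: "integrable ?M \<psi>" unfolding \<psi>_def using v(2) Vi by auto
  have ramp: "\<Lambda> (\<lambda>x. (max \<alpha> (min x b) - \<alpha>) *\<^sub>R e) (\<lambda>x. indicator {\<alpha><..<b} x *\<^sub>R e) = e \<bullet> primitive \<alpha> \<beta> \<psi> b"
    if b: "\<alpha> \<le> b" "b \<le> \<beta>" for b e
  proof -
    note tp = int[OF test_pair_ramp[OF b(1), of \<alpha> \<beta> e]]
    have ri: "integrable ?M (\<lambda>x. (max \<alpha> (min x b) - \<alpha>) *\<^sub>R v1 x)"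
    proof -
      have 1: "integrable ?M (\<lambda>x. (\<beta> - \<alpha>) *\<^sub>R v1 x)" using v(1) by simp
      have "(\<lambda>x. max \<alpha> (min x b) - \<alpha>) \<in> borel_measurable ?M"
        by (intro measurable_restrict_space1 measurable_completion) simp
      then have 2: "(\<lambda>x. (max \<alpha> (min x b) - \<alpha>) *\<^sub>R v1 x) \<in> borel_measurable ?M" using v(1) by auto
      have 3: "norm ((max \<alpha> (min x b) - \<alpha>) *\<^sub>R v1 x) \<le> norm ((\<beta> - \<alpha>) *\<^sub>R v1 x)" for x
        unfolding norm_scaleR using b by (intro mult_right_mono) (auto simp: max_def min_def)
      show ?thesis by (rule Bochner_Integration.integrable_bound[OF 1 2 AE_I2[OF 3]])
    qed
    have i2: "integrable ?M (\<lambda>y. indicator {..b} y *\<^sub>R v2 y)"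
      by (rule integrable_indicator_interval[OF v(2)]) simp
    have "integrable ?M (\<lambda>y. V \<beta> - V y)" using Vi by simp
    then have i3: "integrable ?M (\<lambda>y. indicator {..b} y *\<^sub>R (V \<beta> - V y))"
      by (rule integrable_indicator_interval) simp
    have "AE y in lebesgue. y \<noteq> b" using AE_not_in[of "{b}" lebesgue] by simp
    then have nb: "AE y in ?M. y \<noteq> b" unfolding AE_interval_iff by eventually_elim simp
    have A: "(LINT x|?M. v1 x \<bullet> ((max \<alpha> (min x b) - \<alpha>) *\<^sub>R e))
      = e \<bullet> (LINT y|?M. indicator {..b} y *\<^sub>R (V \<beta> - V y))"
      unfolding V_def integral_ramp[OF v(1) b, symmetric] using ri
      by (subst integral_inner_right[symmetric]) (auto simp: inner_commute)
    have B: "(LINT x|?M. v2 x \<bullet> (indicator {\<alpha><..<b} x *\<^sub>R e)) = e \<bullet> (LINT y|?M. indicator {..b} y *\<^sub>R v2 y)"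
    proof -
      have "(LINT x|?M. v2 x \<bullet> (indicator {\<alpha><..<b} x *\<^sub>R e)) = (LINT x|?M. e \<bullet> (indicator {..b} x *\<^sub>R v2 x))"
      proof (rule integral_cong_AE)
        have "AE x in ?M. x \<in> {\<alpha><..<\<beta>}" by (intro AE_I2) simp
        with nb show "AE x in ?M. v2 x \<bullet> (indicator {\<alpha><..<b} x *\<^sub>R e) = e \<bullet> (indicator {..b} x *\<^sub>R v2 x)"
          by eventually_elim (auto simp: indicator_def inner_commute)
        show "(\<lambda>x. v2 x \<bullet> (indicator {\<alpha><..<b} x *\<^sub>R e)) \<in> borel_measurable ?M" using tp(2) by blast
        show "(\<lambda>x. e \<bullet> (indicator {..b} x *\<^sub>R v2 x)) \<in> borel_measurable ?M"
          by (rule borel_measurable_inner[OF borel_measurable_const borel_measurable_integrable[OF i2]])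
      qed
      also have "\<dots> = e \<bullet> (LINT y|?M. indicator {..b} y *\<^sub>R v2 y)" by (rule integral_inner_right) (rule i2)
      finally show ?thesis .
    qed
    have "\<Lambda> (\<lambda>x. (max \<alpha> (min x b) - \<alpha>) *\<^sub>R e) (\<lambda>x. indicator {\<alpha><..<b} x *\<^sub>R e)
      = e \<bullet> (LINT y|?M. indicator {..b} y *\<^sub>R (V \<beta> - V y)) + e \<bullet> (LINT y|?M. indicator {..b} y *\<^sub>R v2 y)"
      unfolding \<Lambda>_def A[symmetric] B[symmetric] by (rule Bochner_Integration.integral_add[OF tp])
    also have "\<dots> = e \<bullet> primitive \<alpha> \<beta> \<psi> b"
      unfolding primitive_def \<psi>_def scaleR_add_right using i2 i3 by (simp add: inner_add_right)
    finally show ?thesis .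
  qed
  define \<kappa> where "\<kappa> = primitive \<alpha> \<beta> \<psi> \<beta> /\<^sub>R (\<beta> - \<alpha>)"
  \<comment> \<open>The ramp up to \<open>b\<close> ends with the value
    \<open>(b - \<alpha>) e\<close>, a multiple of the end value of the ramp up to \<beta>, so
    \<open>diff\<close> relates the two values of the functional. A linear primitive means that
    \<psi> is constant almost everywhere.\<close>
  have lin: "primitive \<alpha> \<beta> \<psi> b = (b - \<alpha>) *\<^sub>R \<kappa>" if b: "\<alpha> \<le> b" "b \<le> \<beta>" for b
  proof -
    have "e \<bullet> primitive \<alpha> \<beta> \<psi> b = (b - \<alpha>) / (\<beta> - \<alpha>) * (e \<bullet> primitive \<alpha> \<beta> \<psi> \<beta>)" for e
      unfolding ramp[OF b, symmetric] ramp[OF less_imp_le[OF ab] order_refl, symmetric]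
      using b ab by (intro diff test_pair_ramp) auto
    then have "e \<bullet> primitive \<alpha> \<beta> \<psi> b = e \<bullet> ((b - \<alpha>) *\<^sub>R \<kappa>)" for e
      by (simp add: \<kappa>_def divide_inverse)
    then show ?thesis by (metis vector_eq_rdot inner_commute)
  qed
  have V_end: "V \<alpha> = 0" "V \<beta> = integral\<^sup>L ?M v1" by (simp_all add: V_def primitive_endpoints)
  show ?thesis
  proof (rule that[of \<kappa>])
    have ae: "AE x in ?M. x \<in> {\<alpha><..<\<beta>}" by (intro AE_I2) simp
    show "AE x in ?M. v2 x = primitive \<alpha> \<beta> v1 x - primitive \<alpha> \<beta> v1 \<beta> + \<kappa>"
      using primitive_has_vector_derivative[OF \<psi>i] ae
    proof eventually_elim
      case (elim x)
      have "((\<lambda>b. (b - \<alpha>) *\<^sub>R \<kappa>) has_vector_derivative 1 *\<^sub>R \<kappa>) (at x)" by (auto intro!: derivative_eq_intros)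
      then have "(primitive \<alpha> \<beta> \<psi> has_vector_derivative 1 *\<^sub>R \<kappa>) (at x)"
        by (rule has_vector_derivative_transform_within_open[of _ _ _ "{\<alpha><..<\<beta>}"]) (use elim(2) lin in auto)
      then have "\<psi> x = \<kappa>" using vector_derivative_unique_at[OF elim(1)] by simp
      then show ?case unfolding \<psi>_def V_def by (simp add: algebra_simps)
    qed
    fix h k :: "real \<Rightarrow> 'a" assume h: "test_pair \<alpha> \<beta> h k"
    \<comment> \<open>The constant \<open>h \<alpha>\<close> plus the ramp of slope \<open>e\<close>
      has the same end values as \<open>h\<close>, so \<open>diff\<close> reduces the formula to
      these two test functions.\<close>
    define e where "e = (h \<beta> - h \<alpha>) /\<^sub>R (\<beta> - \<alpha>)"
    let ?r = "\<lambda>x. (max \<alpha> (min x \<beta>) - \<alpha>) *\<^sub>R e" and ?k = "\<lambda>x. indicator {\<alpha><..<\<beta>} x *\<^sub>R e"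
    have tr: "test_pair \<alpha> \<beta> ?r ?k" using ab by (intro test_pair_ramp) simp
    have tc: "test_pair \<alpha> \<beta> (\<lambda>_. h \<alpha>) (\<lambda>_. 0)" by (rule test_pair_const)
    have be: "(\<beta> - \<alpha>) *\<^sub>R e = h \<beta> - h \<alpha>" using ab by (simp add: e_def)
    have "\<Lambda> h k = 1 * \<Lambda> (\<lambda>x. h \<alpha> + ?r x) (\<lambda>x. 0 + ?k x)"
      using ab be by (intro diff h test_pair_add[OF tc tr]) auto
    also have "\<dots> = \<Lambda> (\<lambda>_. h \<alpha>) (\<lambda>_. 0) + \<Lambda> ?r ?k"
    proof -
      have "\<Lambda> (\<lambda>x. h \<alpha> + ?r x) (\<lambda>x. 0 + ?k x) = (LINT x|?M. (v1 x \<bullet> h \<alpha> + v2 x \<bullet> 0) + (v1 x \<bullet> ?r x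
        + v2 x \<bullet> ?k x))"
        unfolding \<Lambda>_def by (intro Bochner_Integration.integral_cong) (auto simp: inner_add_right)
      then show ?thesis unfolding \<Lambda>_def using int[OF tc] int[OF tr] by simp
    qed
    also have "\<Lambda> (\<lambda>_. h \<alpha>) (\<lambda>_. 0) = V \<beta> \<bullet> h \<alpha>" unfolding \<Lambda>_def V_end(2) using v(1) by simp
    also have "\<Lambda> ?r ?k = e \<bullet> ((\<beta> - \<alpha>) *\<^sub>R \<kappa>)" using ramp[of \<beta> e] lin[of \<beta>] ab by simp
    also have "\<dots> = \<kappa> \<bullet> (h \<beta> - h \<alpha>)" unfolding be[symmetric] by (simp add: inner_commute)
    finally show "(LINT x|?M. v1 x \<bullet> h x + v2 x \<bullet> k x) = \<kappa> \<bullet> h \<beta> - (\<kappa> - primitive \<alpha> \<beta> v1 \<beta>) \<bullet> h \<alpha>"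
      by (simp add: \<Lambda>_def V_def inner_diff_left inner_diff_right)
  qed
qed

section \<open>Multiplier cones\<close>

text \<open>Since the cone contains 0, the separating constant is negative; a ray on which the
  functional is negative would leave the half-space, so the functional is nonnegative on
  \<open>K\<close>.\<close>

lemma separate_compact_cone:
  fixes Q :: "'a::euclidean_space set"
  assumes Q: "compact Q" "convex Q" "Q \<noteq> {}" and K: "closed K" "convex_cone K" and disj: "Q \<inter> K = {}"
  obtains e where "\<And>x. x \<in> Q \<Longrightarrow> x \<bullet> e < 0" "\<And>k. k \<in> K \<Longrightarrow> 0 \<le> k \<bullet> e"
proof -
  have cK: "convex K" using K(2) by (simp add: convex_cone_def)
  obtain a b where ab: "\<And>x. x \<in> Q \<Longrightarrow> a \<bullet> x < b" "\<And>x. x \<in> K \<Longrightarrow> b < a \<bullet> x"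
    using separating_hyperplane_compact_closed[OF Q(2,1,3) cK K(1) disj] by blast
  have b: "b < 0" using ab(2)[OF convex_cone_contains_0[OF K(2)]] by simp
  have "0 \<le> k \<bullet> a" if k: "k \<in> K" for k
  proof (rule ccontr)
    assume "\<not> 0 \<le> k \<bullet> a"
    then have neg: "a \<bullet> k < 0" by (simp add: inner_commute)
    \<comment> \<open>The factor is positive and scales \<open>k\<close> to a point with value
      exactly \<open>b\<close>, which the strict separation excludes.\<close>
    have "(b / (a \<bullet> k)) *\<^sub>R k \<in> K"
      using K(2) k neg b by (intro conic_mul) (auto simp: divide_nonpos_neg convex_cone_def)
    then show False using ab(2)[of "(b / (a \<bullet> k)) *\<^sub>R k"] neg by simp
  qed
  moreover have "x \<bullet> a < 0" if "x \<in> Q" for x using ab(1)[OF that] b by (simp add: inner_commute)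
  ultimately show ?thesis using that by blast
qed

lemma convex_cone_hull_uminus: "convex_cone hull (uminus ` S) = uminus ` (convex_cone hull S)"
  by (rule convex_cone_hull_linear_image) (simp add: linear_uminus)

text \<open>In a convergent sequence \<open>c n *\<^sub>R q n + k n\<close> the coefficients are
  bounded: the compact set of all \<open>- q\<close> has distance \<open>d > 0\<close> from the
  closed cone \<open>K\<close>, which forces the norm to be at least \<open>c n * d\<close>.
  Compactness then gives a convergent subsequence of the pairs \<open>(c n, q n)\<close>.\<close>

lemma closed_convex_cone_hull_plus:
  fixes Q K :: "'a::euclidean_space set"
  assumes Q: "compact Q" "convex Q" and K: "closed K" "convex_cone K" and disj: "\<And>q. q \<in> Q \<Longrightarrow> - q \<notin> K"
  shows "closed (convex_cone hull Q + K)"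
proof -
  let ?E = "{l *\<^sub>R q + k | l q k. 0 \<le> l \<and> q \<in> Q \<and> k \<in> K}"
  have "closed ?E"
    unfolding closed_sequential_limits
  proof (intro allI impI, elim conjE)
    fix x l assume x: "\<forall>n. x n \<in> ?E" and lim: "x \<longlonglongrightarrow> l"
    then obtain c q k where c: "\<And>n. 0 \<le> c n" "\<And>n. q n \<in> Q" "\<And>n. k n \<in> K" "\<And>n. x n = c n *\<^sub>R q n + k n"
      by (simp add: set_eq_iff) metis
    have "uminus ` Q \<inter> K = {}" using disj by auto
    then obtain d where d: "d > 0" "\<And>y z. y \<in> uminus ` Q \<Longrightarrow> z \<in> K \<Longrightarrow> d \<le> dist y z"
      using separate_compact_closed[OF compact_negations[OF Q(1)] K(1)] by blast
    obtain B where B: "\<And>n. norm (x n) \<le> B"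
      using convergent_imp_Bseq[of x] lim by (auto simp: convergent_def Bseq_def)
    have "c n \<in> {0..B / d}" for n
    proof (cases "c n = 0")
      case True
      have "0 \<le> B" using norm_ge_zero B by (rule order_trans)
      then show ?thesis using True d(1) by simp
    next
      case False
      then have cn: "c n > 0" using c(1)[of n] by simp
      have "d \<le> dist (- q n) (inverse (c n) *\<^sub>R k n)"
        using c(2,3) cn K(2) by (intro d(2) conic_mul) (auto simp: convex_cone_def)
      then have "c n * d \<le> c n * norm (- (q n + inverse (c n) *\<^sub>R k n))"
        using cn by (intro mult_left_mono) (auto simp: dist_norm)
      also have "\<dots> = norm (c n *\<^sub>R (q n + inverse (c n) *\<^sub>R k n))" using cn
        by (simp only: norm_minus_cancel norm_scaleR abs_of_pos)
      also have "c n *\<^sub>R (q n + inverse (c n) *\<^sub>R k n) = x n" using cn c(4)[of n]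
        by (simp add: scaleR_add_right)
      finally show ?thesis using B[of n] d(1) c(1)[of n] by (simp add: le_divide_eq)
    qed
    then have mem: "\<forall>n. (c n, q n) \<in> {0..B / d} \<times> Q" using c(2) by simp
    have comp: "compact ({0..B / d} \<times> Q)" using Q(1) by (intro compact_Times) auto
    obtain y r where r: "y \<in> {0..B / d} \<times> Q" "strict_mono r" "((\<lambda>n. (c n, q n)) \<circ> r) \<longlonglongrightarrow> y"
      using comp[unfolded compact_def, THEN spec[where x="\<lambda>n. (c n, q n)"], THEN mp, OF mem] by blast
    have c': "(\<lambda>n. c (r n)) \<longlonglongrightarrow> fst y" "(\<lambda>n. q (r n)) \<longlonglongrightarrow> snd y"
      using tendsto_fst[OF r(3)] tendsto_snd[OF r(3)] by (simp_all add: o_def)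
    have xl: "(\<lambda>n. x (r n) - c (r n) *\<^sub>R q (r n)) \<longlonglongrightarrow> l - fst y *\<^sub>R snd y"
      using LIMSEQ_subseq_LIMSEQ[OF lim r(2)] by (intro tendsto_intros c') (simp add: o_def)
    have "x (r n) - c (r n) *\<^sub>R q (r n) \<in> K" for n using c(3)[of "r n"] c(4)[of "r n"] by simp
    then have "l - fst y *\<^sub>R snd y \<in> K" using xl by (rule closed_sequentially[OF K(1)])
    then have "l = fst y *\<^sub>R snd y + (l - fst y *\<^sub>R snd y) \<and> 0 \<le> fst y \<and> snd y \<in> Q \<and> l - fst y *\<^sub>R snd y \<in> K"
      using r(1) by auto
    then show "l \<in> ?E" unfolding mem_Collect_eq by (intro exI)
  qed
  \<comment> \<open>The set \<open>?E\<close> is empty when \<open>Q\<close> is; the union with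
    \<open>K\<close> accounts for the apex 0 of the cone hull in that case.\<close>
  moreover have "convex_cone hull Q + K = ?E \<union> K"
  proof -
    have "convex_cone hull Q = insert 0 {l *\<^sub>R q | l q. 0 \<le> l \<and> q \<in> Q}"
      unfolding convex_cone_hull_convex_hull hull_same[of convex, OF Q(2)] by auto
    then show ?thesis by (auto simp: set_plus_def)
  qed
  ultimately show ?thesis using closed_Un[OF _ K(1)] by simp
qed

text \<open>A Farkas lemma with a compact convex set in place of a point: by \<open>dual\<close> the
  set \<open>K0 + {c}\<close> cannot be strictly separated from the negative of the closed cone
  \<open>convex_cone hull Q + K\<close>, so the two meet, and a common point gives the
  decomposition.\<close>

lemma multiplier_cone:
  fixes K0 Q K :: "'a::euclidean_space set"
  assumes K0: "compact K0" "convex K0" "K0 \<noteq> {}"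
    and Q: "compact Q" "convex Q" and K: "closed K" "convex_cone K" and disj: "\<And>q. q \<in> Q \<Longrightarrow> - q \<notin> K"
    and dual: "\<And>\<eta>. (\<And>q. q \<in> Q \<Longrightarrow> q \<bullet> \<eta> \<le> 0) \<Longrightarrow> (\<And>k. k \<in> K \<Longrightarrow> k \<bullet> \<eta> \<le> 0) \<Longrightarrow> 0 \<le> c \<bullet> \<eta> + support_fun K0 \<eta>"
  obtains x y k where "x \<in> K0" "y \<in> convex_cone hull Q" "k \<in> K" "- c = x + y + k"
proof -
  let ?E = "convex_cone hull Q + K"
  have cc: "convex_cone ?E"
    using convex_cone_sums[OF convex_cone_convex_cone_hull K(2), of Q]
    by (rule back_subst[of convex_cone]) (auto simp: set_plus_def)
  have cE: "closed ?E" by (rule closed_convex_cone_hull_plus[OF Q K disj])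
  have QE: "q \<in> ?E" if "q \<in> Q" for q
    using set_plus_intro[OF hull_inc[OF that] convex_cone_contains_0[OF K(2)]] by simp
  have KE: "k \<in> ?E" if "k \<in> K" for k
    using set_plus_intro[OF convex_cone_hull_contains_0[of Q] that] by simp
  have cn: "convex_cone (uminus ` ?E)" using cc
    by (metis convex_cone_hull_uminus hull_same convex_cone_convex_cone_hull)
  have "(K0 + {c}) \<inter> uminus ` ?E \<noteq> {}"
  proof
    assume dis: "(K0 + {c}) \<inter> uminus ` ?E = {}"
    have ne: "K0 + {c} \<noteq> {}" using K0(3) by (auto simp: set_plus_def)
    obtain e where e: "\<And>x. x \<in> K0 + {c} \<Longrightarrow> x \<bullet> e < 0" "\<And>k. k \<in> uminus ` ?E \<Longrightarrow> 0 \<le> k \<bullet> e"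
      by (rule separate_compact_cone[OF compact_plus_singleton[OF K0(1)] convex_plus_singleton[OF K0(2)] ne
            closed_negations[OF cE] cn dis]) (rule that)
    have "0 \<le> c \<bullet> e + support_fun K0 e"
      using e(2) QE KE by (intro dual) force+
    moreover obtain x where "x \<in> K0" "x \<bullet> e = support_fun K0 e" using support_fun_attained[OF K0(1,3)] .
    ultimately show False using e(1)[of "x + c"] by (auto simp: set_plus_def inner_add_left)
  qed
  then obtain w where w: "w \<in> K0 + {c}" "w \<in> uminus ` ?E" by blast
  obtain x where x: "x \<in> K0" "w = x + c" using w(1) by (auto simp: set_plus_def)
  obtain e where e: "e \<in> ?E" "w = - e" using w(2) by blast
  obtain y k where yk: "y \<in> convex_cone hull Q" "k \<in> K" "e = y + k" using e(1) by (auto simp: set_plus_def)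
  have "x + c = - (y + k)" using x(2) e(2) yk(3) by simp
  then have "x + y + k = - c" unfolding eq_neg_iff_add_eq_0 by (simp add: ac_simps)
  then show ?thesis using that[OF x(1) yk(1,2)] by simp
qed

text \<open>The cone over a nonempty convex set is the union of its rays, so one multiplier per
  index suffices; nonemptiness supplies a vector even where the multiplier is 0.\<close>

lemma convex_cone_hull_UN_convex:
  fixes A :: "'i \<Rightarrow> 'a::real_vector set"
  assumes "finite T" "\<And>i. i \<in> T \<Longrightarrow> convex (A i)" "\<And>i. i \<in> T \<Longrightarrow> A i \<noteq> {}" "x \<in> convex_cone hull (\<Union>i\<in>T. A i)"
  shows "\<exists>l a. (\<forall>i\<in>T. 0 \<le> l i \<and> a i \<in> A i) \<and> x = (\<Sum>i\<in>T. l i *\<^sub>R a i)"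
  using assms
proof (induction T arbitrary: x)
  case (insert i T)
  have "x \<in> convex_cone hull (A i \<union> (\<Union>i\<in>T. A i))" using insert.prems by simp
  then obtain y z where yz: "x = y + z" "y \<in> convex_cone hull A i" "z \<in> convex_cone hull (\<Union>i\<in>T. A i)"
    unfolding convex_cone_hull_Un by auto
  obtain l a where la: "\<forall>i\<in>T. 0 \<le> l i \<and> a i \<in> A i" "z = (\<Sum>i\<in>T. l i *\<^sub>R a i)"
    using insert.IH[OF _ _ yz(3)] insert.prems by auto
  have "convex hull (A i) = A i" using insert.prems(1)[of i] by (simp add: hull_same)
  moreover obtain b0 where "b0 \<in> A i" using insert.prems(2)[of i] by auto
  ultimately have "\<exists>c b. 0 \<le> c \<and> b \<in> A i \<and> y = c *\<^sub>R b"
    using yz(2) unfolding convex_cone_hull_convex_hull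
      by (metis (no_types, lifting) UN_E atLeast_iff insert_iff order_refl scaleR_zero_left singletonD)
  then obtain c b where cb: "0 \<le> c" "b \<in> A i" "y = c *\<^sub>R b" by blast
  have "x = (\<Sum>j\<in>insert i T. (l(i := c)) j *\<^sub>R (a(i := b)) j)"
  proof -
    have "(\<Sum>j\<in>T. (l(i := c)) j *\<^sub>R (a(i := b)) j) = z"
      unfolding la(2) using insert.hyps by (intro sum.cong) auto
    then show ?thesis using insert.hyps yz(1) cb(3) by simp
  qed
  moreover have "\<forall>j\<in>insert i T. 0 \<le> (l(i := c)) j \<and> (a(i := b)) j \<in> A j" using la(1) cb by auto
  ultimately show ?case by blast
qed simp

text \<open>The finitely many generating points of the polytopes generate the same cone, and a
  finitely generated cone is closed.\<close>

lemma closed_convex_cone_hull_polytopes: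
  fixes F :: "'a::euclidean_space set set"
  assumes "finite F" "\<And>S. S \<in> F \<Longrightarrow> polytope S"
  shows "closed (convex_cone hull (\<Union>F))"
proof -
  obtain V where V: "\<And>S. S \<in> F \<Longrightarrow> finite (V S) \<and> S = convex hull (V S)"
    using assms(2) unfolding polytope_def by metis
  have "convex_cone hull (\<Union>F) = convex_cone hull (\<Union>S\<in>F. V S)"
  proof (rule antisym; rule hull_minimal)
    show "\<Union>F \<subseteq> convex_cone hull (\<Union>S\<in>F. V S)"
    proof
      fix x assume "x \<in> \<Union>F"
      then obtain S where S: "S \<in> F" "x \<in> convex hull (V S)" using V by blast
      have "convex hull (V S) \<subseteq> convex_cone hull (V S)" by (rule convex_hull_subset_convex_cone_hull)
      also have "\<dots> \<subseteq> convex_cone hull (\<Union>S\<in>F. V S)" using S(1) by (intro hull_mono) auto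
      finally show "x \<in> convex_cone hull (\<Union>S\<in>F. V S)" using S(2) by blast
    qed
    show "(\<Union>S\<in>F. V S) \<subseteq> convex_cone hull (\<Union>F)"
    proof
      fix x assume "x \<in> (\<Union>S\<in>F. V S)"
      then obtain S where "S \<in> F" "x \<in> V S" by blast
      then have "x \<in> \<Union>F" using V[of S] hull_inc[of x "V S" convex] by blast
      then show "x \<in> convex_cone hull (\<Union>F)" by (rule hull_inc)
    qed
  qed (simp_all add: convex_cone_convex_cone_hull)
  then show ?thesis using assms(1) V by (simp add: closed_convex_cone_hull)
qed

lemma polytope_subd:
  fixes A :: "(real \<times> 'a::euclidean_space) set"
  assumes "polytope A" shows "polytope (subd A)"
proof -
  have "subd A = snd ` (A \<inter> {z. (1, 0) \<bullet> z = 0})" by (force simp: subd_def)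
  then show ?thesis
    using assms by (auto intro!: polytope_linear_image polytope_Int_polyhedron polyhedron_hyperplane
      linear_snd)
qed

lemma polytope_plus_singleton:
  fixes S :: "'a::euclidean_space set"
  assumes "polytope S" shows "polytope (S + {w})"
proof -
  obtain V where V: "finite V" "S = convex hull V" using assms by (auto simp: polytope_def)
  have "S + {w} = (+) w ` S" by (auto simp: set_plus_def add.commute)
  also have "\<dots> = convex hull ((+) w ` V)" by (simp add: V(2) convex_hull_translation)
  finally show ?thesis unfolding polytope_def using V(1) by blast
qed

section \<open>Euler--Lagrange inclusion and transversality\<close>

theorem theorem3p3:
  fixes \<alpha> \<beta> :: real
    and p q :: ennreal
    and f :: "real \<Rightarrow> (real^'m) \<times> (real^'m) \<Rightarrow> real"
    and fl fu :: "real \<Rightarrow> (real^'m) \<times> (real^'m) \<Rightarrow> (real \<times> (real^'m) \<times> (real^'m)) set"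
    and l1 l2 :: nat
    and I J :: "nat set"
    and g :: "nat \<Rightarrow> (real^'m) \<times> (real^'m) \<Rightarrow> real"
    and gl gu :: "nat \<Rightarrow> (real^'m) \<times> (real^'m) \<Rightarrow> (real \<times> (real^'m) \<times> (real^'m)) set"
    and ustar :: "real \<Rightarrow> real^'m"
    and P :: "(real^'m) \<times> (real^'m)"
    and Iact :: "nat set"
    and s1 s2 r1 r2 :: "nat \<Rightarrow> real^'m"
    and C :: "nat \<Rightarrow> ((real^'m) \<times> (real^'m)) set"
  assumes "\<alpha> < \<beta>"
    and I: "I = {1..l1}" and J: "J = {l1 + 1..l2}"
    and p: "1 \<le> p" and q: "1 / p + 1 / q = 1"
    and f: "codifferentiability_conditions \<alpha> \<beta> p q f fl fu"
    and p1: "p = 1 \<Longrightarrow>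
      \<exists>(l::nat) (r::nat) (v1::nat \<Rightarrow> real^'m) (v2::nat \<Rightarrow> real^'m)
        (\<omega>1::nat \<Rightarrow> real^'m) (\<omega>2::nat \<Rightarrow> real^'m)
        (fk::nat \<Rightarrow> real \<Rightarrow> (real^'m) \<times> (real^'m) \<Rightarrow> real)
        (hk::nat \<Rightarrow> real \<Rightarrow> (real^'m) \<times> (real^'m) \<Rightarrow> real).
        (\<forall>k\<in>{1..l}. caratheodory \<alpha> \<beta> (fk k)) \<and> (\<forall>k\<in>{1..r}. caratheodory \<alpha> \<beta> (hk k)) \<and>
        (AE x in lebesgue_on {\<alpha><..<\<beta>}. \<forall>z.
           fl x z = convex hull ((\<lambda>k. (fk k x z, v1 k, v2 k)) ` {1..l}) \<and>
           fu x z = convex hull ((\<lambda>k. (hk k x z, \<omega>1 k, \<omega>2 k)) ` {1..r}))"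
    and opt: "locally_optimal \<alpha> \<beta> p f I J g ustar"
    and P: "P = (ustar \<alpha>, ustar \<beta>)"
    and Iact: "Iact = {i \<in> I. g i P = 0}"
    and g: "\<And>i. i \<in> I \<union> J \<union> {0} \<Longrightarrow> continuously_codifferentiable_at (g i) (gl i) (gu i) P"
    and poly: "\<And>j. j \<in> J \<Longrightarrow> polytope (gl j P) \<and> polytope (gu j P)"
    and s: "\<And>i. i \<in> I \<union> J \<Longrightarrow> (0, s1 i, s2 i) \<in> gu i P"
    and r: "\<And>j. j \<in> J \<Longrightarrow> (0, r1 j, r2 j) \<in> gl j P"
    and C: "\<And>j. j \<in> J \<Longrightarrow> C j = cq_set (gl j P) (gu j P) (s1 j, s2 j) (r1 j, r2 j)"
    and cq1: "\<And>j. j \<in> J \<Longrightarrow> C j \<inter> convex_cone hull (\<Union>k\<in>J - {j}. uminus ` C k) = {}"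
    and cq2: "convex hull (\<Union>i\<in>Iact. subd (gl i P) + {(s1 i, s2 i)})
                \<inter> convex_cone hull (\<Union>j\<in>J. uminus ` C j) = {}"
  shows "\<forall>s10 s20 w1 w2.
    (0, s10, s20) \<in> gu 0 P \<and>
    w1 \<in> borel_measurable (lebesgue_on {\<alpha><..<\<beta>}) \<and>
    w2 \<in> borel_measurable (lebesgue_on {\<alpha><..<\<beta>}) \<and>
    (AE x in lebesgue_on {\<alpha><..<\<beta>}. (0, w1 x, w2 x) \<in> fu x (ustar x, vderiv ustar x)) \<longrightarrow>
    (\<exists>\<zeta> lam mul muu.
       \<zeta> \<in> W1p \<alpha> \<beta> q \<and>
       (\<forall>i\<in>I. lam i \<ge> 0) \<and> (\<forall>j\<in>J. mul j \<ge> 0 \<and> muu j \<ge> 0) \<and>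
       (\<forall>i\<in>I. lam i * g i P = 0) \<and>
       (AE x in lebesgue_on {\<alpha><..<\<beta>}.
          (0, vderiv \<zeta> x, \<zeta> x) \<in> fl x (ustar x, vderiv ustar x) + {(0, w1 x, w2 x)}) \<and>
       (0, \<zeta> \<alpha>, - \<zeta> \<beta>) \<in> gl 0 P + {(0, s10, s20)}
          + (\<Sum>i\<in>I. (*\<^sub>R) (lam i) ` (gl i P + {(0, s1 i, s2 i)}))
          + (\<Sum>j\<in>J. (*\<^sub>R) (mul j) ` (gl j P + {(0, s1 j, s2 j)}))
          + (\<Sum>j\<in>J. uminus ` (*\<^sub>R) (muu j) ` ({(0, r1 j, r2 j)} + gu j P)))"
proof (intro allI impI, elim conjE)
  fix s10 s20 w1 w2
  assume s0: "(0, s10, s20) \<in> gu 0 P"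
    and w1m: "w1 \<in> borel_measurable (lebesgue_on {\<alpha><..<\<beta>})"
      and w2m: "w2 \<in> borel_measurable (lebesgue_on {\<alpha><..<\<beta>})"
    and w: "AE x in lebesgue_on {\<alpha><..<\<beta>}. (0, w1 x, w2 x) \<in> fu x (ustar x, vderiv ustar x)"
  let ?M = "lebesgue_on {\<alpha><..<\<beta>}"
  interpret M: finite_measure ?M by (rule finite_measure_interval)
  have sf: "sigma_finite_measure ?M" ..
  note ab = \<open>\<alpha> < \<beta>\<close>
  have u: "ustar \<in> W1p \<alpha> \<beta> p" using opt by (simp add: locally_optimal_def feasible_def)
  have fin: "finite I" "finite J" and no0: "0 \<notin> I" "0 \<notin> J" by (simp_all add: I J)
  have cod: "is_codifferential (g i) P (gl i P) (gu i P)" if "i \<in> I \<union> J \<union> {0}" for i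
    using g[OF that] by (auto simp: continuously_codifferentiable_at_def)
  note cp = is_codifferential_parts[OF cod]
  \<comment> \<open>Index 0 stands for the cost \<open>g 0\<close> and receives the vector chosen in
    the claim; this is unambiguous, as 0 lies neither in \<open>I\<close> nor in
    \<open>J\<close>.\<close>
  define S where "S i = (if i = 0 then (s10, s20) else (s1 i, s2 i))" for i
  define R where "R j = (r1 j, r2 j)" for j
  have Smem: "S i \<in> subd (gu i P)" if "i \<in> I \<union> J \<union> {0}" for i
    using that s[of i] s0 no0 by (auto simp: S_def subd_def)
  have S_eq: "S i = (s1 i, s2 i)" if "i \<in> I \<union> J" for i using that no0 by (auto simp: S_def)
  have Rmem: "R j \<in> subd (gl j P)" if "j \<in> J" for j using r[OF that] by (simp add: R_def subd_def)
  \<comment> \<open>The support function of \<open>A i\<close> bounds the directional derivative of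
    \<open>g i\<close>, that of \<open>B j\<close> the one of \<open>- g j\<close>; the union of
    \<open>A j\<close> and \<open>B j\<close> is \<open>C j\<close>.\<close>
  define A where "A i = subd (gl i P) + {S i}" for i
  define B where "B j = {- R j} + uminus ` subd (gu j P)" for j
  have A: "compact (A i)" "convex (A i)" "A i \<noteq> {}" if "i \<in> I \<union> J \<union> {0}" for i
    unfolding A_def
    by (rule compact_plus_singleton convex_plus_singleton plus_singleton_nonempty, rule cp[OF that])+
  have B: "compact (B j)" "convex (B j)" "B j \<noteq> {}" if "j \<in> J" for j
  proof -
    have c: "compact (uminus ` subd (gu j P))" "convex (uminus ` subd (gu j P))"
      "uminus ` subd (gu j P) \<noteq> {}"
      using cp[of j] that by (auto intro: convex_negations)
    show "compact (B j)" "convex (B j)" unfolding B_def add.commute[of "{- R j}"]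
      by (intro compact_plus_singleton c, intro convex_plus_singleton c)
    show "B j \<noteq> {}" unfolding B_def add.commute[of "{- R j}"] by (intro plus_singleton_nonempty c)
  qed
  have Cj: "C j = A j \<union> B j" if "j \<in> J" for j
    using C[OF that] S_eq[of j] that by (simp add: cq_set_def A_def B_def R_def)
  have polyAB: "polytope (A j)" "polytope (B j)" if "j \<in> J" for j
  proof -
    show "polytope (A j)" unfolding A_def using poly[OF that]
      by (intro polytope_plus_singleton polytope_subd) auto
    have "polytope (uminus ` subd (gu j P))"
      using poly[OF that] by (intro polytope_linear_image polytope_subd linear_uminus) auto
    then show "polytope (B j)" unfolding B_def add.commute[of "{- R j}"] by (rule polytope_plus_singleton)
  qed

  \<comment> \<open>Separating directions from the constraint qualification\<close>
  define N where "N T = convex_cone hull (\<Union>k\<in>T. uminus ` C k)" for T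
  have N: "closed (N T)" "convex_cone (N T)" if TJ: "T \<subseteq> J" for T
  proof -
    have "uminus ` C k = uminus ` A k \<union> uminus ` B k" if "k \<in> T" for k
      using Cj[of k] that TJ by (auto simp: image_Un)
    then have eq: "(\<Union>k\<in>T. uminus ` C k) = \<Union>((\<lambda>k. uminus ` A k) ` T \<union> (\<lambda>k. uminus ` B k) ` T)" by auto
    have "finite T" using TJ fin(2) finite_subset by blast
    have pn: "polytope (uminus ` X)" if "polytope X" for X :: "((real^'m) \<times> (real^'m)) set"
      by (rule polytope_linear_image[OF linear_uminus that])
    show "closed (N T)" unfolding N_def eq
    proof (rule closed_convex_cone_hull_polytopes)
      show "polytope X" if "X \<in> (\<lambda>k. uminus ` A k) ` T \<union> (\<lambda>k. uminus ` B k) ` T" for X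
        using that polyAB TJ by (auto intro: pn)
    qed (simp add: \<open>finite T\<close>)
    show "convex_cone (N T)" unfolding N_def by (rule convex_cone_convex_cone_hull)
  qed
  have Nneg: "c \<bullet> e \<le> 0" if "\<And>k. k \<in> N T \<Longrightarrow> 0 \<le> k \<bullet> e" "j \<in> T" "c \<in> C j" for T e j c
  proof -
    have "- c \<in> N T" unfolding N_def using that(2,3) by (intro hull_inc) auto
    then show ?thesis using that(1)[of "- c"] by simp
  qed
  have suppneg: "support_fun (A j) e \<le> 0 \<and> support_fun (B j) e \<le> 0"
    if "\<And>k. k \<in> N T \<Longrightarrow> 0 \<le> k \<bullet> e" "j \<in> T" "j \<in> J" for T e j
    using Nneg[OF that(1,2)] Cj[OF that(3)] A(3)[of j] B(3)[of j] that(3)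
      by (auto intro!: support_fun_least)
  \<comment> \<open>\<open>C j\<close> avoids the cone of the negatives of the other sets, so each
    of its two halves can be separated from that cone: \<open>A j\<close> yields \<open>ep j\<close>
    and \<open>B j\<close> yields \<open>em j\<close>. The union \<open>C j\<close> need not be
    convex and is not separated as a whole.\<close>
  have dirs: "\<exists>e. support_fun X e < 0 \<and> (\<forall>k\<in>J - {j}. support_fun (A k) e \<le> 0 \<and> support_fun (B k) e \<le> 0)"
    if j: "j \<in> J" and X: "compact X" "convex X" "X \<noteq> {}" "X \<subseteq> C j" for X j
  proof -
    have "X \<inter> N (J - {j}) = {}" using cq1[OF j] X(4) unfolding N_def by blast
    then obtain e where e: "\<And>x. x \<in> X \<Longrightarrow> x \<bullet> e < 0" "\<And>k. k \<in> N (J - {j}) \<Longrightarrow> 0 \<le> k \<bullet> e"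
      by (rule separate_compact_cone[OF X(1-3) N[OF Diff_subset]]) (rule that)
    obtain x where "x \<in> X" "x \<bullet> e = support_fun X e" using support_fun_attained[OF X(1,3)] .
    then show ?thesis using e(1)[of x] suppneg[OF e(2)] by (intro exI[of _ e]) auto
  qed
  have "\<forall>j\<in>J. \<exists>e. support_fun (A j) e < 0 \<and> (\<forall>k\<in>J - {j}. support_fun (A k) e \<le> 0 \<and> support_fun (B k) e \<le> 0)"
    using dirs A Cj by auto
  then obtain ep where ep: "\<And>j. j \<in> J \<Longrightarrow> support_fun (A j) (ep j) < 0"
    "\<And>j k. j \<in> J \<Longrightarrow> k \<in> J \<Longrightarrow> k \<noteq> j \<Longrightarrow> support_fun (A k) (ep j) \<le> 0 \<and> support_fun (B k) (ep j) \<le> 0"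
      by (metis Diff_iff singletonD)
  have "\<forall>j\<in>J. \<exists>e. support_fun (B j) e < 0 \<and> (\<forall>k\<in>J - {j}. support_fun (A k) e \<le> 0 \<and> support_fun (B k) e \<le> 0)"
    using dirs B Cj by auto
  then obtain em where em: "\<And>j. j \<in> J \<Longrightarrow> support_fun (B j) (em j) < 0"
    "\<And>j k. j \<in> J \<Longrightarrow> k \<in> J \<Longrightarrow> k \<noteq> j \<Longrightarrow> support_fun (A k) (em j) \<le> 0 \<and> support_fun (B k) (em j) \<le> 0"
      by (metis Diff_iff singletonD)
  define Q where "Q = convex hull (\<Union>i\<in>Iact. A i)"
  have IactI: "Iact \<subseteq> I" using Iact by auto
  have Q: "compact Q" "convex Q" unfolding Q_def
    using A(1) IactI fin(1) finite_subset[of Iact I] by (auto intro!: compact_convex_hull compact_UN)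
  have QN: "Q \<inter> N J = {}"
  proof -
    have "A i = subd (gl i P) + {(s1 i, s2 i)}" if "i \<in> Iact" for i
      using S_eq[of i] that IactI unfolding A_def by (metis UnI1 subsetD)
    then have "(\<Union>i\<in>Iact. A i) = (\<Union>i\<in>Iact. subd (gl i P) + {(s1 i, s2 i)})" by simp
    then show ?thesis using cq2 unfolding Q_def N_def by simp
  qed
  \<comment> \<open>From the second condition of the constraint qualification: a common direction of
    strict decrease for the majorants of all active inequality constraints. Without active
    constraints \<open>Q\<close> is empty and the zero direction serves.\<close>
  obtain \<eta>0 where \<eta>0: "\<And>i. i \<in> Iact \<Longrightarrow> support_fun (A i) \<eta>0 < 0"
    "\<And>j. j \<in> J \<Longrightarrow> support_fun (A j) \<eta>0 \<le> 0 \<and> support_fun (B j) \<eta>0 \<le> 0"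
  proof (cases "Q = {}")
    case True
    have "A i = {}" if "i \<in> Iact" for i using True that unfolding Q_def convex_hull_eq_empty by blast
    then have "Iact = {}" using A(3) IactI by blast
    then show ?thesis using that[of 0] A(3) B(3) by auto
  next
    case False
    obtain e where e: "\<And>x. x \<in> Q \<Longrightarrow> x \<bullet> e < 0" "\<And>k. k \<in> N J \<Longrightarrow> 0 \<le> k \<bullet> e"
      by (rule separate_compact_cone[OF Q False N[OF order_refl] QN]) (rule that)
    show ?thesis
    proof (rule that[of e])
      show "support_fun (A i) e < 0" if i: "i \<in> Iact" for i
      proof -
        have ii: "i \<in> I \<union> J \<union> {0}" using i IactI by auto
        obtain x where "x \<in> A i" "x \<bullet> e = support_fun (A i) e"
          using support_fun_attained[OF A(1,3)[OF ii]] .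
        moreover have "x \<in> Q" unfolding Q_def using i \<open>x \<in> A i\<close> by (intro hull_inc) auto
        ultimately show ?thesis using e(1)[of x] by simp
      qed
      show "support_fun (A j) e \<le> 0 \<and> support_fun (B j) e \<le> 0" if "j \<in> J" for j
        using suppneg[OF e(2) that that] .
    qed
  qed

  \<comment> \<open>The convex cone of linearized feasible end point directions\<close>
  define Adm where "Adm = {\<eta>. (\<forall>i\<in>Iact. support_fun (A i) \<eta> \<le> 0) \<and> (\<forall>j\<in>J. support_fun (A j) \<eta> \<le> 0 \<and>
    support_fun (B j) \<eta> \<le> 0)}"
  have Adm_add: "\<eta> + \<eta>' \<in> Adm" if "\<eta> \<in> Adm" "\<eta>' \<in> Adm" for \<eta> \<eta>'
  proof -
    have "support_fun (A i) (\<eta> + \<eta>') \<le> 0" if "i \<in> Iact \<union> J" for i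
      using support_fun_add[OF A(1,3), of i \<eta> \<eta>'] that \<open>\<eta> \<in> Adm\<close> \<open>\<eta>' \<in> Adm\<close> IactI
        by (fastforce simp: Adm_def)
    moreover have "support_fun (B j) (\<eta> + \<eta>') \<le> 0" if "j \<in> J" for j
      using support_fun_add[OF B(1,3), of j \<eta> \<eta>'] that \<open>\<eta> \<in> Adm\<close> \<open>\<eta>' \<in> Adm\<close> by (fastforce simp: Adm_def)
    ultimately show ?thesis by (auto simp: Adm_def)
  qed
  have Adm_scale: "t *\<^sub>R \<eta> \<in> Adm" if "\<eta> \<in> Adm" "t > 0" for \<eta> t
  proof -
    have "support_fun (A i) (t *\<^sub>R \<eta>) \<le> 0" if "i \<in> Iact \<union> J" for i
      using support_fun_scale[OF A(1,3), of i t \<eta>] that \<open>\<eta> \<in> Adm\<close> \<open>t > 0\<close> IactI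
        by (auto simp: Adm_def mult_le_0_iff)
    moreover have "support_fun (B j) (t *\<^sub>R \<eta>) \<le> 0" if "j \<in> J" for j
      using support_fun_scale[OF B(1,3), of j t \<eta>] that \<open>\<eta> \<in> Adm\<close> \<open>t > 0\<close>
        by (auto simp: Adm_def mult_le_0_iff)
    ultimately show ?thesis by (auto simp: Adm_def)
  qed
  have Adm_0: "0 \<in> Adm" using A(3) B(3) IactI by (auto simp: Adm_def)
  have \<eta>0A: "\<eta>0 \<in> Adm" using \<eta>0 by (auto simp: Adm_def less_imp_le)
  have A0: "compact (A 0)" "convex (A 0)" "A 0 \<noteq> {}" using A[of 0] by auto

  \<comment> \<open>The shifted slices of the integrand\<close>
  note fD = codifferentiability_conditionsD[OF f]
  have ne: "AE x in ?M. \<forall>z. fl x z \<noteq> {} \<and> fu x z \<noteq> {}"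
    using fD(3) by eventually_elim (auto simp: is_codifferential_def)
  obtain L where L: "integrable ?M L" "\<And>x. 0 \<le> L x"
    "AE x in ?M. \<forall>z. norm (z - (ustar x, vderiv ustar x)) \<le> 1 \<longrightarrow> codiff_bounded (fl x z) (fu x z) (L x)"
    by (rule growth_near[OF p q u fD(6) ne]) (rule that)
  define z where "z x = (ustar x, vderiv ustar x)" for x
  define D where "D x = subd (fl x (z x)) + {(w1 x, w2 x)}" for x
  have wD: "AE x in ?M. (w1 x, w2 x) \<in> subd (fu x (z x))" using w
    by eventually_elim (simp add: subd_def z_def)
  \<comment> \<open>Elements of \<open>D x\<close> are sums of an element of the lower slice and
    \<open>(w1 x, w2 x)\<close>, each bounded by \<open>L x\<close>.\<close>
  have L2: "integrable ?M (\<lambda>x. 2 * L x)" "\<And>x. 0 \<le> 2 * L x" using L(1,2) by auto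
  have D: "AE x in ?M. compact (D x) \<and> D x \<noteq> {} \<and> convex (D x) \<and> (\<forall>v\<in>D x. norm v \<le> 2 * L x)"
    using fD(3) L(3) wD
  proof eventually_elim
    case (elim x)
    have "is_codifferential (f x) (z x) (fl x (z x)) (fu x (z x))" using elim(1) by blast
    note c = is_codifferential_parts[OF this]
    have b: "codiff_bounded (fl x (z x)) (fu x (z x)) (L x)" using elim(2) by (simp add: z_def)
    have "norm v \<le> 2 * L x" if vD: "v \<in> D x" for v
    proof -
      obtain d where d: "d \<in> subd (fl x (z x))" "v = d + (w1 x, w2 x)" using vD
        by (auto simp: D_def set_plus_def)
      have "norm d \<le> L x" "norm (w1 x, w2 x) \<le> L x" using b d(1) elim(3) by (auto simp: codiff_bounded_def)
      then show ?thesis unfolding d(2) using norm_triangle_ineq[of d "(w1 x, w2 x)"] by linarith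
    qed
    moreover have "compact (D x)" "D x \<noteq> {}" "convex (D x)" unfolding D_def
      by (rule compact_plus_singleton convex_plus_singleton plus_singleton_nonempty, rule c)+
    ultimately show ?case by blast
  qed
  have zm: "z \<in> borel_measurable ?M"
    using u unfolding z_def by (intro borel_measurable_Pair) (auto simp: W1p_def in_Lp_def)
  have Dm: "(\<lambda>x. support_fun (D x) (Z x)) \<in> borel_measurable ?M" if Z: "Z \<in> bounded_measurable ?M" for Z
  proof -
    interpret complete_measure ?M by (rule complete_measure_lebesgue_on) auto
    have Zm: "Z \<in> borel_measurable ?M" using Z by (simp add: bounded_measurable_def)
    have "(\<lambda>x. support_fun (subd (fl x (z x))) (Z x)) \<in> borel_measurable ?M"
      by (rule borel_measurable_support_subd[OF fD(4) _ zm Zm])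
        (use fD(3) in \<open>eventually_elim, auto dest: is_codifferential_parts\<close>)
    then have "(\<lambda>x. support_fun (subd (fl x (z x))) (Z x) + (w1 x, w2 x) \<bullet> Z x) \<in> borel_measurable ?M"
      using Zm w1m w2m by (intro borel_measurable_add borel_measurable_inner borel_measurable_Pair)
    then show ?thesis
    proof (rule borel_measurable_AE_eq)
      show "AE x in ?M. support_fun (subd (fl x (z x))) (Z x) + (w1 x, w2 x) \<bullet> Z x
        = support_fun (D x) (Z x)"
        using fD(3)
      proof eventually_elim
        case (elim x)
        have "is_codifferential (f x) (z x) (fl x (z x)) (fu x (z x))" using elim by blast
        note c = is_codifferential_parts[OF this]
        show ?case unfolding D_def by (rule support_fun_plus_singleton[OF c(11,12), symmetric])
      qed
    qed
  qed
  have tpB: "(\<lambda>x. (h x, k x)) \<in> bounded_measurable ?M" if h: "test_pair \<alpha> \<beta> h k" for h k :: "real \<Rightarrow> real^'m"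
  proof -
    obtain K where K: "\<And>x. norm (h x) \<le> K \<and> norm (k x) \<le> K" using h by (auto simp: test_pair_def)
    have "norm (h x, k x) \<le> 2 * K" for x using norm_Pair_le[of "h x" "k x"] K[of x] by linarith
    then show ?thesis unfolding bounded_measurable_def using test_pair_measurable[OF h] by auto
  qed
  note Di = integrable_support_integrand(3)[OF L2 D Dm]

  \<comment> \<open>Nonnegativity of the sublinear majorant of the cost derivative\<close>
  define \<Phi> where "\<Phi> h k = (LINT x|?M. support_fun (D x) (h x, k x)) + support_fun (A 0) (h \<alpha>, h \<beta>)" for h k
  have strict: "0 \<le> \<Phi> h k"
    if h: "test_pair \<alpha> \<beta> h k" and adm: "(h \<alpha>, h \<beta>) \<in> Adm"
      and str: "\<And>i. i \<in> Iact \<Longrightarrow> support_fun (A i) (h \<alpha>, h \<beta>) < 0" for h k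
  proof -
    have "0 \<le> (LINT x|?M. codiff_dir (fl x (ustar x, vderiv ustar x)) (fu x (ustar x, vderiv ustar x)) (h x,
      k x))
       + support_fun (subd (gl 0 P) + {S 0}) (h \<alpha>, h \<beta>)"
      by (rule primal_necessary_condition[OF ab p q f opt P fin g Smem Rmem, of ep em])
        (use ep em h adm str Iact in \<open>auto simp: A_def[symmetric] B_def[symmetric] Adm_def\<close>)
    also have "(LINT x|?M. codiff_dir (fl x (ustar x, vderiv ustar x)) (fu x (ustar x, vderiv ustar x)) (h
      x, k x))
       \<le> (LINT x|?M. support_fun (D x) (h x, k x))"
    proof (rule integral_mono_AE)
      have t: "(\<lambda>n. inverse (real (Suc n))) \<longlonglongrightarrow> 0" "\<And>n. inverse (real (Suc n)) > 0"
        using LIMSEQ_inverse_real_of_nat by auto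
      show "integrable ?M (\<lambda>x. codiff_dir (fl x (ustar x, vderiv ustar x)) (fu x (ustar x, vderiv ustar x))
        (h x, k x))"
        by (rule integral_functional_directional(1)[OF p q f u h h tendsto_const _ _ t]) auto
      show "integrable ?M (\<lambda>x. support_fun (D x) (h x, k x))" using tpB[OF h] by (intro Di)
      show "AE x in ?M. codiff_dir (fl x (ustar x, vderiv ustar x)) (fu x (ustar x, vderiv ustar x)) (h x, k
        x)
          \<le> support_fun (D x) (h x, k x)"
        using fD(3) wD
      proof eventually_elim
        case (elim x)
        have "is_codifferential (f x) (z x) (fl x (z x)) (fu x (z x))" using elim(1) by blast
        from codiff_dir_le[OF this elim(2)] show ?case by (simp add: D_def z_def)
      qed
    qed
    finally show ?thesis by (simp add: \<Phi>_def A_def)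
  qed
  \<comment> \<open>Adding \<epsilon> times a ramp with end values \<open>\<eta>0\<close> makes the
    active inequalities strict; sublinearity controls \<Phi> at the perturbed pair, and \<epsilon>
    tends to 0.\<close>
  have primal: "0 \<le> \<Phi> h k" if h: "test_pair \<alpha> \<beta> h k" and adm: "(h \<alpha>, h \<beta>) \<in> Adm" for h k
  proof -
    define h0 k0 where "h0 = ramp_fun \<alpha> \<beta> \<eta>0" and "k0 = ramp_deriv \<alpha> \<beta> \<eta>0"
    have h0: "test_pair \<alpha> \<beta> h0 k0" unfolding h0_def k0_def by (rule test_pair_ramp_fun[OF ab])
    have h0e: "(h0 \<alpha>, h0 \<beta>) = \<eta>0" unfolding h0_def by (rule ramp_fun_endpoints[OF ab])
    have pert: "0 \<le> \<Phi> h k + \<epsilon> * \<Phi> h0 k0" if \<epsilon>: "\<epsilon> > 0" for \<epsilon>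
    proof -
      let ?h = "\<lambda>x. h x + \<epsilon> *\<^sub>R h0 x" and ?k = "\<lambda>x. k x + \<epsilon> *\<^sub>R k0 x"
      have tp: "test_pair \<alpha> \<beta> ?h ?k" by (rule test_pair_add[OF h test_pair_scale[OF h0]])
      have ends: "(?h \<alpha>, ?h \<beta>) = (h \<alpha>, h \<beta>) + \<epsilon> *\<^sub>R \<eta>0" by (simp add: h0e[symmetric])
      have "0 \<le> \<Phi> ?h ?k"
      proof (rule strict[OF tp])
        show "(?h \<alpha>, ?h \<beta>) \<in> Adm" unfolding ends using adm \<eta>0A \<epsilon> by (intro Adm_add Adm_scale)
        fix i assume i: "i \<in> Iact"
        then have ii: "i \<in> I \<union> J \<union> {0}" using IactI by auto
        have "support_fun (A i) ((h \<alpha>, h \<beta>) + \<epsilon> *\<^sub>R \<eta>0) \<le> support_fun (A i) (h \<alpha>, h \<beta>)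
          + \<epsilon> * support_fun (A i) \<eta>0"
          using support_fun_add[OF A(1,3)[OF ii], of "(h \<alpha>, h \<beta>)"
            "\<epsilon> *\<^sub>R \<eta>0"] support_fun_scale[OF A(1,3)[OF ii], of \<epsilon> \<eta>0] \<epsilon> by simp
        also have "\<dots> < 0" using adm i mult_pos_neg[OF \<epsilon> \<eta>0(1)[OF i]] by (fastforce simp: Adm_def)
        finally show "support_fun (A i) (?h \<alpha>, ?h \<beta>) < 0" unfolding ends .
      qed
      also have "\<Phi> ?h ?k \<le> \<Phi> h k + \<epsilon> * \<Phi> h0 k0"
      proof -
        have "(LINT x|?M. support_fun (D x) (?h x, ?k x)) \<le> (LINT x|?M. support_fun (D x) (h x, k x)
          + \<epsilon> * support_fun (D x) (h0 x, k0 x))"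
        proof (rule integral_mono_AE)
          show "AE x in ?M. support_fun (D x) (?h x, ?k x) \<le> support_fun (D x) (h x, k x)
            + \<epsilon> * support_fun (D x) (h0 x, k0 x)"
            using D
          proof eventually_elim
            case (elim x)
            then show ?case
              using support_fun_add[of "D x" "(h x, k x)"
                "\<epsilon> *\<^sub>R (h0 x, k0 x)"] support_fun_scale[of "D x" \<epsilon> "(h0 x, k0 x)"] \<epsilon> by simp
          qed
        qed (use Di[OF tpB[OF tp] tpB[OF tp]] Di[OF tpB[OF h] tpB[OF h]] Di[OF tpB[OF h0] tpB[OF h0]] in
          auto)
        also have "\<dots> = (LINT x|?M. support_fun (D x) (h x, k x))
          + \<epsilon> * (LINT x|?M. support_fun (D x) (h0 x, k0 x))"
          using Di[OF tpB[OF h] tpB[OF h]] Di[OF tpB[OF h0] tpB[OF h0]] by simp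
        finally have 1: "(LINT x|?M. support_fun (D x) (?h x, ?k x))
          \<le> (LINT x|?M. support_fun (D x) (h x, k x)) + \<epsilon> * (LINT x|?M. support_fun (D x) (h0 x, k0 x))" .
        have "support_fun (A 0) (?h \<alpha>, ?h \<beta>) \<le> support_fun (A 0) (h \<alpha>, h \<beta>)
          + \<epsilon> * support_fun (A 0) (h0 \<alpha>, h0 \<beta>)"
          unfolding ends h0e
          using support_fun_add[OF A0(1,3), of "(h \<alpha>, h \<beta>)"
            "\<epsilon> *\<^sub>R \<eta>0"] support_fun_scale[OF A0(1,3), of \<epsilon> \<eta>0] \<epsilon> by simp
        with 1 show ?thesis by (simp add: \<Phi>_def distrib_left)
      qed
      finally show ?thesis .
    qed
    have "((\<lambda>\<epsilon>. \<Phi> h k + \<epsilon> * \<Phi> h0 k0) \<longlongrightarrow> \<Phi> h k + 0 * \<Phi> h0 k0) (at_right 0)" by (intro tendsto_intros)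
    then have "0 \<le> \<Phi> h k + 0 * \<Phi> h0 k0"
      by (rule tendsto_lowerbound) (auto simp: eventually_at_right_field intro!: exI[of _ 1] pert)
    then show ?thesis by simp
  qed

  \<comment> \<open>A single selection for all test pairs\<close>
  define T where "T = {((\<lambda>x. (h x, k x)), c) | h k c. test_pair \<alpha> \<beta> h k \<and> (h \<alpha>, h \<beta>) \<in> Adm \<and>
    support_fun (A 0) (h \<alpha>, h \<beta>) \<le> c}"
  have TI: "((\<lambda>x. (h x, k x)), c) \<in> T"
    if "test_pair \<alpha> \<beta> h k" "(h \<alpha>, h \<beta>) \<in> Adm" "support_fun (A 0) (h \<alpha>, h \<beta>) \<le> c" for h k c
    unfolding T_def using that by blast
  obtain v where v: "integrable ?M v" "AE x in ?M. v x \<in> D x"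
    "\<And>Z c. (Z, c) \<in> T \<Longrightarrow> 0 \<le> (LINT x|?M. v x \<bullet> Z x) + c"
  proof (rule measurable_selection_sandwich[OF sf L2 D Dm])
    show "Z \<in> bounded_measurable ?M" if "(Z, c) \<in> T" for Z c using that tpB by (auto simp: T_def)
    have "support_fun (A 0) (0, 0) = 0" "(0, 0) \<in> Adm"
      using support_fun_zero[OF A0(3)] Adm_0 by (simp_all add: zero_prod_def)
    then have "((\<lambda>x. (0, 0)), 0) \<in> T" by (intro TI[OF test_pair_const]) simp_all
    then show "((\<lambda>_. 0), 0) \<in> T" by (simp add: zero_prod_def)
    show "((\<lambda>x. Z x + Y x), c + d) \<in> T" if T: "(Z, c) \<in> T" "(Y, d) \<in> T" for Z c Y d
    proof -
      obtain h k where h: "Z = (\<lambda>x. (h x, k x))" "test_pair \<alpha> \<beta> h k" "(h \<alpha>, h \<beta>) \<in> Adm"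
        "support_fun (A 0) (h \<alpha>, h \<beta>) \<le> c"
        using T(1) by (auto simp: T_def)
      obtain h' k' where h': "Y = (\<lambda>x. (h' x, k' x))" "test_pair \<alpha> \<beta> h' k'" "(h' \<alpha>, h' \<beta>) \<in> Adm"
        "support_fun (A 0) (h' \<alpha>, h' \<beta>) \<le> d"
        using T(2) by (auto simp: T_def)
      have "(h \<alpha> + h' \<alpha>, h \<beta> + h' \<beta>) \<in> Adm" using Adm_add[OF h(3) h'(3)] by simp
      \<comment> \<open>The support function is only subadditive; \<open>T\<close> is closed under
        addition because its second component is any upper bound of it, not its exact value.\<close>
      moreover have "support_fun (A 0) (h \<alpha> + h' \<alpha>, h \<beta> + h' \<beta>) \<le> c + d"
        using support_fun_add[OF A0(1,3), of "(h \<alpha>, h \<beta>)" "(h' \<alpha>, h' \<beta>)"] h(4) h'(4) by simp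
      ultimately show ?thesis using TI[OF test_pair_add[OF h(2) h'(2)]] by (simp add: h(1) h'(1))
    qed
    show "((\<lambda>x. t *\<^sub>R Z x), t * c) \<in> T" if T: "(Z, c) \<in> T" and t: "t > 0" for Z c t
    proof -
      obtain h k where h: "Z = (\<lambda>x. (h x, k x))" "test_pair \<alpha> \<beta> h k" "(h \<alpha>, h \<beta>) \<in> Adm"
        "support_fun (A 0) (h \<alpha>, h \<beta>) \<le> c"
        using T(1) by (auto simp: T_def)
      have "(t *\<^sub>R h \<alpha>, t *\<^sub>R h \<beta>) \<in> Adm" using Adm_scale[OF h(3) t] by simp
      moreover have "support_fun (A 0) (t *\<^sub>R h \<alpha>, t *\<^sub>R h \<beta>) \<le> t * c"
        using support_fun_scale[OF A0(1,3), of t "(h \<alpha>, h \<beta>)"] h(4) t by simp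
      ultimately show ?thesis using TI[OF test_pair_scale[OF h(2), of t]] by (simp add: h(1))
    qed
    show "0 \<le> (LINT x|?M. support_fun (D x) (Z x)) + c" if T: "(Z, c) \<in> T" for Z c
    proof -
      obtain h k where h: "Z = (\<lambda>x. (h x, k x))" "test_pair \<alpha> \<beta> h k" "(h \<alpha>, h \<beta>) \<in> Adm"
        "support_fun (A 0) (h \<alpha>, h \<beta>) \<le> c"
        using T by (auto simp: T_def)
      then show ?thesis using primal[OF h(2,3)] by (simp add: \<Phi>_def)
    qed
  qed (assumption, rule that)
  define v1 v2 where "v1 x = fst (v x)" and "v2 x = snd (v x)" for x
  have v12: "integrable ?M v1" "integrable ?M v2" unfolding v1_def v2_def
    by (rule integrable_bounded_linear[OF bounded_linear_fst v(1)], rule integrable_bounded_linear[OF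
      bounded_linear_snd v(1)])
  have act: "0 \<le> (LINT x|?M. v1 x \<bullet> h x + v2 x \<bullet> k x) + support_fun (A 0) (h \<alpha>, h \<beta>)"
    if "test_pair \<alpha> \<beta> h k" "(h \<alpha>, h \<beta>) \<in> Adm" for h k
  proof -
    have "((\<lambda>x. (h x, k x)), support_fun (A 0) (h \<alpha>, h \<beta>)) \<in> T" by (rule TI[OF that order_refl])
    from v(3)[OF this] show ?thesis by (simp add: v1_def v2_def inner_prod_def)
  qed
  \<comment> \<open>Vanishing end values are admissible, so the inequality may be tested with the
    pair and with its negative.\<close>
  have zero: "(LINT x|?M. v1 x \<bullet> h x + v2 x \<bullet> k x) = 0"
    if h: "test_pair \<alpha> \<beta> h k" "h \<alpha> = 0" "h \<beta> = 0" for h k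
  proof -
    have z0: "support_fun (A 0) (0, 0) = 0" "(0, 0) \<in> Adm" using A0(3) Adm_0
      by (simp_all add: zero_prod_def[symmetric])
    have "0 \<le> (LINT x|?M. v1 x \<bullet> (-1) *\<^sub>R h x + v2 x \<bullet> (-1) *\<^sub>R k x)"
      using act[OF test_pair_scale[OF h(1), of "-1"]] h z0 by simp
    also have "(LINT x|?M. v1 x \<bullet> (-1) *\<^sub>R h x + v2 x \<bullet> (-1) *\<^sub>R k x)
      = (LINT x|?M. - (v1 x \<bullet> h x + v2 x \<bullet> k x))"
      by (intro Bochner_Integration.integral_cong) auto
    also have "\<dots> = - (LINT x|?M. v1 x \<bullet> h x + v2 x \<bullet> k x)" by (rule Bochner_Integration.integral_minus)
    finally have "(LINT x|?M. v1 x \<bullet> h x + v2 x \<bullet> k x) \<le> 0" by linarith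
    moreover have "0 \<le> (LINT x|?M. v1 x \<bullet> h x + v2 x \<bullet> k x)" using act[OF h(1)] h z0 by simp
    ultimately show ?thesis by linarith
  qed

  \<comment> \<open>The adjoint arc and the Euler--Lagrange inclusion\<close>
  obtain \<kappa> where \<kappa>: "AE x in ?M. v2 x = primitive \<alpha> \<beta> v1 x - primitive \<alpha> \<beta> v1 \<beta> + \<kappa>"
    "\<And>h k. test_pair \<alpha> \<beta> h k \<Longrightarrow> (LINT x|?M. v1 x \<bullet> h x + v2 x \<bullet> k x)
      = \<kappa> \<bullet> h \<beta> - (\<kappa> - primitive \<alpha> \<beta> v1 \<beta>) \<bullet> h \<alpha>"
    by (rule du_bois_reymond[OF ab v12 zero]) (assumption+, rule that)
  \<comment> \<open>\<open>v2\<close> is determined only almost everywhere; \<zeta> is its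
    absolutely continuous representative, and only for it do the end values make sense.\<close>
  define \<zeta> where "\<zeta> x = primitive \<alpha> \<beta> v1 x - primitive \<alpha> \<beta> v1 \<beta> + \<kappa>" for x
  have \<zeta>e: "\<zeta> \<alpha> = \<kappa> - primitive \<alpha> \<beta> v1 \<beta>" "\<zeta> \<beta> = \<kappa>" by (simp_all add: \<zeta>_def primitive_endpoints)
  have \<zeta>d: "AE x in ?M. (\<zeta> has_vector_derivative v1 x) (at x)"
    using primitive_has_vector_derivative[OF v12(1)]
    by eventually_elim (auto simp: \<zeta>_def[abs_def] intro!: derivative_eq_intros)
  have \<zeta>v: "AE x in ?M. vderiv \<zeta> x = v1 x" using \<zeta>d by eventually_elim (rule vector_derivative_at)
  have incl: "AE x in ?M. (0, vderiv \<zeta> x, \<zeta> x) \<in> fl x (ustar x, vderiv ustar x) + {(0, w1 x, w2 x)}"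
    using v(2) \<kappa>(1) \<zeta>v
  proof eventually_elim
    case (elim x)
    obtain d where d: "(0, d) \<in> fl x (z x)" "v x = d + (w1 x, w2 x)" using elim(1)
      by (auto simp: D_def set_plus_def subd_def)
    have "(0::real, vderiv \<zeta> x, \<zeta> x) = (0, v x)" using elim(2,3)
      by (simp add: prod_eq_iff \<zeta>_def v1_def v2_def)
    also have "\<dots> = (0, d) + (0, w1 x, w2 x)" by (simp add: d(2))
    finally show ?case using d(1) unfolding z_def by (metis set_plus_intro singletonI)
  qed
  have \<zeta>W: "\<zeta> \<in> W1p \<alpha> \<beta> q"
  proof -
    have ac: "abs_continuous_on \<alpha> \<beta> \<zeta>"
      unfolding \<zeta>_def diff_conv_add_uminus add.assoc
      by (intro abs_continuous_on_add primitive_abs_continuous v12 abs_continuous_on_lipschitz[of 0]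
        lipschitz_onI) auto
    have "continuous_on {\<alpha><..<\<beta>} \<zeta>"
      by (rule continuous_on_subset[OF abs_continuous_on_imp_continuous_on[OF ac]]) auto
    then have \<zeta>m: "\<zeta> \<in> borel_measurable ?M" by (rule continuous_imp_measurable_on_sets_lebesgue) simp
    have "norm (\<zeta> x) \<le> (LINT y|?M. norm (v1 y)) + norm (\<kappa> - primitive \<alpha> \<beta> v1 \<beta>)" for x
      using primitive_bounded[OF v12(1), of x] norm_triangle_ineq[of "primitive \<alpha> \<beta> v1 x"
        "\<kappa> - primitive \<alpha> \<beta> v1 \<beta>"]
      by (simp add: \<zeta>_def algebra_simps)
    then have l1: "in_Lp \<alpha> \<beta> q \<zeta>" by (intro in_Lp_bounded[OF \<zeta>m] AE_I2)
    obtain \<gamma> where \<gamma>: "in_Lp \<alpha> \<beta> q \<gamma>"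
      "AE x in ?M. \<forall>(a, v1, v2)\<in>fl x (ustar x, vderiv ustar x). \<forall>(b, w1, w2)\<in>fu x (ustar x, vderiv ustar x).
        norm v1 \<le> \<gamma> x \<and> norm v2 \<le> \<gamma> x \<and> norm w1 \<le> \<gamma> x \<and> norm w2 \<le> \<gamma> x"
      by (rule growth_dual_exponent[OF p q u fD(6)]) (rule that)
    have "in_Lp \<alpha> \<beta> q v1"
    \<comment> \<open>\<open>v1 x\<close> is the sum of a component of the lower slice and
      \<open>w1 x\<close>, each bounded by \<open>\<gamma> x\<close>; hence the dominating function
      \<open>\<gamma> x + \<gamma> x\<close>.\<close>
    proof (rule in_Lp_dominated[OF in_Lp_add[OF \<gamma>(1) \<gamma>(1)]])
      show "v1 \<in> borel_measurable ?M" using v12(1) by auto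
      show "AE x in ?M. norm (v1 x) \<le> \<bar>\<gamma> x + \<gamma> x\<bar>"
        using v(2) \<gamma>(2) w
      proof eventually_elim
        case (elim x)
        obtain d1 d2 where d: "(0, d1, d2) \<in> fl x (z x)" "v x = (d1, d2) + (w1 x, w2 x)"
          using elim(1) by (auto simp: D_def set_plus_def subd_def)
        have "norm d1 \<le> \<gamma> x \<and> norm d2 \<le> \<gamma> x \<and> norm (w1 x) \<le> \<gamma> x \<and> norm (w2 x) \<le> \<gamma> x"
          using bspec[OF bspec[OF elim(2) d(1)[unfolded z_def], unfolded prod.case] elim(3), unfolded
            prod.case] .
        then show ?case using norm_triangle_ineq[of d1 "w1 x"] unfolding v1_def d(2) by simp linarith
      qed
    qed
    then have "in_Lp \<alpha> \<beta> q (vderiv \<zeta>)" by (rule in_Lp_AE_cong) (use \<zeta>v in \<open>auto elim: eventually_mono\<close>)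
    moreover have "AE x in ?M. \<zeta> differentiable (at x)" using \<zeta>d
      by eventually_elim (rule differentiableI_vector)
    ultimately show ?thesis using ac l1 by (simp add: W1p_def)
  qed

  \<comment> \<open>Multipliers and the transversality condition\<close>
  define Kc where "Kc = convex_cone hull (\<Union>j\<in>J. C j)"
  have UC: "(\<Union>j\<in>J. C j) = (\<Union>j\<in>J. A j) \<union> (\<Union>j\<in>J. B j)" using Cj by auto
  have Kc: "closed Kc" "convex_cone Kc"
  proof -
    have eq: "(\<Union>j\<in>J. C j) = \<Union>(A ` J \<union> B ` J)" using UC by auto
    show "closed Kc" unfolding Kc_def eq
      by (rule closed_convex_cone_hull_polytopes) (use polyAB fin(2) in auto)
    show "convex_cone Kc" unfolding Kc_def by (rule convex_cone_convex_cone_hull)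
  qed
  have disj: "- x \<notin> Kc" if "x \<in> Q" for x
  proof
    assume "- x \<in> Kc"
    then have "x \<in> uminus ` Kc" by (metis image_eqI minus_minus)
    also have "uminus ` Kc = N J" unfolding Kc_def N_def convex_cone_hull_uminus[symmetric]
      by (simp add: image_UN)
    finally show False using QN that by blast
  qed
  \<comment> \<open>The signs are those of the boundary term: for every test pair the integral of
    the selection equals \<open>c \<bullet> (h \<alpha>, h \<beta>)\<close>.\<close>
  define c where "c = (- \<zeta> \<alpha>, \<zeta> \<beta>)"
  obtain x0 y k where xyk: "x0 \<in> A 0" "y \<in> convex_cone hull Q" "k \<in> Kc" "- c = x0 + y + k"
  proof (rule multiplier_cone[OF A0 Q Kc disj])
    \<comment> \<open>A vector in the polar of \<open>Q\<close> and \<open>Kc\<close> is an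
      admissible end point direction, and a ramp realizes it as the end values of a test
      pair.\<close>
    fix \<eta> assume q: "\<And>q. q \<in> Q \<Longrightarrow> q \<bullet> \<eta> \<le> 0" and k: "\<And>k. k \<in> Kc \<Longrightarrow> k \<bullet> \<eta> \<le> 0"
    have "\<eta> \<in> Adm"
    proof -
      have "support_fun (A i) \<eta> \<le> 0" if "i \<in> Iact" for i
        using that IactI A(3)[of i] by (intro support_fun_least q) (auto simp: Q_def intro: hull_inc)
      moreover have "support_fun (A j) \<eta> \<le> 0" "support_fun (B j) \<eta> \<le> 0" if "j \<in> J" for j
        using that A(3)[of j] B(3)[of j] by (auto intro!: support_fun_least k hull_inc simp: Kc_def UC)
      ultimately show ?thesis by (auto simp: Adm_def)
    qed
    define h k' where "h = ramp_fun \<alpha> \<beta> \<eta>" and "k' = ramp_deriv \<alpha> \<beta> \<eta>"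
    have h: "test_pair \<alpha> \<beta> h k'" unfolding h_def k'_def by (rule test_pair_ramp_fun[OF ab])
    have e: "(h \<alpha>, h \<beta>) = \<eta>" unfolding h_def by (rule ramp_fun_endpoints[OF ab])
    have "0 \<le> \<zeta> \<beta> \<bullet> h \<beta> - \<zeta> \<alpha> \<bullet> h \<alpha> + support_fun (A 0) (h \<alpha>, h \<beta>)"
      using act[OF h] \<open>\<eta> \<in> Adm\<close> by (simp add: \<kappa>(2)[OF h] \<zeta>e e)
    then have "0 \<le> c \<bullet> (h \<alpha>, h \<beta>) + support_fun (A 0) (h \<alpha>, h \<beta>)" by (simp add: c_def inner_prod_def)
    then show "0 \<le> c \<bullet> \<eta> + support_fun (A 0) \<eta>" unfolding e .
  qed (assumption, rule that)
  have y: "y \<in> convex_cone hull (\<Union>i\<in>Iact. A i)"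
  proof -
    have "Q \<subseteq> convex_cone hull (\<Union>i\<in>Iact. A i)" unfolding Q_def by (rule convex_hull_subset_convex_cone_hull)
    then have "convex_cone hull Q \<subseteq> convex_cone hull (\<Union>i\<in>Iact. A i)"
      by (rule hull_minimal) (rule convex_cone_convex_cone_hull)
    then show ?thesis using xyk(2) by blast
  qed
  obtain lI aI where lI: "\<And>i. i \<in> Iact \<Longrightarrow> 0 \<le> lI i \<and> aI i \<in> A i" "y = (\<Sum>i\<in>Iact. lI i *\<^sub>R aI i)"
    using convex_cone_hull_UN_convex[OF finite_subset[OF IactI fin(1)] _ _ y] A(2,3) IactI by blast
  obtain ka kb where kab: "k = ka + kb" "ka \<in> convex_cone hull (\<Union>j\<in>J. A j)"
    "kb \<in> convex_cone hull (\<Union>j\<in>J. B j)"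
    using xyk(3) unfolding Kc_def UC convex_cone_hull_Un by auto
  obtain mul aJ where mul: "\<And>j. j \<in> J \<Longrightarrow> 0 \<le> mul j \<and> aJ j \<in> A j" "ka = (\<Sum>j\<in>J. mul j *\<^sub>R aJ j)"
    using convex_cone_hull_UN_convex[OF fin(2) _ _ kab(2)] A(2,3) by blast
  obtain muu bJ where muu: "\<And>j. j \<in> J \<Longrightarrow> 0 \<le> muu j \<and> bJ j \<in> B j" "kb = (\<Sum>j\<in>J. muu j *\<^sub>R bJ j)"
    using convex_cone_hull_UN_convex[OF fin(2) _ _ kab(3)] B(2,3) by blast
  \<comment> \<open>Zero multipliers outside the active set give complementary slackness; the
    elements \<open>a0\<close> only fill the terms that these multipliers cancel.\<close>
  define lam where "lam i = (if i \<in> Iact then lI i else 0)" for i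
  have "\<forall>i\<in>I. \<exists>a. a \<in> A i" using A(3) by blast
  then obtain a0 where a0: "\<And>i. i \<in> I \<Longrightarrow> a0 i \<in> A i" by metis
  define aa where "aa i = (if i \<in> Iact then aI i else a0 i)" for i
  have ysum: "y = (\<Sum>i\<in>I. lam i *\<^sub>R aa i)"
    unfolding lI(2) by (rule sum.mono_neutral_cong_left[OF fin(1) IactI]) (auto simp: lam_def aa_def)
  have aA: "aa i \<in> A i" if "i \<in> I" for i using that lI(1) a0 by (auto simp: aa_def)
  \<comment> \<open>All multiplier vectors come from slices over 0, so prefixing the component 0
    leads back into the full codifferential sets.\<close>
  have liftA: "(0, a) \<in> gl i P + {(0, s1 i, s2 i)}" if ia: "i \<in> I \<union> J" "a \<in> A i" for i a
  proof -
    obtain d where d: "(0, d) \<in> gl i P" "a = d + (s1 i, s2 i)" using ia S_eq[OF ia(1)]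
      by (auto simp: A_def set_plus_def subd_def)
    have "(0::real, a) = (0, d) + (0, s1 i, s2 i)" by (simp add: d(2))
    then show ?thesis using d(1) by (metis set_plus_intro singletonI)
  qed
  have liftB: "(0, b) \<in> uminus ` ({(0, r1 j, r2 j)} + gu j P)" if jb: "j \<in> J" "b \<in> B j" for j b
  proof -
    obtain d where d: "(0, d) \<in> gu j P" "b = - R j - d" using jb by (auto simp: B_def set_plus_def subd_def)
    have "(0::real, b) = - ((0, r1 j, r2 j) + (0, d))" by (simp add: d(2) R_def)
    then show ?thesis using d(1) by (intro image_eqI) (auto intro: set_plus_intro)
  qed
  have sum0: "(\<Sum>i\<in>X. l i *\<^sub>R (0::real, b i)) = (0, \<Sum>i\<in>X. l i *\<^sub>R b i)" for X :: "nat set" and l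
    and b :: "nat \<Rightarrow> (real^'m) \<times> (real^'m)"
    by (induction X rule: infinite_finite_induct) (auto simp: zero_prod_def)
  have t0: "(0, x0) \<in> gl 0 P + {(0, s10, s20)}"
  proof -
    obtain d where d: "(0, d) \<in> gl 0 P" "x0 = d + (s10, s20)" using xyk(1)
      by (auto simp: A_def S_def set_plus_def subd_def)
    have "(0::real, x0) = (0, d) + (0, s10, s20)" by (simp add: d(2))
    then show ?thesis using d(1) by (metis set_plus_intro singletonI)
  qed
  have t1: "(0, y) \<in> (\<Sum>i\<in>I. (*\<^sub>R) (lam i) ` (gl i P + {(0, s1 i, s2 i)}))"
    unfolding ysum sum0[symmetric] set_sum_alt[OF fin(1)]
    by (intro CollectI exI[of _ "\<lambda>i. lam i *\<^sub>R (0, aa i)"] conjI refl ballI imageI liftA aA UnI1)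
  have t2: "(0, ka) \<in> (\<Sum>j\<in>J. (*\<^sub>R) (mul j) ` (gl j P + {(0, s1 j, s2 j)}))"
    unfolding mul(2) sum0[symmetric] set_sum_alt[OF fin(2)]
    by (intro CollectI exI[of _ "\<lambda>j. mul j *\<^sub>R (0, aJ j)"] conjI refl ballI imageI liftA mul(1)[THEN
      conjunct2] UnI2)
  have t3: "(0, kb) \<in> (\<Sum>j\<in>J. uminus ` (*\<^sub>R) (muu j) ` ({(0, r1 j, r2 j)} + gu j P))"
  proof -
    have "muu j *\<^sub>R (0, bJ j) \<in> uminus ` (*\<^sub>R) (muu j) ` ({(0, r1 j, r2 j)} + gu j P)" if j: "j \<in> J" for j
    proof -
      obtain d where d: "d \<in> {(0, r1 j, r2 j)} + gu j P" "(0, bJ j) = - d" using liftB[OF j] muu(1)[OF j]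
        by blast
      have "muu j *\<^sub>R (0::real, bJ j) = - (muu j *\<^sub>R d)" unfolding d(2) by simp
      then show ?thesis using d(1) by blast
    qed
    then show ?thesis unfolding muu(2) sum0[symmetric] set_sum_alt[OF fin(2)]
      by (auto intro!: exI[of _ "\<lambda>j. muu j *\<^sub>R (0, bJ j)"])
  qed
  have trans: "(0::real, \<zeta> \<alpha>, - \<zeta> \<beta>) = (0, x0) + (0, y) + (0, ka) + (0, kb)"
    using xyk(4) kab(1) by (simp add: c_def add.assoc)
  show "\<exists>\<zeta> lam mul muu.
       \<zeta> \<in> W1p \<alpha> \<beta> q \<and>
       (\<forall>i\<in>I. lam i \<ge> 0) \<and> (\<forall>j\<in>J. mul j \<ge> 0 \<and> muu j \<ge> 0) \<and>
       (\<forall>i\<in>I. lam i * g i P = 0) \<and>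
       (AE x in lebesgue_on {\<alpha><..<\<beta>}.
          (0, vderiv \<zeta> x, \<zeta> x) \<in> fl x (ustar x, vderiv ustar x) + {(0, w1 x, w2 x)}) \<and>
       (0, \<zeta> \<alpha>, - \<zeta> \<beta>) \<in> gl 0 P + {(0, s10, s20)}
          + (\<Sum>i\<in>I. (*\<^sub>R) (lam i) ` (gl i P + {(0, s1 i, s2 i)}))
          + (\<Sum>j\<in>J. (*\<^sub>R) (mul j) ` (gl j P + {(0, s1 j, s2 j)}))
          + (\<Sum>j\<in>J. uminus ` (*\<^sub>R) (muu j) ` ({(0, r1 j, r2 j)} + gu j P))"
  proof (rule exI[of _ \<zeta>], rule exI[of _ lam], rule exI[of _ mul], rule exI[of _ muu], intro conjI \<zeta>W incl)
    show "\<forall>i\<in>I. lam i \<ge> 0" using lI(1) by (auto simp: lam_def)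
    show "\<forall>j\<in>J. mul j \<ge> 0 \<and> muu j \<ge> 0" using mul(1) muu(1) by auto
    show "\<forall>i\<in>I. lam i * g i P = 0" by (auto simp: lam_def Iact)
    show "(0, \<zeta> \<alpha>, - \<zeta> \<beta>) \<in> gl 0 P + {(0, s10, s20)}
          + (\<Sum>i\<in>I. (*\<^sub>R) (lam i) ` (gl i P + {(0, s1 i, s2 i)}))
          + (\<Sum>j\<in>J. (*\<^sub>R) (mul j) ` (gl j P + {(0, s1 j, s2 j)}))
          + (\<Sum>j\<in>J. uminus ` (*\<^sub>R) (muu j) ` ({(0, r1 j, r2 j)} + gu j P))"
      unfolding trans by (intro set_plus_intro t0 t1 t2 t3)
  qed
qed

end
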